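(* Let $G$ be a compact connected Lie group and let $\rho:G\to\mathrm{GL}(V)$ be a finite-dimensional real or complex representation. Let $(g_t)_{t\ge0}$ be the Riemannian Brownian motion on $G$ starting at the identity. Then $\mathbb E(\rho(g_t))$ respects the isotypic decomposition $V=\bigoplus_{[\tau]\in\hat G}V_{[\tau]}$ and satisfies $$\mathbb E\bigl(\rho(g_t)\bigr)_{|V_{[\tau]}}=\exp\Bigl(\tfrac12c_{[\tau]}t\Bigr)\,\mathrm{id}_{|V_{[\tau]}}$$ for each irreducible subrepresentation $\tau$ of $\rho$. Equivalently, $\mathbb E(\rho(g_t))=\exp\bigl(\tfrac t2\rho(C)\bigr)$. Moreover, $$\lim_{t\to\infty}\mathbb E\bigl(\rho(g_t)\bigr)=T(1)=\int_G\rho(g)\,dg,$$ where $dg$ is the normalized Haar measure.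
   Context: $\kappa$ is a fixed $\mathrm{Ad}_G$-invariant positive-definite symmetric bilinear form on the Lie algebra $\mathfrak g$ of $G$, $\{\xi^a\}$ a $\kappa$-orthonormal basis, also viewed as left-invariant vector fields, $\Delta f=\sum_a\xi^a(\xi^af)$ the Laplace–Beltrami operator, and $C=\sum_a\xi^a\xi^a\in\mathrm U(\mathfrak g)$ the Casimir invariant, so that $\rho(C)=\sum_a\rho(\xi^a)\rho(\xi^a)$ for the induced Lie algebra representation. Brownian motion: $(g_t)_{t\ge0}$ is the $G$-valued solution of the Stratonovich SDE $dg_t=\sum_a\xi^a(g_t)\circ dW^a_t$, $g_0=e$, where $W_t=\sum_a W_t^a\xi^a$ is the centered Gaussian process on $\mathfrak g$ with $\mathbb E(W^a_tW^b_s)=\min(t,s)\delta^{ab}$. It is the Feller diffusion with generator $\frac12\Delta$; for $t>0$ its law has a smooth density $p_t$ with respect to $dg$ satisfying $\frac12\Delta p_t=\partial_tp_t$, $\lim_{t\to0}p_t=\delta_e$, so that $\mathbb E(f(g_t))=\int_Gf\,p_t\,dg$. Isotypic decomposition: $V_{[\tau]}$ is the sum of all irreducible subrepresentations of $V$ equivalent to the irreducible representation $\tau$; $\hat G$ is the set of equivalence classes of irreducible representations. Constants: $c_{[\tau]}\in\mathbb R$ is the non-positive constant, depending only on the isomorphism type of the irreducible representation $\tau$, such that $c_{[\tau]}\int_G\tau(g)\nu(g)\,dg=\int_G\tau(g)\,\Delta\nu(g)\,dg$ for all $C^2$ probability densities $\nu$; it is the scalar by which the Casimir $\tau(C)$ acts.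 *)

theory Defs
  imports "HOL-Probability.Probability" "HOL-Algebra.Group"
begin

section \<open>Lie groups\<close>

(* Only used for open S in a finite-dimensional 'a; there, asking that all iterated directional
   derivatives exist and are continuous is the usual notion of class C^k. *)
primrec Ck_on ::
  "nat \<Rightarrow> 'a::real_normed_vector set \<Rightarrow> ('a \<Rightarrow> 'b::real_normed_vector) \<Rightarrow> bool" where
  "Ck_on 0 = (\<lambda>S f. continuous_on S f)"
| "Ck_on (Suc k) = (\<lambda>S f. (\<forall>x\<in>S. f differentiable at x) \<and>
      (\<forall>v. Ck_on k S (\<lambda>x. frechet_derivative f (at x) v)))"

definition smooth_on :: "'a::real_normed_vector set \<Rightarrow> ('a \<Rightarrow> 'b::real_normed_vector) \<Rightarrow> bool" where
  "smooth_on S f \<longleftrightarrow> (\<forall>k. Ck_on k S f)"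

(* A chart is a pair (U, phi); phi is irrelevant outside U. *)
type_synonym ('g, 'e) chart = "'g set \<times> ('g \<Rightarrow> 'e)"

definition chart_inv :: "('g, 'e) chart \<Rightarrow> 'e \<Rightarrow> 'g" where
  "chart_inv c = inv_into (fst c) (snd c)"

(* The model space 'e is a finite-dimensional normed space and not a euclidean_space, because types
   of the latter class have positive dimension; the trivial group is a Lie group too. *)
definition smooth_atlas ::
  "('g::{second_countable_topology,t2_space}, 'e::real_normed_vector) chart set \<Rightarrow> bool" where
  "smooth_atlas A \<longleftrightarrow>
     (\<exists>B. finite B \<and> span B = (UNIV :: 'e set)) \<and>
     (\<Union>c\<in>A. fst c) = UNIV \<and>
     (\<forall>c\<in>A. open (fst c) \<and> open (snd c ` fst c) \<and>
        homeomorphism (fst c) (snd c ` fst c) (snd c) (chart_inv c)) \<and>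
     (\<forall>c\<in>A. \<forall>d\<in>A. smooth_on (snd c ` (fst c \<inter> fst d)) (snd d \<circ> chart_inv c))"

definition Ck_map ::
  "('g, 'e::real_normed_vector) chart set \<Rightarrow> nat \<Rightarrow> ('g \<Rightarrow> 'b::real_normed_vector) \<Rightarrow> bool" where
  "Ck_map A k f \<longleftrightarrow> (\<forall>c\<in>A. Ck_on k (snd c ` fst c) (f \<circ> chart_inv c))"

definition smooth_map ::
  "('g, 'e::real_normed_vector) chart set \<Rightarrow> ('g \<Rightarrow> 'b::real_normed_vector) \<Rightarrow> bool" where
  "smooth_map A f \<longleftrightarrow> (\<forall>k. Ck_map A k f)"

definition lie_group ::
  "'g::{second_countable_topology,t2_space} monoid \<Rightarrow>
   ('g, 'e::real_normed_vector) chart set \<Rightarrow> bool" where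
  "lie_group G A \<longleftrightarrow>
     group G \<and> carrier G = UNIV \<and> smooth_atlas A \<and>
     continuous_on UNIV (\<lambda>(x, y). x \<otimes>\<^bsub>G\<^esub> y) \<and>
     continuous_on UNIV (\<lambda>x. inv\<^bsub>G\<^esub> x) \<and>
     (\<forall>a\<in>A. \<forall>b\<in>A. \<forall>c\<in>A.
        smooth_on {(x, y). x \<in> snd a ` fst a \<and> y \<in> snd b ` fst b \<and>
                     chart_inv a x \<otimes>\<^bsub>G\<^esub> chart_inv b y \<in> fst c}
          (\<lambda>(x, y). snd c (chart_inv a x \<otimes>\<^bsub>G\<^esub> chart_inv b y))) \<and>
     (\<forall>a\<in>A. \<forall>c\<in>A.
        smooth_on {x. x \<in> snd a ` fst a \<and> inv\<^bsub>G\<^esub> (chart_inv a x) \<in> fst c}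
          (\<lambda>x. snd c (inv\<^bsub>G\<^esub> (chart_inv a x))))"

(* The Lie algebra is the tangent space at the identity, identified with the model space 'e
   through the following chart. *)
definition unit_chart :: "'g monoid \<Rightarrow> ('g, 'e) chart set \<Rightarrow> ('g, 'e) chart" where
  "unit_chart G A = (SOME c. c \<in> A \<and> \<one>\<^bsub>G\<^esub> \<in> fst c)"

(* Action of the left-invariant vector field determined by \<xi>:
   (\<xi> f)(g) is the derivative of x \<mapsto> f (g x) at the identity in the direction \<xi>. *)
definition lvf ::
  "'g monoid \<Rightarrow> ('g, 'e::real_normed_vector) chart set \<Rightarrow> 'e \<Rightarrow>
   ('g \<Rightarrow> 'b::real_normed_vector) \<Rightarrow> 'g \<Rightarrow> 'b" where
  "lvf G A \<xi> f g =
     frechet_derivative (\<lambda>x. f (g \<otimes>\<^bsub>G\<^esub> chart_inv (unit_chart G A) x))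
       (at (snd (unit_chart G A) \<one>\<^bsub>G\<^esub>)) \<xi>"

definition Ad ::
  "'g monoid \<Rightarrow> ('g, 'e::real_normed_vector) chart set \<Rightarrow> 'g \<Rightarrow> 'e \<Rightarrow> 'e" where
  "Ad G A g \<xi> =
     frechet_derivative
       (\<lambda>x. snd (unit_chart G A)
              (g \<otimes>\<^bsub>G\<^esub> chart_inv (unit_chart G A) x \<otimes>\<^bsub>G\<^esub> inv\<^bsub>G\<^esub> g))
       (at (snd (unit_chart G A) \<one>\<^bsub>G\<^esub>)) \<xi>"

definition Ad_invariant_inner ::
  "'g monoid \<Rightarrow> ('g, 'e::real_normed_vector) chart set \<Rightarrow> ('e \<Rightarrow> 'e \<Rightarrow> real) \<Rightarrow> bool" where
  "Ad_invariant_inner G A \<kappa> \<longleftrightarrow>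
     bilinear \<kappa> \<and> (\<forall>x y. \<kappa> x y = \<kappa> y x) \<and> (\<forall>x. x \<noteq> 0 \<longrightarrow> \<kappa> x x > 0) \<and>
     (\<forall>g x y. \<kappa> (Ad G A g x) (Ad G A g y) = \<kappa> x y)"

definition orthonormal_basis ::
  "('e::real_vector \<Rightarrow> 'e \<Rightarrow> real) \<Rightarrow> 'e set \<Rightarrow> bool" where
  "orthonormal_basis \<kappa> \<Xi> \<longleftrightarrow>
     finite \<Xi> \<and> span \<Xi> = UNIV \<and> (\<forall>a\<in>\<Xi>. \<forall>b\<in>\<Xi>. \<kappa> a b = (if a = b then 1 else 0))"

definition laplacian ::
  "'g monoid \<Rightarrow> ('g, 'e::real_normed_vector) chart set \<Rightarrow> 'e set \<Rightarrow>
   ('g \<Rightarrow> 'b::real_normed_vector) \<Rightarrow> 'g \<Rightarrow> 'b" where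
  "laplacian G A \<Xi> f g = (\<Sum>a\<in>\<Xi>. lvf G A a (lvf G A a f) g)"

definition normalized_haar :: "'g::topological_space monoid \<Rightarrow> 'g measure \<Rightarrow> bool" where
  "normalized_haar G \<mu> \<longleftrightarrow>
     prob_space \<mu> \<and> sets \<mu> = sets borel \<and>
     (\<forall>g. distr \<mu> borel (\<lambda>x. g \<otimes>\<^bsub>G\<^esub> x) = \<mu>)"


section \<open>Finite-dimensional real and complex representations\<close>

(* The scalar field 'k is a finite-dimensional real normed field, that is, the real or the complex
   numbers, both of which are instances. The norm on 'v is an auxiliary one inducing the canonical
   topology of a finite-dimensional space; its sort constraints then hold automatically and are
   only there to make the Bochner integral available. *)
definition fd_representation ::
  "'g monoid \<Rightarrow> ('g, 'e::real_normed_vector) chart set \<Rightarrow>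
   ('k::{real_normed_field,euclidean_space} \<Rightarrow> 'v::{banach,second_countable_topology} \<Rightarrow> 'v) \<Rightarrow>
   ('g \<Rightarrow> 'v \<Rightarrow> 'v) \<Rightarrow> bool" where
  "fd_representation G A scal \<rho> \<longleftrightarrow>
     vector_space scal \<and> (\<forall>r v. scal (of_real r) v = r *\<^sub>R v) \<and>
     (\<exists>B. finite B \<and> module.span scal B = UNIV) \<and>
     (\<forall>g. Vector_Spaces.linear scal scal (\<rho> g)) \<and>
     \<rho> \<one>\<^bsub>G\<^esub> = id \<and> (\<forall>g h. \<rho> (g \<otimes>\<^bsub>G\<^esub> h) = \<rho> g \<circ> \<rho> h) \<and>
     (\<forall>v. smooth_map A (\<lambda>g. \<rho> g v))"

definition subrep ::
  "('k::field \<Rightarrow> 'v::ab_group_add \<Rightarrow> 'v) \<Rightarrow> ('g \<Rightarrow> 'v \<Rightarrow> 'v) \<Rightarrow> 'v set \<Rightarrow> bool" where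
  "subrep scal \<rho> U \<longleftrightarrow> module.subspace scal U \<and> (\<forall>g. \<rho> g ` U \<subseteq> U)"

definition irreducible_subrep ::
  "('k::field \<Rightarrow> 'v::ab_group_add \<Rightarrow> 'v) \<Rightarrow> ('g \<Rightarrow> 'v \<Rightarrow> 'v) \<Rightarrow> 'v set \<Rightarrow> bool" where
  "irreducible_subrep scal \<rho> U \<longleftrightarrow>
     subrep scal \<rho> U \<and> U \<noteq> {0} \<and>
     (\<forall>U'. subrep scal \<rho> U' \<and> U' \<subseteq> U \<longrightarrow> U' = {0} \<or> U' = U)"

definition equivalent_subreps ::
  "('k::field \<Rightarrow> 'v::ab_group_add \<Rightarrow> 'v) \<Rightarrow> ('g \<Rightarrow> 'v \<Rightarrow> 'v) \<Rightarrow> 'v set \<Rightarrow> 'v set \<Rightarrow> bool" where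
  "equivalent_subreps scal \<rho> U U' \<longleftrightarrow>
     (\<exists>L. (\<forall>x\<in>U. \<forall>y\<in>U. L (x + y) = L x + L y) \<and>
          (\<forall>c. \<forall>x\<in>U. L (scal c x) = scal c (L x)) \<and>
          bij_betw L U U' \<and> (\<forall>g. \<forall>x\<in>U. L (\<rho> g x) = \<rho> g (L x)))"

(* The classes [\<tau>] of irreducible representations that occur in \<rho>, each one represented by the set
   of all irreducible subrepresentations of \<rho> belonging to it. For all other classes the isotypic
   component is zero. *)
definition irr_classes ::
  "('k::field \<Rightarrow> 'v::ab_group_add \<Rightarrow> 'v) \<Rightarrow> ('g \<Rightarrow> 'v \<Rightarrow> 'v) \<Rightarrow> 'v set set set" where
  "irr_classes scal \<rho> =
     {U. irreducible_subrep scal \<rho> U} //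
     {(U, U'). irreducible_subrep scal \<rho> U \<and> irreducible_subrep scal \<rho> U' \<and>
               equivalent_subreps scal \<rho> U U'}"

definition isotypic ::
  "('k::field \<Rightarrow> 'v::ab_group_add \<Rightarrow> 'v) \<Rightarrow> 'v set set \<Rightarrow> 'v set" where
  "isotypic scal \<tau> = module.span scal (\<Union>\<tau>)"

definition is_direct_sum :: "'i set \<Rightarrow> ('i \<Rightarrow> 'v::comm_monoid_add set) \<Rightarrow> bool" where
  "is_direct_sum I V \<longleftrightarrow>
     finite I \<and>
     (\<forall>v. \<exists>!u. (\<forall>i\<in>I. u i \<in> V i) \<and> (\<forall>i. i \<notin> I \<longrightarrow> u i = 0) \<and> v = (\<Sum>i\<in>I. u i))"

(* Integral of an operator-valued function X, evaluated at the vector v. *)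
definition op_integral ::
  "'w measure \<Rightarrow> ('w \<Rightarrow> 'v \<Rightarrow> 'v::{banach,second_countable_topology}) \<Rightarrow> 'v \<Rightarrow> 'v" where
  "op_integral M X v = (\<integral>\<omega>. X \<omega> v \<partial>M)"

(* T(\<nu>), the integral of \<nu>(g) \<rho>(g) dg *)
definition density_op ::
  "'g measure \<Rightarrow> ('g \<Rightarrow> 'v \<Rightarrow> 'v::{banach,second_countable_topology}) \<Rightarrow>
   ('g \<Rightarrow> real) \<Rightarrow> 'v \<Rightarrow> 'v" where
  "density_op \<mu> \<rho> \<nu> = op_integral \<mu> (\<lambda>g v. \<nu> g *\<^sub>R \<rho> g v)"

definition C2_density ::
  "('g, 'e::real_normed_vector) chart set \<Rightarrow> 'g measure \<Rightarrow> ('g \<Rightarrow> real) \<Rightarrow> bool" where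
  "C2_density A \<mu> \<nu> \<longleftrightarrow> Ck_map A 2 \<nu> \<and> (\<forall>g. 0 \<le> \<nu> g) \<and> (\<integral>g. \<nu> g \<partial>\<mu>) = 1"

(* c_[\<tau>] for the irreducible representation \<tau> given by restricting \<rho> to U *)
definition casimir_const ::
  "'g monoid \<Rightarrow> ('g, 'e::real_normed_vector) chart set \<Rightarrow> 'e set \<Rightarrow> 'g measure \<Rightarrow>
   ('g \<Rightarrow> 'v \<Rightarrow> 'v::{banach,second_countable_topology}) \<Rightarrow> 'v set \<Rightarrow> real" where
  "casimir_const G A \<Xi> \<mu> \<rho> U =
     (THE c. c \<le> 0 \<and>
        (\<forall>\<nu>. C2_density A \<mu> \<nu> \<longrightarrow>
           (\<forall>v\<in>U. c *\<^sub>R density_op \<mu> \<rho> \<nu> v = density_op \<mu> \<rho> (laplacian G A \<Xi> \<nu>) v)))"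

definition lie_rep ::
  "'g monoid \<Rightarrow> ('g, 'e::real_normed_vector) chart set \<Rightarrow>
   ('g \<Rightarrow> 'v \<Rightarrow> 'v::real_normed_vector) \<Rightarrow> 'e \<Rightarrow> 'v \<Rightarrow> 'v" where
  "lie_rep G A \<rho> \<xi> v = lvf G A \<xi> (\<lambda>g. \<rho> g v) \<one>\<^bsub>G\<^esub>"

definition casimir_op ::
  "'g monoid \<Rightarrow> ('g, 'e::real_normed_vector) chart set \<Rightarrow> 'e set \<Rightarrow>
   ('g \<Rightarrow> 'v \<Rightarrow> 'v::real_normed_vector) \<Rightarrow> 'v \<Rightarrow> 'v" where
  "casimir_op G A \<Xi> \<rho> v = (\<Sum>a\<in>\<Xi>. lie_rep G A \<rho> a (lie_rep G A \<rho> a v))"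

definition op_exp :: "('v \<Rightarrow> 'v::real_normed_vector) \<Rightarrow> 'v \<Rightarrow> 'v" where
  "op_exp L v = (\<Sum>n. (L ^^ n) v /\<^sub>R fact n)"


section \<open>Brownian motion\<close>

definition centered_gaussian :: "'w measure \<Rightarrow> ('w \<Rightarrow> real) \<Rightarrow> bool" where
  "centered_gaussian M X \<longleftrightarrow>
     X \<in> borel_measurable M \<and>
     ((AE \<omega> in M. X \<omega> = 0) \<or> (\<exists>\<sigma>>0. distributed M lborel X (normal_density 0 \<sigma>)))"

(* W a is the component of the driving process along the basis vector a. *)
definition gaussian_driver ::
  "'e set \<Rightarrow> 'w measure \<Rightarrow> ('e \<Rightarrow> real \<Rightarrow> 'w \<Rightarrow> real) \<Rightarrow> bool" where
  "gaussian_driver \<Xi> M W \<longleftrightarrow>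
     (\<forall>J c. finite J \<and> J \<subseteq> \<Xi> \<times> {0..} \<longrightarrow>
        centered_gaussian M (\<lambda>\<omega>. \<Sum>(a, t)\<in>J. c (a, t) * W a t \<omega>)) \<and>
     (\<forall>a\<in>\<Xi>. \<forall>b\<in>\<Xi>. \<forall>s\<ge>0. \<forall>t\<ge>0.
        (\<integral>\<omega>. W a t \<omega> * W b s \<omega> \<partial>M) = (if a = b then min t s else 0)) \<and>
     (AE \<omega> in M. \<forall>a\<in>\<Xi>. continuous_on {0..} (\<lambda>t. W a t \<omega>))"

(* Only the F t with t \<ge> 0 matter; negative times are present because of the index type. *)
definition driver_filtration ::
  "'e set \<Rightarrow> 'w measure \<Rightarrow> (real \<Rightarrow> 'w measure) \<Rightarrow> ('e \<Rightarrow> real \<Rightarrow> 'w \<Rightarrow> real) \<Rightarrow> bool" where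
  "driver_filtration \<Xi> M F W \<longleftrightarrow>
     filtration (space M) F \<and> (\<forall>t. subalgebra M (F t)) \<and>
     (\<forall>a\<in>\<Xi>. \<forall>t\<ge>0. W a t \<in> borel_measurable (F t)) \<and>
     (\<forall>s\<ge>0. \<forall>t\<ge>s. prob_space.indep_set M (sets (F s))
        (sets (vimage_algebra (space M) (\<lambda>\<omega>. \<lambda>a\<in>\<Xi>. W a t \<omega> - W a s \<omega>) (PiM \<Xi> (\<lambda>_. borel)))))"

(* S is the Stratonovich integral of X against Y over [0,t]: the limit in probability of the
   symmetric Riemann sums over the partitions 0 = \<tau> 0 \<le> ... \<le> \<tau> n = t, as the mesh tends to 0. *)
definition has_stratonovich_integral ::
  "'w measure \<Rightarrow> (real \<Rightarrow> 'w \<Rightarrow> real) \<Rightarrow> (real \<Rightarrow> 'w \<Rightarrow> real) \<Rightarrow> real \<Rightarrow> ('w \<Rightarrow> real) \<Rightarrow> bool" where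
  "has_stratonovich_integral M X Y t S \<longleftrightarrow>
     S \<in> borel_measurable M \<and>
     (\<forall>\<epsilon>>0. \<exists>\<delta>>0. \<forall>n \<tau>.
        \<tau> 0 = 0 \<and> \<tau> n = t \<and> (\<forall>i<n. \<tau> i \<le> \<tau> (Suc i) \<and> \<tau> (Suc i) - \<tau> i < \<delta>) \<longrightarrow>
        measure M {\<omega> \<in> space M.
          \<bar>(\<Sum>i<n. (X (\<tau> i) \<omega> + X (\<tau> (Suc i)) \<omega>) / 2 * (Y (\<tau> (Suc i)) \<omega> - Y (\<tau> i) \<omega>)) - S \<omega>\<bar> > \<epsilon>}
        < \<epsilon>)"

(* Solution of dg = (sum over a of) a(g) o dW^a with g_0 = 1. As for any SDE on a manifold this
   means: f(g_t) = f(g_0) + (sum over a of) the integral of (a f)(g) o dW^a, for all smooth f. *)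
definition lie_brownian_motion ::
  "'g::topological_space monoid \<Rightarrow> ('g, 'e::real_normed_vector) chart set \<Rightarrow> 'e set \<Rightarrow>
   'w measure \<Rightarrow> (real \<Rightarrow> 'w measure) \<Rightarrow> ('e \<Rightarrow> real \<Rightarrow> 'w \<Rightarrow> real) \<Rightarrow> (real \<Rightarrow> 'w \<Rightarrow> 'g) \<Rightarrow> bool" where
  "lie_brownian_motion G A \<Xi> M F W g \<longleftrightarrow>
     prob_space M \<and> gaussian_driver \<Xi> M W \<and> driver_filtration \<Xi> M F W \<and>
     (\<forall>t\<ge>0. g t \<in> measurable (F t) borel) \<and>
     (AE \<omega> in M. continuous_on {0..} (\<lambda>t. g t \<omega>)) \<and>
     (AE \<omega> in M. g 0 \<omega> = \<one>\<^bsub>G\<^esub>) \<and>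
     (\<forall>f :: 'g \<Rightarrow> real. smooth_map A f \<longrightarrow>
        (\<forall>t\<ge>0. \<exists>S.
           (\<forall>a\<in>\<Xi>. has_stratonovich_integral M (\<lambda>s \<omega>. lvf G A a f (g s \<omega>)) (W a) t (S a)) \<and>
           (AE \<omega> in M. f (g t \<omega>) = f (g 0 \<omega>) + (\<Sum>a\<in>\<Xi>. S a \<omega>))))"

end

theory Submission
  imports Defs
begin

text \<open>
  A matrix coefficient \<open>f\<close> of \<open>\<rho>\<close> and its derivatives \<open>a f\<close> are again matrix coefficients, so the
  Stratonovich equation holds for all of them. The Stratonovich integrals are only given as limits
  of trapezoidal sums over all fine partitions. Refining an arbitrary part of the intervals of a
  partition does not change the limit, hence the local errors are small after summation over
  any set of intervals, hence (averaging over random signs) their squares have a small sum. So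
  \<open>f(g\<^sub>t)\<close> differs from its martingale part by a process of zero quadratic variation, whose
  covariation with the driving Brownian motion vanishes. This gives the Ito form of the equation,
  and \<open>E(f(g\<^sub>t)) = f(1) + \<integral> E(\<Delta>f(g\<^sub>s)) ds / 2\<close> over \<open>[0, t]\<close>; iterating, \<open>E(\<rho>(g\<^sub>t)) = exp(t \<rho>(C) / 2)\<close>.

  The Casimir operator is self-adjoint and non-positive for an invariant inner product and commutes
  with \<open>\<rho>\<close>, so it is a scalar \<open>c \<le> 0\<close> on each irreducible subrepresentation, real or complex, and
  \<open>c = 0\<close> only for trivial ones, as \<open>G\<close> is connected. Integration by parts against the Haar measure
  identifies \<open>c\<close> with the constant \<open>c\<^sub>\<tau>\<close>.
\<close>

section \<open>Finite-dimensional normed spaces\<close>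

text \<open>The definition yields only convergence in probability, separately for each end point,
  and neither adaptedness nor moments of the integrals \<open>S t\<close>. Hence all errors are
  measured by \<open>prob_size\<close>, a truncated first moment, and they become errors of
  expectations only at the end, through second moments bounded independently of the grid. The
  equation is used on two levels, for a function and for its first derivatives; the increments of
  the latter against \<open>W\<close> produce the second-order term with the factor 1/2. Matrix
  coefficients make this work: compactness bounds them, and a left-invariant derivative merely
  changes the vector, so one finite-dimensional space serves all orders and powers of the Casimir
  operator grow geometrically. The spaces are finite-dimensional without being Euclidean, so
  boundedness of linear maps and compactness of bounded closed sets are drawn from coordinates. Over
  the reals no algebraic closedness supplies an eigenvector of the Casimir operator; the maximum of
  a Rayleigh quotient does so over both fields.\<close>

lemma compact_coefficient_box:
  fixes I :: "'i \<Rightarrow> real set"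
  assumes "\<And>i. compact (I i)"
  shows "compact {c. \<forall>i. c i \<in> I i}"
proof -
  \<comment> \<open>Tychonoff, since the function type carries the product topology.\<close>
  have "compactin (product_topology (\<lambda>i. euclidean) UNIV) (PiE UNIV I)"
    using assms by (simp add: compactin_PiE)
  moreover have "PiE UNIV I = {c. \<forall>i. c i \<in> I i}"
    by (auto simp: PiE_def Pi_def)
  ultimately show ?thesis
    by (simp add: euclidean_product_topology compactin_euclidean_iff)
qed

text \<open>Equivalence of the norm with the sup norm of the coefficients, by compactness of the
  unit sphere of the latter.\<close>
lemma coefficients_bounded_by_norm:
  fixes B :: "'a::real_normed_vector set"
  assumes "finite B" "independent B"
  shows "\<exists>K>0. \<forall>c. \<forall>b\<in>B. \<bar>c b\<bar> \<le> K * norm (\<Sum>b\<in>B. c b *\<^sub>R b)"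
proof (cases "B = {}")
  case True
  then show ?thesis by (auto intro: exI[of _ 1])
next
  case False
  \<comment> \<open>Coordinates outside \<open>B\<close> are frozen at 0, so that the cube is a
    product of compact sets over the whole type.\<close>
  define I where "I = (\<lambda>b. if b \<in> B then {-1..1::real} else {0})"
  define box where "box = {c. \<forall>i. c i \<in> I i}"
  have box: "compact box"
    unfolding box_def by (rule compact_coefficient_box) (auto simp: I_def)
  \<comment> \<open>The face of the cube where coordinate \<open>b\<close> is 1. The opposite faces
    are reached as well, because coefficients are later divided by \<open>c b'\<close> together with
    its sign.\<close>
  define J where "J b = box \<inter> (\<lambda>c. c b) -` {1}" for b
  have cont1: "continuous_on UNIV (\<lambda>c::'a \<Rightarrow> real. c b)" for b
    by (rule continuous_on_product_coordinates)
  have J: "compact (J b)" for b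
    unfolding J_def using box
    by (metis closed_singleton closed_vimage compact_Int_closed cont1)
  have contS: "continuous_on X (\<lambda>c. norm (\<Sum>b\<in>B. c b *\<^sub>R b))" for X
    by (intro continuous_intros continuous_on_subset[OF cont1]) auto
  have "\<exists>m>0. \<forall>c\<in>J b. m \<le> norm (\<Sum>b\<in>B. c b *\<^sub>R b)" if b: "b \<in> B" for b
  proof -
    have "(\<lambda>x. if x = b then 1 else 0) \<in> J b"
      using b by (auto simp: J_def box_def I_def)
    then have ne: "J b \<noteq> {}" by blast
    obtain c where c: "c \<in> J b" "\<And>d. d \<in> J b \<Longrightarrow> norm (\<Sum>b\<in>B. c b *\<^sub>R b) \<le> norm (\<Sum>b\<in>B. d b *\<^sub>R b)"
      using continuous_attains_inf[OF J ne contS] by blast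
    have "(\<Sum>b\<in>B. c b *\<^sub>R b) \<noteq> 0"
    proof
      assume "(\<Sum>b\<in>B. c b *\<^sub>R b) = 0"
      then have "c b = 0" using independentD[OF assms(2,1) subset_refl] b by blast
      then show False using c(1) by (simp add: J_def)
    qed
    then show ?thesis using c(2) by (intro exI[of _ "norm (\<Sum>b\<in>B. c b *\<^sub>R b)"]) auto
  qed
  then obtain m where m: "\<And>b. b \<in> B \<Longrightarrow> m b > 0"
     "\<And>b c. b \<in> B \<Longrightarrow> c \<in> J b \<Longrightarrow> m b \<le> norm (\<Sum>b\<in>B. c b *\<^sub>R b)"
    by metis
  define K where "K = (\<Sum>b\<in>B. 1 / m b)"
  have Kb: "1 / m b \<le> K" if "b \<in> B" for b
    unfolding K_def using that assms m(1)
    by (intro member_le_sum) (auto simp: less_imp_le)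
  have K: "K > 0" using False Kb m(1)
    by (meson all_not_in_conv divide_pos_pos less_le_trans zero_less_one)
  have "\<bar>c b\<bar> \<le> K * norm (\<Sum>b\<in>B. c b *\<^sub>R b)" if "b \<in> B" for c b
  proof -
    obtain b' where b': "b' \<in> B" "\<And>x. x \<in> B \<Longrightarrow> \<bar>c x\<bar> \<le> \<bar>c b'\<bar>"
    proof -
      have "Max ((\<lambda>x. \<bar>c x\<bar>) ` B) \<in> (\<lambda>x. \<bar>c x\<bar>) ` B" using assms(1) False by (intro Max_in) auto
      then obtain b' where "b' \<in> B" "\<bar>c b'\<bar> = Max ((\<lambda>x. \<bar>c x\<bar>) ` B)" by auto
      then show thesis using assms(1) by (intro that[of b']) auto
    qed
    show ?thesis
    proof (cases "c b' = 0")
      case True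
      then have "c b = 0" using b'(2)[OF that] by simp
      then show ?thesis using K by auto
    next
      case nz: False
      define d where "d x = (if x \<in> B then c x / c b' else 0)" for x
      have "d \<in> J b'" using b' nz by (auto simp: J_def box_def I_def d_def abs_le_iff divide_simps)
        (smt (verit) b'(2))+
      then have 1: "m b' \<le> norm (\<Sum>b\<in>B. d b *\<^sub>R b)" using m b' by blast
      have "(\<Sum>b\<in>B. d b *\<^sub>R b) = (1 / c b') *\<^sub>R (\<Sum>b\<in>B. c b *\<^sub>R b)"
        by (simp add: scaleR_sum_right d_def)
      then have "norm (\<Sum>b\<in>B. d b *\<^sub>R b) = norm (\<Sum>b\<in>B. c b *\<^sub>R b) / \<bar>c b'\<bar>" by simp
      with 1 have "\<bar>c b'\<bar> \<le> 1 / m b' * norm (\<Sum>b\<in>B. c b *\<^sub>R b)"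
        using nz m(1)[OF b'(1)] by (simp add: field_simps)
      also have "\<dots> \<le> K * norm (\<Sum>b\<in>B. c b *\<^sub>R b)"
        using Kb[OF b'(1)] by (intro mult_right_mono) auto
      finally show ?thesis using b'(2)[OF that] by simp
    qed
  qed
  with K show ?thesis by blast
qed

text \<open>A predicate on the type: the spaces concerned may be zero and carry no distinguished
  inner product.\<close>

definition fin_dim :: "'a::real_vector itself \<Rightarrow> bool" where
  "fin_dim _ \<longleftrightarrow> (\<exists>B::'a set. finite B \<and> span B = UNIV)"

lemma fin_dim_basis:
  assumes "fin_dim TYPE('a::real_vector)"
  obtains B :: "'a::real_vector set" where "finite B" "independent B" "span B = UNIV"
proof -
  obtain S :: "'a::real_vector set" where S: "finite S" "span S = UNIV" using assms by (auto simp: fin_dim_def)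
  obtain B where B: "B \<subseteq> S" "independent B" "S \<subseteq> span B" by (rule maximal_independent_subset)
  have "span B = UNIV" using S B by (metis span_minimal subspace_span top.extremum_uniqueI)
  then show ?thesis using that B S finite_subset by blast
qed

text \<open>Expand in a basis; the coordinates are bounded by the norm.\<close>

lemma linear_fin_dim_bounded:
  fixes f :: "'a::real_normed_vector \<Rightarrow> 'b::real_normed_vector"
  assumes "fin_dim TYPE('a)" "linear f"
  shows "bounded_linear f"
proof -
  obtain B :: "'a set" where B: "finite B" "independent B" "span B = UNIV"
    using fin_dim_basis[OF assms(1)] .
  obtain K where K: "K > 0" "\<And>c b. b \<in> B \<Longrightarrow> \<bar>c b\<bar> \<le> K * norm (\<Sum>b\<in>B. c b *\<^sub>R b)"
    using coefficients_bounded_by_norm[OF B(1,2)] by blast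
  have "norm (f x) \<le> norm x * (\<Sum>b\<in>B. K * norm (f b))" for x
  proof -
    have x: "x = (\<Sum>b\<in>B. representation B x b *\<^sub>R b)"
      using B by (simp add: sum_representation_eq)
    have "f x = (\<Sum>b\<in>B. representation B x b *\<^sub>R f b)"
      by (subst x) (simp add: linear_sum[OF assms(2)] linear_scale[OF assms(2)])
    also have "norm \<dots> \<le> (\<Sum>b\<in>B. norm (representation B x b *\<^sub>R f b))" by (rule norm_sum)
    also have "\<dots> \<le> (\<Sum>b\<in>B. norm x * (K * norm (f b)))"
    proof (rule sum_mono)
      fix b assume b: "b \<in> B"
      have "\<bar>representation B x b\<bar> \<le> K * norm x" using K(2)[OF b, of "representation B x"] x by simp
      then show "norm (representation B x b *\<^sub>R f b) \<le> norm x * (K * norm (f b))"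
        using mult_right_mono[of "\<bar>representation B x b\<bar>" "K * norm x" "norm (f b)"]
        by (simp add: algebra_simps)
    qed
    finally show ?thesis by (simp add: sum_distrib_left)
  qed
  then show ?thesis
    using assms(2) by (intro bounded_linear.intro bounded_linear_axioms.intro exI) auto
qed

text \<open>Coordinates of a basis are the continuous functionals used throughout to separate
  points.\<close>

lemma representation_bounded_linear:
  assumes "independent B" "span B = (UNIV :: 'a::real_normed_vector set)" "fin_dim TYPE('a)"
  shows "bounded_linear (\<lambda>v. representation B v b)"
proof (rule linear_fin_dim_bounded[OF assms(3)])
  show "linear (\<lambda>v. representation B v b)"
    using assms(1,2) by (intro linearI) (simp_all add: representation_add representation_scale)
qed

text \<open>A bounded set lies in the continuous image of a compact box of coefficients. This
  provides the compact sphere for the Rayleigh quotient of the Casimir operator.\<close>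

lemma fin_dim_bounded_closed_compact:
  fixes S :: "'a::real_normed_vector set"
  assumes "fin_dim TYPE('a)" "bounded S" "closed S"
  shows "compact S"
proof -
  obtain B :: "'a set" where B: "finite B" "independent B" "span B = UNIV"
    using fin_dim_basis[OF assms(1)] .
  obtain K where K: "K > 0" "\<And>c b. b \<in> B \<Longrightarrow> \<bar>c b\<bar> \<le> K * norm (\<Sum>b\<in>B. c b *\<^sub>R b)"
    using coefficients_bounded_by_norm[OF B(1,2)] by blast
  obtain R where R: "\<And>x. x \<in> S \<Longrightarrow> norm x \<le> R" using assms(2) by (auto simp: bounded_iff)
  define I where "I = (\<lambda>b. if b \<in> B then {-(K*R)..K*R} else {0})"
  define box where "box = {c. \<forall>i. c i \<in> I i}"
  have box: "compact box"
    unfolding box_def by (rule compact_coefficient_box) (auto simp: I_def)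
  have "continuous_on box (\<lambda>c. \<Sum>b\<in>B. c b *\<^sub>R b)"
    by (intro continuous_intros continuous_on_subset[OF continuous_on_product_coordinates]) auto
  then have "compact ((\<lambda>c. \<Sum>b\<in>B. c b *\<^sub>R b) ` box)" using box compact_continuous_image by blast
  moreover have "S \<subseteq> (\<lambda>c. \<Sum>b\<in>B. c b *\<^sub>R b) ` box"
  proof
    fix x assume x: "x \<in> S"
    have e: "x = (\<Sum>b\<in>B. representation B x b *\<^sub>R b)"
      using B by (simp add: sum_representation_eq)
    have "\<bar>representation B x b\<bar> \<le> K * R" if "b \<in> B" for b
      using K(2)[OF that, of "representation B x"] e R[OF x] K(1)
      by (metis mult_left_mono order_trans less_imp_le)
    then have "representation B x \<in> box"
      unfolding box_def I_def
      by (auto simp: abs_le_iff real_vector.representation_ne_zero) (smt (verit) representation_ne_zero)+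
    with e show "x \<in> (\<lambda>c. \<Sum>b\<in>B. c b *\<^sub>R b) ` box" by blast
  qed
  ultimately show ?thesis using assms(3) by (metis compact_Int_closed inf.absorb2)
qed

section \<open>Convergence in probability and random signs\<close>

text \<open>In terms of random signs this conditions on the last sign, which is how both moment
  computations proceed by induction.\<close>

lemma sum_Pow_lessThan_Suc:
  fixes F :: "nat set \<Rightarrow> 'a::comm_monoid_add"
  shows "(\<Sum>I\<in>Pow {..<Suc n}. F I) = (\<Sum>I\<in>Pow {..<n}. F I + F (insert n I))"
proof -
  have "(\<Sum>I\<in>Pow {..<Suc n}. F I) = (\<Sum>I\<in>Pow {..<n} \<union> insert n ` Pow {..<n}. F I)"
    by (simp add: lessThan_Suc Pow_insert)
  also have "\<dots> = (\<Sum>I\<in>Pow {..<n}. F I) + (\<Sum>I\<in>insert n ` Pow {..<n}. F I)"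
    by (rule sum.union_disjoint) auto
  also have "(\<Sum>I\<in>insert n ` Pow {..<n}. F I) = (\<Sum>I\<in>Pow {..<n}. F (insert n I))"
  proof (subst sum.reindex)
    show "inj_on (insert n) (Pow {..<n})"
      by (rule inj_onI) (metis PowD insert_ident lessThan_iff less_irrefl subsetD)
  qed simp
  finally show ?thesis by (simp add: sum.distrib)
qed

text \<open>A set \<open>I\<close> encodes a choice of signs, plus on \<open>I\<close> and minus
  elsewhere; a sum over \<open>Pow {..<n}\<close> is \<open>2 ^ n\<close> times the expectation over
  independent fair signs.\<close>

definition signed_sum :: "(nat \<Rightarrow> real) \<Rightarrow> nat \<Rightarrow> nat set \<Rightarrow> real" where
  "signed_sum r n I = (\<Sum>i<n. if i \<in> I then r i else - r i)"

lemma signed_sum_Suc: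
  assumes "I \<subseteq> {..<n}"
  shows "signed_sum r (Suc n) I = signed_sum r n I - r n"
    and "signed_sum r (Suc n) (insert n I) = signed_sum r n I + r n"
  using assms by (auto simp: signed_sum_def intro!: sum.cong)

text \<open>The mixed terms cancel: \<open>(s + r)\<^sup>2 + (s - r)\<^sup>2 = 2 * s\<^sup>2 + 2 *
  r\<^sup>2\<close>.\<close>

lemma signed_sum_second_moment:
  "(\<Sum>I\<in>Pow {..<n}. (signed_sum r n I)\<^sup>2) = 2 ^ n * (\<Sum>i<n. (r i)\<^sup>2)"
proof (induction n)
  case 0 then show ?case by (simp add: signed_sum_def)
next
  case (Suc n)
  have "(\<Sum>I\<in>Pow {..<Suc n}. (signed_sum r (Suc n) I)\<^sup>2)
     = (\<Sum>I\<in>Pow {..<n}. 2 * (signed_sum r n I)\<^sup>2 + 2 * (r n)\<^sup>2)"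
    unfolding sum_Pow_lessThan_Suc
    by (rule sum.cong) (auto simp: signed_sum_Suc power2_eq_square algebra_simps)
  also have "\<dots> = 2 * (\<Sum>I\<in>Pow {..<n}. (signed_sum r n I)\<^sup>2) + 2 ^ n * 2 * (r n)\<^sup>2"
    by (simp add: sum.distrib sum_distrib_left card_Pow)
  finally show ?case by (simp add: Suc algebra_simps)
qed

text \<open>Khintchine's inequality for the exponent 4; the mixed term of the induction step is
  evaluated by the second moment.\<close>

lemma signed_sum_fourth_moment:
  "(\<Sum>I\<in>Pow {..<n}. (signed_sum r n I) ^ 4) \<le> 2 ^ n * (3 * (\<Sum>i<n. (r i)\<^sup>2)\<^sup>2)"
proof (induction n)
  case 0 then show ?case by (simp add: signed_sum_def)
next
  case (Suc n)
  let ?q = "\<Sum>i<n. (r i)\<^sup>2"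
  have "(\<Sum>I\<in>Pow {..<Suc n}. (signed_sum r (Suc n) I) ^ 4)
     = (\<Sum>I\<in>Pow {..<n}. 2 * (signed_sum r n I) ^ 4 + 12 * (r n)\<^sup>2 * (signed_sum r n I)\<^sup>2 + 2 * (r n)^4)"
    unfolding sum_Pow_lessThan_Suc
    by (rule sum.cong) (auto simp: signed_sum_Suc power2_eq_square power4_eq_xxxx algebra_simps)
  also have "\<dots> = 2 * (\<Sum>I\<in>Pow {..<n}. (signed_sum r n I) ^ 4)
      + 12 * (r n)\<^sup>2 * (\<Sum>I\<in>Pow {..<n}. (signed_sum r n I)\<^sup>2) + 2 ^ n * 2 * (r n) ^ 4"
    by (simp add: sum.distrib sum_distrib_left card_Pow)
  also have "\<dots> \<le> 2 * (2 ^ n * (3 * ?q\<^sup>2)) + 12 * (r n)\<^sup>2 * (2 ^ n * ?q) + 2 ^ n * 2 * (r n) ^ 4"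
    using Suc by (simp add: signed_sum_second_moment)
  also have "\<dots> = 2 ^ n * (6 * ?q\<^sup>2 + 12 * (r n)\<^sup>2 * ?q + 2 * (r n) ^ 4)"
    by (simp add: algebra_simps)
  \<comment> \<open>Raising the last coefficient from 2 to 6 completes the square
    \<open>6 * (?q + (r n)\<^sup>2)\<^sup>2\<close>.\<close>
  also have "\<dots> \<le> 2 ^ n * (6 * ?q\<^sup>2 + 12 * (r n)\<^sup>2 * ?q + 6 * (r n) ^ 4)"
    by (intro mult_left_mono add_left_mono mult_right_mono) auto
  also have "\<dots> = 2 ^ Suc n * (3 * (?q + (r n)\<^sup>2)\<^sup>2)"
    by (simp add: power2_eq_square power4_eq_xxxx algebra_simps)
  finally show ?case by simp
qed

text \<open>A Paley--Zygmund estimate, stated for the truncation so that it can be integrated.\<close>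
lemma signed_sum_truncated_second_moment:
  "2 ^ n * min 1 (\<Sum>i<n. (r i)\<^sup>2) \<le> 4 * (\<Sum>I\<in>Pow {..<n}. min 1 ((signed_sum r n I)\<^sup>2))"
proof -
  define q where "q = (\<Sum>i<n. (r i)\<^sup>2)"
  have q0: "q \<ge> 0" by (simp add: q_def sum_nonneg)
  show ?thesis
  proof (cases "q = 0")
    case True
    then show ?thesis by (simp add: q_def[symmetric] sum_nonneg)
  next
    case False
    with q0 have q: "q > 0" by simp
    \<comment> \<open>With \<open>x = s\<^sup>2 / q\<close>, the parabola
      \<open>x - x\<^sup>2 / 4\<close> lies below \<open>min 1 x\<close>. Averaged over the signs it
      is at least 1 - 3/4, by the two moments; this is the origin of the factor 4 in the
      claim.\<close>
    have pt: "min 1 q * (s\<^sup>2 / q - s ^ 4 / (4 * q\<^sup>2)) \<le> min 1 (s\<^sup>2)" for s :: real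
    proof -
      define x where "x = s\<^sup>2 / q"
      have x: "x \<ge> 0" "s\<^sup>2 = q * x" "s ^ 4 / (4 * q\<^sup>2) = x\<^sup>2 / 4"
        using q by (auto simp: x_def power2_eq_square power4_eq_xxxx field_simps)
      have "0 \<le> (x / 2 - 1)\<^sup>2" by simp
      then have "x - x\<^sup>2 / 4 \<le> 1" by (simp add: power2_eq_square field_simps)
      then have "x - x\<^sup>2 / 4 \<le> min 1 x" by simp
      then have "min 1 q * (x - x\<^sup>2 / 4) \<le> min 1 q * min 1 x"
        using q by (intro mult_left_mono) auto
      also have "\<dots> \<le> min 1 (q * x)"
      proof (rule min.boundedI)
        show "min 1 q * min 1 x \<le> 1" using q x(1) by (intro mult_le_one) simp_all
        show "min 1 q * min 1 x \<le> q * x" using q x(1) by (intro mult_mono) simp_all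
      qed
      finally show ?thesis by (simp only: x(2)[symmetric] x(3)[symmetric] x_def[symmetric])
    qed
    have "2 ^ n * min 1 q / 4 = min 1 q * ((2 ^ n * q) / q - (2 ^ n * (3 * q\<^sup>2)) / (4 * q\<^sup>2))"
      using q by (simp add: field_simps)
    also have "\<dots> \<le> min 1 q * ((\<Sum>I\<in>Pow {..<n}. (signed_sum r n I)\<^sup>2) / q - 
       (\<Sum>I\<in>Pow {..<n}. (signed_sum r n I) ^ 4) / (4 * q\<^sup>2))"
      using signed_sum_second_moment[of r n] signed_sum_fourth_moment[of r n] q
      by (intro mult_left_mono diff_mono divide_right_mono) (auto simp: q_def)
    also have "\<dots> = (\<Sum>I\<in>Pow {..<n}. min 1 q * ((signed_sum r n I)\<^sup>2 / q - (signed_sum r n I) ^ 4 / (4 * q\<^sup>2)))"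
      unfolding sum_divide_distrib sum_subtractf[symmetric] sum_distrib_left ..
    also have "\<dots> \<le> (\<Sum>I\<in>Pow {..<n}. min 1 ((signed_sum r n I)\<^sup>2))"
      by (intro sum_mono pt)
    finally show ?thesis by (simp add: q_def)
  qed
qed

text \<open>A translation-invariant gauge for convergence in probability.\<close>
definition prob_size :: "'w measure \<Rightarrow> ('w \<Rightarrow> real) \<Rightarrow> real" where
  "prob_size M X = (\<integral>\<omega>. min 1 \<bar>X \<omega>\<bar> \<partial>M)"

lemma prob_size_nonneg: "0 \<le> prob_size M X"
  unfolding prob_size_def by (rule integral_nonneg_AE) auto

context prob_space
begin

lemma prob_size_integrable:
  "X \<in> borel_measurable M \<Longrightarrow> integrable M (\<lambda>\<omega>. min 1 \<bar>X \<omega>\<bar> :: real)"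
  by (rule integrable_const_bound[of _ 1]) auto

lemma prob_size_mono:
  assumes "X \<in> borel_measurable M" "Y \<in> borel_measurable M" "AE \<omega> in M. \<bar>X \<omega>\<bar> \<le> \<bar>Y \<omega>\<bar>"
  shows "prob_size M X \<le> prob_size M Y"
  unfolding prob_size_def using assms(3)
  by (intro integral_mono_AE prob_size_integrable assms(1,2)) auto

lemma prob_size_cong_AE:
  assumes "X \<in> borel_measurable M" "Y \<in> borel_measurable M" "AE \<omega> in M. X \<omega> = Y \<omega>"
  shows "prob_size M X = prob_size M Y"
  unfolding prob_size_def using assms(3)
  by (intro integral_cong_AE) (use assms(1,2) in auto)

lemma prob_size_add:
  assumes "X \<in> borel_measurable M" "Y \<in> borel_measurable M"
  shows "prob_size M (\<lambda>\<omega>. X \<omega> + Y \<omega>) \<le> prob_size M X + prob_size M Y"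
proof -
  have "prob_size M (\<lambda>\<omega>. X \<omega> + Y \<omega>) \<le> (\<integral>\<omega>. min 1 \<bar>X \<omega>\<bar> + min 1 \<bar>Y \<omega>\<bar> \<partial>M)"
    unfolding prob_size_def using assms
    by (intro integral_mono prob_size_integrable Bochner_Integration.integrable_add) auto
  also have "\<dots> = prob_size M X + prob_size M Y"
    unfolding prob_size_def using assms
    by (intro Bochner_Integration.integral_add prob_size_integrable)
  finally show ?thesis .
qed

lemma prob_size_uminus: "prob_size M (\<lambda>\<omega>. - X \<omega>) = prob_size M X"
  by (simp add: prob_size_def)

lemma prob_size_diff:
  assumes "X \<in> borel_measurable M" "Y \<in> borel_measurable M"
  shows "prob_size M (\<lambda>\<omega>. X \<omega> - Y \<omega>) \<le> prob_size M X + prob_size M Y"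
  using prob_size_add[of X "\<lambda>\<omega>. - Y \<omega>"] assms by (simp add: prob_size_uminus)

lemma prob_size_sum:
  assumes "\<And>i. i \<in> I \<Longrightarrow> X i \<in> borel_measurable M"
  shows "prob_size M (\<lambda>\<omega>. \<Sum>i\<in>I. X i \<omega>) \<le> (\<Sum>i\<in>I. prob_size M (X i))"
  using assms
proof (induction I rule: infinite_finite_induct)
  case (insert i I)
  then show ?case
    using prob_size_add[of "X i" "\<lambda>\<omega>. \<Sum>i\<in>I. X i \<omega>"] by (auto intro: borel_measurable_sum)
qed (auto simp: prob_size_def)

text \<open>The truncation destroys homogeneity, but for \<open>1 \<le> c\<close> the truncated
  value grows at most by the factor \<open>c\<close>.\<close>

lemma prob_size_scale:
  assumes "X \<in> borel_measurable M" "1 \<le> c"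
  shows "prob_size M (\<lambda>\<omega>. c * X \<omega>) \<le> c * prob_size M X"
proof -
  have pt: "min 1 \<bar>c * x\<bar> \<le> c * min 1 \<bar>x\<bar>" for x :: real
    using assms(2) by (cases "\<bar>x\<bar> \<le> 1") (auto simp: abs_mult)
  have "prob_size M (\<lambda>\<omega>. c * X \<omega>) \<le> (\<integral>\<omega>. c * min 1 \<bar>X \<omega>\<bar> \<partial>M)"
    unfolding prob_size_def using assms
    by (intro integral_mono prob_size_integrable integrable_mult_right pt) auto
  then show ?thesis by (simp add: prob_size_def)
qed

lemma prob_size_le_expectation:
  assumes "integrable M X"
  shows "prob_size M X \<le> (\<integral>\<omega>. \<bar>X \<omega>\<bar> \<partial>M)"
  unfolding prob_size_def using assms
  by (intro integral_mono prob_size_integrable) auto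

text \<open>Split at the level \<open>e\<close>: below it the integrand is at most \<open>e\<close>,
  above it at most 1 on a set of probability less than \<open>e\<close>.\<close>

lemma prob_size_le_prob:
  assumes [measurable]: "X \<in> borel_measurable M" and "0 < e" 
    "measure M {\<omega> \<in> space M. \<bar>X \<omega>\<bar> > e} < e"
  shows "prob_size M X \<le> 2 * e"
proof -
  let ?A = "{\<omega> \<in> space M. \<bar>X \<omega>\<bar> > e}"
  have A: "?A \<in> sets M" by measurable
  have int: "integrable M (\<lambda>\<omega>. e + indicator ?A \<omega>)"
    by (rule integrable_const_bound[of _ "e + 1"]) (use \<open>0 < e\<close> in \<open>auto simp: indicator_def\<close>)
  have "prob_size M X \<le> (\<integral>\<omega>. e + indicator ?A \<omega> \<partial>M)"
    unfolding prob_size_def using A \<open>0 < e\<close>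
    by (intro integral_mono prob_size_integrable int) (auto simp: indicator_def)
  also have "\<dots> = e + measure M ?A"
  proof -
    have "integrable M (indicator ?A :: 'a \<Rightarrow> real)"
      by (rule integrable_const_bound[of _ 1]) (auto simp: indicator_def)
    from Bochner_Integration.integral_add[OF integrable_const[of e] this]
    show ?thesis using A by (simp add: prob_space)
  qed
  finally show ?thesis using assms(3) by simp
qed

text \<open>Uniform integrability made explicit: up to \<open>K\<close> the gauge controls
  \<open>X\<close>, beyond \<open>K\<close> the square does. With bounded second moments,
  convergence in probability thus becomes convergence in mean, on taking \<open>K\<close> large
  first.\<close>

lemma expectation_le_prob_size:
  assumes "X \<in> borel_measurable M" "integrable M (\<lambda>\<omega>. (X \<omega>)\<^sup>2)" "1 \<le> K"
  shows "(\<integral>\<omega>. \<bar>X \<omega>\<bar> \<partial>M) \<le> K * prob_size M X + (\<integral>\<omega>. (X \<omega>)\<^sup>2 \<partial>M) / K"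
proof -
  have pt: "\<bar>x\<bar> \<le> K * min 1 \<bar>x\<bar> + x\<^sup>2 / K" for x :: real
  proof (cases "\<bar>x\<bar> \<le> K")
    case True
    then have "\<bar>x\<bar> \<le> K * min 1 \<bar>x\<bar>" using \<open>1 \<le> K\<close> mult_right_mono[of 1 K "\<bar>x\<bar>"] by (simp add: min_def)
    moreover have "0 \<le> x\<^sup>2 / K" using \<open>1 \<le> K\<close> by simp
    ultimately show ?thesis by linarith
  next
    case False
    then have "\<bar>x\<bar> * K \<le> \<bar>x\<bar> * \<bar>x\<bar>" by (intro mult_left_mono) auto
    then have "\<bar>x\<bar> \<le> x\<^sup>2 / K" using \<open>1 \<le> K\<close> by (simp add: field_simps power2_eq_square)
    moreover have "0 \<le> K * min 1 \<bar>x\<bar>" using \<open>1 \<le> K\<close> by simp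
    ultimately show ?thesis by linarith
  qed
  have int: "integrable M (\<lambda>\<omega>. K * min 1 \<bar>X \<omega>\<bar> + (X \<omega>)\<^sup>2 / K)"
    using assms by (intro Bochner_Integration.integrable_add integrable_mult_right prob_size_integrable) auto
  have "(\<integral>\<omega>. \<bar>X \<omega>\<bar> \<partial>M) \<le> (\<integral>\<omega>. K * min 1 \<bar>X \<omega>\<bar> + (X \<omega>)\<^sup>2 / K \<partial>M)"
    by (rule integral_mono[OF Bochner_Integration.integrable_bound[OF int] int])
      (use assms pt in \<open>auto intro!: AE_I2\<close>)
  also have "\<dots> = K * prob_size M X + (\<integral>\<omega>. (X \<omega>)\<^sup>2 \<partial>M) / K"
    using assms unfolding prob_size_def
    by (subst Bochner_Integration.integral_add) (auto intro!: prob_size_integrable)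
  finally show ?thesis .
qed

end

section \<open>Trapezoidal sums for Stratonovich integrals\<close>

definition grid :: "real \<Rightarrow> nat \<Rightarrow> nat \<Rightarrow> real" where
  "grid T n i = T * real i / real n"

definition trapezoid :: "(real \<Rightarrow> 'w \<Rightarrow> real) \<Rightarrow> (real \<Rightarrow> 'w \<Rightarrow> real) \<Rightarrow> real \<Rightarrow> real \<Rightarrow> 'w \<Rightarrow> real" where
  "trapezoid X Y s t \<omega> = (X s \<omega> + X t \<omega>) / 2 * (Y t \<omega> - Y s \<omega>)"

text \<open>Repeated points of a partition contribute nothing, so partitions may be padded with
  them.\<close>

lemma trapezoid_same [simp]: "trapezoid X Y s s \<omega> = 0"
  by (simp add: trapezoid_def)

context prob_space
begin

lemma stratonovich_prob_size:
  assumes "has_stratonovich_integral M X Y t S" "\<And>s. s \<ge> 0 \<Longrightarrow> X s \<in> borel_measurable M"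
    "\<And>s. s \<ge> 0 \<Longrightarrow> Y s \<in> borel_measurable M" "e > 0"
  shows "\<exists>d>0. \<forall>n \<tau>. \<tau> 0 = 0 \<and> \<tau> n = t \<and>
     (\<forall>i<n. \<tau> i \<le> \<tau> (Suc i) \<and> \<tau> (Suc i) - \<tau> i < d) \<longrightarrow>
     prob_size M (\<lambda>\<omega>. (\<Sum>i<n. trapezoid X Y (\<tau> i) (\<tau> (Suc i)) \<omega>) - S \<omega>) \<le> e"
proof -
  have [measurable]: "S \<in> borel_measurable M"
    using assms(1) by (simp add: has_stratonovich_integral_def)
  \<comment> \<open>Half of \<open>e\<close>, since \<open>prob_size_le_prob\<close> doubles the
    threshold.\<close>
  have "0 < e / 2" using assms(4) by simp
  with assms(1)[unfolded has_stratonovich_integral_def] obtain d where d: "d > 0" and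
    d': "\<And>n \<tau>. \<tau> 0 = 0 \<and> \<tau> n = t \<and> (\<forall>i<n. \<tau> i \<le> \<tau> (Suc i) \<and> \<tau> (Suc i) - \<tau> i < d) \<Longrightarrow>
        measure M {\<omega> \<in> space M. \<bar>(\<Sum>i<n. trapezoid X Y (\<tau> i) (\<tau> (Suc i)) \<omega>) - S \<omega>\<bar> > e / 2} < e / 2"
    unfolding trapezoid_def by blast
  show ?thesis
  proof (intro exI[of _ d] conjI d allI impI)
    fix n :: nat and \<tau> :: "nat \<Rightarrow> real"
    assume "\<tau> 0 = 0 \<and> \<tau> n = t \<and> (\<forall>i<n. \<tau> i \<le> \<tau> (Suc i) \<and> \<tau> (Suc i) - \<tau> i < d)"
    then have *: "\<tau> 0 = 0" "\<tau> n = t" "\<And>i. i < n \<Longrightarrow> \<tau> i \<le> \<tau> (Suc i) \<and> \<tau> (Suc i) - \<tau> i < d"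
      by auto
    \<comment> \<open>Measurability of \<open>X\<close> and \<open>Y\<close> is assumed only at
      non-negative times.\<close>
    have nn: "\<tau> i \<ge> 0" if "i \<le> n" for i
      using that
    proof (induction i)
      case 0 then show ?case using * by simp
    next
      case (Suc i) then show ?case using *(3)[of i] by auto
    qed
    have meas: "(\<lambda>\<omega>. (\<Sum>i<n. trapezoid X Y (\<tau> i) (\<tau> (Suc i)) \<omega>) - S \<omega>) \<in> borel_measurable M"
      unfolding trapezoid_def using assms(2,3) nn
      by (intro borel_measurable_diff borel_measurable_sum borel_measurable_times borel_measurable_divide
           borel_measurable_add borel_measurable_const) auto
    show "prob_size M (\<lambda>\<omega>. (\<Sum>i<n. trapezoid X Y (\<tau> i) (\<tau> (Suc i)) \<omega>) - S \<omega>) \<le> e"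
      using prob_size_le_prob[OF meas \<open>0 < e / 2\<close> d'[of \<tau> n]] * by simp
  qed
qed

text \<open>The first \<open>i * k\<close> steps of the fine grid partition the interval up to the
  coarse point \<open>grid T n i\<close>. Since \<open>S\<close> is chosen separately for each end
  point, this common refinement is what links the values at different coarse points.\<close>

lemma stratonovich_grid_limit:
  assumes S: "\<And>t. t \<ge> 0 \<Longrightarrow> has_stratonovich_integral M X Y t (S t)"
    and X: "\<And>s. s \<ge> 0 \<Longrightarrow> X s \<in> borel_measurable M"
    and Y: "\<And>s. s \<ge> 0 \<Longrightarrow> Y s \<in> borel_measurable M"
    and T: "T > 0" and n: "n > 0" and e: "e > 0"
  shows "eventually (\<lambda>k. prob_size M (\<lambda>\<omega>. 
     (\<Sum>j<i*k. trapezoid X Y (grid T (n*k) j) (grid T (n*k) (Suc j)) \<omega>) - S (grid T n i) \<omega>) \<le> e) sequentially"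
proof -
  have "grid T n i \<ge> 0" using T by (simp add: grid_def)
  from stratonovich_prob_size[OF S[OF this] X Y e] obtain d where d: "d > 0"
   "\<And>m \<tau>. \<tau> 0 = 0 \<and> \<tau> m = grid T n i \<and>
     (\<forall>i<m. \<tau> i \<le> \<tau> (Suc i) \<and> \<tau> (Suc i) - \<tau> i < d) \<Longrightarrow>
     prob_size M (\<lambda>\<omega>. (\<Sum>i<m. trapezoid X Y (\<tau> i) (\<tau> (Suc i)) \<omega>) - S (grid T n i) \<omega>) \<le> e"
    by blast
  obtain K :: nat where K: "T / d < real K" using reals_Archimedean2 by blast
  have "prob_size M (\<lambda>\<omega>. (\<Sum>j<i*k. trapezoid X Y (grid T (n*k) j) (grid T (n*k) (Suc j)) \<omega>) - S (grid T n i) \<omega>) \<le> e"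
    if k: "k \<ge> max 1 K" for k
  proof (rule d(2), intro conjI allI impI)
    show "grid T (n * k) 0 = 0" by (simp add: grid_def)
    show "grid T (n * k) (i * k) = grid T n i" using k n by (simp add: grid_def)
    fix j
    have mesh: "grid T (n * k) (Suc j) - grid T (n * k) j = T / (real n * real k)"
      by (simp add: grid_def ring_distribs add_divide_distrib)
    moreover have "T / d < real n * real k"
    proof -
      have "real K \<le> real n * real k"
        using k n mult_mono[of 1 "real n" "real K" "real k"] by simp
      then show ?thesis using K by linarith
    qed
    then have "T / (real n * real k) < d" using d(1) k n T
      by (simp add: field_simps)
    ultimately show "grid T (n * k) (Suc j) - grid T (n * k) j < d" by simp
    show "grid T (n * k) j \<le> grid T (n * k) (Suc j)"
      using T by (simp add: grid_def divide_right_mono)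
  qed
  then show ?thesis unfolding eventually_sequentially by blast
qed

end

text \<open>The points of the partition into \<^term>\<open>n\<close> intervals, of which those with index in
  \<^term>\<open>J\<close> are cut into \<^term>\<open>k\<close> pieces; in the others the left end point is repeated.\<close>
definition refined_grid :: "real \<Rightarrow> nat \<Rightarrow> nat \<Rightarrow> nat set \<Rightarrow> nat \<Rightarrow> real" where
  "refined_grid T n k J j = T / n * (real (j div k) + (if j div k \<in> J then real (j mod k) / real k else 0))"

lemma refined_grid_add:
  assumes "l < k"
  shows "refined_grid T n k J (i * k + l) = T / n * (real i + (if i \<in> J then real l / real k else 0))"
  using assms by (simp add: refined_grid_def)

text \<open>The successor of the last index of a block begins the next block. Outside
  \<open>J\<close> the whole coarse interval is therefore crossed in that one step.\<close>

lemma refined_grid_Suc_add: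
  assumes "l < k"
  shows "refined_grid T n k J (Suc (i * k + l)) =
     (if Suc l = k then T / n * real (Suc i) else T / n * (real i + (if i \<in> J then real (Suc l) / real k else 0)))"
proof (cases "Suc l = k")
  case True
  then have "Suc (i * k + l) = Suc i * k + 0" by simp
  then show ?thesis unfolding \<open>Suc (i * k + l) = Suc i * k + 0\<close>
    using refined_grid_add[of 0 k T n J "Suc i"] assms True by simp
next
  case False
  then have "Suc l < k" using assms by simp
  from refined_grid_add[OF this, of T n J i] show ?thesis using False by simp
qed

lemma refined_grid_mesh:
  assumes "0 < k" "0 < T" "0 < n"
  shows "refined_grid T n k J j \<le> refined_grid T n k J (Suc j)"
    "refined_grid T n k J (Suc j) - refined_grid T n k J j \<le> T / n"
proof -
  define i l where "i = j div k" and "l = j mod k"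
  have j: "j = i * k + l" "l < k" using assms by (auto simp: i_def l_def)
  define c where "c = T / n"
  have c: "c > 0" using assms by (simp add: c_def)
  define x where "x = (if i \<in> J then real l / real k else 0)"
  \<comment> \<open>The value 1 stands for the end of the block, be it refined or not.\<close>
  define y where "y = (if Suc l = k then 1 else if i \<in> J then real (Suc l) / real k else 0)"
  have xy: "x \<le> y" "y - x \<le> 1" "0 \<le> x" using j(2) by (auto simp: x_def y_def field_simps)
  have 1: "refined_grid T n k J j = c * (real i + x)" "refined_grid T n k J (Suc j) = c * (real i + y)"
    unfolding j(1) refined_grid_add[OF j(2)] refined_grid_Suc_add[OF j(2)]
    by (auto simp: x_def y_def c_def)
  show "refined_grid T n k J j \<le> refined_grid T n k J (Suc j)"
    unfolding 1 using c xy by (intro mult_left_mono) auto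
  have "refined_grid T n k J (Suc j) - refined_grid T n k J j = c * (y - x)"
    unfolding 1 by (simp add: algebra_simps)
  also have "\<dots> \<le> c * 1" using c xy by (intro mult_left_mono) auto
  finally show "refined_grid T n k J (Suc j) - refined_grid T n k J j \<le> T / n" by (simp add: c_def)
qed

lemma sum_nat_group:
  fixes f :: "nat \<Rightarrow> 'a::comm_monoid_add"
  shows "(\<Sum>j<n*k. f j) = (\<Sum>i<n. \<Sum>l<k. f (i * k + l))"
proof -
  have "(\<Sum>j<n*k. f j) = (\<Sum>i<n. sum f {i*k..<i*k+k})" by (rule sum.nat_group[symmetric])
  also have "\<dots> = (\<Sum>i<n. \<Sum>l<k. f (i * k + l))"
  proof (rule sum.cong[OF refl])
    fix i
    show "sum f {i*k..<i*k+k} = (\<Sum>l<k. f (i * k + l))"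
      using sum.shift_bounds_nat_ivl[of f 0 "i*k" k] by (simp add: atLeast0LessThan add.commute)
  qed
  finally show ?thesis .
qed

text \<open>In a block outside \<open>J\<close> the first \<open>k - 1\<close> intervals are
  degenerate and vanish, while the last one is the coarse interval.\<close>

lemma refined_grid_sum:
  assumes "0 < k" "0 < n"
  shows "(\<Sum>j<n*k. trapezoid X Y (refined_grid T n k J j) (refined_grid T n k J (Suc j)) \<omega>)
   = (\<Sum>i<n. if i \<in> J then (\<Sum>l<k. trapezoid X Y (grid T (n*k) (i*k+l)) (grid T (n*k) (Suc (i*k+l))) \<omega>)
        else trapezoid X Y (grid T n i) (grid T n (Suc i)) \<omega>)"
  unfolding sum_nat_group
proof (rule sum.cong[OF refl])
  fix i assume "i \<in> {..<n}"
  show "(\<Sum>l<k. trapezoid X Y (refined_grid T n k J (i*k+l)) (refined_grid T n k J (Suc (i*k+l))) \<omega>)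
   = (if i \<in> J then (\<Sum>l<k. trapezoid X Y (grid T (n*k) (i*k+l)) (grid T (n*k) (Suc (i*k+l))) \<omega>)
        else trapezoid X Y (grid T n i) (grid T n (Suc i)) \<omega>)"
  proof (cases "i \<in> J")
    case True
    have "refined_grid T n k J (i*k+l) = grid T (n*k) (i*k+l)"
         "refined_grid T n k J (Suc (i*k+l)) = grid T (n*k) (Suc (i*k+l))" if "l < k" for l
      unfolding refined_grid_add[OF that] refined_grid_Suc_add[OF that] using True assms that
      by (auto simp: grid_def field_simps)
    then show ?thesis using True by (auto intro!: sum.cong)
  next
    case False
    obtain k' where k': "k = Suc k'" using assms(1) gr0_implies_Suc by blast
    have "(\<Sum>l<k'. trapezoid X Y (refined_grid T n k J (i*k+l)) (refined_grid T n k J (Suc (i*k+l))) \<omega>) = 0"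
    proof (intro sum.neutral ballI)
      fix l assume "l \<in> {..<k'}"
      then have l: "l < k" "Suc l \<noteq> k" by (auto simp: k')
      show "trapezoid X Y (refined_grid T n k J (i*k+l)) (refined_grid T n k J (Suc (i*k+l))) \<omega> = 0"
        unfolding refined_grid_add[OF l(1)] refined_grid_Suc_add[OF l(1)] using False l(2) by simp
    qed
    moreover have l: "k' < k" "Suc k' = k" by (auto simp: k')
    have "refined_grid T n k J (i*k+k') = grid T n i"
      "refined_grid T n k J (Suc (i*k+k')) = grid T n (Suc i)"
      unfolding refined_grid_add[OF l(1)] refined_grid_Suc_add[OF l(1)] using False l(2)
      by (auto simp: grid_def)
    moreover have "sum h {..<k} = sum h {..<k'} + h k'" for h :: "nat \<Rightarrow> real" by (simp add: k')
    ultimately show ?thesis using False by simp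
  qed
qed

context prob_space
begin

text \<open>Over any subset of the intervals of a fine grid, the Stratonovich integral differs from the
  trapezoidal sums by a small amount, because refining the remaining intervals changes the
  Riemann sum into one that is close to the integral as well.\<close>
lemma stratonovich_subset_remainder:
  assumes S: "\<And>t. t \<ge> 0 \<Longrightarrow> has_stratonovich_integral M X Y t (S t)"
    and X: "\<And>s. s \<ge> 0 \<Longrightarrow> X s \<in> borel_measurable M"
    and Y: "\<And>s. s \<ge> 0 \<Longrightarrow> Y s \<in> borel_measurable M"
    and T: "T > 0" and e: "e > 0"
  shows "\<exists>N>0. \<forall>n\<ge>N. \<forall>I\<subseteq>{..<n}. prob_size M (\<lambda>\<omega>. \<Sum>i\<in>I.
     S (grid T n (Suc i)) \<omega> - S (grid T n i) \<omega> - trapezoid X Y (grid T n i) (grid T n (Suc i)) \<omega>) \<le> e"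
proof -
  have "T \<ge> 0" using T by simp
  from stratonovich_prob_size[OF S[OF this] X Y e] obtain d where d: "d > 0"
   "\<And>m \<tau>. \<tau> 0 = 0 \<and> \<tau> m = T \<and>
     (\<forall>i<m. \<tau> i \<le> \<tau> (Suc i) \<and> \<tau> (Suc i) - \<tau> i < d) \<Longrightarrow>
     prob_size M (\<lambda>\<omega>. (\<Sum>i<m. trapezoid X Y (\<tau> i) (\<tau> (Suc i)) \<omega>) - S T \<omega>) \<le> e"
    by blast
  obtain K :: nat where K: "T / d < real K" using reals_Archimedean2 by blast
  have K0: "K > 0" using K T d(1) by (metis divide_pos_pos gr0I less_trans of_nat_0 order_less_irrefl)
  have grid0: "grid T n i \<ge> 0" for n i using T by (simp add: grid_def)
  have Sm[measurable]: "S (grid T n i) \<in> borel_measurable M" for n i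
    using S[OF grid0] by (simp add: has_stratonovich_integral_def)
  have tm[measurable]: "(\<lambda>\<omega>. trapezoid X Y (grid T n i) (grid T n' j) \<omega>) \<in> borel_measurable M" for n i n' j
    unfolding trapezoid_def using X[OF grid0] Y[OF grid0] by measurable
  define R where "R n i \<omega> = S (grid T n (Suc i)) \<omega> - S (grid T n i) \<omega> - trapezoid X Y (grid T n i) (grid T n (Suc i)) \<omega>"
    for n i \<omega>
  have "prob_size M (\<lambda>\<omega>. \<Sum>i\<in>I. R n i \<omega>) \<le> e" if n: "n \<ge> K" and I: "I \<subseteq> {..<n}" for n I
  \<comment> \<open>The auxiliary refinement \<open>k\<close> is chosen after \<open>n\<close> and
    \<open>I\<close>. Its error goes into the arbitrary \<eta>, so that the bound \<open>e\<close>
    stays uniform in both.\<close>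
  proof (rule field_le_epsilon)
    fix \<eta> :: real assume \<eta>: "\<eta> > 0"
    have n0: "n > 0" using n K0 by simp
    \<comment> \<open>One error for the starting point and at most two for each of the
      \<open>n\<close> intervals: \<open>2 * n + 1\<close> in all.\<close>
    define \<theta> where "\<theta> = \<eta> / (2 * real n + 1)"
    have \<theta>: "\<theta> > 0" using \<eta> by (simp add: \<theta>_def)
    define E where "E k i \<omega> = (\<Sum>j<i*k. trapezoid X Y (grid T (n*k) j) (grid T (n*k) (Suc j)) \<omega>) - S (grid T n i) \<omega>"
      for k i \<omega>
    have Em[measurable]: "E k i \<in> borel_measurable M" for k i unfolding E_def by measurable
    have "eventually (\<lambda>k. \<forall>i\<in>{..n}. prob_size M (E k i) \<le> \<theta>) sequentially"
      unfolding E_def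
      by (intro eventually_ball_finite ballI stratonovich_grid_limit[OF S X Y T n0 \<theta>]) auto
    from eventually_happens'[OF sequentially_bot eventually_conj[OF this eventually_gt_at_top[of 0]]]
    obtain k where k: "k > 0" "\<And>i. i \<le> n \<Longrightarrow> prob_size M (E k i) \<le> \<theta>"
      by auto
    \<comment> \<open>The intervals outside \<open>I\<close> are refined, since there a fine
      trapezoidal sum nearly equals the increment of the integral.\<close>
    define J where "J = {..<n} - I"
    define Q where "Q \<omega> = (\<Sum>j<n*k. trapezoid X Y (refined_grid T n k J j) (refined_grid T n k J (Suc j)) \<omega>) - S T \<omega>" for \<omega>
    have gT: "grid T n n = T" "grid T n 0 = 0" using n0 by (auto simp: grid_def)
    have [measurable]: "S T \<in> borel_measurable M" using Sm[of n n] gT by simp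
    have Qm[measurable]: "Q \<in> borel_measurable M"
      unfolding Q_def refined_grid_sum[OF k(1) n0] by measurable
    have Q: "prob_size M Q \<le> e"
      unfolding Q_def
    proof (rule d(2), intro conjI allI impI)
      show "refined_grid T n k J 0 = 0" by (simp add: refined_grid_def)
      show "refined_grid T n k J (n * k) = T" using k n0 by (auto simp: refined_grid_def)
      fix i
      show "refined_grid T n k J i \<le> refined_grid T n k J (Suc i)"
        using k n0 T by (intro refined_grid_mesh)
      have "T / d < real n" using K n by linarith
      then have "T / n < d" using d(1) n0 by (simp add: field_simps)
      then show "refined_grid T n k J (Suc i) - refined_grid T n k J i < d"
        using refined_grid_mesh(2)[OF k(1) T n0, of J i] by linarith
    qed
    \<comment> \<open>\<open>Q\<close> compares the mixed Riemann sum with \<open>S T\<close>;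
      removing the nearly exact part over \<open>J\<close> leaves the errors over \<open>I\<close>.
      The term \<open>E k 0\<close> is \<open>- S 0\<close>, a start value that is small but not
      literally zero.\<close>
    have eq: "(\<Sum>i\<in>I. R n i \<omega>) = - Q \<omega> + (E k 0 \<omega> + (\<Sum>i\<in>J. E k (Suc i) \<omega> - E k i \<omega>))" for \<omega>
    proof -
      define f where "f i = (\<Sum>l<k. trapezoid X Y (grid T (n*k) (i*k+l)) (grid T (n*k) (Suc (i*k+l))) \<omega>)" for i
      define s where "s i = S (grid T n i) \<omega>" for i
      define t where "t i = trapezoid X Y (grid T n i) (grid T n (Suc i)) \<omega>" for i
      have E: "E k i \<omega> = (\<Sum>i<i. f i) - s i" for i by (simp add: E_def sum_nat_group f_def s_def)
      have un: "{..<n} = I \<union> J" "I \<inter> J = {}" "finite I" "finite J"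
        using I finite_subset by (auto simp: J_def)
      have "Q \<omega> = (\<Sum>i<n. if i \<in> J then f i else t i) - s n"
        unfolding Q_def refined_grid_sum[OF k(1) n0] f_def t_def s_def gT(1) ..
      also have "(\<Sum>i<n. if i \<in> J then f i else t i) = (\<Sum>i\<in>I. t i) + (\<Sum>i\<in>J. f i)"
        unfolding un(1) using un by (subst sum.union_disjoint) (auto intro!: sum.cong arg_cong2[where f="(+)"])
      finally have Q: "Q \<omega> = (\<Sum>i\<in>I. t i) + (\<Sum>i\<in>J. f i) - s n" .
      have "s n - s 0 = (\<Sum>i<n. s (Suc i) - s i)" by (simp add: sum_lessThan_telescope)
      also have "\<dots> = (\<Sum>i\<in>I. s (Suc i) - s i) + (\<Sum>i\<in>J. s (Suc i) - s i)"
        unfolding un(1) using un by (subst sum.union_disjoint) auto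
      finally have s: "s n = s 0 + (\<Sum>i\<in>I. s (Suc i) - s i) + (\<Sum>i\<in>J. s (Suc i) - s i)" by simp
      have "(\<Sum>i\<in>J. E k (Suc i) \<omega> - E k i \<omega>) = (\<Sum>i\<in>J. f i) - (\<Sum>i\<in>J. s (Suc i) - s i)"
        by (simp add: E sum.distrib sum_subtractf)
      moreover have "(\<Sum>i\<in>I. R n i \<omega>) = (\<Sum>i\<in>I. s (Suc i) - s i) - (\<Sum>i\<in>I. t i)"
        by (simp add: R_def s_def t_def sum_subtractf)
      moreover have "E k 0 \<omega> = - s 0" by (simp add: E)
      ultimately show ?thesis using Q s by linarith
    qed
    have "prob_size M (\<lambda>\<omega>. \<Sum>i\<in>I. R n i \<omega>)
       \<le> prob_size M (\<lambda>\<omega>. - Q \<omega>) + prob_size M (\<lambda>\<omega>. E k 0 \<omega> + (\<Sum>i\<in>J. E k (Suc i) \<omega> - E k i \<omega>))"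
      unfolding eq by (rule prob_size_add) measurable
    also have "\<dots> \<le> e + (prob_size M (E k 0) + prob_size M (\<lambda>\<omega>. \<Sum>i\<in>J. E k (Suc i) \<omega> - E k i \<omega>))"
      unfolding prob_size_uminus by (intro add_mono Q prob_size_add) measurable
    also have "\<dots> \<le> e + (\<theta> + (\<Sum>i\<in>J. prob_size M (\<lambda>\<omega>. E k (Suc i) \<omega> - E k i \<omega>)))"
      using k(2)[of 0] by (intro add_mono order_refl prob_size_sum) auto
    also have "\<dots> \<le> e + (\<theta> + (\<Sum>i\<in>J. \<theta> + \<theta>))"
    proof (intro add_mono order_refl sum_mono)
      fix i assume "i \<in> J"
      then have "i < n" by (simp add: J_def)
      then show "prob_size M (\<lambda>\<omega>. E k (Suc i) \<omega> - E k i \<omega>) \<le> \<theta> + \<theta>"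
        using prob_size_diff[OF Em Em, of k "Suc i" k i] k(2)[of i] k(2)[of "Suc i"] by simp
    qed
    also have "\<dots> \<le> e + (\<theta> + (\<Sum>i<n. \<theta> + \<theta>))"
      using \<theta> by (intro add_mono order_refl sum_mono2) (auto simp: J_def)
    also have "\<dots> = e + \<theta> * (2 * real n + 1)" by (simp add: algebra_simps)
    also have "\<dots> = e + \<eta>"
    proof -
      have "2 * real n + 1 \<noteq> 0" using of_nat_0_le_iff[of n, where 'a=real] by linarith
      then show ?thesis by (simp add: \<theta>_def)
    qed
    finally show "prob_size M (\<lambda>\<omega>. \<Sum>i\<in>I. R n i \<omega>) \<le> e + \<eta>" .
  qed
  then show ?thesis using K0 unfolding R_def by blast
qed

text \<open>Averaging over random signs turns smallness of all partial sums into smallness of the sum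
  of squares.\<close>
lemma stratonovich_square_remainder:
  assumes S: "\<And>t. t \<ge> 0 \<Longrightarrow> has_stratonovich_integral M X Y t (S t)"
    and X: "\<And>s. s \<ge> 0 \<Longrightarrow> X s \<in> borel_measurable M"
    and Y: "\<And>s. s \<ge> 0 \<Longrightarrow> Y s \<in> borel_measurable M"
    and T: "T > 0" and e: "e > 0"
  shows "\<exists>N>0. \<forall>n\<ge>N. prob_size M (\<lambda>\<omega>. \<Sum>i<n.
     (S (grid T n (Suc i)) \<omega> - S (grid T n i) \<omega> - trapezoid X Y (grid T n i) (grid T n (Suc i)) \<omega>)\<^sup>2) \<le> e"
proof -
  have grid0: "grid T n i \<ge> 0" for n i using T by (simp add: grid_def)
  have Sm[measurable]: "S (grid T n i) \<in> borel_measurable M" for n i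
    using S[OF grid0] by (simp add: has_stratonovich_integral_def)
  have tm[measurable]: "(\<lambda>\<omega>. trapezoid X Y (grid T n i) (grid T n' j) \<omega>) \<in> borel_measurable M" for n i n' j
    unfolding trapezoid_def using X[OF grid0] Y[OF grid0] by measurable
  define R where "R n i \<omega> = S (grid T n (Suc i)) \<omega> - S (grid T n i) \<omega> - trapezoid X Y (grid T n i) (grid T n (Suc i)) \<omega>"
    for n i \<omega>
  have Rm[measurable]: "R n i \<in> borel_measurable M" for n i unfolding R_def by measurable
  \<comment> \<open>A signed sum is a difference of two subset sums, which turns
    \<open>e / 8\<close> into \<open>e / 4\<close>; the factor 4 of the sign estimate turns this
    into \<open>e\<close>.\<close>
  have "e / 8 > 0" using e by simp
  from stratonovich_subset_remainder[OF S X Y T this] obtain N where N: "N > 0"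
    "\<And>n I. n \<ge> N \<Longrightarrow> I \<subseteq> {..<n} \<Longrightarrow> prob_size M (\<lambda>\<omega>. \<Sum>i\<in>I. R n i \<omega>) \<le> e / 8"
    unfolding R_def by blast
  have "prob_size M (\<lambda>\<omega>. \<Sum>i<n. (R n i \<omega>)\<^sup>2) \<le> e" if n: "n \<ge> N" for n
  proof -
    have sm[measurable]: "(\<lambda>\<omega>. signed_sum (\<lambda>i. R n i \<omega>) n I) \<in> borel_measurable M" for I
      unfolding signed_sum_def by measurable
    have sint: "integrable M (\<lambda>\<omega>. min 1 ((signed_sum (\<lambda>i. R n i \<omega>) n I)\<^sup>2))" for I
      by (rule integrable_const_bound[of _ 1]) auto
    have b: "(\<integral>\<omega>. min 1 ((signed_sum (\<lambda>i. R n i \<omega>) n I)\<^sup>2) \<partial>M) \<le> e / 4" if I: "I \<subseteq> {..<n}" for I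
    proof -
      have sq: "min 1 (x\<^sup>2) \<le> min 1 \<bar>x\<bar>" for x :: real
        using mult_left_mono[of "\<bar>x\<bar>" 1 "\<bar>x\<bar>"]
        by (cases "\<bar>x\<bar> \<le> 1") (auto simp: power2_eq_square abs_mult[symmetric])
      have eq: "signed_sum (\<lambda>i. R n i \<omega>) n I = (\<Sum>i\<in>I. R n i \<omega>) - (\<Sum>i\<in>{..<n} - I. R n i \<omega>)" for \<omega>
      proof -
        have un: "{..<n} = I \<union> ({..<n} - I)" "finite I"
          using I finite_subset by auto
        have "signed_sum (\<lambda>i. R n i \<omega>) n I = (\<Sum>i\<in>I \<union> ({..<n} - I). if i \<in> I then R n i \<omega> else - R n i \<omega>)"
          unfolding signed_sum_def using un(1) by simp
        also have "\<dots> = (\<Sum>i\<in>I. R n i \<omega>) - (\<Sum>i\<in>{..<n} - I. R n i \<omega>)"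
          using un by (subst sum.union_disjoint) (auto simp: sum_negf[symmetric] simp del: sum_negf)
        finally show ?thesis .
      qed
      have "(\<integral>\<omega>. min 1 ((signed_sum (\<lambda>i. R n i \<omega>) n I)\<^sup>2) \<partial>M) \<le> prob_size M (\<lambda>\<omega>. signed_sum (\<lambda>i. R n i \<omega>) n I)"
        unfolding prob_size_def by (intro integral_mono sint sq prob_size_integrable) measurable
      also have "\<dots> \<le> prob_size M (\<lambda>\<omega>. \<Sum>i\<in>I. R n i \<omega>) + prob_size M (\<lambda>\<omega>. \<Sum>i\<in>{..<n} - I. R n i \<omega>)"
        unfolding eq by (rule prob_size_diff) measurable
      also have "\<dots> \<le> e / 8 + e / 8" using n I by (intro add_mono N) auto
      finally show ?thesis by simp
    qed
    \<comment> \<open>Integrate the pointwise sign estimate, then interchange the integral with the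
      finite average over signs.\<close>
    have "2 ^ n * prob_size M (\<lambda>\<omega>. \<Sum>i<n. (R n i \<omega>)\<^sup>2) = (\<integral>\<omega>. 2 ^ n * min 1 (\<Sum>i<n. (R n i \<omega>)\<^sup>2) \<partial>M)"
      by (simp add: prob_size_def sum_nonneg)
    also have "\<dots> \<le> (\<integral>\<omega>. 4 * (\<Sum>I\<in>Pow {..<n}. min 1 ((signed_sum (\<lambda>i. R n i \<omega>) n I)\<^sup>2)) \<partial>M)"
    proof (intro integral_mono signed_sum_truncated_second_moment integrable_mult_right
          Bochner_Integration.integrable_sum sint)
      show "integrable M (\<lambda>\<omega>. min 1 (\<Sum>i<n. (R n i \<omega>)\<^sup>2))"
        by (rule integrable_const_bound[of _ 1]) (auto simp: sum_nonneg)
    qed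
    also have "\<dots> = 4 * (\<Sum>I\<in>Pow {..<n}. \<integral>\<omega>. min 1 ((signed_sum (\<lambda>i. R n i \<omega>) n I)\<^sup>2) \<partial>M)"
      using sint by simp
    also have "\<dots> \<le> 4 * (\<Sum>I\<in>Pow {..<n}. e / 4)"
      by (intro mult_left_mono sum_mono b) auto
    also have "\<dots> = 2 ^ n * e" by (simp add: card_Pow)
    finally show ?thesis by simp
  qed
  then show ?thesis using N(1) unfolding R_def by blast
qed

end

section \<open>The driving process\<close>

context prob_space
begin

text \<open>Expressing the fourth moment by the second treats normal laws and the degenerate law at
  0 alike.\<close>

lemma centered_gaussian_moments:
  assumes "centered_gaussian M X"
  shows "integrable M X" "(\<integral>\<omega>. X \<omega> \<partial>M) = 0" "integrable M (\<lambda>\<omega>. (X \<omega>)\<^sup>2)"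
    "integrable M (\<lambda>\<omega>. (X \<omega>) ^ 4)" "(\<integral>\<omega>. (X \<omega>) ^ 4 \<partial>M) = 3 * (\<integral>\<omega>. (X \<omega>)\<^sup>2 \<partial>M)\<^sup>2"
proof -
  have [measurable]: "X \<in> borel_measurable M" using assms by (simp add: centered_gaussian_def)
  have "integrable M X \<and> (\<integral>\<omega>. X \<omega> \<partial>M) = 0 \<and> integrable M (\<lambda>\<omega>. (X \<omega>)\<^sup>2) \<and>
    integrable M (\<lambda>\<omega>. (X \<omega>) ^ 4) \<and> (\<integral>\<omega>. (X \<omega>) ^ 4 \<partial>M) = 3 * (\<integral>\<omega>. (X \<omega>)\<^sup>2 \<partial>M)\<^sup>2"
  proof (cases "AE \<omega> in M. X \<omega> = 0")
    case True
    have z: "integrable M (\<lambda>\<omega>. X \<omega> ^ k) \<and> (\<integral>\<omega>. X \<omega> ^ k \<partial>M) = 0" if "k > 0" for k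
    proof -
      have ae: "AE \<omega> in M. X \<omega> ^ k = 0" using True that by auto
      have "integrable M (\<lambda>\<omega>. X \<omega> ^ k) \<longleftrightarrow> integrable M (\<lambda>\<omega>. 0 :: real)"
        by (rule integrable_cong_AE) (use ae in auto)
      moreover have "(\<integral>\<omega>. X \<omega> ^ k \<partial>M) = (\<integral>\<omega>. 0 \<partial>M)"
        by (rule integral_cong_AE) (use ae in auto)
      ultimately show ?thesis by simp
    qed
    show ?thesis using z[of 1] z[of 2] z[of 4] by simp
  next
    case False
    then obtain \<sigma> where s: "\<sigma> > 0" and D: "distributed M lborel X (normal_density 0 \<sigma>)"
      using assms by (auto simp: centered_gaussian_def)
    have int: "integrable M (\<lambda>\<omega>. X \<omega> ^ k)" for k
      using distributed_integrable[OF D, of "\<lambda>x. x ^ k"] integrable_normal_moment[OF s, of 0 k] by simp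
    have even: "(\<integral>\<omega>. X \<omega> ^ (2 * k) \<partial>M) = fact (2 * k) / ((2 / \<sigma>\<^sup>2)^k * fact k)" for k
      using distributed_integral[OF D, of "\<lambda>x. x ^ (2 * k)"] integral_normal_moment_even[OF s, of 0 k] by simp
    have "(\<integral>\<omega>. X \<omega> ^ 2 \<partial>M) = \<sigma>\<^sup>2" using even[of 1] s by simp
    moreover have "(\<integral>\<omega>. X \<omega> ^ 4 \<partial>M) = 3 * \<sigma> ^ 4"
      using even[of 2] s by (simp add: fact_numeral power_divide power_mult[symmetric])
    ultimately show ?thesis
      using int[of 1] int[of 2] int[of 4] normal_distributed_expectation[OF s D] by (simp add: power_mult[symmetric])
  qed
  then show "integrable M X" "(\<integral>\<omega>. X \<omega> \<partial>M) = 0" "integrable M (\<lambda>\<omega>. (X \<omega>)\<^sup>2)"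
    "integrable M (\<lambda>\<omega>. (X \<omega>) ^ 4)" "(\<integral>\<omega>. (X \<omega>) ^ 4 \<partial>M) = 3 * (\<integral>\<omega>. (X \<omega>)\<^sup>2 \<partial>M)\<^sup>2" by auto
qed

lemma integrable_mult_of_squares:
  fixes X Y :: "'a \<Rightarrow> real"
  assumes [measurable]: "X \<in> borel_measurable M" "Y \<in> borel_measurable M"
    and "integrable M (\<lambda>\<omega>. (X \<omega>)\<^sup>2)" "integrable M (\<lambda>\<omega>. (Y \<omega>)\<^sup>2)"
  shows "integrable M (\<lambda>\<omega>. X \<omega> * Y \<omega>)"
proof (rule Bochner_Integration.integrable_bound)
  show "integrable M (\<lambda>\<omega>. (X \<omega>)\<^sup>2 + (Y \<omega>)\<^sup>2)" using assms by simp
  show "AE \<omega> in M. norm (X \<omega> * Y \<omega>) \<le> norm ((X \<omega>)\<^sup>2 + (Y \<omega>)\<^sup>2)"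
  proof (rule AE_I2)
    fix \<omega>
    have "2 * \<bar>X \<omega>\<bar> * \<bar>Y \<omega>\<bar> \<le> \<bar>X \<omega>\<bar>\<^sup>2 + \<bar>Y \<omega>\<bar>\<^sup>2" by (rule sum_squares_bound)
    moreover have "0 \<le> \<bar>X \<omega>\<bar> * \<bar>Y \<omega>\<bar>" by simp
    ultimately have "\<bar>X \<omega>\<bar> * \<bar>Y \<omega>\<bar> \<le> \<bar>X \<omega>\<bar>\<^sup>2 + \<bar>Y \<omega>\<bar>\<^sup>2" by linarith
    then show "norm (X \<omega> * Y \<omega>) \<le> norm ((X \<omega>)\<^sup>2 + (Y \<omega>)\<^sup>2)" by (simp add: abs_mult)
  qed
qed measurable

end

section \<open>Independent increments and discrete martingales\<close>

locale driver = prob_space M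
  for M :: "'w measure" +
  fixes \<Xi> :: "'e set" and F :: "real \<Rightarrow> 'w measure" and W :: "'e \<Rightarrow> real \<Rightarrow> 'w \<Rightarrow> real"
  assumes finite_\<Xi>: "finite \<Xi>"
    and gaussian: "gaussian_driver \<Xi> M W"
    and filtration: "driver_filtration \<Xi> M F W"
begin

definition dW :: "'e \<Rightarrow> real \<Rightarrow> real \<Rightarrow> 'w \<Rightarrow> real" where
  "dW a s t \<omega> = W a t \<omega> - W a s \<omega>"

lemma adapted_measurable: "X \<in> measurable (F t) N \<Longrightarrow> X \<in> measurable M N"
  using filtration measurable_from_subalg unfolding driver_filtration_def by blast

lemma adapted_mono: "s \<le> t \<Longrightarrow> X \<in> measurable (F s) N \<Longrightarrow> X \<in> measurable (F t) N"
proof -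
  assume "s \<le> t" and X: "X \<in> measurable (F s) N"
  have "filtration (space M) F" using filtration by (simp add: driver_filtration_def)
  then have "subalgebra (F t) (F s)"
    using \<open>s \<le> t\<close> by (simp add: subalgebra_def filtration_def)
  with X show ?thesis by (rule measurable_from_subalg[rotated])
qed

lemma W_adapted: "a \<in> \<Xi> \<Longrightarrow> 0 \<le> t \<Longrightarrow> W a t \<in> borel_measurable (F t)"
  using filtration by (simp add: driver_filtration_def)

lemma W_measurable: "a \<in> \<Xi> \<Longrightarrow> 0 \<le> t \<Longrightarrow> W a t \<in> borel_measurable M"
  using W_adapted adapted_measurable by blast

lemma dW_adapted: "a \<in> \<Xi> \<Longrightarrow> 0 \<le> s \<Longrightarrow> s \<le> t \<Longrightarrow> dW a s t \<in> borel_measurable (F t)"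
  unfolding dW_def using W_adapted[of a t] adapted_mono[OF _ W_adapted[of a s]]
  by (intro borel_measurable_diff) auto

lemma dW_measurable: "a \<in> \<Xi> \<Longrightarrow> 0 \<le> s \<Longrightarrow> 0 \<le> t \<Longrightarrow> dW a s t \<in> borel_measurable M"
  unfolding dW_def using W_measurable by (intro borel_measurable_diff) auto

lemma W_gaussian: 
  assumes "a \<in> \<Xi>" "0 \<le> t" shows "centered_gaussian M (W a t)"
proof -
  have "\<forall>J c. finite J \<and> J \<subseteq> \<Xi> \<times> {0..} \<longrightarrow>
        centered_gaussian M (\<lambda>\<omega>. \<Sum>(a, t)\<in>J. c (a, t) * W a t \<omega>)"
    using gaussian by (simp add: gaussian_driver_def)
  from this[rule_format, of "{(a, t)}" "\<lambda>_. 1"] have "centered_gaussian M (\<lambda>\<omega>. \<Sum>(a, t)\<in>{(a, t)}. (\<lambda>_. 1) (a, t) * W a t \<omega>)"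
    using assms by simp
  then show ?thesis by simp
qed

lemma dW_gaussian:
  assumes "a \<in> \<Xi>" "0 \<le> s" "s < t" shows "centered_gaussian M (dW a s t)"
proof -
  have "\<forall>J c. finite J \<and> J \<subseteq> \<Xi> \<times> {0..} \<longrightarrow>
        centered_gaussian M (\<lambda>\<omega>. \<Sum>(a, t)\<in>J. c (a, t) * W a t \<omega>)"
    using gaussian by (simp add: gaussian_driver_def)
  \<comment> \<open>The weights 1 and -1 are told apart by the time, which is possible because
    \<open>s < t\<close>; for equal times the index set would collapse to one point.\<close>
  from this[rule_format, of "{(a, s), (a, t)}" "\<lambda>(b, u). if u = t then 1 else -1"]
  have "centered_gaussian M (\<lambda>\<omega>. \<Sum>(a, u)\<in>{(a, s), (a, t)}. (if u = t then 1 else -1) * W a u \<omega>)"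
    using assms by simp
  then show ?thesis using assms by (simp add: dW_def[abs_def])
qed

lemma W_covariance:
  assumes "a \<in> \<Xi>" "b \<in> \<Xi>" "0 \<le> s" "0 \<le> t"
  shows "(\<integral>\<omega>. W a t \<omega> * W b s \<omega> \<partial>M) = (if a = b then min t s else 0)"
    "integrable M (\<lambda>\<omega>. W a t \<omega> * W b s \<omega>)"
proof -
  have "\<forall>a\<in>\<Xi>. \<forall>b\<in>\<Xi>. \<forall>s\<ge>0. \<forall>t\<ge>0. (\<integral>\<omega>. W a t \<omega> * W b s \<omega> \<partial>M) = (if a = b then min t s else 0)"
    using gaussian by (simp add: gaussian_driver_def)
  then show "(\<integral>\<omega>. W a t \<omega> * W b s \<omega> \<partial>M) = (if a = b then min t s else 0)" using assms by blast
  show "integrable M (\<lambda>\<omega>. W a t \<omega> * W b s \<omega>)"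
    using assms by (intro integrable_mult_of_squares W_measurable centered_gaussian_moments(3) W_gaussian)
qed

lemma dW_covariance:
  assumes "a \<in> \<Xi>" "b \<in> \<Xi>" "0 \<le> s" "s \<le> t"
  shows "(\<integral>\<omega>. dW a s t \<omega> * dW b s t \<omega> \<partial>M) = (if a = b then t - s else 0)"
    "integrable M (\<lambda>\<omega>. dW a s t \<omega> * dW b s t \<omega>)"
proof -
  have t: "0 \<le> t" using assms by simp
  note I = W_covariance(2)
  have e: "dW a s t \<omega> * dW b s t \<omega> = (W a t \<omega> * W b t \<omega> - W a t \<omega> * W b s \<omega>) - (W a s \<omega> * W b t \<omega> - W a s \<omega> * W b s \<omega>)" for \<omega>
    by (simp add: dW_def algebra_simps)
  show "integrable M (\<lambda>\<omega>. dW a s t \<omega> * dW b s t \<omega>)"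
    unfolding e using assms t by (intro Bochner_Integration.integrable_diff I)
  show "(\<integral>\<omega>. dW a s t \<omega> * dW b s t \<omega> \<partial>M) = (if a = b then t - s else 0)"
    unfolding e using assms t
    by (simp add: W_covariance)
qed

lemma dW_moments:
  assumes "a \<in> \<Xi>" "0 \<le> s" "s < t"
  shows "integrable M (dW a s t)" "(\<integral>\<omega>. dW a s t \<omega> \<partial>M) = 0"
    "integrable M (\<lambda>\<omega>. (dW a s t \<omega>)\<^sup>2)" "(\<integral>\<omega>. (dW a s t \<omega>)\<^sup>2 \<partial>M) = t - s"
    "integrable M (\<lambda>\<omega>. (dW a s t \<omega>) ^ 4)" "(\<integral>\<omega>. (dW a s t \<omega>) ^ 4 \<partial>M) = 3 * (t - s)\<^sup>2"
  using centered_gaussian_moments[OF dW_gaussian[OF assms]] dW_covariance[of a a s t] assms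
  by (auto simp: power2_eq_square)

text \<open>The past is independent of the whole vector of increments. A function \<open>h\<close>
  of that vector covers single increments, which give the martingale property, and products of two,
  which give the covariations.\<close>

lemma indep_product:
  fixes Y :: "'w \<Rightarrow> real" and h :: "('e \<Rightarrow> real) \<Rightarrow> real"
  assumes s: "0 \<le> s" "s \<le> t" and Y: "Y \<in> borel_measurable (F s)" and "integrable M Y"
    and h: "h \<in> borel_measurable (PiM \<Xi> (\<lambda>_. borel))" and "integrable M (\<lambda>\<omega>. h (\<lambda>a\<in>\<Xi>. dW a s t \<omega>))"
  shows "(\<integral>\<omega>. Y \<omega> * h (\<lambda>a\<in>\<Xi>. dW a s t \<omega>) \<partial>M) = (\<integral>\<omega>. Y \<omega> \<partial>M) * (\<integral>\<omega>. h (\<lambda>a\<in>\<Xi>. dW a s t \<omega>) \<partial>M)"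
    and "integrable M (\<lambda>\<omega>. Y \<omega> * h (\<lambda>a\<in>\<Xi>. dW a s t \<omega>))"
proof -
  let ?Z = "\<lambda>\<omega>. h (\<lambda>a\<in>\<Xi>. dW a s t \<omega>)"
  let ?D = "\<lambda>\<omega>. \<lambda>a\<in>\<Xi>. W a t \<omega> - W a s \<omega>"
  let ?V = "vimage_algebra (space M) ?D (PiM \<Xi> (\<lambda>_. borel))"
  have D: "?D \<in> space M \<rightarrow> space (PiM \<Xi> (\<lambda>_. borel :: real measure))" by (auto simp: space_PiM)
  have spF: "space (F s) = space M" using filtration by (simp add: driver_filtration_def subalgebra_def)
  have ind: "indep_set (sets (F s)) (sets ?V)"
    using filtration s unfolding driver_filtration_def by blast
  have ZV: "?Z \<in> borel_measurable ?V"
    unfolding dW_def by (rule measurable_compose[OF measurable_vimage_algebra1[OF D] h])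
  have Ym: "Y \<in> borel_measurable M" using Y adapted_measurable by blast
  have Zm: "?Z \<in> borel_measurable M" using assms by auto
  have 1: "sigma_sets (space M) {Y -` A \<inter> space M |A. A \<in> sets borel} \<subseteq> sets (F s)"
    using measurable_sets[OF Y] unfolding spF[symmetric] by (intro sets.sigma_sets_subset) auto
  have 2: "sigma_sets (space M) {?Z -` A \<inter> space M |A. A \<in> sets borel} \<subseteq> sets ?V"
  proof -
    have "{?Z -` A \<inter> space M |A. A \<in> sets borel} \<subseteq> sets ?V"
      using measurable_sets[OF ZV] by auto
    from sets.sigma_sets_subset[OF this] show ?thesis by simp
  qed
  have "indep_var borel Y borel ?Z"
    unfolding indep_var_eq
  proof (intro conjI Ym Zm)
    show "indep_set (sigma_sets (space M) {Y -` A \<inter> space M |A. A \<in> sets borel})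
      (sigma_sets (space M) {?Z -` A \<inter> space M |A. A \<in> sets borel})"
      using ind 1 2 unfolding indep_sets2_eq by blast
  qed
  from indep_var_lebesgue_integral[OF this assms(4,6)] indep_var_integrable[OF this assms(4,6)]
  show "(\<integral>\<omega>. Y \<omega> * ?Z \<omega> \<partial>M) = (\<integral>\<omega>. Y \<omega> \<partial>M) * (\<integral>\<omega>. ?Z \<omega> \<partial>M)" "integrable M (\<lambda>\<omega>. Y \<omega> * ?Z \<omega>)" .
qed

lemma indep_dW:
  assumes "0 \<le> s" "s < t" "Y \<in> borel_measurable (F s)" "integrable M Y" "a \<in> \<Xi>"
  shows "(\<integral>\<omega>. Y \<omega> * dW a s t \<omega> \<partial>M) = 0" "integrable M (\<lambda>\<omega>. Y \<omega> * dW a s t \<omega>)"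
  using indep_product[of s t Y "\<lambda>x. x a"] dW_moments[of a s t] assms by auto

lemma indep_dW_dW:
  assumes "0 \<le> s" "s < t" "Y \<in> borel_measurable (F s)" "integrable M Y" "a \<in> \<Xi>" "b \<in> \<Xi>"
  shows "(\<integral>\<omega>. Y \<omega> * (dW a s t \<omega> * dW b s t \<omega>) \<partial>M) = (if a = b then t - s else 0) * (\<integral>\<omega>. Y \<omega> \<partial>M)"
    "integrable M (\<lambda>\<omega>. Y \<omega> * (dW a s t \<omega> * dW b s t \<omega>))"
  using indep_product[of s t Y "\<lambda>x. x a * x b"] dW_covariance[of a b s t] assms by auto

end

lemma grid_nonneg: "T > 0 \<Longrightarrow> 0 \<le> grid T n i"
  by (simp add: grid_def)

lemma grid_Suc_diff: "grid T n (Suc i) - grid T n i = T / real n"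
  by (simp add: grid_def ring_distribs add_divide_distrib)

lemma grid_strict: "T > 0 \<Longrightarrow> n > 0 \<Longrightarrow> grid T n i < grid T n (Suc i)"
  using grid_Suc_diff[of T n i] by (simp add: algebra_simps)

lemma grid_0 [simp]: "grid T n 0 = 0"
  by (simp add: grid_def)

lemma grid_end: "n > 0 \<Longrightarrow> grid T n n = T"
  by (simp add: grid_def)

context driver
begin

text \<open>The Ito isometry for sums, as an inequality: the cross term pairs the past factor
  \<open>P k * Y k\<close> with a centred increment independent of it.\<close>

lemma martingale_sum:
  assumes t: "\<And>i. 0 \<le> t i" "\<And>i. t i < t (Suc i)" and a: "a \<in> \<Xi>"
    and Y: "\<And>i. Y i \<in> borel_measurable (F (t i))" "\<And>i \<omega>. \<bar>Y i \<omega>\<bar> \<le> K"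
  defines "P \<equiv> \<lambda>k \<omega>. \<Sum>i<k. Y i \<omega> * dW a (t i) (t (Suc i)) \<omega>"
  shows "P k \<in> borel_measurable (F (t k)) \<and> integrable M (\<lambda>\<omega>. (P k \<omega>)\<^sup>2) \<and> integrable M (P k) \<and>
    (\<integral>\<omega>. P k \<omega> \<partial>M) = 0 \<and> (\<integral>\<omega>. (P k \<omega>)\<^sup>2 \<partial>M) \<le> K\<^sup>2 * (t k - t 0)"
proof (induction k)
  case 0
  then show ?case by (simp add: P_def)
next
  case (Suc k)
  let ?w = "dW a (t k) (t (Suc k))"
  have Ym: "Y k \<in> borel_measurable M" using Y(1) adapted_measurable by blast
  have wm: "?w \<in> borel_measurable M" using t a by (intro dW_measurable)
  have Pm: "P k \<in> borel_measurable M" using Suc adapted_measurable by blast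
  have bnd: "integrable M (\<lambda>\<omega>. Y k \<omega> * Z \<omega>)" if "integrable M Z" for Z :: "'w \<Rightarrow> real"
    by (rule Bochner_Integration.integrable_bound[of _ "\<lambda>\<omega>. K * Z \<omega>"])
      (use that Y(2) Ym in \<open>auto simp: abs_mult intro!: AE_I2 mult_right_mono intro: order_trans[OF _ abs_ge_self]\<close>)
  have Yint: "integrable M (Y k)" using bnd[of "\<lambda>_. 1"] by simp
  have w: "integrable M ?w" "integrable M (\<lambda>\<omega>. (?w \<omega>)\<^sup>2)" "(\<integral>\<omega>. (?w \<omega>)\<^sup>2 \<partial>M) = t (Suc k) - t k"
    using dW_moments[OF a t(1) t(2)] by auto
  have Ps: "P (Suc k) = (\<lambda>\<omega>. P k \<omega> + Y k \<omega> * ?w \<omega>)" by (simp add: P_def)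
  have m: "P (Suc k) \<in> borel_measurable (F (t (Suc k)))"
    unfolding Ps using adapted_mono[of "t k" "t (Suc k)"] Suc Y(1) dW_adapted[OF a t(1)] t(2)[of k]
    by (intro borel_measurable_add borel_measurable_times) auto
  have i1: "integrable M (\<lambda>\<omega>. Y k \<omega> * ?w \<omega>)" using bnd w by blast
  have i2: "integrable M (\<lambda>\<omega>. (Y k \<omega> * ?w \<omega>)\<^sup>2)"
    using bnd[OF bnd[OF w(2)]] by (simp add: power2_eq_square algebra_simps)
  \<comment> \<open>\<open>P k * Y k\<close> is measurable at time \<open>t k\<close> and integrable
    because \<open>Y\<close> is bounded, so independence kills the cross term.\<close>
  have i3: "integrable M (\<lambda>\<omega>. (P k \<omega> * Y k \<omega>) * ?w \<omega>)" and e3: "(\<integral>\<omega>. (P k \<omega> * Y k \<omega>) * ?w \<omega> \<partial>M) = 0"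
    using indep_dW[of "t k" "t (Suc k)" "\<lambda>\<omega>. P k \<omega> * Y k \<omega>" a] t a Suc Y(1) bnd[of "P k"]
    by (auto simp: mult.commute)
  have e1: "(\<integral>\<omega>. Y k \<omega> * ?w \<omega> \<partial>M) = 0"
    using indep_dW[of "t k" "t (Suc k)" "Y k" a] t a Y(1) Yint by auto
  have sq: "(P (Suc k) \<omega>)\<^sup>2 = ((P k \<omega>)\<^sup>2 + 2 * ((P k \<omega> * Y k \<omega>) * ?w \<omega>)) + (Y k \<omega> * ?w \<omega>)\<^sup>2" for \<omega>
    by (simp add: Ps power2_eq_square algebra_simps)
  have i4: "integrable M (\<lambda>\<omega>. (P (Suc k) \<omega>)\<^sup>2)"
    unfolding sq using Suc i2 i3 by (intro Bochner_Integration.integrable_add integrable_mult_right) auto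
  have "(\<integral>\<omega>. (Y k \<omega> * ?w \<omega>)\<^sup>2 \<partial>M) \<le> (\<integral>\<omega>. K\<^sup>2 * (?w \<omega>)\<^sup>2 \<partial>M)"
  proof (intro integral_mono i2 integrable_mult_right w)
    fix \<omega>
    have "(Y k \<omega>)\<^sup>2 \<le> K\<^sup>2" using power_mono[OF Y(2)[of k \<omega>], of 2] by simp
    then show "(Y k \<omega> * ?w \<omega>)\<^sup>2 \<le> K\<^sup>2 * (?w \<omega>)\<^sup>2" by (simp add: power_mult_distrib mult_right_mono)
  qed
  then have e2: "(\<integral>\<omega>. (Y k \<omega> * ?w \<omega>)\<^sup>2 \<partial>M) \<le> K\<^sup>2 * (t (Suc k) - t k)" by (simp add: w)
  have "(\<integral>\<omega>. (P (Suc k) \<omega>)\<^sup>2 \<partial>M) = (\<integral>\<omega>. (P k \<omega>)\<^sup>2 \<partial>M) + 2 * (\<integral>\<omega>. (P k \<omega> * Y k \<omega>) * ?w \<omega> \<partial>M) + (\<integral>\<omega>. (Y k \<omega> * ?w \<omega>)\<^sup>2 \<partial>M)"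
    unfolding sq using Suc i2 i3 by simp
  also have "\<dots> \<le> K\<^sup>2 * (t k - t 0) + K\<^sup>2 * (t (Suc k) - t k)" using Suc e2 e3 by simp
  also have "\<dots> = K\<^sup>2 * (t (Suc k) - t 0)" by (simp add: algebra_simps)
  finally have "(\<integral>\<omega>. (P (Suc k) \<omega>)\<^sup>2 \<partial>M) \<le> K\<^sup>2 * (t (Suc k) - t 0)" .
  moreover have "integrable M (P (Suc k))" "(\<integral>\<omega>. P (Suc k) \<omega> \<partial>M) = 0"
    unfolding Ps using Suc i1 e1 by auto
  ultimately show ?case using m i4 by blast
qed

section \<open>Sums of squared increments along a grid\<close>

definition gridW :: "real \<Rightarrow> nat \<Rightarrow> 'e \<Rightarrow> nat \<Rightarrow> 'w \<Rightarrow> real" where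
  "gridW T n a i = dW a (grid T n i) (grid T n (Suc i))"

lemma gridW_moments:
  assumes "a \<in> \<Xi>" "T > 0" "n > 0"
  shows "gridW T n a i \<in> borel_measurable M"
    "integrable M (\<lambda>\<omega>. (gridW T n a i \<omega>)\<^sup>2)" "(\<integral>\<omega>. (gridW T n a i \<omega>)\<^sup>2 \<partial>M) = T / n"
    "integrable M (\<lambda>\<omega>. (gridW T n a i \<omega>) ^ 4)" "(\<integral>\<omega>. (gridW T n a i \<omega>) ^ 4 \<partial>M) = 3 * (T / n)\<^sup>2"
  using dW_moments[OF assms(1) grid_nonneg[OF assms(2)] grid_strict[OF assms(2,3)], of i]
    dW_measurable[OF assms(1) grid_nonneg[OF assms(2)] grid_nonneg[OF assms(2)]]
  unfolding gridW_def grid_Suc_diff by auto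

definition quadratic_sum :: "real \<Rightarrow> nat \<Rightarrow> 'w \<Rightarrow> real" where
  "quadratic_sum T n \<omega> = (\<Sum>i<n. \<Sum>a\<in>\<Xi>. (gridW T n a i \<omega>)\<^sup>2)"

text \<open>Cauchy-Schwarz over the \<open>n\<close> intervals and over the directions costs
  \<open>n * card \<Xi>\<close>. Each of as many fourth moments is
  \<open>3 * (T / n)\<^sup>2\<close>, so all powers of \<open>n\<close> cancel.\<close>

lemma quadratic_sum_moments:
  assumes "T > 0" "n > 0"
  shows "quadratic_sum T n \<in> borel_measurable M" "integrable M (\<lambda>\<omega>. (quadratic_sum T n \<omega>)\<^sup>2)"
    "(\<integral>\<omega>. (quadratic_sum T n \<omega>)\<^sup>2 \<partial>M) \<le> 3 * (real (card \<Xi>))\<^sup>2 * T\<^sup>2"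
proof -
  let ?m = "real (card \<Xi>)"
  show m[measurable]: "quadratic_sum T n \<in> borel_measurable M"
    unfolding quadratic_sum_def[abs_def] using gridW_moments(1) assms
    by (intro borel_measurable_sum borel_measurable_power) auto
  have b: "(quadratic_sum T n \<omega>)\<^sup>2 \<le> (\<Sum>i<n. \<Sum>a\<in>\<Xi>. n * ?m * (gridW T n a i \<omega>) ^ 4)" for \<omega>
  proof -
    have "(quadratic_sum T n \<omega>)\<^sup>2 \<le> (\<Sum>i<n. (\<Sum>a\<in>\<Xi>. (gridW T n a i \<omega>)\<^sup>2)\<^sup>2) * n"
      unfolding quadratic_sum_def using sum_squared_le_sum_of_squares[of _ "{..<n}"] by simp
    also have "\<dots> \<le> (\<Sum>i<n. (\<Sum>a\<in>\<Xi>. ((gridW T n a i \<omega>)\<^sup>2)\<^sup>2) * ?m) * n"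
      by (intro mult_right_mono sum_mono sum_squared_le_sum_of_squares) auto
    finally show ?thesis by (simp add: sum_distrib_left sum_distrib_right power_mult[symmetric] mult_ac)
  qed
  have I: "integrable M (\<lambda>\<omega>. \<Sum>i<n. \<Sum>a\<in>\<Xi>. n * ?m * (gridW T n a i \<omega>) ^ 4)"
    using gridW_moments(4) assms by (intro Bochner_Integration.integrable_sum integrable_mult_right) auto
  show I2: "integrable M (\<lambda>\<omega>. (quadratic_sum T n \<omega>)\<^sup>2)"
    by (rule Bochner_Integration.integrable_bound[OF I]) (use b in \<open>auto intro!: AE_I2 intro: order_trans[OF _ abs_ge_self]\<close>)
  have "(\<integral>\<omega>. (quadratic_sum T n \<omega>)\<^sup>2 \<partial>M) \<le> (\<integral>\<omega>. (\<Sum>i<n. \<Sum>a\<in>\<Xi>. n * ?m * (gridW T n a i \<omega>) ^ 4) \<partial>M)"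
    by (intro integral_mono I I2 b)
  also have "\<dots> = (\<Sum>i<n. \<Sum>a\<in>\<Xi>. n * ?m * (3 * (T / n)\<^sup>2))"
    using gridW_moments(4,5) assms by (subst Bochner_Integration.integral_sum | simp)+
  also have "\<dots> = 3 * ?m\<^sup>2 * T\<^sup>2" using assms by (simp add: power2_eq_square field_simps)
  finally show "(\<integral>\<omega>. (quadratic_sum T n \<omega>)\<^sup>2 \<partial>M) \<le> 3 * ?m\<^sup>2 * T\<^sup>2" .
qed

section \<open>Local errors in a Stratonovich equation\<close>

definition grid_remainder :: "(real \<Rightarrow> 'w \<Rightarrow> real) \<Rightarrow> ('e \<Rightarrow> real \<Rightarrow> 'w \<Rightarrow> real) \<Rightarrow> real \<Rightarrow> nat \<Rightarrow> nat \<Rightarrow> 'w \<Rightarrow> real" where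
  "grid_remainder f f1 T n i \<omega> = f (grid T n (Suc i)) \<omega> - f (grid T n i) \<omega> -
     (\<Sum>a\<in>\<Xi>. trapezoid (f1 a) (W a) (grid T n i) (grid T n (Suc i)) \<omega>)"

text \<open>The integrals \<open>S\<close> are chosen afresh for every \<open>t\<close>; no
  regularity in \<open>t\<close> is built in.\<close>

definition stratonovich_equation :: "(real \<Rightarrow> 'w \<Rightarrow> real) \<Rightarrow> ('e \<Rightarrow> real \<Rightarrow> 'w \<Rightarrow> real) \<Rightarrow> bool" where
  "stratonovich_equation f f1 \<longleftrightarrow> (\<forall>t\<ge>0. \<exists>S.
     (\<forall>a\<in>\<Xi>. has_stratonovich_integral M (f1 a) (W a) t (S a)) \<and>
     (AE \<omega> in M. f t \<omega> = f 0 \<omega> + (\<Sum>a\<in>\<Xi>. S a \<omega>)))"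

text \<open>Almost surely the remainder is the sum over the directions of the remainders of the
  single integrals. The estimate for subsets, taken for all intervals, gives the first claim; the
  estimate for squares gives the second.\<close>

lemma grid_remainder_small:
  assumes eq: "stratonovich_equation f f1"
    and f: "\<And>t. t \<ge> 0 \<Longrightarrow> f t \<in> borel_measurable M"
    and f1: "\<And>a t. a \<in> \<Xi> \<Longrightarrow> t \<ge> 0 \<Longrightarrow> f1 a t \<in> borel_measurable M"
    and T: "T > 0" and e: "e > 0"
  shows "eventually (\<lambda>n. prob_size M (\<lambda>\<omega>. \<Sum>i<n. grid_remainder f f1 T n i \<omega>) \<le> e) sequentially"
    and "eventually (\<lambda>n. prob_size M (\<lambda>\<omega>. \<Sum>i<n. (grid_remainder f f1 T n i \<omega>)\<^sup>2) \<le> e) sequentially"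
proof -
  from eq obtain S where S: "\<And>t a. t \<ge> 0 \<Longrightarrow> a \<in> \<Xi> \<Longrightarrow> has_stratonovich_integral M (f1 a) (W a) t (S t a)"
    "\<And>t. t \<ge> 0 \<Longrightarrow> AE \<omega> in M. f t \<omega> = f 0 \<omega> + (\<Sum>a\<in>\<Xi>. S t a \<omega>)"
    unfolding stratonovich_equation_def by metis
  \<comment> \<open>At least 1 even for empty \<Xi>. For the squares one factor \<open>m\<close>
    pays for Cauchy-Schwarz over the directions and one for adding them up, hence the tolerance
    \<open>e / (m * m)\<close>.\<close>
  define m where "m = real (card \<Xi>) + 1"
  have m: "m \<ge> 1" by (simp add: m_def)
  note g0 = grid_nonneg[OF T]
  define R where "R a n i \<omega> = S (grid T n (Suc i)) a \<omega> - S (grid T n i) a \<omega> - trapezoid (f1 a) (W a) (grid T n i) (grid T n (Suc i)) \<omega>"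
    for a n i \<omega>
  have Sm: "S (grid T n i) a \<in> borel_measurable M" if "a \<in> \<Xi>" for n i a
    using S(1)[OF g0 that] by (simp add: has_stratonovich_integral_def)
  have trm: "(\<lambda>\<omega>. trapezoid (f1 a) (W a) (grid T n i) (grid T n (Suc i)) \<omega>) \<in> borel_measurable M" if "a \<in> \<Xi>" for a n i
    unfolding trapezoid_def using f1[OF that g0] W_measurable[OF that g0] by measurable
  have Rm: "R a n i \<in> borel_measurable M" if "a \<in> \<Xi>" for a n i
    unfolding R_def using Sm trm that by measurable
  have Um: "grid_remainder f f1 T n i \<in> borel_measurable M" for n i
    unfolding grid_remainder_def[abs_def] using f[OF g0] trm by (intro borel_measurable_diff borel_measurable_sum) auto
  have ae: "AE \<omega> in M. \<forall>i. grid_remainder f f1 T n i \<omega> = (\<Sum>a\<in>\<Xi>. R a n i \<omega>)" for n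
  proof -
    \<comment> \<open>The exceptional set depends on the time, but only countably many grid points
      occur.\<close>
    have "AE \<omega> in M. \<forall>i. f (grid T n i) \<omega> = f 0 \<omega> + (\<Sum>a\<in>\<Xi>. S (grid T n i) a \<omega>)"
      unfolding AE_all_countable using S(2)[OF g0] by blast
    then show ?thesis
    proof (eventually_elim, intro allI)
      fix \<omega> i assume *: "\<forall>i. f (grid T n i) \<omega> = f 0 \<omega> + (\<Sum>a\<in>\<Xi>. S (grid T n i) a \<omega>)"
      show "grid_remainder f f1 T n i \<omega> = (\<Sum>a\<in>\<Xi>. R a n i \<omega>)"
        unfolding grid_remainder_def R_def using *[rule_format, of i] *[rule_format, of "Suc i"]
        by (simp add: sum_subtractf)
    qed
  qed
  have e1: "e / (m * m) > 0" using e m by simp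
  have m1: "e / (m * m) \<le> e / m"
    using e m mult_left_mono[of 1 m m] by (intro divide_left_mono) auto
  have "eventually (\<lambda>n. \<forall>a\<in>\<Xi>. prob_size M (\<lambda>\<omega>. \<Sum>i<n. R a n i \<omega>) \<le> e / (m * m)) sequentially"
  proof (intro eventually_ball_finite ballI finite_\<Xi>)
    fix a assume a: "a \<in> \<Xi>"
    show "eventually (\<lambda>n. prob_size M (\<lambda>\<omega>. \<Sum>i<n. R a n i \<omega>) \<le> e / (m * m)) sequentially"
      using stratonovich_subset_remainder[OF S(1)[OF _ a] f1[OF a] W_measurable[OF a] T e1]
      unfolding eventually_sequentially R_def by blast
  qed
  then show "eventually (\<lambda>n. prob_size M (\<lambda>\<omega>. \<Sum>i<n. grid_remainder f f1 T n i \<omega>) \<le> e) sequentially"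
  proof eventually_elim
    fix n assume *: "\<forall>a\<in>\<Xi>. prob_size M (\<lambda>\<omega>. \<Sum>i<n. R a n i \<omega>) \<le> e / (m * m)"
    have "prob_size M (\<lambda>\<omega>. \<Sum>i<n. grid_remainder f f1 T n i \<omega>) = prob_size M (\<lambda>\<omega>. \<Sum>a\<in>\<Xi>. \<Sum>i<n. R a n i \<omega>)"
    proof (rule prob_size_cong_AE)
      show "AE \<omega> in M. (\<Sum>i<n. grid_remainder f f1 T n i \<omega>) = (\<Sum>a\<in>\<Xi>. \<Sum>i<n. R a n i \<omega>)"
        using ae[of n] by eventually_elim (subst sum.swap, simp)
    qed (use Um Rm in measurable)
    also have "\<dots> \<le> (\<Sum>a\<in>\<Xi>. prob_size M (\<lambda>\<omega>. \<Sum>i<n. R a n i \<omega>))"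
      by (rule prob_size_sum) (use Rm in measurable)
    also have "\<dots> \<le> (\<Sum>a\<in>\<Xi>. e / m)" using * m1 by (intro sum_mono) force
    also have "\<dots> \<le> e" using e m by (simp add: m_def field_simps)
    finally show "prob_size M (\<lambda>\<omega>. \<Sum>i<n. grid_remainder f f1 T n i \<omega>) \<le> e" .
  qed
  have "eventually (\<lambda>n. \<forall>a\<in>\<Xi>. prob_size M (\<lambda>\<omega>. \<Sum>i<n. (R a n i \<omega>)\<^sup>2) \<le> e / (m * m)) sequentially"
  proof (intro eventually_ball_finite ballI finite_\<Xi>)
    fix a assume a: "a \<in> \<Xi>"
    show "eventually (\<lambda>n. prob_size M (\<lambda>\<omega>. \<Sum>i<n. (R a n i \<omega>)\<^sup>2) \<le> e / (m * m)) sequentially"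
      using stratonovich_square_remainder[OF S(1)[OF _ a] f1[OF a] W_measurable[OF a] T e1]
      unfolding eventually_sequentially R_def by blast
  qed
  then show "eventually (\<lambda>n. prob_size M (\<lambda>\<omega>. \<Sum>i<n. (grid_remainder f f1 T n i \<omega>)\<^sup>2) \<le> e) sequentially"
  proof eventually_elim
    fix n assume *: "\<forall>a\<in>\<Xi>. prob_size M (\<lambda>\<omega>. \<Sum>i<n. (R a n i \<omega>)\<^sup>2) \<le> e / (m * m)"
    have R2: "(\<lambda>\<omega>. \<Sum>i<n. (R a n i \<omega>)\<^sup>2) \<in> borel_measurable M" if "a \<in> \<Xi>" for a
      using Rm[OF that] by measurable
    have R3: "(\<lambda>\<omega>. \<Sum>a\<in>\<Xi>. \<Sum>i<n. (R a n i \<omega>)\<^sup>2) \<in> borel_measurable M"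
      by (rule borel_measurable_sum) (rule R2)
    have "prob_size M (\<lambda>\<omega>. \<Sum>i<n. (grid_remainder f f1 T n i \<omega>)\<^sup>2) \<le> prob_size M (\<lambda>\<omega>. m * (\<Sum>a\<in>\<Xi>. \<Sum>i<n. (R a n i \<omega>)\<^sup>2))"
    proof (rule prob_size_mono)
      show "AE \<omega> in M. \<bar>\<Sum>i<n. (grid_remainder f f1 T n i \<omega>)\<^sup>2\<bar> \<le> \<bar>m * (\<Sum>a\<in>\<Xi>. \<Sum>i<n. (R a n i \<omega>)\<^sup>2)\<bar>"
        using ae[of n]
      proof eventually_elim
        fix \<omega> assume *: "\<forall>i. grid_remainder f f1 T n i \<omega> = (\<Sum>a\<in>\<Xi>. R a n i \<omega>)"
        have "(\<Sum>i<n. (grid_remainder f f1 T n i \<omega>)\<^sup>2) \<le> (\<Sum>i<n. (\<Sum>a\<in>\<Xi>. (R a n i \<omega>)\<^sup>2) * card \<Xi>)"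
          using * by (simp add: sum_squared_le_sum_of_squares sum_mono)
        also have "\<dots> = real (card \<Xi>) * (\<Sum>a\<in>\<Xi>. \<Sum>i<n. (R a n i \<omega>)\<^sup>2)"
          by (subst sum.swap) (simp add: sum_distrib_left sum_distrib_right mult_ac)
        also have "\<dots> \<le> m * (\<Sum>a\<in>\<Xi>. \<Sum>i<n. (R a n i \<omega>)\<^sup>2)"
          by (intro mult_right_mono) (auto simp: sum_nonneg m_def)
        finally show "\<bar>\<Sum>i<n. (grid_remainder f f1 T n i \<omega>)\<^sup>2\<bar> \<le> \<bar>m * (\<Sum>a\<in>\<Xi>. \<Sum>i<n. (R a n i \<omega>)\<^sup>2)\<bar>"
          using m by (simp add: sum_nonneg)
      qed
    qed (use Um R3 in measurable)
    also have "\<dots> \<le> m * prob_size M (\<lambda>\<omega>. \<Sum>a\<in>\<Xi>. \<Sum>i<n. (R a n i \<omega>)\<^sup>2)"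
      by (rule prob_size_scale[OF R3 m])
    also have "\<dots> \<le> m * (\<Sum>a\<in>\<Xi>. prob_size M (\<lambda>\<omega>. \<Sum>i<n. (R a n i \<omega>)\<^sup>2))"
      using m by (intro mult_left_mono prob_size_sum R2) auto
    also have "\<dots> \<le> m * (\<Sum>a\<in>\<Xi>. e / (m * m))" using * m by (intro mult_left_mono sum_mono) auto
    also have "\<dots> = real (card \<Xi>) * (e / m)" using m by simp
    also have "\<dots> \<le> e" using e m by (simp add: m_def field_simps)
    finally show "prob_size M (\<lambda>\<omega>. \<Sum>i<n. (grid_remainder f f1 T n i \<omega>)\<^sup>2) \<le> e" .
  qed
qed

text \<open>A process of vanishing quadratic variation has vanishing covariation with
  \<open>W\<close>. The products are split with a weight \<open>L\<close>, fixed before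
  \<open>n\<close>: the part from \<open>W\<close> has mean \<open>T / L\<close>, and the other part
  is small for large \<open>n\<close>.\<close>

lemma prob_size_sum_times_gridW:
  assumes V: "\<And>n i. V n i \<in> borel_measurable M"
    and small: "\<And>e. e > 0 \<Longrightarrow> eventually (\<lambda>n. prob_size M (\<lambda>\<omega>. \<Sum>i<n. (V n i \<omega>)\<^sup>2) \<le> e) sequentially"
    and a: "a \<in> \<Xi>" and T: "T > 0" and e: "e > 0"
  shows "eventually (\<lambda>n. prob_size M (\<lambda>\<omega>. \<Sum>i<n. V n i \<omega> * gridW T n a i \<omega>) \<le> e) sequentially"
proof -
  \<comment> \<open>The second summand makes \<open>T / L\<close> at most \<open>e / 2\<close>; the
    first gives \<open>L \<ge> 1\<close>, as \<open>prob_size_scale\<close> demands.\<close>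
  define L where "L = 1 + 2 * T / e"
  have L: "L \<ge> 1" "T / L \<le> e / 2" using T e by (auto simp: L_def field_simps)
  have "e / (2 * L) > 0" using L e by simp
  from eventually_conj[OF small[OF this] eventually_gt_at_top[of 0]] show ?thesis
  proof eventually_elim
    fix n :: nat assume *: "prob_size M (\<lambda>\<omega>. \<Sum>i<n. (V n i \<omega>)\<^sup>2) \<le> e / (2 * L) \<and> 0 < n"
    then have n: "n > 0" by simp
    note g = gridW_moments[OF a T n]
    have [measurable]: "gridW T n a i \<in> borel_measurable M" "V n i \<in> borel_measurable M" for i using g V by auto
    have int: "integrable M (\<lambda>\<omega>. (1/L) * (\<Sum>i<n. (gridW T n a i \<omega>)\<^sup>2))"
      using g by (intro integrable_mult_right Bochner_Integration.integrable_sum)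
    have "prob_size M (\<lambda>\<omega>. \<Sum>i<n. V n i \<omega> * gridW T n a i \<omega>) \<le>
        prob_size M (\<lambda>\<omega>. L * (\<Sum>i<n. (V n i \<omega>)\<^sup>2) + (1/L) * (\<Sum>i<n. (gridW T n a i \<omega>)\<^sup>2))"
    proof (rule prob_size_mono)
      have xy: "\<bar>x * y\<bar> \<le> L * x\<^sup>2 + (1/L) * y\<^sup>2" for x y :: real
      proof -
        have "2 * \<bar>sqrt L * x\<bar> * \<bar>y / sqrt L\<bar> \<le> \<bar>sqrt L * x\<bar>\<^sup>2 + \<bar>y / sqrt L\<bar>\<^sup>2" by (rule sum_squares_bound)
        then have "2 * \<bar>x * y\<bar> \<le> L * x\<^sup>2 + (1/L) * y\<^sup>2" using L
          by (simp add: power_mult_distrib power_divide abs_mult)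
        then show ?thesis using abs_ge_zero[of "x * y"] by linarith
      qed
      show "AE \<omega> in M. \<bar>\<Sum>i<n. V n i \<omega> * gridW T n a i \<omega>\<bar> \<le> \<bar>L * (\<Sum>i<n. (V n i \<omega>)\<^sup>2) + (1/L) * (\<Sum>i<n. (gridW T n a i \<omega>)\<^sup>2)\<bar>"
      proof (rule AE_I2)
        fix \<omega>
        have "\<bar>\<Sum>i<n. V n i \<omega> * gridW T n a i \<omega>\<bar> \<le> (\<Sum>i<n. L * (V n i \<omega>)\<^sup>2 + (1/L) * (gridW T n a i \<omega>)\<^sup>2)"
          by (rule order_trans[OF sum_abs]) (intro sum_mono xy)
        also have "\<dots> = L * (\<Sum>i<n. (V n i \<omega>)\<^sup>2) + (1/L) * (\<Sum>i<n. (gridW T n a i \<omega>)\<^sup>2)"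
          unfolding sum.distrib sum_distrib_left ..
        finally show "\<bar>\<Sum>i<n. V n i \<omega> * gridW T n a i \<omega>\<bar> \<le> \<bar>L * (\<Sum>i<n. (V n i \<omega>)\<^sup>2) + (1/L) * (\<Sum>i<n. (gridW T n a i \<omega>)\<^sup>2)\<bar>"
          by linarith
      qed
    qed measurable
    also have "\<dots> \<le> prob_size M (\<lambda>\<omega>. L * (\<Sum>i<n. (V n i \<omega>)\<^sup>2)) + prob_size M (\<lambda>\<omega>. (1/L) * (\<Sum>i<n. (gridW T n a i \<omega>)\<^sup>2))"
      by (rule prob_size_add) measurable
    also have "\<dots> \<le> L * prob_size M (\<lambda>\<omega>. \<Sum>i<n. (V n i \<omega>)\<^sup>2) + (\<integral>\<omega>. \<bar>(1/L) * (\<Sum>i<n. (gridW T n a i \<omega>)\<^sup>2)\<bar> \<partial>M)"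
      by (intro add_mono prob_size_scale prob_size_le_expectation int L(1)) measurable
    also have "(\<integral>\<omega>. \<bar>(1/L) * (\<Sum>i<n. (gridW T n a i \<omega>)\<^sup>2)\<bar> \<partial>M) = (\<integral>\<omega>. (1/L) * (\<Sum>i<n. (gridW T n a i \<omega>)\<^sup>2) \<partial>M)"
      using L(1) by (simp add: sum_nonneg)
    also have "\<dots> = (1/L) * (\<Sum>i<n. T / n)"
      using g by simp
    also have "\<dots> = T / L" using n by simp
    also have "L * prob_size M (\<lambda>\<omega>. \<Sum>i<n. (V n i \<omega>)\<^sup>2) + T / L \<le> L * (e / (2 * L)) + e / 2"
      using * L by (intro add_mono mult_left_mono) auto
    also have "\<dots> = e" using L by simp
    finally show "prob_size M (\<lambda>\<omega>. \<Sum>i<n. V n i \<omega> * gridW T n a i \<omega>) \<le> e" .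
  qed
qed

text \<open>The second Stratonovich equation identifies the covariations that turn the trapezoidal sums for \<^term>\<open>f\<close> into left-point sums.\<close>
lemma expectation_increment:
  fixes f :: "real \<Rightarrow> 'w \<Rightarrow> real" and f1 :: "'e \<Rightarrow> real \<Rightarrow> 'w \<Rightarrow> real"
    and f2 :: "'e \<Rightarrow> 'e \<Rightarrow> real \<Rightarrow> 'w \<Rightarrow> real"
  assumes T: "T > 0"
    and eq: "stratonovich_equation f f1"
    and eq1: "\<And>a. a \<in> \<Xi> \<Longrightarrow> stratonovich_equation (f1 a) (\<lambda>b. f2 b a)"
    and f: "\<And>t. t \<ge> 0 \<Longrightarrow> f t \<in> borel_measurable (F t)"
    and f1: "\<And>a t. a \<in> \<Xi> \<Longrightarrow> t \<ge> 0 \<Longrightarrow> f1 a t \<in> borel_measurable (F t)"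
    and f2: "\<And>a b t. a \<in> \<Xi> \<Longrightarrow> b \<in> \<Xi> \<Longrightarrow> t \<ge> 0 \<Longrightarrow> f2 b a t \<in> borel_measurable (F t)"
    and fK: "\<And>t \<omega>. \<bar>f t \<omega>\<bar> \<le> K"
    and f1K: "\<And>a t \<omega>. a \<in> \<Xi> \<Longrightarrow> \<bar>f1 a t \<omega>\<bar> \<le> K"
    and f2K: "\<And>a b t \<omega>. a \<in> \<Xi> \<Longrightarrow> b \<in> \<Xi> \<Longrightarrow> \<bar>f2 b a t \<omega>\<bar> \<le> K"
    and cont: "\<And>e. e > 0 \<Longrightarrow> \<exists>d>0. \<forall>s\<in>{0..T}. \<forall>t\<in>{0..T}. \<forall>a\<in>\<Xi>. \<forall>b\<in>\<Xi>. \<bar>s - t\<bar> < d \<longrightarrow>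
        (\<integral>\<omega>. (f2 b a s \<omega> - f2 b a t \<omega>)\<^sup>2 \<partial>M) \<le> e"
  shows "(\<lambda>n. (T / n) * (\<Sum>i<n. (\<Sum>a\<in>\<Xi>. \<integral>\<omega>. f2 a a (grid T n i) \<omega> \<partial>M) / 2))
     \<longlonglongrightarrow> (\<integral>\<omega>. f T \<omega> \<partial>M) - (\<integral>\<omega>. f 0 \<omega> \<partial>M)"
proof -
  let ?c = "real (card \<Xi>)"
  note g0 = grid_nonneg[OF T]
  have K: "K \<ge> 0" using fK[of 0 undefined] abs_ge_zero order_trans by blast
  have fm: "f t \<in> borel_measurable M" if "t \<ge> 0" for t using f[OF that] adapted_measurable by blast
  have f1m: "f1 a t \<in> borel_measurable M" if "t \<ge> 0" "a \<in> \<Xi>" for a t using f1 that adapted_measurable by blast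
  have f2m: "f2 b a t \<in> borel_measurable M" if "t \<ge> 0" "a \<in> \<Xi>" "b \<in> \<Xi>" for a b t using f2 that adapted_measurable by blast
  have fint: "integrable M (f t)" if "t \<ge> 0" for t
    by (rule integrable_const_bound[of _ K]) (use fK fm that in auto)
  have f2int: "integrable M (f2 b a t)" if "t \<ge> 0" "a \<in> \<Xi>" "b \<in> \<Xi>" for a b t
    by (rule integrable_const_bound[of _ K]) (use f2K f2m that in auto)
  define V where "V a n i = grid_remainder (f1 a) (\<lambda>b. f2 b a) T n i" for a n i
  define U where "U n i = grid_remainder f f1 T n i" for n i
  have tr_m: "(\<lambda>\<omega>. trapezoid (h b) (W b) (grid T n i) (grid T n (Suc i)) \<omega>) \<in> borel_measurable M" 
    if "\<And>t. t \<ge> 0 \<Longrightarrow> h b t \<in> borel_measurable M" "b \<in> \<Xi>" for h :: "'e \<Rightarrow> real \<Rightarrow> 'w \<Rightarrow> real" and b n i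
    unfolding trapezoid_def using that(1)[OF g0] W_measurable[OF that(2) g0] by measurable
  have Um[measurable]: "U n i \<in> borel_measurable M" for n i
    unfolding U_def grid_remainder_def[abs_def] using fm[OF g0] f1m
    by (intro borel_measurable_diff borel_measurable_sum tr_m) auto
  have Vm: "V a n i \<in> borel_measurable M" if "a \<in> \<Xi>" for a n i
    unfolding V_def grid_remainder_def[abs_def] using f1m[OF g0] f2m that
    by (intro borel_measurable_diff borel_measurable_sum tr_m) auto
  \<comment> \<open>\<open>P\<close> holds the centred Ito sums and \<open>Q\<close> the left-point
    covariation terms; \<open>D\<close> corrects \<open>f2\<close> for the right end points, and
    \<open>E\<close> is the rest. The divisors 2 and 4 arise because a trapezoid is the left value
    plus half an increment, applied to \<open>f1\<close> and then once more to
    \<open>f2\<close>.\<close>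
  define P where "P n a \<omega> = (\<Sum>i<n. f1 a (grid T n i) \<omega> * gridW T n a i \<omega>)" for n a \<omega>
  define Q where "Q n \<omega> = (\<Sum>i<n. \<Sum>a\<in>\<Xi>. \<Sum>b\<in>\<Xi>. f2 b a (grid T n i) \<omega> * (gridW T n b i \<omega> * gridW T n a i \<omega>)) / 2" for n \<omega>
  define D where "D n \<omega> = (\<Sum>i<n. \<Sum>a\<in>\<Xi>. \<Sum>b\<in>\<Xi>. (f2 b a (grid T n (Suc i)) \<omega> - f2 b a (grid T n i) \<omega>) * (gridW T n b i \<omega> * gridW T n a i \<omega>)) / 4" for n \<omega>
  define E where "E n \<omega> = f T \<omega> - f 0 \<omega> - (\<Sum>a\<in>\<Xi>. P n a \<omega>) - (Q n \<omega> + D n \<omega>)" for n \<omega>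
  have gWm: "gridW T n a i \<in> borel_measurable M" if "a \<in> \<Xi>" for n a i
    unfolding gridW_def using dW_measurable[OF that g0 g0] .
  have Pm: "P n a \<in> borel_measurable M" if "a \<in> \<Xi>" for n a
    unfolding P_def[abs_def] using f1m[OF g0 that] gWm[OF that]
    by (intro borel_measurable_sum borel_measurable_times) auto
  have Qm[measurable]: "Q n \<in> borel_measurable M" for n
    unfolding Q_def[abs_def] using f2m[OF g0] gWm
    by (intro borel_measurable_sum borel_measurable_times borel_measurable_divide borel_measurable_const) auto
  have Dm[measurable]: "D n \<in> borel_measurable M" for n
    unfolding D_def[abs_def] using f2m[OF g0] gWm
    by (intro borel_measurable_sum borel_measurable_times borel_measurable_divide borel_measurable_diff borel_measurable_const) auto
  have SPm[measurable]: "(\<lambda>\<omega>. \<Sum>a\<in>\<Xi>. P n a \<omega>) \<in> borel_measurable M" for n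
    by (rule borel_measurable_sum) (rule Pm)
  have fTm[measurable]: "f T \<in> borel_measurable M" "f 0 \<in> borel_measurable M" using fm T by auto
  have Em[measurable]: "E n \<in> borel_measurable M" for n
    unfolding E_def[abs_def] by measurable
  have ww: "integrable M (\<lambda>\<omega>. gridW T n b i \<omega> * gridW T n a i \<omega>)" if "a \<in> \<Xi>" "b \<in> \<Xi>" "n > 0" for n a b i
    using dW_covariance(2)[of b a "grid T n i" "grid T n (Suc i)"] grid_strict[OF T, of n i] that g0[of n i]
    by (auto simp: gridW_def)

  have P: "integrable M (P n a)" "(\<integral>\<omega>. P n a \<omega> \<partial>M) = 0" "integrable M (\<lambda>\<omega>. (P n a \<omega>)\<^sup>2)" "(\<integral>\<omega>. (P n a \<omega>)\<^sup>2 \<partial>M) \<le> K\<^sup>2 * T"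
    if n: "n > 0" and a: "a \<in> \<Xi>" for n a
    using martingale_sum[of "grid T n" a "\<lambda>i. f1 a (grid T n i)" K n, OF g0 grid_strict[OF T n] a f1[OF a g0] f1K[OF a]]
    unfolding gridW_def[symmetric] P_def[symmetric] by (auto simp: grid_end[OF n])

  \<comment> \<open>Insert the equation for \<open>f1\<close> into the increments of
    \<open>f1\<close> hidden in the trapezoids of \<open>f\<close>. Only the local errors
    \<open>U\<close> and the products of \<open>V\<close> with increments of \<open>W\<close> remain
    in \<open>E\<close>.\<close>
  have E_eq: "E n \<omega> = (\<Sum>i<n. U n i \<omega>) + (\<Sum>a\<in>\<Xi>. \<Sum>i<n. V a n i \<omega> * gridW T n a i \<omega>) / 2" if n: "n > 0" for n \<omega>
  proof -
    have tr: "trapezoid X (W b) (grid T n i) (grid T n (Suc i)) \<omega> = 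
        (X (grid T n i) \<omega> + (X (grid T n (Suc i)) \<omega> - X (grid T n i) \<omega>) / 2) * gridW T n b i \<omega>" for X b i
      by (simp add: trapezoid_def gridW_def dW_def field_simps)
    have f1d: "f1 a (grid T n (Suc i)) \<omega> - f1 a (grid T n i) \<omega> = V a n i \<omega> +
       (\<Sum>b\<in>\<Xi>. (f2 b a (grid T n i) \<omega> + (f2 b a (grid T n (Suc i)) \<omega> - f2 b a (grid T n i) \<omega>) / 2) * gridW T n b i \<omega>)" for a i
      by (simp add: V_def grid_remainder_def tr)
    have fd: "f (grid T n (Suc i)) \<omega> - f (grid T n i) \<omega> = U n i \<omega> + 
       (\<Sum>a\<in>\<Xi>. f1 a (grid T n i) \<omega> * gridW T n a i \<omega>) + (\<Sum>a\<in>\<Xi>. V a n i \<omega> * gridW T n a i \<omega>) / 2 +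
       ((\<Sum>a\<in>\<Xi>. \<Sum>b\<in>\<Xi>. f2 b a (grid T n i) \<omega> * (gridW T n b i \<omega> * gridW T n a i \<omega>)) / 2 +
        (\<Sum>a\<in>\<Xi>. \<Sum>b\<in>\<Xi>. (f2 b a (grid T n (Suc i)) \<omega> - f2 b a (grid T n i) \<omega>) * (gridW T n b i \<omega> * gridW T n a i \<omega>)) / 4)" for i
    proof -
      have "f (grid T n (Suc i)) \<omega> - f (grid T n i) \<omega> = U n i \<omega> + (\<Sum>a\<in>\<Xi>. trapezoid (f1 a) (W a) (grid T n i) (grid T n (Suc i)) \<omega>)"
        by (simp add: U_def grid_remainder_def)
      also have "(\<Sum>a\<in>\<Xi>. trapezoid (f1 a) (W a) (grid T n i) (grid T n (Suc i)) \<omega>) =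
        (\<Sum>a\<in>\<Xi>. f1 a (grid T n i) \<omega> * gridW T n a i \<omega> + (V a n i \<omega> * gridW T n a i \<omega> / 2 +
         ((\<Sum>b\<in>\<Xi>. f2 b a (grid T n i) \<omega> * (gridW T n b i \<omega> * gridW T n a i \<omega>)) / 2 +
          (\<Sum>b\<in>\<Xi>. (f2 b a (grid T n (Suc i)) \<omega> - f2 b a (grid T n i) \<omega>) * (gridW T n b i \<omega> * gridW T n a i \<omega>)) / 4)))"
      proof (rule sum.cong[OF refl])
        fix a assume "a \<in> \<Xi>"
        have "trapezoid (f1 a) (W a) (grid T n i) (grid T n (Suc i)) \<omega> = f1 a (grid T n i) \<omega> * gridW T n a i \<omega>
           + (V a n i \<omega> + (\<Sum>b\<in>\<Xi>. (f2 b a (grid T n i) \<omega> + (f2 b a (grid T n (Suc i)) \<omega> - f2 b a (grid T n i) \<omega>) / 2) * gridW T n b i \<omega>)) / 2 * gridW T n a i \<omega>"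
          unfolding tr f1d by (simp add: algebra_simps)
        also have "(\<Sum>b\<in>\<Xi>. (f2 b a (grid T n i) \<omega> + (f2 b a (grid T n (Suc i)) \<omega> - f2 b a (grid T n i) \<omega>) / 2) * gridW T n b i \<omega>)
           = (\<Sum>b\<in>\<Xi>. f2 b a (grid T n i) \<omega> * gridW T n b i \<omega>) + (\<Sum>b\<in>\<Xi>. (f2 b a (grid T n (Suc i)) \<omega> - f2 b a (grid T n i) \<omega>) * gridW T n b i \<omega>) / 2"
          by (simp only: distrib_right sum.distrib sum_divide_distrib times_divide_eq_left)
        also have "f1 a (grid T n i) \<omega> * gridW T n a i \<omega> + (V a n i \<omega> + ((\<Sum>b\<in>\<Xi>. f2 b a (grid T n i) \<omega> * gridW T n b i \<omega>) + (\<Sum>b\<in>\<Xi>. (f2 b a (grid T n (Suc i)) \<omega> - f2 b a (grid T n i) \<omega>) * gridW T n b i \<omega>) / 2)) / 2 * gridW T n a i \<omega>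
          = f1 a (grid T n i) \<omega> * gridW T n a i \<omega> + (V a n i \<omega> * gridW T n a i \<omega> / 2 +
           ((\<Sum>b\<in>\<Xi>. f2 b a (grid T n i) \<omega> * gridW T n b i \<omega>) * gridW T n a i \<omega> / 2 +
            (\<Sum>b\<in>\<Xi>. (f2 b a (grid T n (Suc i)) \<omega> - f2 b a (grid T n i) \<omega>) * gridW T n b i \<omega>) * gridW T n a i \<omega> / 4))"
          by (simp add: field_simps)
        finally show "trapezoid (f1 a) (W a) (grid T n i) (grid T n (Suc i)) \<omega> = f1 a (grid T n i) \<omega> * gridW T n a i \<omega> + (V a n i \<omega> * gridW T n a i \<omega> / 2 +
         ((\<Sum>b\<in>\<Xi>. f2 b a (grid T n i) \<omega> * (gridW T n b i \<omega> * gridW T n a i \<omega>)) / 2 +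
          (\<Sum>b\<in>\<Xi>. (f2 b a (grid T n (Suc i)) \<omega> - f2 b a (grid T n i) \<omega>) * (gridW T n b i \<omega> * gridW T n a i \<omega>)) / 4))"
          by (simp only: sum_distrib_right mult.assoc)
      qed
      finally show ?thesis by (simp only: sum.distrib sum_divide_distrib add.assoc)
    qed
    have "f T \<omega> - f 0 \<omega> = (\<Sum>i<n. f (grid T n (Suc i)) \<omega> - f (grid T n i) \<omega>)"
      using sum_lessThan_telescope[of "\<lambda>i. f (grid T n i) \<omega>" n] by (simp add: grid_end[OF n])
    also have "\<dots> = (\<Sum>i<n. U n i \<omega>) + (\<Sum>i<n. \<Sum>a\<in>\<Xi>. f1 a (grid T n i) \<omega> * gridW T n a i \<omega>)
        + (\<Sum>i<n. \<Sum>a\<in>\<Xi>. V a n i \<omega> * gridW T n a i \<omega>) / 2 + (Q n \<omega> + D n \<omega>)"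
      unfolding fd Q_def D_def by (simp only: sum.distrib sum_divide_distrib)
    finally show ?thesis
      unfolding E_def P_def by (simp add: sum.swap[of _ "{..<n}" \<Xi>])
  qed
  have E_small: "(\<lambda>n. prob_size M (E n)) \<longlonglongrightarrow> 0"
  proof (rule LIMSEQ_I)
    fix e :: real assume e: "e > 0"
    \<comment> \<open>A share \<open>d\<close> for each direction and half a share for
      \<open>U\<close>; the added 1 keeps the denominator positive when \<Xi> is empty.\<close>
    define d where "d = e / (2 * (?c + 1))"
    have d: "d > 0" "d \<le> e / 2" "?c * d \<le> e / 2 - d" using e by (auto simp: d_def field_simps)
    have "eventually (\<lambda>n. prob_size M (\<lambda>\<omega>. \<Sum>i<n. U n i \<omega>) \<le> d / 2) sequentially"
      unfolding U_def using d by (intro grid_remainder_small(1)[OF eq fm f1m T]) auto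
    moreover have "eventually (\<lambda>n. \<forall>a\<in>\<Xi>. prob_size M (\<lambda>\<omega>. \<Sum>i<n. V a n i \<omega> * gridW T n a i \<omega>) \<le> d) sequentially"
    proof (intro eventually_ball_finite finite_\<Xi> ballI prob_size_sum_times_gridW Vm T d)
      fix a and e :: real assume "a \<in> \<Xi>" "e > 0"
      then show "eventually (\<lambda>n. prob_size M (\<lambda>\<omega>. \<Sum>i<n. (V a n i \<omega>)\<^sup>2) \<le> e) sequentially"
        unfolding V_def by (intro grid_remainder_small(2)[OF eq1 f1m f2m T]) auto
    qed
    ultimately have "eventually (\<lambda>n. prob_size M (E n) < e) sequentially"
      using eventually_gt_at_top[of 0]
    proof eventually_elim
      fix n :: nat assume 1: "prob_size M (\<lambda>\<omega>. \<Sum>i<n. U n i \<omega>) \<le> d / 2" and n: "0 < n"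
        and 2: "\<forall>a\<in>\<Xi>. prob_size M (\<lambda>\<omega>. \<Sum>i<n. V a n i \<omega> * gridW T n a i \<omega>) \<le> d"
      have VWm: "(\<lambda>\<omega>. \<Sum>i<n. V a n i \<omega> * gridW T n a i \<omega>) \<in> borel_measurable M" if "a \<in> \<Xi>" for a
        using Vm[OF that] gWm[OF that] by measurable
      have SVWm: "(\<lambda>\<omega>. \<Sum>a\<in>\<Xi>. \<Sum>i<n. V a n i \<omega> * gridW T n a i \<omega>) \<in> borel_measurable M"
        by (rule borel_measurable_sum) (rule VWm)
      have "prob_size M (E n) = prob_size M (\<lambda>\<omega>. (\<Sum>i<n. U n i \<omega>) + (\<Sum>a\<in>\<Xi>. \<Sum>i<n. V a n i \<omega> * gridW T n a i \<omega>) / 2)"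
        using E_eq[OF n] by (simp add: prob_size_def)
      also have "\<dots> \<le> prob_size M (\<lambda>\<omega>. \<Sum>i<n. U n i \<omega>) + prob_size M (\<lambda>\<omega>. (\<Sum>a\<in>\<Xi>. \<Sum>i<n. V a n i \<omega> * gridW T n a i \<omega>) / 2)"
        by (rule prob_size_add) (use SVWm in measurable)
      also have "\<dots> \<le> d / 2 + prob_size M (\<lambda>\<omega>. \<Sum>a\<in>\<Xi>. \<Sum>i<n. V a n i \<omega> * gridW T n a i \<omega>)"
        using 1 by (intro add_mono prob_size_mono) (use SVWm in auto)
      also have "\<dots> \<le> d / 2 + (\<Sum>a\<in>\<Xi>. prob_size M (\<lambda>\<omega>. \<Sum>i<n. V a n i \<omega> * gridW T n a i \<omega>))"
        by (intro add_left_mono prob_size_sum VWm)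
      also have "\<dots> \<le> d / 2 + (\<Sum>a\<in>\<Xi>. d)" using 2 by (intro add_left_mono sum_mono) auto
      also have "\<dots> < e" using d e by simp
      finally show "prob_size M (E n) < e" .
    qed
    then show "\<exists>no. \<forall>n\<ge>no. norm (prob_size M (E n) - 0) < e"
      by (simp add: eventually_sequentially abs_of_nonneg[OF prob_size_nonneg])
  qed

  \<comment> \<open>A bound for the second moment of \<open>E n\<close> that is free of
    \<open>n\<close>: its three summands stem from \<open>f T - f 0\<close>, from the martingale
    sums, and from \<open>Q n + D n\<close> dominated by \<open>quadratic_sum\<close>.\<close>
  define C where "C = 3 * ((2 * K)\<^sup>2 + ?c * (?c * (K\<^sup>2 * T)) + (K * ?c)\<^sup>2 * (3 * ?c\<^sup>2 * T\<^sup>2))"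
  have E2: "integrable M (\<lambda>\<omega>. (E n \<omega>)\<^sup>2) \<and> (\<integral>\<omega>. (E n \<omega>)\<^sup>2 \<partial>M) \<le> C" if n: "n > 0" for n
  proof -
    note q = quadratic_sum_moments[OF T n]
    have QD: "\<bar>Q n \<omega> + D n \<omega>\<bar> \<le> K * ?c * quadratic_sum T n \<omega>" for \<omega>
    proof -
      have eq: "Q n \<omega> + D n \<omega> = (\<Sum>i<n. \<Sum>a\<in>\<Xi>. \<Sum>b\<in>\<Xi>. (f2 b a (grid T n i) \<omega> + f2 b a (grid T n (Suc i)) \<omega>) / 4 * (gridW T n b i \<omega> * gridW T n a i \<omega>))"
        unfolding Q_def D_def sum_divide_distrib sum.distrib[symmetric]
        by (intro sum.cong refl) (simp add: field_simps)
      have b1: "\<bar>(f2 b a s \<omega> + f2 b a t \<omega>) / 4 * (x * y)\<bar> \<le> K / 2 * ((x\<^sup>2 + y\<^sup>2) / 2)" if "a \<in> \<Xi>" "b \<in> \<Xi>" for a b s t and x y :: real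
      proof -
        have "\<bar>(f2 b a s \<omega> + f2 b a t \<omega>) / 4\<bar> \<le> K / 2" using f2K[of a b s \<omega>] f2K[of a b t \<omega>] that by simp
        moreover have "\<bar>x * y\<bar> \<le> (x\<^sup>2 + y\<^sup>2) / 2" using sum_squares_bound[of "\<bar>x\<bar>" "\<bar>y\<bar>"] by (simp add: abs_mult)
        ultimately show ?thesis unfolding abs_mult[of "(f2 b a s \<omega> + f2 b a t \<omega>) / 4"] using K by (intro mult_mono) auto
      qed
      have "\<bar>Q n \<omega> + D n \<omega>\<bar> \<le> (\<Sum>i<n. \<Sum>a\<in>\<Xi>. \<Sum>b\<in>\<Xi>. K / 2 * (((gridW T n b i \<omega>)\<^sup>2 + (gridW T n a i \<omega>)\<^sup>2) / 2))"
        unfolding eq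
        by (intro order_trans[OF sum_abs] sum_mono b1)
      also have "\<dots> = (\<Sum>i<n. K / 2 * (?c * (\<Sum>a\<in>\<Xi>. (gridW T n a i \<omega>)\<^sup>2)))"
        by (intro sum.cong refl) (simp add: sum.distrib sum_distrib_left[symmetric] sum_divide_distrib[symmetric] sum_distrib_right[symmetric] field_simps)
      also have "\<dots> = K / 2 * ?c * quadratic_sum T n \<omega>"
        by (simp add: quadratic_sum_def sum_distrib_left mult_ac)
      also have "\<dots> \<le> K * ?c * quadratic_sum T n \<omega>"
        using K by (intro mult_right_mono) (auto simp: quadratic_sum_def sum_nonneg)
      finally show ?thesis .
    qed
    define B where "B \<omega> = 3 * ((2 * K)\<^sup>2 + ?c * (\<Sum>a\<in>\<Xi>. (P n a \<omega>)\<^sup>2) + (K * ?c)\<^sup>2 * (quadratic_sum T n \<omega>)\<^sup>2)" for \<omega>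
    have EB: "(E n \<omega>)\<^sup>2 \<le> B \<omega>" for \<omega>
    proof -
      have three: "(x - y - z)\<^sup>2 \<le> 3 * (x\<^sup>2 + y\<^sup>2 + z\<^sup>2)" for x y z :: real
      proof -
        have "0 \<le> (x + y)\<^sup>2 + (x + z)\<^sup>2 + (y - z)\<^sup>2" by simp
        then show ?thesis by (simp add: power2_eq_square algebra_simps)
      qed
      have "(E n \<omega>)\<^sup>2 \<le> 3 * ((f T \<omega> - f 0 \<omega>)\<^sup>2 + (\<Sum>a\<in>\<Xi>. P n a \<omega>)\<^sup>2 + (Q n \<omega> + D n \<omega>)\<^sup>2)"
        unfolding E_def by (rule three)
      also have "\<dots> \<le> B \<omega>"
        unfolding B_def
      proof (intro mult_left_mono add_mono)
        have "\<bar>f T \<omega> - f 0 \<omega>\<bar> \<le> 2 * K" using fK[of T \<omega>] fK[of 0 \<omega>] by linarith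
        then show "(f T \<omega> - f 0 \<omega>)\<^sup>2 \<le> (2 * K)\<^sup>2" using power_mono[of "\<bar>f T \<omega> - f 0 \<omega>\<bar>" "2 * K" 2] by simp
        show "(\<Sum>a\<in>\<Xi>. P n a \<omega>)\<^sup>2 \<le> ?c * (\<Sum>a\<in>\<Xi>. (P n a \<omega>)\<^sup>2)"
          using sum_squared_le_sum_of_squares[of "\<lambda>a. P n a \<omega>" \<Xi>] by (simp add: mult.commute)
        show "(Q n \<omega> + D n \<omega>)\<^sup>2 \<le> (K * ?c)\<^sup>2 * (quadratic_sum T n \<omega>)\<^sup>2"
          using power_mono[OF QD[of \<omega>], of 2] by (simp add: power_mult_distrib)
      qed simp
      finally show ?thesis .
    qed
    have B: "integrable M B" unfolding B_def[abs_def]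
      using q(2) P(3)[OF n] by (intro integrable_mult_right Bochner_Integration.integrable_add Bochner_Integration.integrable_sum integrable_const) auto
    have I: "integrable M (\<lambda>\<omega>. (E n \<omega>)\<^sup>2)"
      by (rule Bochner_Integration.integrable_bound[OF B]) (use EB in \<open>auto intro!: AE_I2 intro: order_trans[OF _ abs_ge_self]\<close>)
    have "(\<integral>\<omega>. (E n \<omega>)\<^sup>2 \<partial>M) \<le> (\<integral>\<omega>. B \<omega> \<partial>M)" by (intro integral_mono I B EB)
    also have "\<dots> = 3 * ((2 * K)\<^sup>2 + ?c * (\<Sum>a\<in>\<Xi>. \<integral>\<omega>. (P n a \<omega>)\<^sup>2 \<partial>M) + (K * ?c)\<^sup>2 * (\<integral>\<omega>. (quadratic_sum T n \<omega>)\<^sup>2 \<partial>M))"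
      unfolding B_def using q(2) P(3)[OF n] by (simp add: prob_space)
    also have "\<dots> \<le> 3 * ((2 * K)\<^sup>2 + ?c * (\<Sum>a\<in>\<Xi>. K\<^sup>2 * T) + (K * ?c)\<^sup>2 * (3 * ?c\<^sup>2 * T\<^sup>2))"
      using q(3) P(4)[OF n] by (intro mult_left_mono add_mono order_refl sum_mono) auto
    finally show ?thesis using I by (simp add: C_def)
  qed
  have C0: "C \<ge> 0" using T by (simp add: C_def)
  have E_int: "integrable M (E n)" if "n > 0" for n
    using integrable_mult_of_squares[of "\<lambda>_. 1" "E n"] E2[OF that] by simp
  have E_lim: "(\<lambda>n. \<integral>\<omega>. \<bar>E n \<omega>\<bar> \<partial>M) \<longlonglongrightarrow> 0"
  proof (rule LIMSEQ_I)
    fix e :: real assume e: "e > 0"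
    \<comment> \<open>Makes the tail \<open>C / L\<close> less than \<open>e / 2\<close>; thereafter
      \<open>n\<close> is taken so large that the gauge, multiplied by \<open>L\<close>, is below
      \<open>e / 2\<close> too.\<close>
    define L where "L = 1 + 2 * C / e"
    have L: "L \<ge> 1" using C0 e by (simp add: L_def)
    have CL: "C / L < e / 2" using C0 e by (simp add: L_def field_simps)
    have "e / (2 * L) > 0" using e L by simp
    from eventually_conj[OF order_tendstoD(2)[OF E_small this] eventually_gt_at_top[of 0]]
    have "eventually (\<lambda>n. norm ((\<integral>\<omega>. \<bar>E n \<omega>\<bar> \<partial>M) - 0) < e) sequentially"
    proof eventually_elim
      fix n :: nat assume *: "prob_size M (E n) < e / (2 * L) \<and> 0 < n"
      have "(\<integral>\<omega>. \<bar>E n \<omega>\<bar> \<partial>M) \<le> L * prob_size M (E n) + (\<integral>\<omega>. (E n \<omega>)\<^sup>2 \<partial>M) / L"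
        using E2[of n] * by (intro expectation_le_prob_size L) auto
      also have "\<dots> \<le> L * (e / (2 * L)) + C / L"
        using E2[of n] * L by (intro add_mono mult_left_mono divide_right_mono) auto
      also have "L * (e / (2 * L)) = e / 2" using L by simp
      also have "e / 2 + C / L < e" using CL by linarith
      finally show "norm ((\<integral>\<omega>. \<bar>E n \<omega>\<bar> \<partial>M) - 0) < e" by simp
    qed
    then show "\<exists>no. \<forall>n\<ge>no. norm ((\<integral>\<omega>. \<bar>E n \<omega>\<bar> \<partial>M) - 0) < e" by (auto simp: eventually_sequentially)
  qed

  have f2d_int: "integrable M (\<lambda>\<omega>. (f2 b a s \<omega> - f2 b a t \<omega>) * Z \<omega>)" if "s \<ge> 0" "t \<ge> 0" "a \<in> \<Xi>" "b \<in> \<Xi>" "integrable M Z" for a b s t Z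
  proof (rule Bochner_Integration.integrable_bound[of _ "\<lambda>\<omega>. (2 * K) * Z \<omega>"])
    show "integrable M (\<lambda>\<omega>. (2 * K) * Z \<omega>)" using that by simp
    show "(\<lambda>\<omega>. (f2 b a s \<omega> - f2 b a t \<omega>) * Z \<omega>) \<in> borel_measurable M"
      using f2m that by (intro borel_measurable_times borel_measurable_diff) auto
    show "AE \<omega> in M. norm ((f2 b a s \<omega> - f2 b a t \<omega>) * Z \<omega>) \<le> norm ((2 * K) * Z \<omega>)"
    proof (rule AE_I2)
      fix \<omega>
      have "\<bar>f2 b a s \<omega> - f2 b a t \<omega>\<bar> \<le> 2 * K" using f2K[of a b s \<omega>] f2K[of a b t \<omega>] that by linarith
      then show "norm ((f2 b a s \<omega> - f2 b a t \<omega>) * Z \<omega>) \<le> norm ((2 * K) * Z \<omega>)"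
        using K by (simp add: abs_mult mult_right_mono)
    qed
  qed
  have D_int: "integrable M (D n)" if "n > 0" for n
    unfolding D_def[abs_def] using that ww f2d_int g0
    by (intro integrable_divide Bochner_Integration.integrable_sum f2d_int) auto
  have D_lim: "(\<lambda>n. \<integral>\<omega>. \<bar>D n \<omega>\<bar> \<partial>M) \<longlonglongrightarrow> 0"
  proof (rule LIMSEQ_I)
    fix e :: real assume e: "e > 0"
    \<comment> \<open>Each of the \<open>n * card \<Xi> * card \<Xi>\<close> summands will be at
      most \<open>4 * l * h\<close> with \<open>h = T / n\<close>. The added 1 avoids a zero
      denominator for empty \<Xi>.\<close>
    define l where "l = e / (?c * ?c * (4 * T) + 1)"
    have l: "l > 0" "?c * ?c * (4 * T) * l < e"
    proof -
      have p: "?c * ?c * (4 * T) + 1 > 0" using T by (intro add_nonneg_pos) auto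
      then show "l > 0" using e by (simp add: l_def)
      show "?c * ?c * (4 * T) * l < e" using p e by (simp add: l_def field_simps)
    qed
    have "l\<^sup>2 > 0" using l by simp
    from cont[OF this] obtain d where d: "d > 0" "\<And>s t a b. s \<in> {0..T} \<Longrightarrow> t \<in> {0..T} \<Longrightarrow> a \<in> \<Xi> \<Longrightarrow> b \<in> \<Xi> \<Longrightarrow>
      \<bar>s - t\<bar> < d \<Longrightarrow> (\<integral>\<omega>. (f2 b a s \<omega> - f2 b a t \<omega>)\<^sup>2 \<partial>M) \<le> l\<^sup>2" by blast
    obtain N :: nat where N: "T / d < N" using reals_Archimedean2 by blast
    have "norm ((\<integral>\<omega>. \<bar>D n \<omega>\<bar> \<partial>M) - 0) < e" if n: "n \<ge> N + 1" for n
    proof -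
      have n0: "n > 0" using n by simp
      define h where "h = T / n"
      have h: "h > 0" using T n0 by (simp add: h_def)
      have hd: "h < d"
      proof -
        have "T / d < real n" using N n by linarith
        then show ?thesis using d(1) n0 by (simp add: h_def field_simps)
      qed
      have summand: "(\<integral>\<omega>. \<bar>(f2 b a (grid T n (Suc i)) \<omega> - f2 b a (grid T n i) \<omega>) * (gridW T n b i \<omega> * gridW T n a i \<omega>)\<bar> \<partial>M) \<le> 4 * l * h"
        if ab: "a \<in> \<Xi>" "b \<in> \<Xi>" and i: "i < n" for a b i
      proof -
        let ?x = "\<lambda>\<omega>. f2 b a (grid T n (Suc i)) \<omega> - f2 b a (grid T n i) \<omega>"
        let ?y = "\<lambda>\<omega>. gridW T n b i \<omega> * gridW T n a i \<omega>"
        have gle: "grid T n j \<le> T" if "j \<le> n" for j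
          using T n0 that by (simp add: grid_def field_simps)
        have x2: "(\<integral>\<omega>. (?x \<omega>)\<^sup>2 \<partial>M) \<le> l\<^sup>2"
        proof (rule d(2))
          show "grid T n (Suc i) \<in> {0..T}" "grid T n i \<in> {0..T}" using g0 gle i by auto
          show "\<bar>grid T n (Suc i) - grid T n i\<bar> < d" using hd h unfolding grid_Suc_diff h_def by simp
        qed fact+
        have xm: "?x \<in> borel_measurable M" using f2m[OF g0 ab] by measurable
        have x2i: "integrable M (\<lambda>\<omega>. (?x \<omega>)\<^sup>2)"
          using f2d_int[OF g0 g0 ab, of "\<lambda>\<omega>. ?x \<omega>" n "Suc i" n i] f2int[OF g0 ab] by (simp add: power2_eq_square)
        note ga = gridW_moments[OF ab(1) T n0, of i] note gb = gridW_moments[OF ab(2) T n0, of i]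
        \<comment> \<open>Weights for a product of a factor of mean square \<open>l\<^sup>2\<close>
          and one of mean square \<open>3 * h\<^sup>2\<close>: with \<open>h / l\<close> and
          \<open>l / h\<close> the two parts are at most \<open>l * h\<close> and
          \<open>3 * l * h\<close>.\<close>
        define B where "B \<omega> = (h / l) * (?x \<omega>)\<^sup>2 + (l / h) * ((gridW T n b i \<omega>) ^ 4 / 2 + (gridW T n a i \<omega>) ^ 4 / 2)" for \<omega>
        have B: "integrable M B" unfolding B_def[abs_def]
          using x2i ga gb by (intro Bochner_Integration.integrable_add integrable_mult_right integrable_divide)
        have pt: "\<bar>?x \<omega> * ?y \<omega>\<bar> \<le> B \<omega>" for \<omega>
        proof -
          define x where "x = \<bar>?x \<omega>\<bar>"
          define u where "u = gridW T n b i \<omega>" define v where "v = gridW T n a i \<omega>"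
          define y where "y = \<bar>u * v\<bar>"
          define r where "r = sqrt (h / l)"
          have r: "r > 0" "r\<^sup>2 = h / l" using h l by (auto simp: r_def)
          have "2 * (r * x) * (y / r) \<le> (r * x)\<^sup>2 + (y / r)\<^sup>2" by (rule sum_squares_bound)
          then have "2 * (x * y) \<le> (h / l) * x\<^sup>2 + (l / h) * y\<^sup>2"
            using r by (simp add: power_mult_distrib power_divide mult_ac)
          moreover have "0 \<le> x * y" by (simp add: x_def y_def)
          moreover have "y\<^sup>2 \<le> u ^ 4 / 2 + v ^ 4 / 2"
            using sum_squares_bound[of "u\<^sup>2" "v\<^sup>2"] by (simp add: y_def power_mult_distrib power_mult[symmetric])
          then have "(l / h) * y\<^sup>2 \<le> (l / h) * (u ^ 4 / 2 + v ^ 4 / 2)" using h l by (intro mult_left_mono) auto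
          ultimately have "x * y \<le> (h / l) * x\<^sup>2 + (l / h) * (u ^ 4 / 2 + v ^ 4 / 2)" by linarith
          then show ?thesis by (simp add: B_def x_def y_def u_def v_def abs_mult)
        qed
        have "(\<integral>\<omega>. \<bar>?x \<omega> * ?y \<omega>\<bar> \<partial>M) \<le> (\<integral>\<omega>. B \<omega> \<partial>M)"
          using f2d_int[OF g0 g0 ab ww[OF ab n0]] by (intro integral_mono B pt integrable_abs)
        also have "\<dots> = (h / l) * (\<integral>\<omega>. (?x \<omega>)\<^sup>2 \<partial>M) + (l / h) * (3 * h\<^sup>2)"
          unfolding B_def using x2i ga gb by (simp add: h_def)
        also have "\<dots> \<le> (h / l) * l\<^sup>2 + (l / h) * (3 * h\<^sup>2)"
          using h l x2 by (intro add_right_mono mult_left_mono) auto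
        also have "\<dots> = 4 * l * h" using h l by (simp add: power2_eq_square)
        finally show ?thesis .
      qed
      have "(\<integral>\<omega>. \<bar>D n \<omega>\<bar> \<partial>M) \<le> (\<integral>\<omega>. (\<Sum>i<n. \<Sum>a\<in>\<Xi>. \<Sum>b\<in>\<Xi>. \<bar>(f2 b a (grid T n (Suc i)) \<omega> - f2 b a (grid T n i) \<omega>) * (gridW T n b i \<omega> * gridW T n a i \<omega>)\<bar>) \<partial>M)"
      proof (intro integral_mono integrable_abs D_int n0 Bochner_Integration.integrable_sum f2d_int g0 ww)
        fix \<omega>
        have "\<bar>\<Sum>i<n. \<Sum>a\<in>\<Xi>. \<Sum>b\<in>\<Xi>. (f2 b a (grid T n (Suc i)) \<omega> - f2 b a (grid T n i) \<omega>) * (gridW T n b i \<omega> * gridW T n a i \<omega>)\<bar>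
          \<le> (\<Sum>i<n. \<Sum>a\<in>\<Xi>. \<Sum>b\<in>\<Xi>. \<bar>(f2 b a (grid T n (Suc i)) \<omega> - f2 b a (grid T n i) \<omega>) * (gridW T n b i \<omega> * gridW T n a i \<omega>)\<bar>)"
          by (intro order_trans[OF sum_abs] sum_mono order_refl)
        then show "\<bar>D n \<omega>\<bar> \<le> (\<Sum>i<n. \<Sum>a\<in>\<Xi>. \<Sum>b\<in>\<Xi>. \<bar>(f2 b a (grid T n (Suc i)) \<omega> - f2 b a (grid T n i) \<omega>) * (gridW T n b i \<omega> * gridW T n a i \<omega>)\<bar>)"
          unfolding D_def by linarith
      qed
      also have "\<dots> = (\<Sum>i<n. \<Sum>a\<in>\<Xi>. \<Sum>b\<in>\<Xi>. \<integral>\<omega>. \<bar>(f2 b a (grid T n (Suc i)) \<omega> - f2 b a (grid T n i) \<omega>) * (gridW T n b i \<omega> * gridW T n a i \<omega>)\<bar> \<partial>M)"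
        using f2d_int[OF g0 g0 _ _ ww] n0
        by (simp add: Bochner_Integration.integral_sum Bochner_Integration.integrable_sum integrable_abs cong: sum.cong)
      also have "\<dots> \<le> (\<Sum>i<n. \<Sum>a\<in>\<Xi>. \<Sum>b\<in>\<Xi>. 4 * l * h)"
        by (intro sum_mono summand) auto
      also have "\<dots> = ?c * ?c * (4 * T) * l" using n0 by (simp add: h_def)
      also have "\<dots> < e" by (rule l(2))
      finally show ?thesis by simp
    qed
    then show "\<exists>no. \<forall>n\<ge>no. norm ((\<integral>\<omega>. \<bar>D n \<omega>\<bar> \<partial>M) - 0) < e" by blast
  qed

  \<comment> \<open>\<open>f2\<close> at a left end point is independent of the following
    increments, whose mixed products have mean zero; only the diagonal terms survive.\<close>
  have Q_exp: "integrable M (Q n)" "(\<integral>\<omega>. Q n \<omega> \<partial>M) = (T / n) * (\<Sum>i<n. (\<Sum>a\<in>\<Xi>. \<integral>\<omega>. f2 a a (grid T n i) \<omega> \<partial>M) / 2)" if n: "n > 0" for n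
  proof -
    have 1: "(\<integral>\<omega>. f2 b a (grid T n i) \<omega> * (gridW T n b i \<omega> * gridW T n a i \<omega>) \<partial>M) = (if b = a then T / n else 0) * (\<integral>\<omega>. f2 b a (grid T n i) \<omega> \<partial>M)"
        "integrable M (\<lambda>\<omega>. f2 b a (grid T n i) \<omega> * (gridW T n b i \<omega> * gridW T n a i \<omega>))"
      if "a \<in> \<Xi>" "b \<in> \<Xi>" for a b i
      using indep_dW_dW[OF g0 grid_strict[OF T n] f2[OF that g0] f2int[OF g0 that] that(2,1)]
      unfolding gridW_def grid_Suc_diff by auto
    show "integrable M (Q n)" unfolding Q_def[abs_def]
      using 1(2) by (intro integrable_divide Bochner_Integration.integrable_sum) auto
    have "(\<integral>\<omega>. Q n \<omega> \<partial>M) = (\<Sum>i<n. \<Sum>a\<in>\<Xi>. \<Sum>b\<in>\<Xi>. \<integral>\<omega>. f2 b a (grid T n i) \<omega> * (gridW T n b i \<omega> * gridW T n a i \<omega>) \<partial>M) / 2"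
      unfolding Q_def using 1(2)
      by (simp add: Bochner_Integration.integral_sum Bochner_Integration.integrable_sum cong: sum.cong)
    also have "\<dots> = (\<Sum>i<n. \<Sum>a\<in>\<Xi>. (T / n) * (\<integral>\<omega>. f2 a a (grid T n i) \<omega> \<partial>M)) / 2"
    proof -
      have "(\<Sum>b\<in>\<Xi>. \<integral>\<omega>. f2 b a (grid T n i) \<omega> * (gridW T n b i \<omega> * gridW T n a i \<omega>) \<partial>M) = (T / n) * (\<integral>\<omega>. f2 a a (grid T n i) \<omega> \<partial>M)"
        if a: "a \<in> \<Xi>" for a i
      proof -
        have "(\<Sum>b\<in>\<Xi>. \<integral>\<omega>. f2 b a (grid T n i) \<omega> * (gridW T n b i \<omega> * gridW T n a i \<omega>) \<partial>M) =
           (\<Sum>b\<in>\<Xi>. if b = a then (T / n) * (\<integral>\<omega>. f2 b a (grid T n i) \<omega> \<partial>M) else 0)"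
          using 1(1) a by (intro sum.cong) auto
        then show ?thesis using a finite_\<Xi> by (simp add: sum.delta)
      qed
      then show ?thesis by simp
    qed
    finally show "(\<integral>\<omega>. Q n \<omega> \<partial>M) = (T / n) * (\<Sum>i<n. (\<Sum>a\<in>\<Xi>. \<integral>\<omega>. f2 a a (grid T n i) \<omega> \<partial>M) / 2)"
      by (simp add: sum_distrib_left sum_divide_distrib)
  qed
  \<comment> \<open>The martingale sums have mean zero, so the mean increment of \<open>f\<close> is
    the mean of \<open>Q n\<close> up to the means of \<open>E n\<close> and
    \<open>D n\<close>.\<close>
  have bound: "norm ((\<integral>\<omega>. Q n \<omega> \<partial>M) - ((\<integral>\<omega>. f T \<omega> \<partial>M) - (\<integral>\<omega>. f 0 \<omega> \<partial>M))) \<le> (\<integral>\<omega>. \<bar>E n \<omega>\<bar> \<partial>M) + (\<integral>\<omega>. \<bar>D n \<omega>\<bar> \<partial>M)"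
    if n: "n > 0" for n
  proof -
    have "(\<integral>\<omega>. E n \<omega> \<partial>M) = (\<integral>\<omega>. f T \<omega> \<partial>M) - (\<integral>\<omega>. f 0 \<omega> \<partial>M) - (\<Sum>a\<in>\<Xi>. \<integral>\<omega>. P n a \<omega> \<partial>M) - ((\<integral>\<omega>. Q n \<omega> \<partial>M) + (\<integral>\<omega>. D n \<omega> \<partial>M))"
      unfolding E_def using fint T P(1)[OF n] Q_exp(1)[OF n] D_int[OF n] by simp
    then have "(\<integral>\<omega>. Q n \<omega> \<partial>M) - ((\<integral>\<omega>. f T \<omega> \<partial>M) - (\<integral>\<omega>. f 0 \<omega> \<partial>M)) = - (\<integral>\<omega>. E n \<omega> \<partial>M) - (\<integral>\<omega>. D n \<omega> \<partial>M)"
      using P(2)[OF n] by simp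
    moreover have "\<bar>\<integral>\<omega>. E n \<omega> \<partial>M\<bar> \<le> (\<integral>\<omega>. \<bar>E n \<omega>\<bar> \<partial>M)" "\<bar>\<integral>\<omega>. D n \<omega> \<partial>M\<bar> \<le> (\<integral>\<omega>. \<bar>D n \<omega>\<bar> \<partial>M)"
      by (rule integral_abs_bound)+
    ultimately show ?thesis unfolding real_norm_def by linarith
  qed
  have "(\<lambda>n. (\<integral>\<omega>. Q n \<omega> \<partial>M) - ((\<integral>\<omega>. f T \<omega> \<partial>M) - (\<integral>\<omega>. f 0 \<omega> \<partial>M))) \<longlonglongrightarrow> 0"
    by (rule Lim_null_comparison[OF _ tendsto_add_zero[OF E_lim D_lim]])
      (rule eventually_mono[OF eventually_gt_at_top[of 0] bound])
  then have "(\<lambda>n. \<integral>\<omega>. Q n \<omega> \<partial>M) \<longlonglongrightarrow> (\<integral>\<omega>. f T \<omega> \<partial>M) - (\<integral>\<omega>. f 0 \<omega> \<partial>M)"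
    by (rule LIM_zero_cancel)
  then show ?thesis
    by (rule Lim_transform_eventually) (rule eventually_mono[OF eventually_gt_at_top[of 0] Q_exp(2)])
qed

end

section \<open>Riemann sums and the exponential series\<close>

lemma riemann_sum_limit:
  fixes v :: "real \<Rightarrow> real"
  assumes T: "T > 0" and v: "continuous_on {0..T} v"
  shows "(\<lambda>n. (T / n) * (\<Sum>i<n. v (grid T n i))) \<longlonglongrightarrow> integral {0..T} v"
proof (rule LIMSEQ_I)
  fix e :: real assume e: "e > 0"
  define V where "V t = integral {0..t} v" for t
  have V: "(V has_vector_derivative v t) (at t within {0..T})" if "t \<in> {0..T}" for t
    unfolding V_def[abs_def] using integral_has_vector_derivative[OF v that] .
  have "uniformly_continuous_on {0..T} v" using v by (intro compact_uniformly_continuous) auto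
  moreover have "e / (2 * T) > 0" using e T by simp
  ultimately obtain d where d: "d > 0" "\<And>s t. s \<in> {0..T} \<Longrightarrow> t \<in> {0..T} \<Longrightarrow> dist s t < d \<Longrightarrow> dist (v s) (v t) < e / (2 * T)"
    unfolding uniformly_continuous_on_def by metis
  obtain N :: nat where N: "T / d < N" using reals_Archimedean2 by blast
  have "norm ((T / n) * (\<Sum>i<n. v (grid T n i)) - integral {0..T} v) < e" if n: "n \<ge> N + 1" for n
  proof -
    have n0: "n > 0" using n by simp
    define h where "h = T / n"
    have h: "h > 0" using T n0 by (simp add: h_def)
    have "T / d < real n" using N n by linarith
    then have hd: "h < d" using d(1) n0 by (simp add: h_def field_simps)
    have gle: "grid T n j \<le> T" if "j \<le> n" for j
      using T n0 that by (simp add: grid_def field_simps)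
    have step: "\<bar>h * v (grid T n i) - (V (grid T n (Suc i)) - V (grid T n i))\<bar> \<le> h * (e / (2 * T))" if i: "i < n" for i
    proof -
      let ?a = "grid T n i" and ?b = "grid T n (Suc i)"
      have ab: "?a < ?b" "?b - ?a = h" using grid_strict[OF T n0] grid_Suc_diff by (auto simp: h_def)
      have sub: "{?a..?b} \<subseteq> {0..T}" using grid_nonneg[OF T, of n i] gle[of "Suc i"] i by auto
      \<comment> \<open>By the mean value theorem the increment of the primitive is
        \<open>h * v x\<close> at some interior point, to be compared with the left-point
        value.\<close>
      have "\<exists>x\<in>{?a<..<?b}. V ?b - V ?a = (?b - ?a) *\<^sub>R v x"
      proof (rule mvt_simple[OF ab(1), of V "\<lambda>x r. r *\<^sub>R v x"])
        fix x assume "?a \<le> x" "x \<le> ?b"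
        then show "(V has_derivative (\<lambda>r. r *\<^sub>R v x)) (at x within {?a..?b})"
          using V[of x] sub has_derivative_subset unfolding has_vector_derivative_def by fastforce
      qed
      then obtain x where x: "x \<in> {?a<..<?b}" "V ?b - V ?a = h * v x" using ab by auto
      have "dist (v ?a) (v x) < e / (2 * T)"
      proof (rule d(2))
        show "?a \<in> {0..T}" "x \<in> {0..T}" using sub x ab by auto
        show "dist ?a x < d" using x(1) ab(2) hd by (auto simp: dist_real_def)
      qed
      then have "h * \<bar>v ?a - v x\<bar> \<le> h * (e / (2 * T))" using h by (intro mult_left_mono) (auto simp: dist_real_def)
      moreover have "h * v ?a - h * v x = h * (v ?a - v x)" by (simp add: algebra_simps)
      ultimately show ?thesis using h by (simp add: x(2) abs_mult)
    qed
    have "V (grid T n n) - V (grid T n 0) = (\<Sum>i<n. V (grid T n (Suc i)) - V (grid T n i))"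
      using sum_lessThan_telescope[of "\<lambda>i. V (grid T n i)" n] by simp
    then have "integral {0..T} v = (\<Sum>i<n. V (grid T n (Suc i)) - V (grid T n i))"
      by (simp add: grid_end[OF n0] V_def)
    then have "norm ((T / n) * (\<Sum>i<n. v (grid T n i)) - integral {0..T} v) = \<bar>\<Sum>i<n. h * v (grid T n i) - (V (grid T n (Suc i)) - V (grid T n i))\<bar>"
      by (simp add: h_def sum_subtractf sum_distrib_left)
    also have "\<dots> \<le> (\<Sum>i<n. h * (e / (2 * T)))"
      by (intro order_trans[OF sum_abs] sum_mono step) auto
    also have "\<dots> = e / 2" using n0 T by (simp add: h_def)
    also have "\<dots> < e" using e by simp
    finally show ?thesis .
  qed
  then show "\<exists>no. \<forall>n\<ge>no. norm ((T / n) * (\<Sum>i<n. v (grid T n i)) - integral {0..T} v) < e" by blast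
qed

text \<open>Each \<phi> k is a primitive of the next, hence the k-th derivative of \<phi> 0 on the
  interval, one-sided at its ends. Taylor's formula at 0 leaves at most
  \<open>K * (L * T) ^ Suc p / fact p\<close>, which tends to 0.\<close>

lemma iterated_integral_exponential_series:
  fixes \<phi> :: "nat \<Rightarrow> real \<Rightarrow> real"
  assumes cont: "\<And>k. continuous_on {0..} (\<phi> k)"
    and int: "\<And>k T. T > 0 \<Longrightarrow> \<phi> k T - \<phi> k 0 = integral {0..T} (\<phi> (Suc k))"
    and bound: "\<And>k t. t \<ge> 0 \<Longrightarrow> \<bar>\<phi> k t\<bar> \<le> K * L ^ k" and L: "L \<ge> 0" and T: "T \<ge> 0"
  shows "(\<lambda>k. \<phi> k 0 * T ^ k / fact k) sums \<phi> 0 T"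
proof (cases "T = 0")
  case True
  have "(\<lambda>k. \<phi> k 0 * T ^ k / fact k) = (\<lambda>k. if k = 0 then \<phi> 0 0 else 0)" using True by auto
  then show ?thesis using True sums_single[of 0 "\<lambda>_. \<phi> 0 0"] by simp
next
  case False
  with T have T: "T > 0" by simp
  have der: "(\<phi> k has_vector_derivative \<phi> (Suc k) t) (at t within {0..T})" if t: "t \<in> {0..T}" for k t
  proof -
    have "((\<lambda>u. \<phi> k 0 + integral {0..u} (\<phi> (Suc k))) has_vector_derivative 0 + \<phi> (Suc k) t) (at t within {0..T})"
      using integral_has_vector_derivative[OF continuous_on_subset[OF cont] t]
      by (intro has_vector_derivative_add has_vector_derivative_const) auto
    then show ?thesis
    proof (rule has_vector_derivative_transform[OF t, rotated, THEN has_vector_derivative_eq_rhs])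
      fix u assume "u \<in> {0..T}"
      then show "\<phi> k u = \<phi> k 0 + integral {0..u} (\<phi> (Suc k))" using int[of u k] by (cases "u = 0") auto
    qed simp
  qed
  have taylor: "\<bar>\<phi> 0 T - (\<Sum>i<Suc p. \<phi> i 0 * T ^ i / fact i)\<bar> \<le> K * (L * T) ^ Suc p / fact p" for p
  proof -
    let ?i = "\<lambda>x. ((T - x) ^ p / fact p) *\<^sub>R \<phi> (Suc p) x"
    have "(?i has_integral \<phi> 0 T - (\<Sum>i<Suc p. ((T - 0) ^ i / fact i) *\<^sub>R \<phi> i 0)) {0..T}"
      using Taylor_has_integral[of "Suc p" \<phi> "\<phi> 0" 0 T] der T by auto
    moreover have "norm (?i x) \<le> T ^ p / fact p * (K * L ^ Suc p)" if "x \<in> {0..T}" for x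
    proof -
      have "\<bar>(T - x) ^ p / fact p\<bar> * \<bar>\<phi> (Suc p) x\<bar> \<le> T ^ p / fact p * (K * L ^ Suc p)"
        using that bound[of x "Suc p"] by (intro mult_mono) (auto intro!: divide_right_mono power_mono)
      then show ?thesis by (simp add: abs_mult)
    qed
    moreover have "0 \<le> T ^ p / fact p * (K * L ^ Suc p)"
      using T L bound[of 0 0] by simp
    ultimately have "norm (\<phi> 0 T - (\<Sum>i<Suc p. ((T - 0) ^ i / fact i) *\<^sub>R \<phi> i 0)) \<le> T ^ p / fact p * (K * L ^ Suc p) * measure lborel (cbox 0 T)"
      by (intro has_integral_bound) auto
    then show ?thesis using T by (simp add: power_mult_distrib mult_ac)
  qed
  have "(\<lambda>p. K * (L * T) * ((L * T) ^ p /\<^sub>R fact p)) \<longlonglongrightarrow> K * (L * T) * 0"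
    by (intro tendsto_mult tendsto_const summable_LIMSEQ_zero summable_exp_generic)
  then have lim: "(\<lambda>p. K * (L * T) ^ Suc p / fact p) \<longlonglongrightarrow> 0"
    by (simp add: divide_inverse mult_ac)
  have "(\<lambda>p. (\<Sum>i<Suc p. \<phi> i 0 * T ^ i / fact i) - \<phi> 0 T) \<longlonglongrightarrow> 0"
  proof (rule Lim_null_comparison[OF _ lim], rule always_eventually, rule allI)
    fix p show "norm ((\<Sum>i<Suc p. \<phi> i 0 * T ^ i / fact i) - \<phi> 0 T) \<le> K * (L * T) ^ Suc p / fact p"
      using taylor[of p] by (simp add: abs_minus_commute)
  qed
  then have "(\<lambda>p. \<Sum>i<Suc p. \<phi> i 0 * T ^ i / fact i) \<longlonglongrightarrow> \<phi> 0 T" by (rule LIM_zero_cancel)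
  then have "(\<lambda>p. \<Sum>i<p. \<phi> i 0 * T ^ i / fact i) \<longlonglongrightarrow> \<phi> 0 T" by (rule LIMSEQ_imp_Suc)
  then show ?thesis by (simp add: sums_def)
qed

section \<open>Calculus on Lie groups\<close>

lemma frechet_derivative_cong_open:
  assumes "open S" "x \<in> S" "\<And>y. y \<in> S \<Longrightarrow> f y = g y" "f differentiable at x"
  shows "g differentiable at x" "frechet_derivative g (at x) = frechet_derivative f (at x)"
proof -
  have "(f has_derivative frechet_derivative f (at x)) (at x)"
    using assms(4) by (simp add: frechet_derivative_works)
  then have "(g has_derivative frechet_derivative f (at x)) (at x)"
    using has_derivative_transform_within_open assms(1-3) by blast
  then show "g differentiable at x" "frechet_derivative g (at x) = frechet_derivative f (at x)"
    using differentiableI frechet_derivative_at by (blast, metis)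
qed

lemma Ck_on_cong:
  assumes "open S" "\<And>x. x \<in> S \<Longrightarrow> f x = g x" "Ck_on k S f"
  shows "Ck_on k S g"
  using assms(2,3)
proof (induction k arbitrary: f g)
  case 0
  then show ?case using continuous_on_cong[OF refl, of S f g] by simp
next
  case (Suc k)
  note d = frechet_derivative_cong_open[OF assms(1) _ Suc.prems(1)]
  show ?case
    unfolding Ck_on.simps
  proof (intro conjI ballI allI)
    fix x assume "x \<in> S"
    with d(1)[OF this] Suc.prems(2) show "g differentiable at x" by simp
  next
    fix v
    show "Ck_on k S (\<lambda>x. frechet_derivative g (at x) v)"
    proof (rule Suc.IH[of "\<lambda>x. frechet_derivative f (at x) v"])
      show "Ck_on k S (\<lambda>x. frechet_derivative f (at x) v)" using Suc.prems(2) by simp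
      fix x assume "x \<in> S"
      with d(2)[OF this] Suc.prems(2) show "frechet_derivative f (at x) v = frechet_derivative g (at x) v" by simp
    qed
  qed
qed

text \<open>Serves two purposes: taking coordinates of vector-valued maps, and adding constants to
  matrix coefficients.\<close>

lemma Ck_on_affine:
  assumes "open S" "bounded_linear L" "Ck_on k S f"
  shows "Ck_on k S (\<lambda>x. c + L (f x))"
  using assms(3)
proof (induction k arbitrary: f c)
  case 0
  then show ?case
    by (auto intro!: continuous_intros bounded_linear.continuous_on[OF assms(2)])
next
  case (Suc k)
  have d: "((\<lambda>x. c + L (f x)) has_derivative (\<lambda>v. L (frechet_derivative f (at x) v))) (at x)" if "x \<in> S" for x
  proof -
    have "(f has_derivative frechet_derivative f (at x)) (at x)"
      using Suc.prems that by (simp add: frechet_derivative_works)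
    from bounded_linear.has_derivative[OF assms(2) this] show ?thesis
      by (auto intro!: derivative_eq_intros)
  qed
  show ?case
    unfolding Ck_on.simps
  proof (intro conjI ballI allI)
    fix x assume "x \<in> S"
    then show "(\<lambda>x. c + L (f x)) differentiable at x" using d differentiableI by blast
  next
    fix v
    have "Ck_on k S (\<lambda>x. 0 + L (frechet_derivative f (at x) v))"
      using Suc.IH[of "\<lambda>x. frechet_derivative f (at x) v" 0] Suc.prems by simp
    then show "Ck_on k S (\<lambda>x. frechet_derivative (\<lambda>x. c + L (f x)) (at x) v)"
      by (rule Ck_on_cong[OF assms(1), rotated]) (simp add: frechet_derivative_at[OF d, symmetric])
  qed
qed

lemma Ck_on_Suc_imp: "Ck_on (Suc k) S f \<Longrightarrow> Ck_on k S f"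
proof (induction k arbitrary: f)
  case 0
  then show ?case
    by (simp add: continuous_at_imp_continuous_on differentiable_imp_continuous_within)
next
  case (Suc k)
  then show ?case by simp
qed

lemma Ck_on_le: "k \<le> l \<Longrightarrow> Ck_on l S f \<Longrightarrow> Ck_on k S f"
  by (induction rule: dec_induct) (auto simp del: Ck_on.simps dest: Ck_on_Suc_imp)

lemma Ck_map_affine:
  assumes "\<And>c. c \<in> A \<Longrightarrow> open (snd c ` fst c)" "bounded_linear L" "Ck_map A k f"
  shows "Ck_map A k (\<lambda>x. c + L (f x))"
  unfolding Ck_map_def
proof
  fix c' assume "c' \<in> A"
  with assms(3) have "Ck_on k (snd c' ` fst c') (f \<circ> chart_inv c')" by (simp add: Ck_map_def)
  from Ck_on_affine[OF assms(1)[OF \<open>c' \<in> A\<close>] assms(2) this, of c]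
  show "Ck_on k (snd c' ` fst c') ((\<lambda>x. c + L (f x)) \<circ> chart_inv c')" by (simp add: comp_def)
qed

locale lie =
  fixes G :: "'g::{second_countable_topology,t2_space} monoid" (structure)
    and A :: "('g, 'e::real_normed_vector) chart set"
  assumes lie: "lie_group G A"
begin

lemma group: "group G" and carrier [simp]: "carrier G = UNIV" and smooth_atlas: "smooth_atlas A"
  using lie by (auto simp: lie_group_def)

sublocale group G by (rule group)

lemma inv_mult_cancel [simp]: "inv g \<otimes> (g \<otimes> h) = h" "g \<otimes> (inv g \<otimes> h) = h"
  by (simp_all add: m_assoc[symmetric])

lemma fin_dim_model: "fin_dim TYPE('e)"
  using smooth_atlas by (auto simp: smooth_atlas_def fin_dim_def)

lemma chart_at: "\<exists>c\<in>A. g \<in> fst c"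
  using smooth_atlas by (auto simp: smooth_atlas_def)

lemma chart:
  assumes "c \<in> A"
  shows "open (fst c)" "open (snd c ` fst c)" "g \<in> fst c \<Longrightarrow> chart_inv c (snd c g) = g"
    "x \<in> snd c ` fst c \<Longrightarrow> snd c (chart_inv c x) = x" "x \<in> snd c ` fst c \<Longrightarrow> chart_inv c x \<in> fst c"
    "continuous_on (fst c) (snd c)" "continuous_on (snd c ` fst c) (chart_inv c)"
  using smooth_atlas assms unfolding smooth_atlas_def homeomorphism_def by auto

lemma continuous_mult: "continuous_on UNIV (\<lambda>(x, y). x \<otimes> y)"
  and continuous_inv: "continuous_on UNIV (\<lambda>x. inv x)"
  using lie by (auto simp: lie_group_def)

lemma continuous_on_mult [continuous_intros]:
  "continuous_on S f \<Longrightarrow> continuous_on S h \<Longrightarrow> continuous_on S (\<lambda>x. f x \<otimes> h x)"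
  using continuous_on_compose2[OF continuous_mult, of S "\<lambda>x. (f x, h x)"] by (auto intro: continuous_on_Pair)

lemma continuous_on_inv [continuous_intros]:
  "continuous_on S f \<Longrightarrow> continuous_on S (\<lambda>x. inv (f x))"
  using continuous_on_compose2[OF continuous_inv] by auto

lemma Ck_map_continuous:
  assumes "Ck_map A k f"
  shows "continuous_on UNIV f"
proof -
  have "isCont f g" for g
  proof -
    obtain c where c: "c \<in> A" "g \<in> fst c" using chart_at by blast
    have "Ck_on 0 (snd c ` fst c) (f \<circ> chart_inv c)"
      using assms c(1) Ck_on_le[of 0 k] by (auto simp: Ck_map_def simp del: Ck_on.simps)
    then have "continuous_on (fst c) (\<lambda>g. (f \<circ> chart_inv c) (snd c g))"
      using continuous_on_compose2[OF _ chart(6)[OF c(1)], of "snd c ` fst c" "f \<circ> chart_inv c"] by (simp add: comp_def)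
    then have "continuous_on (fst c) f"
      by (rule continuous_on_eq) (simp add: chart(3)[OF c(1)])
    then show ?thesis
      using c(2) continuous_on_eq_continuous_at[OF chart(1)[OF c(1)]] by blast
  qed
  then show ?thesis
    by (intro continuous_at_imp_continuous_on ballI)
qed

section \<open>Multiplication read in charts\<close>

definition mult_dom :: "('g, 'e) chart \<Rightarrow> ('g, 'e) chart \<Rightarrow> ('g, 'e) chart \<Rightarrow> ('e \<times> 'e) set" where
  "mult_dom a b c = {(x, y). x \<in> snd a ` fst a \<and> y \<in> snd b ` fst b \<and> chart_inv a x \<otimes> chart_inv b y \<in> fst c}"

definition mult_map :: "('g, 'e) chart \<Rightarrow> ('g, 'e) chart \<Rightarrow> ('g, 'e) chart \<Rightarrow> 'e \<times> 'e \<Rightarrow> 'e" where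
  "mult_map a b c = (\<lambda>(x, y). snd c (chart_inv a x \<otimes> chart_inv b y))"

lemma mult_map_smooth:
  assumes "a \<in> A" "b \<in> A" "c \<in> A"
  shows "smooth_on (mult_dom a b c) (mult_map a b c)"
proof -
  have "\<forall>a\<in>A. \<forall>b\<in>A. \<forall>c\<in>A. smooth_on (mult_dom a b c) (mult_map a b c)"
    using lie unfolding lie_group_def mult_dom_def mult_map_def by (elim conjE)
  then show ?thesis using assms by blast
qed

lemma open_mult_dom:
  assumes "a \<in> A" "b \<in> A" "c \<in> A"
  shows "open (mult_dom a b c)"
proof -
  let ?D = "snd a ` fst a \<times> snd b ` fst b"
  have "continuous_on ?D (\<lambda>p. chart_inv a (fst p) \<otimes> chart_inv b (snd p))"
  proof (rule continuous_on_mult)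
    show "continuous_on ?D (\<lambda>p. chart_inv a (fst p))"
      by (rule continuous_on_compose2[OF chart(7)[OF assms(1)] continuous_on_fst[OF continuous_on_id]]) auto
    show "continuous_on ?D (\<lambda>p. chart_inv b (snd p))"
      by (rule continuous_on_compose2[OF chart(7)[OF assms(2)] continuous_on_snd[OF continuous_on_id]]) auto
  qed
  then have "open ((\<lambda>p. chart_inv a (fst p) \<otimes> chart_inv b (snd p)) -` fst c \<inter> ?D)"
    using continuous_on_open_vimage[OF open_Times[OF chart(2)[OF assms(1)] chart(2)[OF assms(2)]]] chart(1)[OF assms(3)]
    by blast
  also have "(\<lambda>p. chart_inv a (fst p) \<otimes> chart_inv b (snd p)) -` fst c \<inter> ?D = mult_dom a b c"
    by (auto simp: mult_dom_def)
  finally show ?thesis .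
qed

lemma mult_map_has_derivative:
  assumes "a \<in> A" "b \<in> A" "c \<in> A" "p \<in> mult_dom a b c"
  shows "(mult_map a b c has_derivative frechet_derivative (mult_map a b c) (at p)) (at p)"
proof -
  have "Ck_on (Suc 0) (mult_dom a b c) (mult_map a b c)"
    using mult_map_smooth[OF assms(1-3)] unfolding smooth_on_def by blast
  then show ?thesis using assms(4) by (simp add: frechet_derivative_works)
qed

lemma mult_map_has_derivative_right:
  assumes "a \<in> A" "b \<in> A" "c \<in> A" "(x, y) \<in> mult_dom a b c"
  shows "((\<lambda>y. mult_map a b c (x, y)) has_derivative
    (\<lambda>v. frechet_derivative (mult_map a b c) (at (x, y)) (0, v))) (at y)"
proof -
  have "((\<lambda>y. (x, y)) has_derivative (\<lambda>v. (0, v))) (at y)" by (auto intro!: derivative_eq_intros)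
  from has_derivative_compose[OF this mult_map_has_derivative[OF assms]] show ?thesis .
qed

lemma mult_map_has_derivative_left:
  assumes "a \<in> A" "b \<in> A" "c \<in> A" "(x, y) \<in> mult_dom a b c"
  shows "((\<lambda>x. mult_map a b c (x, y)) has_derivative
    (\<lambda>v. frechet_derivative (mult_map a b c) (at (x, y)) (v, 0))) (at x)"
proof -
  have "((\<lambda>x. (x, y)) has_derivative (\<lambda>v. (v, 0))) (at x)" by (auto intro!: derivative_eq_intros)
  from has_derivative_compose[OF this mult_map_has_derivative[OF assms]] show ?thesis .
qed

text \<open>A partial map of the multiplication, with the first factor frozen in any chart around
  \<open>g\<close>.\<close>

lemma left_translation_differentiable:
  assumes "b \<in> A" "c \<in> A" "y \<in> snd b ` fst b" "g \<otimes> chart_inv b y \<in> fst c"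
  shows "(\<lambda>y. snd c (g \<otimes> chart_inv b y)) differentiable at y"
proof -
  obtain a where a: "a \<in> A" "g \<in> fst a" using chart_at by blast
  have "(snd a g, y) \<in> mult_dom a b c" using assms a by (auto simp: mult_dom_def chart(3))
  from mult_map_has_derivative_right[OF a(1) assms(1,2) this] show ?thesis
    using a by (auto simp: mult_map_def chart(3) intro: differentiableI)
qed

lemma right_translation_differentiable:
  assumes "b \<in> A" "c \<in> A" "y \<in> snd b ` fst b" "chart_inv b y \<otimes> g \<in> fst c"
  shows "(\<lambda>y. snd c (chart_inv b y \<otimes> g)) differentiable at y"
proof -
  obtain a where a: "a \<in> A" "g \<in> fst a" using chart_at by blast
  have "(y, snd a g) \<in> mult_dom b a c" using assms a by (auto simp: mult_dom_def chart(3))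
  from mult_map_has_derivative_left[OF assms(1) a(1) assms(2) this] show ?thesis
    using a by (auto simp: mult_map_def chart(3) intro: differentiableI)
qed

abbreviation "uc \<equiv> unit_chart G A"
abbreviation "y0 \<equiv> snd (unit_chart G A) \<one>"
abbreviation "ucinv \<equiv> chart_inv (unit_chart G A)"

lemma unit_chart: "uc \<in> A" "\<one> \<in> fst uc"
  using someI_ex[of "\<lambda>c. c \<in> A \<and> \<one> \<in> fst c"] chart_at[of \<one>] unfolding unit_chart_def by blast+

lemma y0: "y0 \<in> snd uc ` fst uc" "ucinv y0 = \<one>"
  using unit_chart chart(3) by auto

lemmas uc = chart[OF unit_chart(1)]

lemma eventually_near:
  assumes "open S" "F y \<in> S" "b \<in> A" "y \<in> snd b ` fst b" "continuous_on (snd b ` fst b) F"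
  obtains N where "open N" "y \<in> N" "N \<subseteq> snd b ` fst b" "\<And>z. z \<in> N \<Longrightarrow> F z \<in> S"
proof (rule that)
  show "open (F -` S \<inter> snd b ` fst b)"
    using continuous_on_open_vimage[OF chart(2)[OF assms(3)]] assms(1,5) by blast
qed (use assms in auto)

text \<open>Conjugation is a left translation into a chart around \<open>g\<close> followed by a
  right translation back. \<open>Ad\<close> is written with \<open>frechet_derivative\<close>, which
  says something only once differentiability is known.\<close>

lemma Ad_chart_differentiable:
  "(\<lambda>x. snd uc (g \<otimes> ucinv x \<otimes> inv g)) differentiable at y0"
proof -
  obtain c where c: "c \<in> A" "g \<in> fst c" using chart_at by blast
  have cont: "continuous_on (snd uc ` fst uc) (\<lambda>x. g \<otimes> ucinv x)"
    by (intro continuous_intros uc)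
  obtain N where N: "open N" "y0 \<in> N" "N \<subseteq> snd uc ` fst uc" "\<And>z. z \<in> N \<Longrightarrow> g \<otimes> ucinv z \<in> fst c"
    using eventually_near[OF chart(1)[OF c(1)] _ unit_chart(1) y0(1) cont] c(2) y0 by auto
  have "(\<lambda>x. snd c (g \<otimes> ucinv x)) differentiable at y0"
    using c y0 unit_chart by (intro left_translation_differentiable) auto
  moreover have "(\<lambda>z. snd uc (chart_inv c z \<otimes> inv g)) differentiable at (snd c (g \<otimes> ucinv y0))"
    using c y0 unit_chart chart(3) by (intro right_translation_differentiable) auto
  ultimately have "(\<lambda>x. snd uc (chart_inv c (snd c (g \<otimes> ucinv x)) \<otimes> inv g)) differentiable at y0"
    using differentiable_chain_at[of "\<lambda>x. snd c (g \<otimes> ucinv x)" y0 "\<lambda>z. snd uc (chart_inv c z \<otimes> inv g)"]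
    by (simp add: comp_def)
  then show ?thesis
    by (rule frechet_derivative_cong_open(1)[OF N(1,2), rotated]) (simp add: N(4) chart(3)[OF c(1)])
qed

end

text \<open>The product rule in order one, as required for showing that left-invariant derivatives
  of C2 functions are C1.\<close>

lemma Ck_on_1_scaleR:
  fixes \<alpha> :: "'a::real_normed_vector \<Rightarrow> real" and h :: "'a \<Rightarrow> 'b::real_normed_vector"
  assumes "open S" "Ck_on 1 S \<alpha>" "Ck_on 1 S h"
  shows "Ck_on 1 S (\<lambda>x. \<alpha> x *\<^sub>R h x)"
proof -
  have a: "(\<alpha> has_derivative frechet_derivative \<alpha> (at x)) (at x)"
    and h: "(h has_derivative frechet_derivative h (at x)) (at x)" if "x \<in> S" for x
    using assms that by (auto simp: frechet_derivative_works)
  have d: "((\<lambda>x. \<alpha> x *\<^sub>R h x) has_derivative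
      (\<lambda>v. \<alpha> x *\<^sub>R frechet_derivative h (at x) v + frechet_derivative \<alpha> (at x) v *\<^sub>R h x)) (at x)" if "x \<in> S" for x
    by (rule has_derivative_scaleR[OF a h]) (use that in auto)
  have ca: "continuous_on S \<alpha>" "continuous_on S h"
    by (simp_all add: continuous_at_imp_continuous_on has_derivative_continuous[OF a] has_derivative_continuous[OF h])
  have "continuous_on S (\<lambda>x. frechet_derivative (\<lambda>x. \<alpha> x *\<^sub>R h x) (at x) v)" for v
  proof -
    have "continuous_on S (\<lambda>x. \<alpha> x *\<^sub>R frechet_derivative h (at x) v + frechet_derivative \<alpha> (at x) v *\<^sub>R h x)"
      using assms ca by (intro continuous_on_add continuous_on_scaleR) auto
    then show ?thesis
      by (rule continuous_on_eq) (simp add: frechet_derivative_at[OF d, symmetric])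
  qed
  then show ?thesis using d by (auto intro: differentiableI)
qed

lemma Ck_on_1_add:
  assumes "Ck_on 1 S f" "Ck_on 1 S h"
  shows "Ck_on 1 S (\<lambda>x. f x + h x)"
proof -
  have d: "((\<lambda>x. f x + h x) has_derivative (\<lambda>v. frechet_derivative f (at x) v + frechet_derivative h (at x) v)) (at x)"
    if "x \<in> S" for x
    using assms that by (intro has_derivative_add) (auto simp: frechet_derivative_works)
  have "continuous_on S (\<lambda>x. frechet_derivative (\<lambda>x. f x + h x) (at x) v)" for v
  proof -
    have "continuous_on S (\<lambda>x. frechet_derivative f (at x) v + frechet_derivative h (at x) v)"
      using assms by (intro continuous_on_add) auto
    then show ?thesis
      by (rule continuous_on_eq) (simp add: frechet_derivative_at[OF d, symmetric])
  qed
  then show ?thesis using d by (auto intro: differentiableI)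
qed

lemma Ck_on_1_sum:
  assumes "finite B" "\<And>b. b \<in> B \<Longrightarrow> Ck_on 1 S (f b)"
  shows "Ck_on 1 S (\<lambda>x. \<Sum>b\<in>B. f b x)"
  using assms
proof (induction B rule: finite_induct)
  case empty
  show ?case by (auto simp: frechet_derivative_const)
next
  case (insert b B)
  then show ?case using Ck_on_1_add[of S "f b" "\<lambda>x. \<Sum>b\<in>B. f b x"] by simp
qed

text \<open>To be applied to derivatives of the multiplication, with the second argument fixed at
  the unit.\<close>

lemma Ck_on_1_slice:
  fixes w :: "'a::real_normed_vector \<times> 'b::real_normed_vector \<Rightarrow> 'c::real_normed_vector"
  assumes "Ck_on 1 D w" "\<And>x. x \<in> S \<Longrightarrow> (x, y) \<in> D"
  shows "Ck_on 1 S (\<lambda>x. w (x, y))"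
proof -
  have d: "((\<lambda>x. w (x, y)) has_derivative (\<lambda>v. frechet_derivative w (at (x, y)) (v, 0))) (at x)" if "x \<in> S" for x
  proof -
    have 1: "((\<lambda>x. (x, y)) has_derivative (\<lambda>v. (v, 0))) (at x)" by (auto intro!: derivative_eq_intros)
    have "(w has_derivative frechet_derivative w (at (x, y))) (at (x, y))"
      using assms that by (auto simp: frechet_derivative_works)
    from has_derivative_compose[OF 1 this] show ?thesis .
  qed
  have "continuous_on S (\<lambda>x. frechet_derivative (\<lambda>x. w (x, y)) (at x) v)" for v
  proof -
    have "continuous_on D (\<lambda>p. frechet_derivative w (at p) (v, 0))" using assms(1) by simp
    then have "continuous_on S (\<lambda>x. frechet_derivative w (at (x, y)) (v, 0))"
      by (rule continuous_on_compose2[of D _ S "\<lambda>x. (x, y)"]) (use assms(2) in \<open>auto intro!: continuous_intros\<close>)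
    then show ?thesis
      by (rule continuous_on_eq) (simp add: frechet_derivative_at[OF d, symmetric])
  qed
  then show ?thesis using d by (auto intro: differentiableI)
qed

lemma Ck_map_le:
  assumes "k \<le> l" "Ck_map A l f"
  shows "Ck_map A k f"
  unfolding Ck_map_def
proof
  fix c assume "c \<in> A"
  with assms(2) have "Ck_on l (snd c ` fst c) (f \<circ> chart_inv c)" unfolding Ck_map_def by blast
  then show "Ck_on k (snd c ` fst c) (f \<circ> chart_inv c)" by (rule Ck_on_le[OF assms(1)])
qed

section \<open>Left-invariant derivatives in charts\<close>

context lie
begin

lemma mult_dom_unit: "c \<in> A \<Longrightarrow> x \<in> snd c ` fst c \<Longrightarrow> (x, y0) \<in> mult_dom c uc c"
  using y0 chart(5) by (auto simp: mult_dom_def)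

lemma mult_map_in_chart: "p \<in> mult_dom a b c \<Longrightarrow> mult_map a b c p \<in> snd c ` fst c"
  by (auto simp: mult_dom_def mult_map_def)

lemma mult_map_unit: "c \<in> A \<Longrightarrow> x \<in> snd c ` fst c \<Longrightarrow> mult_map c uc c (x, y0) = x"
  using y0 chart(4) by (simp add: mult_map_def)

lemma C1_chart_derivative:
  assumes "Ck_map A 1 f" "c \<in> A" "x \<in> snd c ` fst c"
  shows "((f \<circ> chart_inv c) has_derivative frechet_derivative (f \<circ> chart_inv c) (at x)) (at x)"
proof -
  have "Ck_on (Suc 0) (snd c ` fst c) (f \<circ> chart_inv c)"
    using assms(1,2) unfolding Ck_map_def One_nat_def by blast
  then have "\<forall>x\<in>snd c ` fst c. (f \<circ> chart_inv c) differentiable at x"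
    unfolding Ck_on.simps by blast
  with assms(3) have "(f \<circ> chart_inv c) differentiable at x" by blast
  then show ?thesis by (simp only: frechet_derivative_works)
qed

text \<open>The chain-rule expression for the derivative of \<open>f\<close> along the second factor
  of a product. At \<open>y0\<close> it is \<open>lvf\<close>; its values at nearby points enter the
  mean value estimate along \<open>unit_curve\<close>.\<close>

definition deriv_right :: "('g \<Rightarrow> 'b::real_normed_vector) \<Rightarrow> ('g, 'e) chart \<Rightarrow> 'e \<times> 'e \<Rightarrow> 'e \<Rightarrow> 'b" where
  "deriv_right f c p \<xi> = frechet_derivative (f \<circ> chart_inv c) (at (mult_map c uc c p))
     (frechet_derivative (mult_map c uc c) (at p) (0, \<xi>))"

lemma C1_has_derivative_right:
  assumes f: "Ck_map A 1 f" and c: "c \<in> A" and p: "(x, y) \<in> mult_dom c uc c"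
  shows "((\<lambda>y. f (chart_inv c x \<otimes> ucinv y)) has_derivative deriv_right f c (x, y)) (at y)"
proof -
  have "((f \<circ> chart_inv c) has_derivative frechet_derivative (f \<circ> chart_inv c) (at (mult_map c uc c (x, y)))) (at (mult_map c uc c (x, y)))"
    by (rule C1_chart_derivative[OF f c mult_map_in_chart[OF p]])
  from has_derivative_compose[OF mult_map_has_derivative_right[OF c unit_chart(1) c p] this]
  have 1: "((\<lambda>y. (f \<circ> chart_inv c) (mult_map c uc c (x, y))) has_derivative deriv_right f c (x, y)) (at y)"
    unfolding deriv_right_def[abs_def] .
  show ?thesis
  proof (rule has_derivative_transform_within_open[OF 1])
    show "open ((\<lambda>y. (x, y)) -` mult_dom c uc c)"
      using open_mult_dom[OF c unit_chart(1) c] by (intro open_vimage continuous_intros)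
    show "y \<in> (\<lambda>y. (x, y)) -` mult_dom c uc c" using p by simp
    fix z assume "z \<in> (\<lambda>y. (x, y)) -` mult_dom c uc c"
    then show "(f \<circ> chart_inv c) (mult_map c uc c (x, z)) = f (chart_inv c x \<otimes> ucinv z)"
      by (auto simp: mult_map_def mult_dom_def chart(3)[OF c])
  qed
qed

lemma lvf_chart:
  assumes "Ck_map A 1 f" "c \<in> A" "x \<in> snd c ` fst c"
  shows "lvf G A \<xi> f (chart_inv c x) = deriv_right f c (x, y0) \<xi>"
  unfolding lvf_def
  by (simp add: frechet_derivative_at[OF C1_has_derivative_right[OF assms(1,2) mult_dom_unit[OF assms(2,3)]], symmetric])

text \<open>\<open>Ck_on\<close> controls derivatives of \<open>f\<close> in fixed directions only,
  whereas here the direction varies with \<open>p\<close>. Expanding the direction in a basis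
  separates the two dependences.\<close>

lemma deriv_right_basis:
  assumes B: "finite B" "independent B" "span B = (UNIV :: 'e set)"
    and f: "Ck_map A 1 f" and c: "c \<in> A" and p: "p \<in> mult_dom c uc c"
  shows "deriv_right f c p \<xi> = (\<Sum>b\<in>B. representation B (frechet_derivative (mult_map c uc c) (at p) (0, \<xi>)) b *\<^sub>R
     frechet_derivative (f \<circ> chart_inv c) (at (mult_map c uc c p)) b)"
proof -
  have "linear (frechet_derivative (f \<circ> chart_inv c) (at (mult_map c uc c p)))"
    by (rule has_derivative_linear[OF C1_chart_derivative[OF f c mult_map_in_chart[OF p]]])
  note lin = linear_sum[OF this] linear_scale[OF this]
  have "deriv_right f c p \<xi> = frechet_derivative (f \<circ> chart_inv c) (at (mult_map c uc c p))
     (\<Sum>b\<in>B. representation B (frechet_derivative (mult_map c uc c) (at p) (0, \<xi>)) b *\<^sub>R b)"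
    unfolding deriv_right_def using B by (simp add: sum_representation_eq)
  then show ?thesis by (simp add: lin)
qed

lemma mult_map_derivative_Ck:
  assumes "c \<in> A"
  shows "Ck_on k (mult_dom c uc c) (\<lambda>p. frechet_derivative (mult_map c uc c) (at p) v)"
proof -
  have "Ck_on (Suc k) (mult_dom c uc c) (mult_map c uc c)"
    using mult_map_smooth[OF assms unit_chart(1) assms] unfolding smooth_on_def by blast
  then show ?thesis unfolding Ck_on.simps by blast
qed

lemma deriv_right_continuous:
  assumes f: "Ck_map A 1 f" and c: "c \<in> A"
  shows "continuous_on (mult_dom c uc c) (\<lambda>p. deriv_right f c p \<xi>)"
proof -
  obtain B :: "'e set" where B: "finite B" "independent B" "span B = UNIV"
    using fin_dim_basis[OF fin_dim_model] .
  have "Ck_on 0 (mult_dom c uc c) (mult_map c uc c)"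
    using mult_map_smooth[OF c unit_chart(1) c] unfolding smooth_on_def by blast
  then have mm: "continuous_on (mult_dom c uc c) (mult_map c uc c)" by simp
  have "continuous_on (mult_dom c uc c) (\<lambda>p. \<Sum>b\<in>B. representation B (frechet_derivative (mult_map c uc c) (at p) (0, \<xi>)) b *\<^sub>R
     frechet_derivative (f \<circ> chart_inv c) (at (mult_map c uc c p)) b)"
  proof (intro continuous_on_sum continuous_on_scaleR)
    fix b assume b: "b \<in> B"
    show "continuous_on (mult_dom c uc c) (\<lambda>p. representation B (frechet_derivative (mult_map c uc c) (at p) (0, \<xi>)) b)"
      using mult_map_derivative_Ck[OF c, of 0 "(0, \<xi>)"]
      by (intro bounded_linear.continuous_on[OF representation_bounded_linear[OF B(2,3) fin_dim_model]]) simp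
    have "continuous_on (snd c ` fst c) (\<lambda>x. frechet_derivative (f \<circ> chart_inv c) (at x) b)"
      using f c by (simp add: Ck_map_def)
    then show "continuous_on (mult_dom c uc c) (\<lambda>p. frechet_derivative (f \<circ> chart_inv c) (at (mult_map c uc c p)) b)"
      by (rule continuous_on_compose2[OF _ mm]) (use mult_map_in_chart in blast)
  qed
  then show ?thesis
    by (rule continuous_on_eq) (simp add: deriv_right_basis[OF B f c])
qed

text \<open>The expansion of \<open>deriv_right_basis\<close> at \<open>(x, y0)\<close>, where the
  base point is \<open>x\<close> itself: coefficients smooth in \<open>x\<close> times first partial
  derivatives of \<open>f\<close>.\<close>

lemma lvf_C1:
  fixes f :: "'g \<Rightarrow> 'b::real_normed_vector"
  assumes f: "Ck_map A 2 f"
  shows "Ck_map A 1 (lvf G A \<xi> f)"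
  unfolding Ck_map_def
proof
  fix c assume c: "c \<in> A"
  note opn = chart(2)[OF c]
  obtain B :: "'e set" where B: "finite B" "independent B" "span B = UNIV"
    using fin_dim_basis[OF fin_dim_model] .
  have f2: "Ck_on (Suc 1) (snd c ` fst c) (f \<circ> chart_inv c)"
    using f c by (simp add: Ck_map_def numeral_2_eq_2)
  have f1: "Ck_map A 1 f" by (rule Ck_map_le[OF _ f]) simp
  have "Ck_on 1 (snd c ` fst c) (\<lambda>x. \<Sum>b\<in>B. representation B (frechet_derivative (mult_map c uc c) (at (x, y0)) (0, \<xi>)) b *\<^sub>R
     frechet_derivative (f \<circ> chart_inv c) (at x) b)"
  proof (intro Ck_on_1_sum B(1) Ck_on_1_scaleR opn)
    fix b
    have "Ck_on 1 (snd c ` fst c) (\<lambda>x. frechet_derivative (mult_map c uc c) (at (x, y0)) (0, \<xi>))"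
      by (rule Ck_on_1_slice[OF mult_map_derivative_Ck[OF c] mult_dom_unit[OF c]])
    from Ck_on_affine[OF opn representation_bounded_linear[OF B(2,3) fin_dim_model, of b] this, of 0]
    show "Ck_on 1 (snd c ` fst c) (\<lambda>x. representation B (frechet_derivative (mult_map c uc c) (at (x, y0)) (0, \<xi>)) b)"
      by simp
    show "Ck_on 1 (snd c ` fst c) (\<lambda>x. frechet_derivative (f \<circ> chart_inv c) (at x) b)"
      using f2 by (simp only: Ck_on.simps)
  qed
  then show "Ck_on 1 (snd c ` fst c) (lvf G A \<xi> f \<circ> chart_inv c)"
  proof (rule Ck_on_cong[OF opn, rotated])
    fix x assume x: "x \<in> snd c ` fst c"
    show "(\<Sum>b\<in>B. representation B (frechet_derivative (mult_map c uc c) (at (x, y0)) (0, \<xi>)) b *\<^sub>R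
     frechet_derivative (f \<circ> chart_inv c) (at x) b) = (lvf G A \<xi> f \<circ> chart_inv c) x"
      using deriv_right_basis[OF B f1 c mult_dom_unit[OF c x]] lvf_chart[OF f1 c x]
      by (simp add: mult_map_unit[OF c x])
  qed
qed

text \<open>A line in the unit chart, not a one-parameter subgroup: only its velocity at 0 matters.
  Once the line has left the chart, \<open>chart_inv\<close> returns an unspecified point, so
  statements are restricted to small \<open>s\<close>.\<close>

definition unit_curve :: "'e \<Rightarrow> real \<Rightarrow> 'g" where
  "unit_curve \<xi> s = ucinv (y0 + s *\<^sub>R \<xi>)"

lemma unit_curve_0 [simp]: "unit_curve \<xi> 0 = \<one>"
  using y0 by (simp add: unit_curve_def)

lemma C1_derivative_along_curve:
  assumes f: "Ck_map A 1 f"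
  shows "((\<lambda>s. f (g \<otimes> unit_curve \<xi> s)) has_vector_derivative lvf G A \<xi> f g) (at 0)"
proof -
  obtain c where c: "c \<in> A" "g \<in> fst c" using chart_at by blast
  define x where "x = snd c g"
  have x: "x \<in> snd c ` fst c" "chart_inv c x = g" using c chart(3) by (auto simp: x_def)
  have "((\<lambda>y. f (g \<otimes> ucinv y)) has_derivative deriv_right f c (x, y0)) (at (y0 + 0 *\<^sub>R \<xi>))"
    using C1_has_derivative_right[OF f c(1) mult_dom_unit[OF c(1) x(1)]] x(2) by simp
  moreover have "((\<lambda>s. y0 + s *\<^sub>R \<xi>) has_derivative (\<lambda>r. r *\<^sub>R \<xi>)) (at 0)"
    by (auto intro!: derivative_eq_intros)
  ultimately have d: "((\<lambda>s. f (g \<otimes> unit_curve \<xi> s)) has_derivative (\<lambda>r. deriv_right f c (x, y0) (r *\<^sub>R \<xi>))) (at 0)"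
    unfolding unit_curve_def by (rule has_derivative_compose[rotated])
  have "linear (deriv_right f c (x, y0))"
    by (rule has_derivative_linear[OF C1_has_derivative_right[OF f c(1) mult_dom_unit[OF c(1) x(1)]]])
  then have "deriv_right f c (x, y0) (r *\<^sub>R \<xi>) = r *\<^sub>R lvf G A \<xi> f g" for r
    using lvf_chart[OF f c(1) x(1)] x(2) by (simp add: linear_scale)
  with d show ?thesis by (simp add: has_vector_derivative_def)
qed

text \<open>\<open>deriv_right\<close> is jointly continuous, hence bounded near the given point and
  the unit; the mean value inequality in \<open>s\<close> is then uniform in nearby
  \<open>g\<close>.\<close>

lemma C1_locally_Lipschitz_along_curve:
  assumes f: "Ck_map A 1 f"
  shows "\<exists>N \<delta> L. open N \<and> g0 \<in> N \<and> \<delta> > 0 \<and> L \<ge> 0 \<and>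
    (\<forall>g\<in>N. \<forall>s. \<bar>s\<bar> < \<delta> \<longrightarrow> norm (f (g \<otimes> unit_curve \<xi> s) - f g) \<le> L * \<bar>s\<bar>)"
proof -
  obtain c where c: "c \<in> A" "g0 \<in> fst c" using chart_at by blast
  define x0 where "x0 = snd c g0"
  define D where "D = mult_dom c uc c"
  define K where "K p = deriv_right f c p \<xi>" for p
  have p0: "(x0, y0) \<in> D" unfolding D_def x0_def using c by (intro mult_dom_unit) auto
  have D: "open D" unfolding D_def by (intro open_mult_dom c unit_chart)
  obtain r1 where r1: "r1 > 0" "ball (x0, y0) r1 \<subseteq> D" using D p0 open_contains_ball by blast
  have "continuous (at (x0, y0)) K"
    using deriv_right_continuous[OF f c(1), of \<xi>] continuous_on_eq_continuous_at[OF D, of K] p0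
    unfolding D_def K_def[abs_def] by simp
  from this[unfolded continuous_at_eps_delta, rule_format, of 1]
  obtain r2 where r2: "r2 > 0" "\<And>p. dist p (x0, y0) < r2 \<Longrightarrow> dist (K p) (K (x0, y0)) < 1"
    by auto
  define r where "r = min r1 r2"
  define L where "L = norm (K (x0, y0)) + 1"
  have r: "r > 0" using r1 r2 by (simp add: r_def)
  have KL: "norm (K p) \<le> L" and pD: "p \<in> D" if "dist p (x0, y0) < r" for p
  proof -
    have "norm (K p) \<le> norm (K p - K (x0, y0)) + norm (K (x0, y0))" by (rule norm_triangle_sub[of "K p" "K (x0, y0)", THEN order_trans]) simp
    then show "norm (K p) \<le> L" using r2(2)[of p] that by (simp add: r_def L_def dist_norm)
    show "p \<in> D" using that r1 by (auto simp: r_def dist_commute)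
  qed
  define N where "N = fst c \<inter> snd c -` ball x0 (r / 2)"
  have "open (snd c -` ball x0 (r / 2) \<inter> fst c)"
    using continuous_on_open_vimage[OF chart(1)[OF c(1)], of "snd c"] chart(6)[OF c(1)] by simp
  then have N: "open N" by (simp add: N_def Int_commute)
  have g0: "g0 \<in> N" using c r by (simp add: N_def x0_def)
  \<comment> \<open>Keeps the curve within \<open>r / 2\<close> of \<open>y0\<close>; the added 1
    admits the zero direction.\<close>
  define \<delta> where "\<delta> = r / (2 * (norm \<xi> + 1))"
  have \<delta>: "\<delta> > 0" using r by (simp add: \<delta>_def add_nonneg_pos)
  have "norm (f (g \<otimes> unit_curve \<xi> s) - f g) \<le> L * \<bar>s\<bar>" if g: "g \<in> N" and s: "\<bar>s\<bar> < \<delta>" for g s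
  proof -
    define x where "x = snd c g"
    have x: "dist x x0 < r / 2" "chart_inv c x = g" using g c chart(3) by (auto simp: N_def x_def dist_commute)
    have near: "dist (x, y0 + u *\<^sub>R \<xi>) (x0, y0) < r" if u: "u \<in> {-\<bar>s\<bar>..\<bar>s\<bar>}" for u
    proof -
      have "\<bar>u\<bar> * norm \<xi> \<le> \<delta> * (norm \<xi> + 1)" using u s \<delta> by (intro mult_mono) auto
      also have "\<dots> = r / 2"
      proof -
        have "n \<noteq> 0 \<Longrightarrow> r / (2 * n) * n = r / 2" for n :: real by simp
        moreover have "norm \<xi> + 1 \<noteq> 0" using norm_ge_zero[of \<xi>] by linarith
        ultimately show ?thesis unfolding \<delta>_def by blast
      qed
      finally have 1: "dist (y0 + u *\<^sub>R \<xi>) y0 \<le> r / 2" by (simp add: dist_norm)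
      have "dist (x, y0 + u *\<^sub>R \<xi>) (x0, y0) \<le> dist x x0 + dist (y0 + u *\<^sub>R \<xi>) y0"
        unfolding dist_Pair_Pair by (rule sqrt_sum_squares_le_sum) auto
      then show ?thesis using x(1) 1 by linarith
    qed
    have der: "((\<lambda>u. f (g \<otimes> unit_curve \<xi> u)) has_derivative (\<lambda>h. h *\<^sub>R K (x, y0 + u *\<^sub>R \<xi>))) (at u within {-\<bar>s\<bar>..\<bar>s\<bar>})"
      if u: "u \<in> {-\<bar>s\<bar>..\<bar>s\<bar>}" for u
    proof -
      have p: "(x, y0 + u *\<^sub>R \<xi>) \<in> mult_dom c uc c" using pD[OF near[OF u]] by (simp add: D_def)
      note d = C1_has_derivative_right[OF f c(1) p]
      have "((\<lambda>s. y0 + s *\<^sub>R \<xi>) has_derivative (\<lambda>r. r *\<^sub>R \<xi>)) (at u within {-\<bar>s\<bar>..\<bar>s\<bar>})"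
        by (auto intro!: derivative_eq_intros)
      from has_derivative_compose[OF this d]
      have "((\<lambda>u. f (g \<otimes> unit_curve \<xi> u)) has_derivative (\<lambda>h. deriv_right f c (x, y0 + u *\<^sub>R \<xi>) (h *\<^sub>R \<xi>))) (at u within {-\<bar>s\<bar>..\<bar>s\<bar>})"
        unfolding unit_curve_def x(2) .
      then show ?thesis
        using linear_scale[OF has_derivative_linear[OF d]] by (simp add: K_def)
    qed
    have "norm (f (g \<otimes> unit_curve \<xi> s) - f (g \<otimes> unit_curve \<xi> 0)) \<le> L * norm (s - 0)"
    proof (rule differentiable_bound[OF _ der])
      fix u assume u: "u \<in> {-\<bar>s\<bar>..\<bar>s\<bar>}"
      show "onorm (\<lambda>h. h *\<^sub>R K (x, y0 + u *\<^sub>R \<xi>)) \<le> L"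
      proof (rule onorm_le)
        fix h :: real
        show "norm (h *\<^sub>R K (x, y0 + u *\<^sub>R \<xi>)) \<le> L * norm h"
          using mult_right_mono[OF KL[OF near[OF u]], of "\<bar>h\<bar>"] by (simp add: mult.commute)
      qed
    qed auto
    then show ?thesis by simp
  qed
  moreover have "L \<ge> 0" by (simp add: L_def)
  ultimately show ?thesis using N g0 \<delta> by blast
qed

text \<open>A finite subcover makes the local constants global. The result dominates difference
  quotients under the Haar integral.\<close>

lemma C1_Lipschitz_along_curve:
  assumes f: "Ck_map A 1 f" and cpt: "compact (UNIV :: 'g set)"
  obtains \<delta> L where "\<delta> > 0" "L \<ge> 0" "\<And>g s. \<bar>s\<bar> < \<delta> \<Longrightarrow> norm (f (g \<otimes> unit_curve \<xi> s) - f g) \<le> L * \<bar>s\<bar>"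
proof -
  define Q where "Q g0 N \<delta> L \<longleftrightarrow> open N \<and> g0 \<in> N \<and> \<delta> > 0 \<and> L \<ge> 0 \<and>
    (\<forall>g\<in>N. \<forall>s. \<bar>s\<bar> < \<delta> \<longrightarrow> norm (f (g \<otimes> unit_curve \<xi> s) - f g) \<le> L * \<bar>s\<bar>)" for g0 N \<delta> L
  have "\<forall>g0. \<exists>N \<delta> L. Q g0 N \<delta> L" using C1_locally_Lipschitz_along_curve[OF f] unfolding Q_def by blast
  from choice[OF this] obtain N where "\<forall>g0. \<exists>\<delta> L. Q g0 (N g0) \<delta> L" by blast
  from choice[OF this] obtain \<delta> where "\<forall>g0. \<exists>L. Q g0 (N g0) (\<delta> g0) L" by blast
  from choice[OF this] obtain L where "\<forall>g0. Q g0 (N g0) (\<delta> g0) (L g0)" by blast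
  then have N: "\<And>g. open (N g)" "\<And>g. g \<in> N g" "\<And>g. \<delta> g > 0" "\<And>g. L g \<ge> 0"
    "\<And>g0 g s. g \<in> N g0 \<Longrightarrow> \<bar>s\<bar> < \<delta> g0 \<Longrightarrow> norm (f (g \<otimes> unit_curve \<xi> s) - f g) \<le> L g0 * \<bar>s\<bar>"
    by (auto simp: Q_def)
  have "UNIV \<subseteq> (\<Union>g\<in>UNIV. N g)" using N(2) by blast
  then obtain J where J: "finite J" "UNIV \<subseteq> (\<Union>g\<in>J. N g)"
    by (rule compactE_image[OF cpt N(1)])
  have ne: "J \<noteq> {}" using J(2) by auto
  show thesis
  proof (rule that[of "Min (\<delta> ` J)" "Max (L ` J)"])
    show "Min (\<delta> ` J) > 0" using J(1) ne N(3) by simp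
    obtain j where "j \<in> J" using ne by blast
    then have "L j \<le> Max (L ` J)" using J(1) by simp
    then show "Max (L ` J) \<ge> 0" using N(4)[of j] by linarith
    fix g s assume s: "\<bar>s\<bar> < Min (\<delta> ` J)"
    obtain j where j: "j \<in> J" "g \<in> N j" using J(2) by blast
    have "\<bar>s\<bar> < \<delta> j" using s J(1) j(1) ne by auto
    then have "norm (f (g \<otimes> unit_curve \<xi> s) - f g) \<le> L j * \<bar>s\<bar>" using N(5) j by blast
    also have "\<dots> \<le> Max (L ` J) * \<bar>s\<bar>" using J(1) j by (intro mult_right_mono) auto
    finally show "norm (f (g \<otimes> unit_curve \<xi> s) - f g) \<le> Max (L ` J) * \<bar>s\<bar>" .
  qed
qed

end

section \<open>Haar measure\<close>

locale compact_lie = lie G A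
  for G :: "'g::{second_countable_topology,t2_space} monoid" (structure)
    and A :: "('g, 'e::real_normed_vector) chart set" +
  fixes \<mu> :: "'g measure"
  assumes cpt: "compact (UNIV :: 'g set)" and haar: "normalized_haar G \<mu>"
begin

sublocale haar: prob_space \<mu>
  using haar by (simp add: normalized_haar_def)

lemma sets_haar [measurable_cong, simp]: "sets \<mu> = sets borel"
  using haar by (simp add: normalized_haar_def)

lemma space_haar [simp]: "space \<mu> = UNIV"
  using sets_eq_imp_space_eq[OF sets_haar] by simp

lemma haar_UNIV [simp]: "measure \<mu> UNIV = 1"
  using haar.prob_space by simp

lemma continuous_measurable: "continuous_on UNIV f \<Longrightarrow> f \<in> borel_measurable \<mu>"
  for f :: "'g \<Rightarrow> 'b::topological_space"
  using borel_measurable_continuous_onI[of f] by (simp cong: measurable_cong_sets)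

lemma continuous_norm_bounded:
  fixes f :: "'g \<Rightarrow> 'b::real_normed_vector"
  assumes "continuous_on UNIV f"
  obtains K where "\<And>g. norm (f g) \<le> K"
  using compact_imp_bounded[OF compact_continuous_image[OF assms cpt]] by (auto simp: bounded_iff)

lemma continuous_integrable:
  fixes f :: "'g \<Rightarrow> 'b::{banach,second_countable_topology}"
  assumes "continuous_on UNIV f"
  shows "integrable \<mu> f"
proof -
  obtain K where "\<And>g. norm (f g) \<le> K" using continuous_norm_bounded[OF assms] by blast
  then show ?thesis
    by (intro haar.integrable_const_bound[of _ K] continuous_measurable assms) auto
qed

lemma left_invariant:
  fixes f :: "'g \<Rightarrow> 'b::{banach,second_countable_topology}"
  assumes "continuous_on UNIV f"
  shows "(\<integral>x. f (g \<otimes> x) \<partial>\<mu>) = (\<integral>x. f x \<partial>\<mu>)"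
proof -
  have "(\<lambda>x. g \<otimes> x) \<in> measurable \<mu> borel"
    by (intro continuous_measurable continuous_intros)
  then have "(\<integral>x. f x \<partial>distr \<mu> borel (\<lambda>x. g \<otimes> x)) = (\<integral>x. f (g \<otimes> x) \<partial>\<mu>)"
    using assms by (intro integral_distr borel_measurable_continuous_onI)
  moreover have "distr \<mu> borel (\<lambda>x. g \<otimes> x) = \<mu>"
    using haar by (simp add: normalized_haar_def)
  ultimately show ?thesis by simp
qed

text \<open>Evaluate the integral of \<^term>\<open>f (inv a \<otimes> b)\<close> over both variables in the two possible orders.\<close>
lemma inverse_invariant:
  fixes f :: "'g \<Rightarrow> 'b::{banach,second_countable_topology}"
  assumes f: "continuous_on UNIV f"
  shows "(\<integral>x. f (inv x) \<partial>\<mu>) = (\<integral>x. f x \<partial>\<mu>)"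
proof -
  interpret P: pair_prob_space \<mu> \<mu> ..
  obtain K where K: "\<And>g. norm (f g) \<le> K" using continuous_norm_bounded[OF f] by blast
  have "continuous_on UNIV (\<lambda>p. f (inv (fst p) \<otimes> snd p))"
    by (rule continuous_on_compose2[OF f])
       (auto intro!: continuous_on_mult continuous_on_inv continuous_on_fst continuous_on_snd continuous_on_id)
  then have "(\<lambda>p. f (inv (fst p) \<otimes> snd p)) \<in> borel_measurable borel"
    by (rule borel_measurable_continuous_onI)
  \<comment> \<open>By second countability the product sigma-algebra is the Borel one, so joint
    continuity gives joint measurability.\<close>
  moreover have "sets (\<mu> \<Otimes>\<^sub>M \<mu>) = sets (borel :: ('g \<times> 'g) measure)"
    unfolding borel_prod[symmetric] by (rule sets_pair_measure_cong) simp_all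
  ultimately have "(\<lambda>p. f (inv (fst p) \<otimes> snd p)) \<in> borel_measurable (\<mu> \<Otimes>\<^sub>M \<mu>)"
    by (simp cong: measurable_cong_sets)
  then have int: "integrable (\<mu> \<Otimes>\<^sub>M \<mu>) (\<lambda>(a, b). f (inv a \<otimes> b))"
    unfolding case_prod_beta by (rule P.integrable_const_bound[of _ K, rotated]) (use K in auto)
  have "(\<integral>b. f b \<partial>\<mu>) = (\<integral>a. (\<integral>b. f (inv a \<otimes> b) \<partial>\<mu>) \<partial>\<mu>)"
    by (simp add: left_invariant[OF f] haar.prob_space)
  also have "\<dots> = (\<integral>b. (\<integral>a. f (inv a \<otimes> b) \<partial>\<mu>) \<partial>\<mu>)"
    using P.Fubini_integral[OF int] by simp
  also have "\<dots> = (\<integral>b. (\<integral>a. f (inv a) \<partial>\<mu>) \<partial>\<mu>)"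
  proof -
    have fi: "continuous_on UNIV (\<lambda>x. f (inv x))"
      by (rule continuous_on_compose2[OF f continuous_inv]) simp
    \<comment> \<open>\<open>inv a \<otimes> b\<close> is the inverse of
      \<open>inv b \<otimes> a\<close>, so left invariance in \<open>a\<close> removes
      \<open>b\<close>.\<close>
    have "(\<integral>a. f (inv a \<otimes> b) \<partial>\<mu>) = (\<integral>a. f (inv a) \<partial>\<mu>)" for b
      using left_invariant[OF fi, of "inv b"] by (simp add: inv_mult_group)
    then show ?thesis by simp
  qed
  finally show ?thesis by (simp add: haar.prob_space)
qed

text \<open>Inversion preserves the integral and exchanges right with left translations.\<close>

lemma right_invariant:
  fixes f :: "'g \<Rightarrow> 'b::{banach,second_countable_topology}"
  assumes f: "continuous_on UNIV f"
  shows "(\<integral>x. f (x \<otimes> h) \<partial>\<mu>) = (\<integral>x. f x \<partial>\<mu>)"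
proof -
  have 1: "continuous_on UNIV (\<lambda>x. f (x \<otimes> h))"
    by (rule continuous_on_compose2[OF f]) (auto intro!: continuous_on_mult)
  have 2: "continuous_on UNIV (\<lambda>x. f (inv x))"
    by (rule continuous_on_compose2[OF f continuous_inv]) simp
  have "(\<integral>x. f (x \<otimes> h) \<partial>\<mu>) = (\<integral>x. f (inv x \<otimes> h) \<partial>\<mu>)"
    by (rule inverse_invariant[OF 1, symmetric])
  also have "\<dots> = (\<integral>x. f (inv (inv h \<otimes> x)) \<partial>\<mu>)" by (simp add: inv_mult_group)
  also have "\<dots> = (\<integral>x. f (inv x) \<partial>\<mu>)" by (rule left_invariant[OF 2])
  also have "\<dots> = (\<integral>x. f x \<partial>\<mu>)" by (rule inverse_invariant[OF f])
  finally show ?thesis .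
qed

end

section \<open>Representations and complete reducibility\<close>

locale compact_rep = compact_lie G A \<mu>
  for G :: "'g::{second_countable_topology,t2_space} monoid" (structure)
    and A :: "('g, 'e::real_normed_vector) chart set" and \<mu> +
  fixes scal :: "'k::{real_normed_field,euclidean_space} \<Rightarrow> 'v::{banach,second_countable_topology} \<Rightarrow> 'v"
    and \<rho> :: "'g \<Rightarrow> 'v \<Rightarrow> 'v"
  assumes rep: "fd_representation G A scal \<rho>"
begin

sublocale vs: vector_space scal
  using rep by (simp add: fd_representation_def)

lemma scal_of_real: "scal (of_real r) v = r *\<^sub>R v"
  using rep by (simp add: fd_representation_def)

lemma fin_dim_scal: "\<exists>B. finite B \<and> vs.span B = UNIV"
  using rep by (simp add: fd_representation_def)

lemma \<rho>_linear: "Vector_Spaces.linear scal scal (\<rho> g)"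
  using rep by (simp add: fd_representation_def)

lemma \<rho>_one [simp]: "\<rho> \<one> v = v" and \<rho>_mult: "\<rho> (g \<otimes> h) v = \<rho> g (\<rho> h v)"
  using rep by (simp_all add: fd_representation_def)

lemma \<rho>_smooth: "smooth_map A (\<lambda>g. \<rho> g v)"
  using rep by (simp add: fd_representation_def)

lemma \<rho>_inv [simp]: "\<rho> (inv g) (\<rho> g v) = v" "\<rho> g (\<rho> (inv g) v) = v"
  by (simp_all add: \<rho>_mult[symmetric])

text \<open>Linearity over the scalar field of the representation in bare equations, convenient for
  rewriting; \<open>klin_iff\<close> links it to the general notion.\<close>

definition klin :: "('v \<Rightarrow> 'v) \<Rightarrow> bool" where
  "klin L \<longleftrightarrow> (\<forall>x y. L (x + y) = L x + L y) \<and> (\<forall>c x. L (scal c x) = scal c (L x))"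

lemma klin_iff: "klin L \<longleftrightarrow> Vector_Spaces.linear scal scal L"
  unfolding klin_def linear_iff_module_hom module_hom_iff using vs.module_axioms by auto

lemma klinD: "klin L \<Longrightarrow> L (x + y) = L x + L y" "klin L \<Longrightarrow> L (scal c x) = scal c (L x)"
  by (auto simp: klin_def)

lemma klin_linear: "klin L \<Longrightarrow> linear L"
  using klinD(2)[of L "of_real r" for r] by (intro linearI) (simp_all add: klinD(1) scal_of_real)

lemma klin_\<rho>: "klin (\<rho> g)"
  using \<rho>_linear by (simp add: klin_iff)

lemma klin_comp: "klin L \<Longrightarrow> klin L' \<Longrightarrow> klin (\<lambda>x. L (L' x))"
  by (simp add: klin_def)

text \<open>Restriction of scalars: products of a real basis of the field with a spanning set over
  the field span over the reals.\<close>

lemma fin_dim_V: "fin_dim TYPE('v)"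
proof -
  obtain B where B: "finite B" "vs.span B = UNIV" using fin_dim_scal by blast
  define S where "S = (\<lambda>(k, b). scal k b) ` (Basis \<times> B)"
  have *: "scal c b \<in> span S" if "b \<in> B" for c b
  proof -
    have "scal c b = scal (\<Sum>k\<in>Basis. (c \<bullet> k) *\<^sub>R k) b" by (simp add: euclidean_representation)
    also have "\<dots> = (\<Sum>k\<in>Basis. scal ((c \<bullet> k) *\<^sub>R k) b)" by (rule vs.scale_sum_left)
    also have "\<dots> = (\<Sum>k\<in>Basis. (c \<bullet> k) *\<^sub>R scal k b)"
      by (simp only: scaleR_conv_of_real[where 'a='k] vs.scale_scale[symmetric] scal_of_real)
    also have "\<dots> \<in> span S"
      using that by (intro span_sum span_scale span_base) (auto simp: S_def)
    finally show ?thesis .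
  qed
  have "x \<in> span S" for x
  proof -
    have "x \<in> vs.span B" using B by simp
    then show ?thesis
    proof (induction rule: vs.span_induct_alt)
      case base show ?case by (rule span_zero)
    next
      case (step c b y) then show ?case using * by (intro span_add) auto
    qed
  qed
  moreover have "finite S" using B by (simp add: S_def)
  ultimately show ?thesis by (auto simp: fin_dim_def)
qed

lemma linear_bounded: "linear L \<Longrightarrow> bounded_linear L"
  for L :: "'v \<Rightarrow> 'b::real_normed_vector"
  by (rule linear_fin_dim_bounded[OF fin_dim_V])

lemma klin_bounded: "klin L \<Longrightarrow> bounded_linear L"
  by (intro linear_bounded klin_linear)

lemma linear_\<rho>: "linear (\<rho> g)" and bounded_linear_\<rho>: "bounded_linear (\<rho> g)"
  using klin_\<rho> klin_linear klin_bounded by blast+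

lemma linear_scal: "linear (scal c)"
  by (rule linearI) (simp_all add: vs.scale_right_distrib scal_of_real[symmetric] mult.commute)

lemma bounded_linear_scal: "bounded_linear (scal c)"
  by (rule linear_bounded[OF linear_scal])

lemma continuous_\<rho>: "continuous_on UNIV (\<lambda>g. \<rho> g v)"
  using \<rho>_smooth[of v] Ck_map_continuous[of 0] unfolding smooth_map_def by blast

text \<open>Joint continuity of the action follows from continuity of the orbits of finitely many
  basis vectors.\<close>

lemma continuous_on_\<rho>:
  assumes h: "continuous_on S h" and w: "continuous_on S w"
  shows "continuous_on S (\<lambda>x. \<rho> (h x) (w x))"
proof -
  obtain B :: "'v set" where B: "finite B" "independent B" "span B = UNIV"
    using fin_dim_basis[OF fin_dim_V] .
  have "continuous_on S (\<lambda>x. \<Sum>b\<in>B. representation B (w x) b *\<^sub>R \<rho> (h x) b)"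
  proof (intro continuous_on_sum continuous_on_scaleR)
    fix b
    show "continuous_on S (\<lambda>x. representation B (w x) b)"
      by (rule bounded_linear.continuous_on[OF representation_bounded_linear[OF B(2,3) fin_dim_V] w])
    show "continuous_on S (\<lambda>x. \<rho> (h x) b)"
      by (rule continuous_on_compose2[OF continuous_\<rho> h]) simp
  qed
  moreover have "\<rho> (h x) (w x) = (\<Sum>b\<in>B. representation B (w x) b *\<^sub>R \<rho> (h x) b)" for x
  proof -
    have "\<rho> (h x) (w x) = \<rho> (h x) (\<Sum>b\<in>B. representation B (w x) b *\<^sub>R b)"
      using B by (simp add: sum_representation_eq)
    then show ?thesis by (simp add: linear_sum[OF linear_\<rho>] linear_scale[OF linear_\<rho>])
  qed
  ultimately show ?thesis by simp
qed

lemma klin_integral: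
  assumes F: "\<And>v. continuous_on UNIV (\<lambda>g. F g v)" and lin: "\<And>g. klin (F g)"
  shows "klin (\<lambda>v. \<integral>g. F g v \<partial>\<mu>)"
  unfolding klin_def
proof (intro conjI allI)
  fix x y c
  note I = continuous_integrable[OF F]
  show "(\<integral>g. F g (x + y) \<partial>\<mu>) = (\<integral>g. F g x \<partial>\<mu>) + (\<integral>g. F g y \<partial>\<mu>)"
    using I by (simp add: klinD(1)[OF lin])
  show "(\<integral>g. F g (scal c x) \<partial>\<mu>) = scal c (\<integral>g. F g x \<partial>\<mu>)"
    using integral_bounded_linear[OF bounded_linear_scal I, of c x] by (simp add: klinD(2)[OF lin])
qed

definition equivariant :: "('v \<Rightarrow> 'v) \<Rightarrow> bool" where
  "equivariant L \<longleftrightarrow> klin L \<and> (\<forall>g x. L (\<rho> g x) = \<rho> g (L x))"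

text \<open>Maschke's averaging: integrate the conjugates of an arbitrary linear projection over the
  group.\<close>

lemma equivariant_projection:
  assumes U: "subrep scal \<rho> U"
  shows "\<exists>p. equivariant p \<and> (\<forall>x. p x \<in> U) \<and> (\<forall>x\<in>U. p x = x)"
proof -
  interpret vp: vector_space_pair scal scal by unfold_locales
  have sub: "vs.subspace U" and inv: "\<And>g x. x \<in> U \<Longrightarrow> \<rho> g x \<in> U" using U by (auto simp: subrep_def)
  have "Vector_Spaces.linear scal scal id" by (rule vs.linear_id)
  from vp.linear_exists_left_inverse_on[OF this sub] obtain p0 where
    p0: "p0 ` UNIV \<subseteq> U" "Vector_Spaces.linear scal scal p0" "\<forall>v\<in>U. p0 v = v" by auto
  have k0: "klin p0" using p0(2) by (simp add: klin_iff)
  define F where "F g x = \<rho> g (p0 (\<rho> (inv g) x))" for g x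
  define p where "p x = (\<integral>g. F g x \<partial>\<mu>)" for x
  have c: "continuous_on UNIV (\<lambda>g. F g x)" for x
    unfolding F_def
    by (intro continuous_on_\<rho> continuous_on_id bounded_linear.continuous_on[OF klin_bounded[OF k0]]
         continuous_on_const continuous_inv)
  have kF: "klin (F g)" for g
    unfolding F_def[abs_def] by (intro klin_comp[OF klin_\<rho>] klin_comp[OF k0] klin_\<rho>)
  have "klin p" unfolding p_def[abs_def] by (rule klin_integral[OF c kF])
  moreover have "p (\<rho> h x) = \<rho> h (p x)" for h x
  proof -
    have "F g (\<rho> h x) = \<rho> h (F (inv h \<otimes> g) x)" for g
      by (simp add: F_def \<rho>_mult inv_mult_group)
    then have "p (\<rho> h x) = (\<integral>g. \<rho> h (F (inv h \<otimes> g) x) \<partial>\<mu>)" by (simp add: p_def)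
    also have "\<dots> = (\<integral>g. \<rho> h (F g x) \<partial>\<mu>)"
      by (rule left_invariant) (intro continuous_on_\<rho> continuous_on_const c)
    also have "\<dots> = \<rho> h (p x)"
      unfolding p_def by (rule integral_bounded_linear[OF bounded_linear_\<rho> continuous_integrable[OF c]])
    finally show ?thesis .
  qed
  ultimately have "equivariant p" by (simp add: equivariant_def)
  moreover have "p x = x" if "x \<in> U" for x
  proof -
    have "F g x = x" for g using p0(3) inv[OF that] by (simp add: F_def)
    then show ?thesis by (simp add: p_def haar.prob_space)
  qed
  \<comment> \<open>The integrand takes values in \<open>U\<close>, where \<open>p0\<close> is the
    identity. As \<open>p0\<close> passes through the integral,
    \<open>p x = p0 (p x)\<close>.\<close>
  moreover have "p x \<in> U" for x
  proof -
    have FU: "F g x \<in> U" for g unfolding F_def using p0(1) inv by blast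
    have bl: "bounded_linear p0" by (rule klin_bounded[OF k0])
    have "p0 (p x) = (\<integral>g. p0 (F g x) \<partial>\<mu>)"
      unfolding p_def by (rule integral_bounded_linear[OF bl continuous_integrable[OF c], symmetric])
    also have "\<dots> = p x" unfolding p_def using p0(3) FU by simp
    finally show ?thesis using p0(1) by (metis rangeI subsetD)
  qed
  ultimately show ?thesis by (intro exI[of _ p]) simp
qed

section \<open>Irreducible subrepresentations\<close>

lemma subrep_kernel:
  assumes "equivariant L" "subrep scal \<rho> U"
  shows "subrep scal \<rho> {x \<in> U. L x = 0}"
proof -
  have L0: "L 0 = 0" and kl: "klin L" and e: "\<And>g x. L (\<rho> g x) = \<rho> g (L x)"
    using assms(1) klin_linear linear_0 by (auto simp: equivariant_def)
  have U: "vs.subspace U" "\<And>g x. x \<in> U \<Longrightarrow> \<rho> g x \<in> U" using assms(2) by (auto simp: subrep_def)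
  have "vs.subspace {x \<in> U. L x = 0}"
    using U(1) by (intro vs.subspaceI) (auto simp: L0 klinD[OF kl] vs.subspace_0 vs.subspace_add vs.subspace_scale)
  moreover have "\<rho> g ` {x \<in> U. L x = 0} \<subseteq> {x \<in> U. L x = 0}" for g
    using U(2) linear_0[OF linear_\<rho>] by (auto simp: e)
  ultimately show ?thesis by (simp add: subrep_def)
qed

lemma subrep_image:
  assumes "equivariant L" "subrep scal \<rho> U"
  shows "subrep scal \<rho> (L ` U)"
proof -
  have L0: "L 0 = 0" and kl: "klin L" and e: "\<And>g x. L (\<rho> g x) = \<rho> g (L x)"
    using assms(1) klin_linear linear_0 by (auto simp: equivariant_def)
  have U: "vs.subspace U" "\<And>g x. x \<in> U \<Longrightarrow> \<rho> g x \<in> U" using assms(2) by (auto simp: subrep_def)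
  have "vs.subspace (L ` U)"
  proof (rule vs.subspaceI)
    show "0 \<in> L ` U" using U(1) L0 vs.subspace_0 by force
    fix x y c assume "x \<in> L ` U" "y \<in> L ` U"
    then obtain x' y' where "x' \<in> U" "y' \<in> U" "x = L x'" "y = L y'" by blast
    then show "x + y \<in> L ` U" "scal c x \<in> L ` U"
      using U(1) by (auto simp: klinD[OF kl, symmetric] vs.subspace_add vs.subspace_scale)
  qed
  moreover have "\<rho> g ` (L ` U) \<subseteq> L ` U" for g
    using U(2) by (auto simp: e[symmetric])
  ultimately show ?thesis by (simp add: subrep_def)
qed

lemma subrep_span:
  assumes "\<And>U. U \<in> S \<Longrightarrow> subrep scal \<rho> U"
  shows "subrep scal \<rho> (vs.span (\<Union>S))"
  unfolding subrep_def
proof (intro conjI allI image_subsetI)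
  show "vs.subspace (vs.span (\<Union>S))" by (rule vs.subspace_span)
  fix g x assume "x \<in> vs.span (\<Union>S)"
  then show "\<rho> g x \<in> vs.span (\<Union>S)"
  proof (induction rule: vs.span_induct_alt)
    case base show ?case by (simp add: linear_0[OF linear_\<rho>] vs.span_zero)
  next
    case (step c b y)
    then obtain U where U: "U \<in> S" "b \<in> U" by blast
    have "\<rho> g ` U \<subseteq> U" using assms[OF U(1)] by (simp add: subrep_def)
    then have "\<rho> g b \<in> \<Union>S" using U by blast
    then show ?case using step
      by (simp add: klinD[OF klin_\<rho>] vs.span_add vs.span_scale vs.span_base)
  qed
qed

lemma subrep_Int: "subrep scal \<rho> U \<Longrightarrow> subrep scal \<rho> U' \<Longrightarrow> subrep scal \<rho> (U \<inter> U')"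
  unfolding subrep_def using vs.subspace_inter by blast

lemma subrep_zero: "subrep scal \<rho> U \<Longrightarrow> 0 \<in> U"
  by (auto simp: subrep_def vs.subspace_0)

text \<open>Take a nonzero subrepresentation of least dimension over the scalar field.\<close>

lemma contains_irreducible:
  assumes U: "subrep scal \<rho> U" "U \<noteq> {0}"
  obtains W where "irreducible_subrep scal \<rho> W" "W \<subseteq> U"
proof -
  obtain B where B: "finite B" "vs.span B = UNIV" using fin_dim_scal by blast
  obtain B' where B': "B' \<subseteq> B" "vs.independent B'" "B \<subseteq> vs.span B'"
    by (rule vs.maximal_independent_subset)
  have "finite B'" by (rule finite_subset[OF B'(1) B(1)])
  moreover have "vs.span B' = UNIV"
    using vs.span_minimal[OF B'(3) vs.subspace_span] B(2) by auto
  ultimately interpret finite_dimensional_vector_space scal B'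
    using B'(2) by unfold_locales
  define P where "P W \<longleftrightarrow> subrep scal \<rho> W \<and> W \<noteq> {0} \<and> W \<subseteq> U" for W
  have "P U" using U by (simp add: P_def)
  then obtain W where W: "P W" "\<And>W'. P W' \<Longrightarrow> vs.dim W \<le> vs.dim W'"
    using ex_has_least_nat[of P U vs.dim] by blast
  have "irreducible_subrep scal \<rho> W"
    unfolding irreducible_subrep_def
  proof (intro conjI allI impI)
    show "subrep scal \<rho> W" "W \<noteq> {0}" using W(1) by (auto simp: P_def)
    fix W' assume W': "subrep scal \<rho> W' \<and> W' \<subseteq> W"
    show "W' = {0} \<or> W' = W"
    proof (cases "W' = {0}")
      case False
      then have "P W'" using W' W(1) by (auto simp: P_def)
      then have "vs.dim W \<le> vs.dim W'" by (rule W(2))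
      then have "W' = W" using W' W(1) by (intro subspace_dim_equal) (auto simp: P_def subrep_def)
      then show ?thesis by simp
    qed simp
  qed
  then show thesis using that W(1) by (auto simp: P_def)
qed

text \<open>The projection onto \<open>W\<close> cannot vanish on every member of \<open>S\<close>.
  On a member where it does not, kernel and image leave only an isomorphism, as in Schur's
  lemma.\<close>

lemma irreducible_in_span:
  assumes W: "irreducible_subrep scal \<rho> W" and S: "\<And>U. U \<in> S \<Longrightarrow> irreducible_subrep scal \<rho> U"
    and sub: "W \<subseteq> vs.span (\<Union>S)"
  obtains U where "U \<in> S" "equivalent_subreps scal \<rho> U W"
proof -
  have sW: "subrep scal \<rho> W" "W \<noteq> {0}" "\<And>U'. subrep scal \<rho> U' \<Longrightarrow> U' \<subseteq> W \<Longrightarrow> U' = {0} \<or> U' = W"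
    using W by (auto simp: irreducible_subrep_def)
  obtain p where p: "equivariant p" "\<And>x. p x \<in> W" "\<And>x. x \<in> W \<Longrightarrow> p x = x"
    using equivariant_projection[OF sW(1)] by auto
  have kp: "klin p" using p(1) by (simp add: equivariant_def)
  have "\<exists>U\<in>S. \<exists>x\<in>U. p x \<noteq> 0"
  proof (rule ccontr)
    assume "\<not> ?thesis"
    then have z: "p b = 0" if "b \<in> \<Union>S" for b using that by blast
    have "p x = 0" if "x \<in> vs.span (\<Union>S)" for x
      using that
    proof (induction rule: vs.span_induct_alt)
      case base show ?case by (rule linear_0[OF klin_linear[OF kp]])
    next
      case (step c b y) then show ?case using z by (simp add: klinD[OF kp])
    qed
    then have "W \<subseteq> {0}" using sub p(3) by force
    then show False using sW(2) subrep_zero[OF sW(1)] by blast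
  qed
  then obtain U x where U: "U \<in> S" "x \<in> U" "p x \<noteq> 0" by blast
  have sU: "subrep scal \<rho> U" "\<And>U'. subrep scal \<rho> U' \<Longrightarrow> U' \<subseteq> U \<Longrightarrow> U' = {0} \<or> U' = U"
    using S[OF U(1)] by (auto simp: irreducible_subrep_def)
  have "{x \<in> U. p x = 0} = {0} \<or> {x \<in> U. p x = 0} = U"
    by (intro sU(2) subrep_kernel p(1) sU(1)) auto
  then have ker: "{x \<in> U. p x = 0} = {0}" using U by blast
  have "p ` U = {0} \<or> p ` U = W"
    by (intro sW(3) subrep_image p(1) sU(1)) (use p(2) in auto)
  then have im: "p ` U = W" using U by blast
  have "inj_on p U"
  proof (rule inj_onI)
    fix a b assume ab: "a \<in> U" "b \<in> U" "p a = p b"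
    have "a - b \<in> U" using ab sU(1) vs.subspace_diff by (simp add: subrep_def)
    moreover have "p (a - b) = 0" using ab linear_diff[OF klin_linear[OF kp]] by simp
    ultimately have "a - b \<in> {x \<in> U. p x = 0}" by simp
    then show "a = b" using ker by simp
  qed
  then have "equivalent_subreps scal \<rho> U W"
    unfolding equivalent_subreps_def using p(1) im
    by (intro exI[of _ p]) (auto simp: equivariant_def klin_def bij_betw_def)
  then show thesis using that U(1) by blast
qed

lemma equivalent_refl: "equivalent_subreps scal \<rho> U U"
  unfolding equivalent_subreps_def by (intro exI[of _ "\<lambda>x. x"]) (auto simp: bij_betw_def)

lemma equivalent_sym:
  assumes "equivalent_subreps scal \<rho> U U'" "subrep scal \<rho> U"
  shows "equivalent_subreps scal \<rho> U' U"
proof -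
  obtain L where "(\<forall>x\<in>U. \<forall>y\<in>U. L (x + y) = L x + L y) \<and>
    (\<forall>c. \<forall>x\<in>U. L (scal c x) = scal c (L x)) \<and> bij_betw L U U' \<and> (\<forall>g. \<forall>x\<in>U. L (\<rho> g x) = \<rho> g (L x))"
    using assms(1) unfolding equivalent_subreps_def by (elim exE)
  then have L: "\<And>x y. x \<in> U \<Longrightarrow> y \<in> U \<Longrightarrow> L (x + y) = L x + L y"
    "\<And>c x. x \<in> U \<Longrightarrow> L (scal c x) = scal c (L x)" "bij_betw L U U'" "\<And>g x. x \<in> U \<Longrightarrow> L (\<rho> g x) = \<rho> g (L x)"
    by simp_all
  have sub: "vs.subspace U" "\<And>g. \<rho> g ` U \<subseteq> U" using assms(2) by (simp_all add: subrep_def)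
  note U = vs.subspace_add[OF sub(1)] vs.subspace_scale[OF sub(1)]
  have Ug: "\<rho> g x \<in> U" if "x \<in> U" for g x using sub(2)[of g] that by blast
  define K where "K = inv_into U L"
  have K: "bij_betw K U' U" "\<And>x. x \<in> U \<Longrightarrow> K (L x) = x"
    unfolding K_def by (rule bij_betw_inv_into[OF L(3)], rule bij_betw_inv_into_left[OF L(3)])
  have K3: "\<exists>x\<in>U. y = L x" if "y \<in> U'" for y
    using that L(3) unfolding bij_betw_def by blast
  show ?thesis
    unfolding equivalent_subreps_def
  proof (intro exI[of _ K] conjI ballI allI K(1))
    fix x y assume xy: "x \<in> U'" "y \<in> U'"
    obtain x' where x': "x' \<in> U" "x = L x'" by (rule bexE[OF K3[OF xy(1)]])
    obtain y' where y': "y' \<in> U" "y = L y'" by (rule bexE[OF K3[OF xy(2)]])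
    note e = x'(1) y'(1) x'(2) y'(2)
    have "x + y = L (x' + y')" using e L(1) by simp
    then show "K (x + y) = K x + K y" using e K(2) U(1) by simp
  next
    fix c x assume x: "x \<in> U'"
    obtain x' where e: "x' \<in> U" "x = L x'" by (rule bexE[OF K3[OF x]])
    have "scal c x = L (scal c x')" using e L(2) by simp
    then show "K (scal c x) = scal c (K x)" using e K(2) U(2) by simp
  next
    fix g x assume x: "x \<in> U'"
    obtain x' where e: "x' \<in> U" "x = L x'" by (rule bexE[OF K3[OF x]])
    have "\<rho> g x = L (\<rho> g x')" using e L(4) by simp
    then show "K (\<rho> g x) = \<rho> g (K x)" using e K(2) Ug by simp
  qed
qed

lemma equivalent_trans:
  assumes "equivalent_subreps scal \<rho> U V" "equivalent_subreps scal \<rho> V W"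
  shows "equivalent_subreps scal \<rho> U W"
proof -
  obtain L where "(\<forall>x\<in>U. \<forall>y\<in>U. L (x + y) = L x + L y) \<and>
    (\<forall>c. \<forall>x\<in>U. L (scal c x) = scal c (L x)) \<and> bij_betw L U V \<and> (\<forall>g. \<forall>x\<in>U. L (\<rho> g x) = \<rho> g (L x))"
    using assms(1) unfolding equivalent_subreps_def by (elim exE)
  then have L: "\<And>x y. x \<in> U \<Longrightarrow> y \<in> U \<Longrightarrow> L (x + y) = L x + L y"
    "\<And>c x. x \<in> U \<Longrightarrow> L (scal c x) = scal c (L x)" "bij_betw L U V" "\<And>g x. x \<in> U \<Longrightarrow> L (\<rho> g x) = \<rho> g (L x)"
    by simp_all
  obtain K where "(\<forall>x\<in>V. \<forall>y\<in>V. K (x + y) = K x + K y) \<and>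
    (\<forall>c. \<forall>x\<in>V. K (scal c x) = scal c (K x)) \<and> bij_betw K V W \<and> (\<forall>g. \<forall>x\<in>V. K (\<rho> g x) = \<rho> g (K x))"
    using assms(2) unfolding equivalent_subreps_def by (elim exE)
  then have K: "\<And>x y. x \<in> V \<Longrightarrow> y \<in> V \<Longrightarrow> K (x + y) = K x + K y"
    "\<And>c x. x \<in> V \<Longrightarrow> K (scal c x) = scal c (K x)" "bij_betw K V W" "\<And>g x. x \<in> V \<Longrightarrow> K (\<rho> g x) = \<rho> g (K x)"
    by simp_all
  have LV: "L x \<in> V" if "x \<in> U" for x using that L(3) by (auto simp: bij_betw_def)
  show ?thesis
    unfolding equivalent_subreps_def
    by (intro exI[of _ "K \<circ> L"] conjI ballI allI bij_betw_trans[OF L(3) K(3)])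
       (simp_all add: L(1,2,4) K(1,2,4) LV)
qed

section \<open>The isotypic decomposition\<close>

definition Irr :: "'v set set" where
  "Irr = {U. irreducible_subrep scal \<rho> U}"

definition irr_rel :: "('v set \<times> 'v set) set" where
  "irr_rel = {(U, U'). irreducible_subrep scal \<rho> U \<and> irreducible_subrep scal \<rho> U' \<and>
     equivalent_subreps scal \<rho> U U'}"

lemma irr_classes_eq: "irr_classes scal \<rho> = Irr // irr_rel"
  by (simp add: irr_classes_def Irr_def irr_rel_def)

lemma Irr_subrep: "U \<in> Irr \<Longrightarrow> subrep scal \<rho> U"
  by (simp add: Irr_def irreducible_subrep_def)

lemma equiv_irr_rel: "equiv Irr irr_rel"
proof (rule equivI)
  show "irr_rel \<subseteq> Irr \<times> Irr" by (auto simp: irr_rel_def Irr_def)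
  show "refl_on Irr irr_rel"
    by (rule refl_onI) (auto simp: irr_rel_def Irr_def equivalent_refl)
  show "sym irr_rel"
  proof (rule symI)
    fix U U' assume "(U, U') \<in> irr_rel"
    then have *: "irreducible_subrep scal \<rho> U" "irreducible_subrep scal \<rho> U'" "equivalent_subreps scal \<rho> U U'"
      by (simp_all add: irr_rel_def)
    have "equivalent_subreps scal \<rho> U' U"
      by (rule equivalent_sym[OF *(3)]) (use *(1) in \<open>simp add: irreducible_subrep_def\<close>)
    with * show "(U', U) \<in> irr_rel" by (simp add: irr_rel_def)
  qed
  show "trans irr_rel"
  proof (rule transI)
    fix U V W assume "(U, V) \<in> irr_rel" "(V, W) \<in> irr_rel"
    then have "irreducible_subrep scal \<rho> U" "irreducible_subrep scal \<rho> W"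
      and e: "equivalent_subreps scal \<rho> U V" "equivalent_subreps scal \<rho> V W"
      by (simp_all add: irr_rel_def)
    then show "(U, W) \<in> irr_rel" using equivalent_trans[OF e] by (simp add: irr_rel_def)
  qed
qed

lemma irr_class_members:
  assumes "\<tau> \<in> irr_classes scal \<rho>"
  shows "\<tau> \<subseteq> Irr" "\<tau> \<noteq> {}" "U \<in> \<tau> \<Longrightarrow> U' \<in> \<tau> \<Longrightarrow> equivalent_subreps scal \<rho> U U'"
proof -
  have t: "\<tau> \<in> Irr // irr_rel" using assms by (simp add: irr_classes_eq)
  show "\<tau> \<subseteq> Irr" by (rule in_quotient_imp_subset[OF equiv_irr_rel t])
  show "\<tau> \<noteq> {}" by (rule in_quotient_imp_non_empty[OF equiv_irr_rel t])
  assume "U \<in> \<tau>" "U' \<in> \<tau>"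
  then have "(U, U') \<in> irr_rel" using in_quotient_imp_in_rel[OF equiv_irr_rel t, of U U'] by simp
  then show "equivalent_subreps scal \<rho> U U'" by (simp add: irr_rel_def)
qed

lemma Union_irr_classes: "\<Union>(irr_classes scal \<rho>) = Irr"
  unfolding irr_classes_eq by (rule Union_quotient[OF equiv_irr_rel])

lemma subrep_isotypic:
  assumes "\<tau> \<in> irr_classes scal \<rho>"
  shows "subrep scal \<rho> (isotypic scal \<tau>)"
  unfolding isotypic_def
  by (rule subrep_span) (use irr_class_members(1)[OF assms] Irr_subrep in auto)

text \<open>Otherwise the kernel of the projection onto this span is nonzero and contains an
  irreducible subrepresentation, which the projection would both fix and annihilate.\<close>

lemma span_Irr: "vs.span (\<Union>Irr) = UNIV"
proof (rule ccontr)
  assume n: "vs.span (\<Union>Irr) \<noteq> UNIV"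
  have s: "subrep scal \<rho> (vs.span (\<Union>Irr))" by (rule subrep_span[OF Irr_subrep])
  obtain p where p: "equivariant p" "\<And>x. p x \<in> vs.span (\<Union>Irr)" "\<And>x. x \<in> vs.span (\<Union>Irr) \<Longrightarrow> p x = x"
    using equivariant_projection[OF s] by auto
  have lp: "linear p" using p(1) klin_linear by (simp add: equivariant_def)
  have "subrep scal \<rho> UNIV" by (simp add: subrep_def)
  from subrep_kernel[OF p(1) this] have k: "subrep scal \<rho> {x. p x = 0}" by simp
  obtain x where x: "x \<notin> vs.span (\<Union>Irr)" using n by blast
  have "p (x - p x) = 0" using p(2,3) by (simp add: linear_diff[OF lp])
  moreover have "x - p x \<noteq> 0" using x p(2)[of x] by auto
  ultimately have ne: "{x. p x = 0} \<noteq> {0}" by blast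
  obtain W where W: "irreducible_subrep scal \<rho> W" "W \<subseteq> {x. p x = 0}"
    by (rule contains_irreducible[OF k ne])
  have "w = 0" if w: "w \<in> W" for w
  proof -
    have "w \<in> \<Union>Irr" using w W(1) by (auto simp: Irr_def)
    then have "p w = w" by (intro p(3) vs.span_base)
    moreover have "p w = 0" using W(2) w by blast
    ultimately show ?thesis by simp
  qed
  then have "W \<subseteq> {0}" by blast
  moreover have "0 \<in> W" using W(1) subrep_zero by (simp add: irreducible_subrep_def)
  ultimately show False using W(1) by (auto simp: irreducible_subrep_def)
qed

text \<open>Finitely many irreducible subrepresentations already span, and by
  \<open>irreducible_in_span\<close> every class contains one of them.\<close>

lemma finite_irr_classes: "finite (irr_classes scal \<rho>)"
proof -
  obtain B where B: "finite B" "vs.span B = UNIV" using fin_dim_scal by blast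
  obtain T where T: "T \<subseteq> \<Union>Irr" "vs.independent T" "\<Union>Irr \<subseteq> vs.span T"
    by (rule vs.maximal_independent_subset)
  have fT: "finite T"
    using vs.independent_span_bound[OF B(1) T(2)] B(2) by simp
  have "\<forall>x\<in>T. \<exists>U\<in>Irr. x \<in> U" using T(1) by blast
  from bchoice[OF this[unfolded Bex_def]] obtain u where u: "\<And>x. x \<in> T \<Longrightarrow> u x \<in> Irr" "\<And>x. x \<in> T \<Longrightarrow> x \<in> u x"
    by auto
  define S where "S = u ` T"
  have S: "finite S" "S \<subseteq> Irr" using fT u(1) by (auto simp: S_def)
  have "vs.span T \<subseteq> vs.span (\<Union>S)" using u(2) by (intro vs.span_mono) (auto simp: S_def)
  moreover have "vs.span T = UNIV"
    using vs.span_minimal[OF T(3) vs.subspace_span] span_Irr by auto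
  ultimately have sp: "vs.span (\<Union>S) = UNIV" by auto
  have "irr_classes scal \<rho> \<subseteq> (\<lambda>U. irr_rel `` {U}) ` S"
  proof
    fix \<tau> assume t: "\<tau> \<in> irr_classes scal \<rho>"
    then obtain W where W: "W \<in> Irr" "\<tau> = irr_rel `` {W}"
      unfolding irr_classes_eq by (rule quotientE)
    have iW: "irreducible_subrep scal \<rho> W" using W(1) by (simp add: Irr_def)
    obtain U where U: "U \<in> S" "equivalent_subreps scal \<rho> U W"
    proof (rule irreducible_in_span[OF iW])
      show "\<And>U. U \<in> S \<Longrightarrow> irreducible_subrep scal \<rho> U" using S(2) by (auto simp: Irr_def)
      show "W \<subseteq> vs.span (\<Union>S)" using sp by simp
    qed
    have "(U, W) \<in> irr_rel" using U S(2) iW by (auto simp: irr_rel_def Irr_def)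
    then have "irr_rel `` {U} = \<tau>" using equiv_class_eq[OF equiv_irr_rel] W(2) by simp
    then show "\<tau> \<in> (\<lambda>U. irr_rel `` {U}) ` S" using U(1) by blast
  qed
  then show ?thesis using S(1) finite_subset by blast
qed

text \<open>An irreducible subrepresentation of the intersection would be equivalent to a member of
  \<tau> and to one of another class.\<close>

lemma isotypic_Int_others:
  assumes t: "\<tau> \<in> irr_classes scal \<rho>"
  shows "isotypic scal \<tau> \<inter> vs.span (\<Union>(\<Union>(irr_classes scal \<rho> - {\<tau>}))) = {0}"
proof (rule ccontr)
  let ?J = "\<Union>(irr_classes scal \<rho> - {\<tau>})"
  assume ne: "isotypic scal \<tau> \<inter> vs.span (\<Union>?J) \<noteq> {0}"
  have J: "?J \<subseteq> Irr" using Union_irr_classes by blast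
  have "subrep scal \<rho> (vs.span (\<Union>?J))" by (rule subrep_span[OF Irr_subrep]) (use J in blast)
  from subrep_Int[OF subrep_isotypic[OF t] this]
  obtain W where W: "irreducible_subrep scal \<rho> W" "W \<subseteq> isotypic scal \<tau> \<inter> vs.span (\<Union>?J)"
    by (rule contains_irreducible[OF _ ne])
  have W1: "W \<subseteq> vs.span (\<Union>\<tau>)" using W(2) by (simp add: isotypic_def)
  have W2: "W \<subseteq> vs.span (\<Union>?J)" using W(2) by simp
  obtain U where U: "U \<in> \<tau>" "equivalent_subreps scal \<rho> U W"
    by (rule irreducible_in_span[OF W(1) _ W1]) (use irr_class_members(1)[OF t] in \<open>auto simp: Irr_def\<close>)
  obtain U' where U': "U' \<in> ?J" "equivalent_subreps scal \<rho> U' W"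
    by (rule irreducible_in_span[OF W(1) _ W2]) (use J in \<open>auto simp: Irr_def\<close>)
  obtain \<sigma> where \<sigma>: "\<sigma> \<in> irr_classes scal \<rho>" "\<sigma> \<noteq> \<tau>" "U' \<in> \<sigma>" using U'(1) by blast
  have i: "irreducible_subrep scal \<rho> U" "irreducible_subrep scal \<rho> U'"
    using irr_class_members(1)[OF t] irr_class_members(1)[OF \<sigma>(1)] U(1) \<sigma>(3) by (auto simp: Irr_def)
  have "(U, W) \<in> irr_rel" "(U', W) \<in> irr_rel" using i W(1) U(2) U'(2) by (auto simp: irr_rel_def)
  then have "(U, U') \<in> irr_rel" using equiv_irr_rel by (meson equivE symD transD)
  then have "\<tau> = \<sigma>"
    using quotient_eq_iff[OF equiv_irr_rel, of \<tau> \<sigma> U U'] t \<sigma> U(1) by (simp add: irr_classes_eq)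
  then show False using \<sigma>(2) by simp
qed

lemma isotypic_decomposition_exists:
  "\<exists>u. (\<forall>\<tau>\<in>irr_classes scal \<rho>. u \<tau> \<in> isotypic scal \<tau>) \<and> (\<forall>\<tau>. \<tau> \<notin> irr_classes scal \<rho> \<longrightarrow> u \<tau> = 0) \<and>
     v = (\<Sum>\<tau>\<in>irr_classes scal \<rho>. u \<tau>)"
proof -
  let ?I = "irr_classes scal \<rho>"
  define P where "P v u \<longleftrightarrow> (\<forall>\<tau>\<in>?I. u \<tau> \<in> isotypic scal \<tau>) \<and> (\<forall>\<tau>. \<tau> \<notin> ?I \<longrightarrow> u \<tau> = 0) \<and> v = (\<Sum>\<tau>\<in>?I. u \<tau>)" for v u
  have "v \<in> vs.span (\<Union>Irr)" by (simp add: span_Irr)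
  then have "\<exists>u. P v u"
  proof (induction rule: vs.span_induct_alt)
    case base
    show ?case by (rule exI[of _ "\<lambda>_. 0"]) (simp add: P_def isotypic_def vs.span_zero)
  next
    case (step c x y)
    obtain u where u: "P y u" using step(2) by (rule exE)
    obtain U where U: "U \<in> Irr" "x \<in> U" using step(1) by blast
    obtain \<tau> where \<tau>: "\<tau> \<in> ?I" "U \<in> \<tau>" using U(1) unfolding Union_irr_classes[symmetric] by (rule UnionE)
    have x: "scal c x \<in> isotypic scal \<tau>"
      unfolding isotypic_def by (rule vs.span_scale[OF vs.span_base[OF UnionI[OF \<tau>(2) U(2)]]])
    have "P (scal c x + y) (\<lambda>\<sigma>. (if \<sigma> = \<tau> then scal c x else 0) + u \<sigma>)"
      unfolding P_def
    proof (intro conjI ballI allI impI)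
      fix \<sigma> assume "\<sigma> \<in> ?I"
      then have "u \<sigma> \<in> isotypic scal \<sigma>" using u by (simp add: P_def)
      then show "(if \<sigma> = \<tau> then scal c x else 0) + u \<sigma> \<in> isotypic scal \<sigma>"
        using x by (auto simp: isotypic_def intro: vs.span_add)
    next
      fix \<sigma> assume "\<sigma> \<notin> ?I"
      then show "(if \<sigma> = \<tau> then scal c x else 0) + u \<sigma> = 0" using u \<tau> by (auto simp: P_def)
    next
      show "scal c x + y = (\<Sum>\<sigma>\<in>?I. (if \<sigma> = \<tau> then scal c x else 0) + u \<sigma>)"
        using u \<tau>(1) finite_irr_classes by (simp add: P_def sum.distrib)
    qed
    then show ?case by (rule exI[where P = "P (scal c x + y)"])
  qed
  then show ?thesis by (simp add: P_def)
qed

lemma isotypic_independent: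
  assumes d: "\<And>\<sigma>. \<sigma> \<in> irr_classes scal \<rho> \<Longrightarrow> d \<sigma> \<in> isotypic scal \<sigma>"
    and zero: "(\<Sum>\<sigma>\<in>irr_classes scal \<rho>. d \<sigma>) = 0" and \<tau>: "\<tau> \<in> irr_classes scal \<rho>"
  shows "d \<tau> = 0"
proof -
  let ?I = "irr_classes scal \<rho>"
  have "d \<tau> + (\<Sum>\<sigma>\<in>?I - {\<tau>}. d \<sigma>) = 0"
    using zero sum.remove[OF finite_irr_classes \<tau>, of d] by simp
  then have eq: "d \<tau> = - (\<Sum>\<sigma>\<in>?I - {\<tau>}. d \<sigma>)" by (rule eq_neg_iff_add_eq_0[THEN iffD2])
  have "- (\<Sum>\<sigma>\<in>?I - {\<tau>}. d \<sigma>) \<in> vs.span (\<Union>(\<Union>(?I - {\<tau>})))"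
  proof (rule vs.span_neg, rule vs.span_sum)
    fix \<sigma> assume s: "\<sigma> \<in> ?I - {\<tau>}"
    then have "\<Union>\<sigma> \<subseteq> \<Union>(\<Union>(?I - {\<tau>}))" by blast
    from vs.span_mono[OF this] show "d \<sigma> \<in> vs.span (\<Union>(\<Union>(?I - {\<tau>})))"
      using d[of \<sigma>] s by (auto simp: isotypic_def)
  qed
  then have "d \<tau> \<in> isotypic scal \<tau> \<inter> vs.span (\<Union>(\<Union>(?I - {\<tau>})))"
    using d[OF \<tau>] by (simp only: eq[symmetric] Int_iff)
  then show ?thesis unfolding isotypic_Int_others[OF \<tau>] by (rule singletonD)
qed

lemma isotypic_direct_sum: "is_direct_sum (irr_classes scal \<rho>) (isotypic scal)"
  unfolding is_direct_sum_def
proof (rule conjI[OF finite_irr_classes], rule allI, rule ex_ex1I)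
  fix v
  show "\<exists>u. (\<forall>i\<in>irr_classes scal \<rho>. u i \<in> isotypic scal i) \<and> (\<forall>i. i \<notin> irr_classes scal \<rho> \<longrightarrow> u i = 0) \<and>
      v = (\<Sum>i\<in>irr_classes scal \<rho>. u i)"
    by (rule isotypic_decomposition_exists)
next
  fix v u u'
  assume "(\<forall>i\<in>irr_classes scal \<rho>. u i \<in> isotypic scal i) \<and> (\<forall>i. i \<notin> irr_classes scal \<rho> \<longrightarrow> u i = 0) \<and>
      v = (\<Sum>i\<in>irr_classes scal \<rho>. u i)"
  note u = conjunct1[OF this] conjunct1[OF conjunct2[OF this]] conjunct2[OF conjunct2[OF this], symmetric]
  assume "(\<forall>i\<in>irr_classes scal \<rho>. u' i \<in> isotypic scal i) \<and> (\<forall>i. i \<notin> irr_classes scal \<rho> \<longrightarrow> u' i = 0) \<and>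
      v = (\<Sum>i\<in>irr_classes scal \<rho>. u' i)"
  note u' = conjunct1[OF this] conjunct1[OF conjunct2[OF this]] conjunct2[OF conjunct2[OF this], symmetric]
  have dm: "u i - u' i \<in> isotypic scal i" if "i \<in> irr_classes scal \<rho>" for i
    using bspec[OF u(1) that] bspec[OF u'(1) that] unfolding isotypic_def by (rule vs.span_diff)
  have s0: "(\<Sum>i\<in>irr_classes scal \<rho>. u i - u' i) = 0" by (simp only: sum_subtractf u(3) u'(3) diff_self)
  show "u = u'"
  proof
    fix i
    show "u i = u' i"
    proof (cases "i \<in> irr_classes scal \<rho>")
      case True
      from isotypic_independent[of "\<lambda>i. u i - u' i", OF dm s0 True] show ?thesis by simp
    next
      case False
      then show ?thesis using u(2) u'(2) by simp
    qed
  qed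
qed

end

section \<open>The Casimir operator\<close>

text \<open>Provides the product rule and continuity for an inner product unrelated to the given
  norm.\<close>

lemma fin_dim_bilinear_bounded:
  fixes h :: "'a::real_normed_vector \<Rightarrow> 'a \<Rightarrow> real"
  assumes fd: "fin_dim TYPE('a)" and l: "\<And>y. linear (\<lambda>x. h x y)" and r: "\<And>x. linear (h x)"
  shows "bounded_bilinear h"
proof -
  obtain B :: "'a set" where B: "finite B" "independent B" "span B = UNIV"
    using fin_dim_basis[OF fd] .
  have "\<forall>b. \<exists>K. \<forall>x. norm (representation B x b) \<le> norm x * K"
    using bounded_linear.bounded[OF representation_bounded_linear[OF B(2,3) fd]] by blast
  from choice[OF this] obtain R where R: "\<And>b x. norm (representation B x b) \<le> norm x * R b" by blast
  have "\<forall>b. \<exists>K. \<forall>y. norm (h b y) \<le> norm y * K"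
    using bounded_linear.bounded[OF linear_fin_dim_bounded[OF fd r]] by blast
  from choice[OF this] obtain K where K: "\<And>b y. norm (h b y) \<le> norm y * K b" by blast
  have "norm (h x y) \<le> norm x * norm y * (\<Sum>b\<in>B. R b * K b)" for x y
  proof -
    have "h x y = h (\<Sum>b\<in>B. representation B x b *\<^sub>R b) y"
      using B by (simp add: sum_representation_eq)
    also have "\<dots> = (\<Sum>b\<in>B. representation B x b * h b y)"
      by (simp add: linear_sum[OF l] linear_scale[OF l])
    also have "norm \<dots> \<le> (\<Sum>b\<in>B. norm (representation B x b) * norm (h b y))"
      by (rule order_trans[OF norm_sum]) (simp add: abs_mult)
    also have "\<dots> \<le> (\<Sum>b\<in>B. (norm x * R b) * (norm y * K b))"
      by (intro sum_mono mult_mono R K) (use order_trans[OF norm_ge_zero R] in auto)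
    also have "\<dots> = norm x * norm y * (\<Sum>b\<in>B. R b * K b)" by (simp add: sum_distrib_left mult_ac)
    finally show ?thesis .
  qed
  then show ?thesis
    using linear_add[OF l] linear_add[OF r] linear_scale[OF l] linear_scale[OF r]
    by (intro bounded_bilinear.intro exI[of _ "\<Sum>b\<in>B. R b * K b"]) auto
qed

text \<open>The orthonormal family \<open>T a\<close> is complete by the count \<open>\<Sum>\<^sub>b \<kappa> (r b) (r b) = n - n = 0\<close> of the components \<open>r b\<close> orthogonal to it.\<close>
lemma orthonormal_contraction:
  fixes \<kappa> :: "'e::real_vector \<Rightarrow> 'e \<Rightarrow> real" and h :: "'e \<Rightarrow> 'e \<Rightarrow> 'v::real_vector"
  assumes bil: "bilinear \<kappa>" and sym: "\<And>x y. \<kappa> x y = \<kappa> y x" and pos: "\<And>x. x \<noteq> 0 \<Longrightarrow> \<kappa> x x > 0"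
    and on: "orthonormal_basis \<kappa> \<Xi>" and T: "\<And>a b. a \<in> \<Xi> \<Longrightarrow> b \<in> \<Xi> \<Longrightarrow> \<kappa> (T a) (T b) = \<kappa> a b"
    and h: "bilinear h"
  shows "(\<Sum>a\<in>\<Xi>. h (T a) (T a)) = (\<Sum>a\<in>\<Xi>. h a a)"
proof -
  have fin: "finite \<Xi>" and sp: "span \<Xi> = UNIV" and ab: "\<And>a b. a \<in> \<Xi> \<Longrightarrow> b \<in> \<Xi> \<Longrightarrow> \<kappa> a b = (if a = b then 1 else 0)"
    using on by (auto simp: orthonormal_basis_def)
  have lr: "linear (\<kappa> x)" and ll: "linear (\<lambda>y. \<kappa> y x)" for x using bil by (auto simp: bilinear_def)
  have hr: "linear (h x)" and hl: "linear (\<lambda>y. h y x)" for x using h by (auto simp: bilinear_def)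
  have expand: "x = (\<Sum>b\<in>\<Xi>. \<kappa> x b *\<^sub>R b)" for x
  proof -
    have "x \<in> span \<Xi>" using sp by simp
    then obtain u where u: "x = (\<Sum>b\<in>\<Xi>. u b *\<^sub>R b)" unfolding span_finite[OF fin] by blast
    have "\<kappa> x b = u b" if b: "b \<in> \<Xi>" for b
    proof -
      have "\<kappa> x b = (\<Sum>c\<in>\<Xi>. u c * \<kappa> c b)"
        unfolding u by (simp add: linear_sum[OF ll] linear_scale[OF ll])
      also have "\<dots> = (\<Sum>c\<in>\<Xi>. if c = b then u c else 0)" using ab b by (intro sum.cong) auto
      finally show ?thesis using b fin by simp
    qed
    then have "(\<Sum>b\<in>\<Xi>. \<kappa> x b *\<^sub>R b) = (\<Sum>b\<in>\<Xi>. u b *\<^sub>R b)" by (intro sum.cong) auto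
    then show ?thesis by (rule trans[OF u HOL.sym])
  qed
  have parseval: "\<kappa> x y = (\<Sum>b\<in>\<Xi>. \<kappa> x b * \<kappa> y b)" for x y
  proof -
    have "\<kappa> x y = \<kappa> x (\<Sum>b\<in>\<Xi>. \<kappa> y b *\<^sub>R b)" by (simp only: expand[symmetric])
    then show ?thesis by (simp add: linear_sum[OF lr] linear_scale[OF lr] mult.commute)
  qed
  have TT: "\<kappa> (T a) (T b) = (if a = b then 1 else 0)" if "a \<in> \<Xi>" "b \<in> \<Xi>" for a b using T ab that by simp
  \<comment> \<open>The component of \<open>b\<close> orthogonal to the family \<open>T a\<close>;
    its square length is the defect in Bessel's inequality.\<close>
  define r where "r b = b - (\<Sum>a\<in>\<Xi>. \<kappa> (T a) b *\<^sub>R T a)" for b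
  have rr: "\<kappa> (r b) (r b) = \<kappa> b b - (\<Sum>a\<in>\<Xi>. \<kappa> (T a) b * \<kappa> (T a) b)" for b
  proof -
    define s where "s = (\<Sum>a\<in>\<Xi>. \<kappa> (T a) b *\<^sub>R T a)"
    have bs: "\<kappa> b s = (\<Sum>a\<in>\<Xi>. \<kappa> (T a) b * \<kappa> (T a) b)"
      unfolding s_def by (simp add: linear_sum[OF lr] linear_scale[OF lr] sym[of b])
    have Ts: "\<kappa> (T c) s = \<kappa> (T c) b" if c: "c \<in> \<Xi>" for c
    proof -
      have "\<kappa> (T c) s = (\<Sum>a\<in>\<Xi>. \<kappa> (T a) b * \<kappa> (T c) (T a))"
        unfolding s_def by (simp add: linear_sum[OF lr] linear_scale[OF lr])
      also have "\<dots> = (\<Sum>a\<in>\<Xi>. if a = c then \<kappa> (T a) b else 0)" using TT c by (intro sum.cong) auto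
      finally show ?thesis using c fin by simp
    qed
    have "\<kappa> s s = (\<Sum>a\<in>\<Xi>. \<kappa> (T a) b * \<kappa> (T a) s)"
      by (subst (1) s_def) (simp add: linear_sum[OF ll] linear_scale[OF ll])
    also have "\<dots> = \<kappa> b s" unfolding bs using Ts by (intro sum.cong) auto
    finally have ss: "\<kappa> s s = \<kappa> b s" .
    have "\<kappa> (b - s) (b - s) = \<kappa> b b - \<kappa> b s - \<kappa> s b + \<kappa> s s"
      by (simp add: linear_diff[OF lr] linear_diff[OF ll])
    then show ?thesis using ss bs sym[of s b] by (simp add: r_def s_def)
  qed
  \<comment> \<open>Sum the defects over \<open>b\<close>; by Parseval for each \<open>T a\<close>,
    the double sum counts the same number of unit vectors as the first sum.\<close>
  have "(\<Sum>b\<in>\<Xi>. \<kappa> (r b) (r b)) = (\<Sum>b\<in>\<Xi>. \<kappa> b b) - (\<Sum>a\<in>\<Xi>. \<Sum>b\<in>\<Xi>. \<kappa> (T a) b * \<kappa> (T a) b)"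
    unfolding rr sum_subtractf by (subst sum.swap) simp
  also have "(\<Sum>a\<in>\<Xi>. \<Sum>b\<in>\<Xi>. \<kappa> (T a) b * \<kappa> (T a) b) = (\<Sum>a\<in>\<Xi>. \<kappa> (T a) (T a))"
    by (simp only: parseval[symmetric])
  also have "\<dots> = (\<Sum>b\<in>\<Xi>. \<kappa> b b)" using T by (intro sum.cong) auto
  finally have z: "(\<Sum>b\<in>\<Xi>. \<kappa> (r b) (r b)) = 0" by simp
  have nn: "\<kappa> x x \<ge> 0" for x using pos[of x] linear_0[OF lr] by (cases "x = 0") (auto simp: less_imp_le)
  have r0: "r b = 0" if b: "b \<in> \<Xi>" for b
  proof (rule ccontr)
    assume "r b \<noteq> 0"
    then have "0 < \<kappa> (r b) (r b)" by (rule pos)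
    also have "\<dots> \<le> (\<Sum>b\<in>\<Xi>. \<kappa> (r b) (r b))" using b fin nn by (intro member_le_sum) auto
    finally show False using z by simp
  qed
  then have Tb: "b = (\<Sum>a\<in>\<Xi>. \<kappa> (T a) b *\<^sub>R T a)" if "b \<in> \<Xi>" for b using that by (simp add: r_def)
  \<comment> \<open>The matrix of the \<open>T a\<close> is thus orthogonal also with respect to
    summation over \<open>a\<close>, which is what contracting \<open>h\<close> uses.\<close>
  have dual: "(\<Sum>a\<in>\<Xi>. \<kappa> (T a) b * \<kappa> (T a) c) = (if b = c then 1 else 0)" if bc: "b \<in> \<Xi>" "c \<in> \<Xi>" for b c
  proof -
    have "\<kappa> b c = \<kappa> (\<Sum>a\<in>\<Xi>. \<kappa> (T a) b *\<^sub>R T a) c" by (simp only: Tb[OF bc(1), symmetric])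
    also have "\<dots> = (\<Sum>a\<in>\<Xi>. \<kappa> (T a) b * \<kappa> (T a) c)"
      by (simp add: linear_sum[OF ll] linear_scale[OF ll])
    finally show ?thesis using ab bc by simp
  qed
  have "(\<Sum>a\<in>\<Xi>. h (T a) (T a)) = (\<Sum>a\<in>\<Xi>. h (\<Sum>b\<in>\<Xi>. \<kappa> (T a) b *\<^sub>R b) (\<Sum>c\<in>\<Xi>. \<kappa> (T a) c *\<^sub>R c))"
    by (simp only: expand[symmetric])
  also have "\<dots> = (\<Sum>a\<in>\<Xi>. \<Sum>b\<in>\<Xi>. \<Sum>c\<in>\<Xi>. (\<kappa> (T a) b * \<kappa> (T a) c) *\<^sub>R h b c)"
    unfolding linear_sum[OF hl] linear_scale[OF hl]
    unfolding linear_sum[OF hr] linear_scale[OF hr] scaleR_sum_right scaleR_scaleR ..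
  also have "\<dots> = (\<Sum>b\<in>\<Xi>. \<Sum>c\<in>\<Xi>. (\<Sum>a\<in>\<Xi>. \<kappa> (T a) b * \<kappa> (T a) c) *\<^sub>R h b c)"
    unfolding scaleR_sum_left by (subst sum.swap, rule sum.cong[OF refl], rule sum.swap)
  also have "\<dots> = (\<Sum>b\<in>\<Xi>. \<Sum>c\<in>\<Xi>. if b = c then h b c else 0)"
    using dual by (intro sum.cong refl) auto
  also have "\<dots> = (\<Sum>b\<in>\<Xi>. h b b)" using fin by (intro sum.cong) auto
  finally show ?thesis .
qed

section \<open>The derived representation and an invariant inner product\<close>

context compact_rep
begin

abbreviation X :: "'e \<Rightarrow> 'v \<Rightarrow> 'v" where "X \<equiv> lie_rep G A \<rho>"

lemma \<rho>_C1: "Ck_map A 1 (\<lambda>g. \<rho> g v)"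
  using \<rho>_smooth by (simp only: smooth_map_def)

lemma orbit_derivative: "((\<lambda>y. \<rho> (ucinv y) v) has_derivative (\<lambda>\<xi>. X \<xi> v)) (at y0)"
proof -
  have "(((\<lambda>g. \<rho> g v) \<circ> ucinv) has_derivative frechet_derivative ((\<lambda>g. \<rho> g v) \<circ> ucinv) (at y0)) (at y0)"
    by (rule C1_chart_derivative[OF \<rho>_C1 unit_chart(1) y0(1)])
  then show ?thesis unfolding lie_rep_def lvf_def comp_def by simp
qed

lemma X_unique:
  assumes "((\<lambda>y. \<rho> (ucinv y) v) has_derivative D) (at y0)"
  shows "X \<xi> v = D \<xi>"
  using has_derivative_unique[OF orbit_derivative assms] by (rule fun_cong)

lemma linear_X_left: "linear (\<lambda>\<xi>. X \<xi> v)"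
  by (rule has_derivative_linear[OF orbit_derivative])

text \<open>Differentiate the intertwining relation at the unit.\<close>

lemma X_commute:
  assumes "bounded_linear L" "\<And>g x. L (\<rho> g x) = \<rho> g (L x)"
  shows "L (X \<xi> v) = X \<xi> (L v)"
proof -
  have "((\<lambda>y. L (\<rho> (ucinv y) v)) has_derivative (\<lambda>\<xi>. L (X \<xi> v))) (at y0)"
    by (rule bounded_linear.has_derivative[OF assms(1) orbit_derivative])
  then show ?thesis unfolding assms(2) by (rule X_unique[symmetric])
qed

lemma klin_X: "klin (X \<xi>)"
  unfolding klin_def
proof (intro conjI allI)
  fix v w c
  have "((\<lambda>y. \<rho> (ucinv y) v + \<rho> (ucinv y) w) has_derivative (\<lambda>\<xi>. X \<xi> v + X \<xi> w)) (at y0)"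
    by (intro has_derivative_add orbit_derivative)
  then show "X \<xi> (v + w) = X \<xi> v + X \<xi> w"
    unfolding klinD(1)[OF klin_\<rho>, symmetric] by (rule X_unique)
  show "X \<xi> (scal c v) = scal c (X \<xi> v)"
    by (rule X_commute[symmetric, OF bounded_linear_scal]) (simp add: klinD(2)[OF klin_\<rho>])
qed

lemma linear_X: "linear (X \<xi>)" and bounded_linear_X: "bounded_linear (X \<xi>)"
  using klin_linear[OF klin_X] klin_bounded[OF klin_X] by auto

text \<open>In the product \<rho> g (\<rho> (ucinv y) v) only the inner factor depends on
  \<open>y\<close>. Matrix coefficients are therefore closed under left-invariant
  derivatives.\<close>

lemma lvf_matrix_coefficient:
  assumes "bounded_linear \<phi>"
  shows "lvf G A \<xi> (\<lambda>g. \<phi> (\<rho> g v)) g = \<phi> (\<rho> g (X \<xi> v))"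
proof -
  have "((\<lambda>y. \<phi> (\<rho> g (\<rho> (ucinv y) v))) has_derivative (\<lambda>\<xi>. \<phi> (\<rho> g (X \<xi> v)))) (at y0)"
    by (intro bounded_linear.has_derivative[OF assms] bounded_linear.has_derivative[OF bounded_linear_\<rho>] orbit_derivative)
  from frechet_derivative_at[OF this, symmetric] show ?thesis
    unfolding lvf_def \<rho>_mult by (rule fun_cong)
qed

text \<open>The constant \<open>c\<close> is there for densities of the form 1 plus a small
  coefficient.\<close>

lemma matrix_coefficient_smooth:
  assumes "bounded_linear \<phi>"
  shows "smooth_map A (\<lambda>g. c + \<phi> (\<rho> g v))"
  unfolding smooth_map_def
proof
  fix k
  have "Ck_map A k (\<lambda>g. \<rho> g v)" using \<rho>_smooth by (simp only: smooth_map_def)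
  then show "Ck_map A k (\<lambda>g. c + \<phi> (\<rho> g v))" by (intro Ck_map_affine chart(2) assms)
qed

text \<open>Two derivatives of one function at the unit: by the chain rule through conjugation in
  the chart, valid while the conjugate stays in the chart, and by multiplicativity of
  \<rho>.\<close>

lemma X_Ad: "X (Ad G A g \<xi>) v = \<rho> g (X \<xi> (\<rho> (inv g) v))"
proof -
  define N where "N x = snd uc (g \<otimes> ucinv x \<otimes> inv g)" for x
  have N0: "N y0 = y0" by (simp add: N_def y0)
  have "N differentiable at y0" unfolding N_def[abs_def] by (rule Ad_chart_differentiable)
  then have "(N has_derivative Ad G A g) (at y0)"
    unfolding frechet_derivative_works N_def[abs_def] Ad_def[abs_def] .
  moreover have "((\<lambda>y. \<rho> (ucinv y) v) has_derivative (\<lambda>\<xi>. X \<xi> v)) (at (N y0))"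
    unfolding N0 by (rule orbit_derivative)
  ultimately have 1: "((\<lambda>x. \<rho> (ucinv (N x)) v) has_derivative (\<lambda>\<xi>. X (Ad G A g \<xi>) v)) (at y0)"
    by (rule has_derivative_compose)
  have cont: "continuous_on (snd uc ` fst uc) (\<lambda>x. g \<otimes> ucinv x \<otimes> inv g)"
    by (intro continuous_on_mult continuous_on_const uc(7))
  define S where "S = (\<lambda>x. g \<otimes> ucinv x \<otimes> inv g) -` fst uc \<inter> snd uc ` fst uc"
  have "open S"
    unfolding S_def using continuous_on_open_vimage[OF uc(2)] cont uc(1) by blast
  moreover have "y0 \<in> S" using y0 unit_chart(2) by (simp add: S_def)
  moreover have "\<And>z. z \<in> S \<Longrightarrow> g \<otimes> ucinv z \<otimes> inv g \<in> fst uc" by (simp add: S_def)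
  ultimately have S: "open S" "y0 \<in> S" "\<And>z. z \<in> S \<Longrightarrow> g \<otimes> ucinv z \<otimes> inv g \<in> fst uc" by simp_all
  have 2: "((\<lambda>x. \<rho> g (\<rho> (ucinv x) (\<rho> (inv g) v))) has_derivative (\<lambda>\<xi>. X (Ad G A g \<xi>) v)) (at y0)"
  proof (rule has_derivative_transform_within_open[OF 1 S(1,2)])
    fix x assume "x \<in> S"
    then show "\<rho> (ucinv (N x)) v = \<rho> g (\<rho> (ucinv x) (\<rho> (inv g) v))"
      using S(3) by (simp add: N_def uc(3) \<rho>_mult)
  qed
  have 3: "((\<lambda>x. \<rho> g (\<rho> (ucinv x) (\<rho> (inv g) v))) has_derivative (\<lambda>\<xi>. \<rho> g (X \<xi> (\<rho> (inv g) v)))) (at y0)"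
    by (rule bounded_linear.has_derivative[OF bounded_linear_\<rho> orbit_derivative])
  show ?thesis using has_derivative_unique[OF 2 3] by (rule fun_cong)
qed

text \<open>Weyl's trick, with a real-valued form for complex scalars too. A further factor \<rho> h
  is absorbed on the right of the group variable, hence the appeal to right invariance.\<close>

lemma invariant_inner_product:
  "\<exists>ip :: 'v \<Rightarrow> 'v \<Rightarrow> real. bounded_bilinear ip \<and> (\<forall>x y. ip x y = ip y x) \<and> (\<forall>x. x \<noteq> 0 \<longrightarrow> ip x x > 0) \<and>
     (\<forall>g x y. ip (\<rho> g x) (\<rho> g y) = ip x y)"
proof -
  obtain B :: "'v set" where B: "finite B" "independent B" "span B = UNIV"
    using fin_dim_basis[OF fin_dim_V] .
  define ip0 where "ip0 x y = (\<Sum>b\<in>B. representation B x b * representation B y b)" for x y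
  note rep_bl = representation_bounded_linear[OF B(2,3) fin_dim_V]
  have rep_lin: "representation B (x + y) b = representation B x b + representation B y b"
    "representation B (r *\<^sub>R x) b = r * representation B x b" for x y r b
    using linear_add[OF bounded_linear.linear[OF rep_bl]] linear_scale[OF bounded_linear.linear[OF rep_bl]] by auto
  define ip where "ip x y = (\<integral>g. ip0 (\<rho> g x) (\<rho> g y) \<partial>\<mu>)" for x y
  have cont: "continuous_on UNIV (\<lambda>g. ip0 (\<rho> g x) (\<rho> g y))" for x y
    unfolding ip0_def
    by (intro continuous_on_sum continuous_on_mult' bounded_linear.continuous_on[OF rep_bl] continuous_\<rho>)
  note int = continuous_integrable[OF cont]
  have add: "ip0 (x + x') y = ip0 x y + ip0 x' y" and scale: "ip0 (r *\<^sub>R x) y = r * ip0 x y"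
    and sym0: "ip0 x y = ip0 y x" for x x' y r
    by (simp_all add: ip0_def rep_lin sum.distrib sum_distrib_left algebra_simps)
  have sym: "ip x y = ip y x" for x y by (simp add: ip_def sym0)
  have lin: "linear (\<lambda>x. ip x y)" for y
    by (rule linearI) (use int in \<open>simp_all add: ip_def linear_add[OF linear_\<rho>] linear_scale[OF linear_\<rho>] add scale\<close>)
  have lin': "linear (ip x)" for x using lin[of x] by (simp add: sym[of _ x])
  have bb: "bounded_bilinear ip" by (rule fin_dim_bilinear_bounded[OF fin_dim_V lin lin'])
  have inv: "ip (\<rho> h x) (\<rho> h y) = ip x y" for h x y
    using right_invariant[OF cont[of x y], of h] by (simp add: ip_def \<rho>_mult)
  have pos0: "ip0 x x > 0" if "x \<noteq> 0" for x
  proof -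
    have "\<exists>b\<in>B. representation B x b \<noteq> 0"
    proof (rule ccontr)
      assume "\<not> ?thesis"
      then have "(\<Sum>b\<in>B. representation B x b *\<^sub>R b) = 0" by simp
      then show False using that B by (simp add: sum_representation_eq)
    qed
    then obtain b where b: "b \<in> B" "representation B x b \<noteq> 0" by (rule bexE)
    have "0 < representation B x b * representation B x b"
      using b(2) by (simp add: zero_less_mult_iff linorder_neq_iff[symmetric])
    then show ?thesis unfolding ip0_def by (rule sum_pos2[OF B(1) b(1)]) simp
  qed
  have pos: "ip x x > 0" if "x \<noteq> 0" for x
  proof -
    have p: "ip0 (\<rho> g x) (\<rho> g x) > 0" for g
    proof (rule pos0)
      show "\<rho> g x \<noteq> 0"
      proof
        assume "\<rho> g x = 0"
        then have "\<rho> (inv g) (\<rho> g x) = 0" by (simp only: linear_0[OF linear_\<rho>])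
        then show False using that by simp
      qed
    qed
    have "ip x x \<noteq> 0"
    proof
      assume "ip x x = 0"
      then have "AE g in \<mu>. ip0 (\<rho> g x) (\<rho> g x) = 0"
        unfolding ip_def using integral_nonneg_eq_0_iff_AE[OF int] p by (simp add: less_imp_le)
      then have "AE g in \<mu>. False" using p by (auto simp: less_le)
      then show False by simp
    qed
    moreover have "ip x x \<ge> 0" unfolding ip_def using p by (intro integral_nonneg_AE) (simp add: less_imp_le)
    ultimately show ?thesis by simp
  qed
  show ?thesis by (intro exI[of _ ip] conjI allI impI bb sym pos inv)
qed

end

text \<open>The first-order condition at an extremum, phrased without derivatives.\<close>

lemma quadratic_nonneg_linear_zero:
  fixes b c :: real
  assumes "\<And>t. 0 \<le> 2 * t * b + t\<^sup>2 * c"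
  shows "b = 0"
proof (rule ccontr)
  assume "b \<noteq> 0"
  \<comment> \<open>Positive and larger than \<open>c\<close>, so that at the point
    \<open>- b / d\<close> the linear term outweighs the quadratic one.\<close>
  define d where "d = \<bar>c\<bar> + 1"
  have d: "d > 0" "c < d" by (auto simp: d_def)
  have "0 \<le> 2 * (- b / d) * b + (- b / d)\<^sup>2 * c" by (rule assms)
  also have "\<dots> = (b\<^sup>2 / d) * (c / d - 2)" using d by (simp add: power2_eq_square field_simps)
  also have "\<dots> < 0"
  proof (rule mult_pos_neg)
    show "b\<^sup>2 / d > 0" using d \<open>b \<noteq> 0\<close> by simp
    have "c / d < 1" using d by simp
    then show "c / d - 2 < 0" by linarith
  qed
  finally show False by simp
qed

locale casimir_rep = compact_rep G A \<mu> scal \<rho>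
  for G :: "'g::{second_countable_topology,t2_space} monoid" (structure)
    and A :: "('g, 'e::real_normed_vector) chart set" and \<mu>
    and scal :: "'k::{real_normed_field,euclidean_space} \<Rightarrow> 'v::{banach,second_countable_topology} \<Rightarrow> 'v"
    and \<rho> :: "'g \<Rightarrow> 'v \<Rightarrow> 'v" +
  fixes \<kappa> :: "'e \<Rightarrow> 'e \<Rightarrow> real" and \<Xi> :: "'e set"
  assumes conn: "connected (UNIV :: 'g set)"
    and Ad_inv: "Ad_invariant_inner G A \<kappa>"
    and on: "orthonormal_basis \<kappa> \<Xi>"
begin

abbreviation Cas :: "'v \<Rightarrow> 'v" where "Cas \<equiv> casimir_op G A \<Xi> \<rho>"

lemma finite_basis: "finite \<Xi>" and span_basis: "span \<Xi> = UNIV"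
  using on by (simp_all add: orthonormal_basis_def)

text \<open>Kept general in \<open>L\<close>, so as to cover scalar multiplications, invariant
  projections and equivalences extended by a projection.\<close>

lemma Cas_commute:
  assumes L: "bounded_linear L" "\<And>g x. L (\<rho> g x) = \<rho> g (L x)"
  shows "L (Cas v) = Cas (L v)"
  unfolding casimir_op_def linear_sum[OF bounded_linear.linear[OF L(1)]] X_commute[OF L] ..

lemma klin_Cas: "klin Cas"
  unfolding klin_def
proof (intro conjI allI)
  fix v w c
  show "Cas (v + w) = Cas v + Cas w"
    by (simp add: casimir_op_def klinD(1)[OF klin_X] sum.distrib)
  show "Cas (scal c v) = scal c (Cas v)"
    by (rule Cas_commute[symmetric, OF bounded_linear_scal]) (simp add: klinD(2)[OF klin_\<rho>])
qed

text \<open>Conjugating by \<rho> g replaces the basis by its image under \<open>Ad\<close>. By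
  invariance of \<kappa> this image is again orthonormal, and the contraction does not see the
  change.\<close>

lemma Cas_\<rho>: "Cas (\<rho> g v) = \<rho> g (Cas v)"
proof -
  define w where "w = \<rho> g v"
  note I = Ad_inv[unfolded Ad_invariant_inner_def]
  note bil = conjunct1[OF I] conjunct1[OF conjunct2[OF I], rule_format]
    conjunct1[OF conjunct2[OF conjunct2[OF I]], rule_format]
    conjunct2[OF conjunct2[OF conjunct2[OF I]], rule_format]
  have "linear (\<lambda>\<eta>. X \<xi> (X \<eta> w))" for \<xi>
    using linear_compose[OF linear_X_left[of w] linear_X[of \<xi>]] by (simp only: comp_def)
  then have h: "bilinear (\<lambda>\<xi> \<eta>. X \<xi> (X \<eta> w))"
    unfolding bilinear_def using linear_X_left by simp
  have "(\<Sum>a\<in>\<Xi>. X (Ad G A g a) (X (Ad G A g a) w)) = (\<Sum>a\<in>\<Xi>. X a (X a w))"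
    by (rule orthonormal_contraction[OF bil(1) _ _ on _ h], rule bil(2), erule bil(3), rule bil(4))
  then  have "Cas w = (\<Sum>a\<in>\<Xi>. X (Ad G A g a) (X (Ad G A g a) w))" by (simp add: casimir_op_def)
  also have "\<dots> = (\<Sum>a\<in>\<Xi>. \<rho> g (X a (X a v)))" by (simp add: X_Ad w_def)
  also have "\<dots> = \<rho> g (Cas v)" by (simp add: casimir_op_def linear_sum[OF linear_\<rho>])
  finally show ?thesis by (simp add: w_def)
qed

text \<open>A vector annihilated by the Lie algebra is fixed near the unit, hence its stabilizer is an
  open subgroup.\<close>
lemma invariant_if_annihilated:
  assumes "\<And>a. a \<in> \<Xi> \<Longrightarrow> X a v = 0"
  shows "\<rho> g v = v"
proof -
  have X0: "X \<xi> v = 0" for \<xi>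
  proof -
    have "\<xi> \<in> span \<Xi>" by (simp add: span_basis)
    then show ?thesis
    proof (induction rule: span_induct_alt)
      case base show ?case by (rule linear_0[OF linear_X_left])
    next
      case (step c x y)
      then show ?case using assms[of x] by (simp add: linear_add[OF linear_X_left] linear_scale[OF linear_X_left])
    qed
  qed
  \<comment> \<open>Transport the vanishing derivative from the unit: near \<open>y\<close>,
    \<open>ucinv z\<close> is \<open>h\<close> times \<open>ucinv (N z)\<close>, and
    \<open>N\<close> sends \<open>y\<close> to \<open>y0\<close>.\<close>
  have der: "((\<lambda>y. \<rho> (ucinv y) v) has_derivative (\<lambda>_. 0)) (at y)" if y: "y \<in> snd uc ` fst uc" for y
  proof -
    define h where "h = ucinv y"
    define N where "N z = snd uc (inv h \<otimes> ucinv z)" for z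
    have hy: "inv h \<otimes> ucinv y = \<one>" by (simp add: h_def)
    have Ny: "N y = y0" by (simp add: N_def hy)
    have "N differentiable at y"
      unfolding N_def[abs_def]
      by (rule left_translation_differentiable[OF unit_chart(1) unit_chart(1) y]) (simp add: hy unit_chart(2))
    then have "(N has_derivative frechet_derivative N (at y)) (at y)" by (simp only: frechet_derivative_works)
    moreover have "((\<lambda>z. \<rho> (ucinv z) v) has_derivative (\<lambda>_. 0)) (at (N y))"
      unfolding Ny using orbit_derivative[of v] by (simp only: X0)
    ultimately have "((\<lambda>z. \<rho> (ucinv (N z)) v) has_derivative (\<lambda>_. 0)) (at y)"
      by (rule has_derivative_compose)
    from bounded_linear.has_derivative[OF bounded_linear_\<rho>[of h] this]
    have d: "((\<lambda>z. \<rho> h (\<rho> (ucinv (N z)) v)) has_derivative (\<lambda>_. 0)) (at y)"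
      by (simp add: linear_0[OF linear_\<rho>])
    define S where "S = (\<lambda>z. inv h \<otimes> ucinv z) -` fst uc \<inter> snd uc ` fst uc"
    have cont: "continuous_on (snd uc ` fst uc) (\<lambda>z. inv h \<otimes> ucinv z)"
      by (intro continuous_on_mult continuous_on_const uc(7))
    have S: "open S"
      unfolding S_def using continuous_on_open_vimage[OF uc(2)] cont uc(1) by blast
    have yS: "y \<in> S" using y by (simp add: S_def hy unit_chart(2))
    show ?thesis
    proof (rule has_derivative_transform_within_open[OF d S yS])
      fix z assume "z \<in> S"
      then show "\<rho> h (\<rho> (ucinv (N z)) v) = \<rho> (ucinv z) v"
        by (simp add: S_def N_def uc(3) \<rho>_mult)
    qed
  qed
  obtain r where r: "r > 0" "ball y0 r \<subseteq> snd uc ` fst uc"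
    using uc(2) y0(1) open_contains_ball by blast
  have fixed: "\<rho> (ucinv y) v = v" if y: "y \<in> ball y0 r" for y
  proof -
    have "\<exists>c. \<forall>x\<in>ball y0 r. \<rho> (ucinv x) v = c"
    proof (rule has_derivative_zero_constant)
      show "convex (ball y0 r)" by (rule convex_ball)
      fix x assume "x \<in> ball y0 r"
      then have "x \<in> snd uc ` fst uc" using r(2) by (rule subsetD[rotated])
      from der[OF this] show "((\<lambda>y. \<rho> (ucinv y) v) has_derivative (\<lambda>h. 0)) (at x within ball y0 r)"
        by (rule has_derivative_at_withinI)
    qed
    then obtain c where c: "\<And>x. x \<in> ball y0 r \<Longrightarrow> \<rho> (ucinv x) v = c" by blast
    have "\<rho> (ucinv y0) v = c" using r(1) by (intro c) simp
    then show ?thesis using c[OF y] by (simp add: y0(2))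
  qed
  define N where "N = snd uc -` ball y0 r \<inter> fst uc"
  have N: "open N"
    unfolding N_def using continuous_on_open_vimage[OF uc(1), of "snd uc"] uc(6) by simp
  have N1: "\<one> \<in> N" using r(1) unit_chart(2) by (simp add: N_def)
  define H where "H = {h. \<rho> h v = v}"
  have NH: "N \<subseteq> H"
  proof
    fix h assume h: "h \<in> N"
    then have "\<rho> (ucinv (snd uc h)) v = v" by (intro fixed) (simp add: N_def)
    then show "h \<in> H" using h by (simp add: H_def N_def uc(3))
  qed
  define T where "T h = (\<lambda>x. inv h \<otimes> x) -` N" for h
  have T: "open (T h)" "h \<in> T h" for h
    unfolding T_def using N N1 by (auto intro!: open_vimage continuous_on_mult continuous_on_id continuous_on_const)
  \<comment> \<open>Membership in the stabilizer is constant on the neighbourhood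
    \<open>T h\<close>, the left translate of \<open>N\<close> by \<open>h\<close>; hence
    \<open>H\<close> and its complement are both open.\<close>
  have inH: "(x \<in> H) = (h \<in> H)" if "x \<in> T h" for x h
  proof -
    have "inv h \<otimes> x \<in> H" using that NH by (auto simp: T_def)
    then have n: "\<rho> (inv h) (\<rho> x v) = v" by (simp add: H_def \<rho>_mult)
    then have "\<rho> h (\<rho> (inv h) (\<rho> x v)) = \<rho> h v" by simp
    then have "\<rho> x v = \<rho> h v" by simp
    then show ?thesis by (simp add: H_def)
  qed
  have "open H"
  proof (rule open_subopen[THEN iffD2], rule ballI)
    fix h assume "h \<in> H"
    have "T h \<subseteq> H"
    proof
      fix x assume "x \<in> T h"
      from inH[OF this] show "x \<in> H" using \<open>h \<in> H\<close> by (rule iffD2)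
    qed
    with T[of h] show "\<exists>T. open T \<and> h \<in> T \<and> T \<subseteq> H" by (intro exI[of _ "T h"] conjI)
  qed
  moreover have "open (- H)"
  proof (rule open_subopen[THEN iffD2], rule ballI)
    fix h assume "h \<in> - H"
    have "T h \<subseteq> - H"
    proof
      fix x assume "x \<in> T h"
      from inH[OF this] show "x \<in> - H" using \<open>h \<in> - H\<close> by simp
    qed
    with T[of h] show "\<exists>T. open T \<and> h \<in> T \<and> T \<subseteq> - H" by (intro exI[of _ "T h"] conjI)
  qed
  ultimately have "H = {} \<or> H = UNIV"
    using conn connected_clopen[where 'a='g] by (simp add: closed_def)
  moreover have "\<one> \<in> H" by (simp add: H_def)
  ultimately have "g \<in> H" by auto
  then show ?thesis by (simp add: H_def)
qed

text \<open>Differentiate the constant function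
  \<open>ip (\<rho> (ucinv z) x) (\<rho> (ucinv z) y)\<close> at the unit.\<close>

lemma X_skew:
  assumes bb: "bounded_bilinear ip" and inv: "\<And>g x y. ip (\<rho> g x) (\<rho> g y) = ip x y"
  shows "ip (X \<xi> x) y + ip x (X \<xi> y) = (0 :: real)"
proof -
  have "((\<lambda>z. ip (\<rho> (ucinv z) x) (\<rho> (ucinv z) y)) has_derivative
     (\<lambda>\<xi>. ip (\<rho> (ucinv y0) x) (X \<xi> y) + ip (X \<xi> x) (\<rho> (ucinv y0) y))) (at y0)"
    by (rule bounded_bilinear.FDERIV[OF bb orbit_derivative orbit_derivative])
  then have "((\<lambda>z. ip x y) has_derivative (\<lambda>\<xi>. ip x (X \<xi> y) + ip (X \<xi> x) y)) (at y0)"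
    unfolding inv y0(2) \<rho>_one .
  from has_derivative_unique[OF this has_derivative_const]
  have "ip x (X \<xi> y) + ip (X \<xi> x) y = 0" by (rule fun_cong)
  then show ?thesis by simp
qed

text \<open>The expression on the right yields at once symmetry and non-positivity of the Casimir
  operator and its kernel.\<close>

lemma Cas_form:
  assumes bb: "bounded_bilinear ip" and inv: "\<And>g x y. ip (\<rho> g x) (\<rho> g y) = ip x y"
  shows "ip (Cas x) y = - (\<Sum>a\<in>\<Xi>. ip (X a x) (X a y) :: real)"
proof -
  have "ip (Cas x) y = (\<Sum>a\<in>\<Xi>. ip (X a (X a x)) y)"
    unfolding casimir_op_def by (rule bounded_bilinear.sum_left[OF bb])
  also have "\<dots> = (\<Sum>a\<in>\<Xi>. - ip (X a x) (X a y))"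
    using X_skew[OF bb inv] by (intro sum.cong refl) (simp add: eq_neg_iff_add_eq_0)
  finally show ?thesis by (simp add: sum_negf)
qed

text \<open>In an invariant inner product the sum of the square lengths of all \<open>X a x\<close>
  vanishes, so the Lie algebra annihilates \<open>x\<close>.\<close>

lemma Cas_zero_invariant:
  assumes "Cas x = 0"
  shows "\<rho> g x = x"
proof (rule invariant_if_annihilated)
  fix a assume a: "a \<in> \<Xi>"
  obtain ip :: "'v \<Rightarrow> 'v \<Rightarrow> real" where ip: "bounded_bilinear ip" "\<forall>x y. ip x y = ip y x"
    "\<forall>x. x \<noteq> 0 \<longrightarrow> ip x x > 0" "\<forall>g x y. ip (\<rho> g x) (\<rho> g y) = ip x y"
    using invariant_inner_product by (elim exE conjE)
  have nn: "ip z z \<ge> 0" for z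
    using ip(3) bounded_bilinear.zero_left[OF ip(1)] by (cases "z = 0") (auto simp: less_imp_le)
  have "(\<Sum>a\<in>\<Xi>. ip (X a x) (X a x)) = 0"
    using Cas_form[OF ip(1) ip(4)[rule_format], of x x] assms bounded_bilinear.zero_left[OF ip(1)] by simp
  then have "ip (X a x) (X a x) = 0"
    using sum_nonneg_eq_0_iff[OF finite_basis, of "\<lambda>a. ip (X a x) (X a x)"] nn a by simp
  then show "X a x = 0" using ip(3) by fastforce
qed

text \<open>A maximum of the Rayleigh quotient over \<open>U\<close> supplies an eigenvector with
  real eigenvalue for real and complex scalars alike; its eigenspace in \<open>U\<close> is a
  nonzero subrepresentation and so all of \<open>U\<close>.\<close>

lemma irreducible_Cas_scalar:
  assumes U: "irreducible_subrep scal \<rho> U"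
  shows "\<exists>c\<le>0. \<forall>x\<in>U. Cas x = c *\<^sub>R x"
proof -
  have sU: "subrep scal \<rho> U" "U \<noteq> {0}" and min: "\<And>U'. subrep scal \<rho> U' \<Longrightarrow> U' \<subseteq> U \<Longrightarrow> U' = {0} \<or> U' = U"
    using U by (simp_all add: irreducible_subrep_def)
  obtain p where p: "equivariant p" "\<forall>x. p x \<in> U" "\<forall>x\<in>U. p x = x"
    using equivariant_projection[OF sU(1)] by (elim exE conjE)
  have pl: "bounded_linear p" "linear p" "\<And>g x. p (\<rho> g x) = \<rho> g (p x)"
    using p(1) klin_bounded klin_linear by (simp_all add: equivariant_def)
  have Cl: "linear Cas" "bounded_linear Cas" using klin_linear[OF klin_Cas] klin_bounded[OF klin_Cas] by auto
  \<comment> \<open>Instead of following derivatives of orbits inside \<open>U\<close>, use that the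
    projection onto \<open>U\<close> commutes with the Casimir operator.\<close>
  have CU: "Cas x \<in> U" if "x \<in> U" for x
  proof -
    have "p (Cas x) = Cas (p x)" by (rule Cas_commute[OF pl(1,3)])
    then have "p (Cas x) = Cas x" using p(3) that by simp
    then show ?thesis using p(2)[rule_format, of "Cas x"] by simp
  qed
  obtain ip :: "'v \<Rightarrow> 'v \<Rightarrow> real" where ip: "bounded_bilinear ip" "\<forall>x y. ip x y = ip y x"
    "\<forall>x. x \<noteq> 0 \<longrightarrow> ip x x > 0" "\<forall>g x y. ip (\<rho> g x) (\<rho> g y) = ip x y"
    using invariant_inner_product by (elim exE conjE)
  note form = Cas_form[OF ip(1) ip(4)[rule_format]]
  note bl = bounded_bilinear.add_left[OF ip(1)] bounded_bilinear.add_right[OF ip(1)]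
    bounded_bilinear.scaleR_left[OF ip(1)] bounded_bilinear.scaleR_right[OF ip(1)]
    bounded_bilinear.diff_left[OF ip(1)] bounded_bilinear.zero_left[OF ip(1)]
  have nn: "ip z z \<ge> 0" for z
    using ip(3) bl(6) by (cases "z = 0") (auto simp: less_imp_le)
  have Csym: "ip (Cas x) y = ip x (Cas y)" for x y
  proof -
    have "ip x (Cas y) = ip (Cas y) x" using ip(2) by simp
    also have "\<dots> = - (\<Sum>a\<in>\<Xi>. ip (X a x) (X a y))"
      unfolding form using ip(2) by simp
    finally show ?thesis by (simp add: form)
  qed
  \<comment> \<open>The sphere of the given norm suffices because the quotient is homogeneous of
    degree 0. Describing \<open>U\<close> as the fixed set of \<open>p\<close> shows
    closedness.\<close>
  define S where "S = {x. p x = x \<and> norm x = 1}"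
  have UpS: "x \<in> U \<longleftrightarrow> p x = x" for x
    using p(2)[rule_format, of x] p(3)[rule_format, of x] by auto
  have "compact S"
  proof (rule fin_dim_bounded_closed_compact[OF fin_dim_V])
    show "bounded S" by (auto simp: S_def bounded_iff)
    have "closed {x. p x = x}"
      by (rule closed_Collect_eq[OF bounded_linear.continuous_on[OF pl(1) continuous_on_id] continuous_on_id])
    moreover have "closed {x :: 'v. norm x = 1}"
      by (rule closed_Collect_eq[OF continuous_on_norm_id continuous_on_const])
    ultimately have "closed ({x. p x = x} \<inter> {x. norm x = 1})" by (rule closed_Int)
    then show "closed S" by (simp add: S_def Collect_conj_eq)
  qed
  moreover have "S \<noteq> {}"
  proof -
    obtain x where x: "x \<in> U" "x \<noteq> 0" using sU subrep_zero[OF sU(1)] by blast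
    have "p ((1 / norm x) *\<^sub>R x) = (1 / norm x) *\<^sub>R x"
      using x(1) by (simp add: linear_scale[OF pl(2)] UpS)
    then have "(1 / norm x) *\<^sub>R x \<in> S" using x(2) by (simp add: S_def)
    then show ?thesis by blast
  qed
  moreover have "continuous_on S (\<lambda>x. ip (Cas x) x / ip x x)"
  proof (rule continuous_on_divide)
    show "continuous_on S (\<lambda>x. ip (Cas x) x)"
      by (rule bounded_bilinear.continuous_on[OF ip(1) bounded_linear.continuous_on[OF Cl(2) continuous_on_id] continuous_on_id])
    show "continuous_on S (\<lambda>x. ip x x)"
      by (rule bounded_bilinear.continuous_on[OF ip(1) continuous_on_id continuous_on_id])
    show "\<forall>x\<in>S. ip x x \<noteq> 0"
    proof
      fix x assume "x \<in> S"
      then have "x \<noteq> 0" by (auto simp: S_def)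
      then show "ip x x \<noteq> 0" using ip(3) by fastforce
    qed
  qed
  ultimately obtain x0 where x0: "x0 \<in> S" "\<And>x. x \<in> S \<Longrightarrow> ip (Cas x) x / ip x x \<le> ip (Cas x0) x0 / ip x0 x0"
    using continuous_attains_sup[of S "\<lambda>x. ip (Cas x) x / ip x x"] by auto
  define c where "c = ip (Cas x0) x0 / ip x0 x0"
  have x0U: "x0 \<in> U" "x0 \<noteq> 0" using x0(1) by (auto simp: S_def UpS)
  have ip0: "ip x0 x0 > 0" using ip(3) x0U(2) by simp
  have c0: "c \<le> 0"
    unfolding c_def form using nn ip0 by (intro divide_nonpos_pos) (auto intro!: sum_nonneg)
  have max: "ip (Cas x) x \<le> c * ip x x" if x: "x \<in> U" for x
  proof (cases "x = 0")
    case True then show ?thesis by (simp add: bl linear_0[OF Cl(1)])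
  next
    case False
    define y where "y = (1 / norm x) *\<^sub>R x"
    have "p y = y" using x by (simp add: y_def linear_scale[OF pl(2)] UpS)
    then have "y \<in> S" using False by (simp add: S_def y_def)
    then have 1: "ip (Cas y) y / ip y y \<le> c" using x0(2) by (simp add: c_def)
    have "y \<noteq> 0" using False by (simp add: y_def)
    then have "ip y y > 0" using ip(3) by simp
    with 1 have 2: "ip (Cas y) y \<le> c * ip y y" by (simp add: divide_le_eq)
    have xy: "x = norm x *\<^sub>R y" using False by (simp add: y_def)
    have "ip (Cas x) x = (norm x)\<^sup>2 * ip (Cas y) y" "ip x x = (norm x)\<^sup>2 * ip y y"
      by (subst (1 2) xy, simp add: linear_scale[OF Cl(1)] bl power2_eq_square)+
    then show ?thesis using mult_left_mono[OF 2, of "(norm x)\<^sup>2"] by (simp add: mult_ac)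
  qed
  \<comment> \<open>Perturb the maximiser to \<open>x0 + t *\<^sub>R y\<close>: by symmetry the
    coefficient of \<open>2 * t\<close> is the inner product in question.\<close>
  have orth: "ip (c *\<^sub>R x0 - Cas x0) y = 0" if y: "y \<in> U" for y
  proof (rule quadratic_nonneg_linear_zero)
    fix t :: real
    define z where "z = x0 + t *\<^sub>R y"
    have "z \<in> U" using x0U(1) y by (simp add: UpS z_def linear_add[OF pl(2)] linear_scale[OF pl(2)])
    from max[OF this] have "0 \<le> c * ip z z - ip (Cas z) z" by simp
    also have "c * ip z z = c * ip x0 x0 + 2 * t * (c * ip x0 y) + t\<^sup>2 * (c * ip y y)"
      using ip(2)[rule_format, of y x0] by (simp add: z_def bl power2_eq_square algebra_simps)
    also have "ip (Cas z) z = ip (Cas x0) x0 + 2 * t * ip (Cas x0) y + t\<^sup>2 * ip (Cas y) y"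
      using ip(2)[rule_format, of y "Cas x0"] Csym[of y x0]
      by (simp add: z_def linear_add[OF Cl(1)] linear_scale[OF Cl(1)] bl power2_eq_square algebra_simps)
    also have "ip (Cas x0) x0 = c * ip x0 x0" using ip0 by (simp add: c_def)
    finally show "0 \<le> 2 * t * ip (c *\<^sub>R x0 - Cas x0) y + t\<^sup>2 * (c * ip y y - ip (Cas y) y)"
      by (simp add: bl algebra_simps)
  qed
  have eig: "Cas x0 = c *\<^sub>R x0"
  proof -
    have "c *\<^sub>R x0 - Cas x0 \<in> U"
      using x0U(1) CU[OF x0U(1)] by (simp add: UpS linear_diff[OF pl(2)] linear_scale[OF pl(2)])
    from orth[OF this] have "c *\<^sub>R x0 - Cas x0 = 0" using ip(3) by fastforce
    then show ?thesis by simp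
  qed
  \<comment> \<open>Written with \<open>scal\<close> in place of the real scaling, so that linearity
    over the field and equivariance are immediate.\<close>
  define L where "L x = Cas x + scal (of_real (- c)) x" for x
  have "equivariant L"
    unfolding equivariant_def klin_def
  proof (intro conjI allI)
    fix x y d g
    show "L (x + y) = L x + L y"
      by (simp add: L_def klinD(1)[OF klin_Cas] vs.scale_right_distrib)
    show "L (scal d x) = scal d (L x)"
      by (simp only: L_def klinD(2)[OF klin_Cas] vs.scale_right_distrib vs.scale_left_commute[of "of_real (- c)" d])
    show "L (\<rho> g x) = \<rho> g (L x)"
      by (simp only: L_def Cas_\<rho> klinD[OF klin_\<rho>])
  qed
  from subrep_kernel[OF this sU(1)] have "{x \<in> U. L x = 0} = {0} \<or> {x \<in> U. L x = 0} = U"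
    by (rule min) simp
  moreover have "x0 \<in> {x \<in> U. L x = 0}" using x0U(1) eig by (simp add: L_def scal_of_real[of "- c"] del: of_real_minus)
  ultimately have "{x \<in> U. L x = 0} = U" using x0U(2) by auto
  then have "Cas x = c *\<^sub>R x" if "x \<in> U" for x
  proof -
    have "L x = 0" using that \<open>{x \<in> U. L x = 0} = U\<close> by auto
    then show ?thesis by (simp add: L_def scal_of_real[of "- c"] del: of_real_minus)
  qed
  then show ?thesis using c0 by auto
qed

text \<open>An equivalence \<open>L\<close> lives only on \<open>U\<close>; composed with the
  projection it becomes an intertwiner of the whole space, and these commute with the Casimir
  operator.\<close>

lemma isotypic_Cas_scalar:
  assumes t: "\<tau> \<in> irr_classes scal \<rho>" and U: "U \<in> \<tau>" and c: "\<And>x. x \<in> U \<Longrightarrow> Cas x = c *\<^sub>R x"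
    and v: "v \<in> isotypic scal \<tau>"
  shows "Cas v = c *\<^sub>R v"
proof -
  have sU: "subrep scal \<rho> U" using U irr_class_members(1)[OF t] Irr_subrep by blast
  obtain p where p: "equivariant p" "\<forall>x. p x \<in> U" "\<forall>x\<in>U. p x = x"
    using equivariant_projection[OF sU] by (elim exE conjE)
  have pk: "klin p" "\<And>g x. p (\<rho> g x) = \<rho> g (p x)" using p(1) by (simp_all add: equivariant_def)
  have member: "Cas y = c *\<^sub>R y" if U': "U' \<in> \<tau>" and y: "y \<in> U'" for U' y
  proof -
    have "equivalent_subreps scal \<rho> U U'" by (rule irr_class_members(3)[OF t U U'])
    then obtain L where L: "(\<forall>x\<in>U. \<forall>y\<in>U. L (x + y) = L x + L y) \<and>
      (\<forall>c. \<forall>x\<in>U. L (scal c x) = scal c (L x)) \<and> bij_betw L U U' \<and> (\<forall>g. \<forall>x\<in>U. L (\<rho> g x) = \<rho> g (L x))"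
      unfolding equivalent_subreps_def by (elim exE)
    define K where "K x = L (p x)" for x
    have kK: "klin K"
      unfolding klin_def K_def klinD[OF pk(1)] using L p(2) by simp
    have "K (Cas x) = Cas (K x)" for x
      by (rule Cas_commute[OF klin_bounded[OF kK]]) (use L p(2) in \<open>simp add: K_def pk(2)\<close>)
    moreover obtain x where x: "x \<in> U" "L x = y"
      using L y unfolding bij_betw_def by blast
    ultimately have "Cas y = K (Cas x)" using p(3) by (simp add: K_def)
    also have "\<dots> = c *\<^sub>R K x" using c[OF x(1)] linear_scale[OF klin_linear[OF kK]] by simp
    finally show ?thesis using x p(3) by (simp add: K_def)
  qed
  from v show ?thesis unfolding isotypic_def
  proof (induction rule: vs.span_induct_alt)
    case base show ?case by (simp add: linear_0[OF klin_linear[OF klin_Cas]])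
  next
    case (step k x y)
    then obtain U' where "U' \<in> \<tau>" "x \<in> U'" by blast
    then have "Cas x = c *\<^sub>R x" by (rule member)
    then show ?case using step(2)
      by (simp add: klinD[OF klin_Cas] scaleR_add_right linear_scale[OF linear_scal])
  qed
qed

section \<open>Integration by parts and the constant of a class\<close>

lemma weighted_integral_linear:
  assumes h: "continuous_on UNIV (h :: 'g \<Rightarrow> real)"
  shows "bounded_linear (\<lambda>w. \<integral>g. h g *\<^sub>R \<rho> g w \<partial>\<mu>)" "integrable \<mu> (\<lambda>g. h g *\<^sub>R \<rho> g w)"
proof -
  have c: "continuous_on UNIV (\<lambda>g. h g *\<^sub>R \<rho> g w)" for w
    by (intro continuous_on_scaleR h continuous_\<rho>)
  show "integrable \<mu> (\<lambda>g. h g *\<^sub>R \<rho> g w)" by (rule continuous_integrable[OF c])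
  have k: "klin (\<lambda>w. h g *\<^sub>R \<rho> g w)" for g
    unfolding klin_def
    by (simp add: klinD[OF klin_\<rho>] scaleR_add_right linear_scale[OF linear_scal])
  show "bounded_linear (\<lambda>w. \<integral>g. h g *\<^sub>R \<rho> g w \<partial>\<mu>)"
    by (rule klin_bounded[OF klin_integral[OF c k]])
qed

text \<open>With \<open>u\<close> the curve point,
  \<open>\<rho> (inv u) w - w = - \<rho> (inv u) (\<rho> u w - w)\<close>. The quotient of the last
  bracket tends to \<open>X \<xi> w\<close> and \<open>inv u\<close> to the unit, and the action is
  jointly continuous.\<close>

lemma orbit_difference_quotient:
  assumes s: "s \<longlonglongrightarrow> 0" "\<And>n. s n > 0"
  shows "(\<lambda>n. (1 / s n) *\<^sub>R (\<rho> (inv (unit_curve \<xi> (s n))) w - w)) \<longlonglongrightarrow> - X \<xi> w"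
proof -
  have sx: "(\<lambda>n. y0 + s n *\<^sub>R \<xi>) \<longlonglongrightarrow> y0 + 0 *\<^sub>R \<xi>"
    by (intro tendsto_add tendsto_scaleR tendsto_const s(1))
  have "\<forall>y\<in>snd uc ` fst uc. continuous (at y) ucinv"
    using uc(7) unfolding continuous_on_eq_continuous_at[OF uc(2)] .
  then have "continuous (at y0) ucinv" using y0(1) by (rule bspec)
  then have "(\<lambda>n. ucinv (y0 + s n *\<^sub>R \<xi>)) \<longlonglongrightarrow> ucinv y0"
    using sx by (intro isCont_tendsto_compose[of y0 ucinv]) simp_all
  then have g1: "(\<lambda>n. unit_curve \<xi> (s n)) \<longlonglongrightarrow> \<one>" by (simp add: unit_curve_def y0(2))
  have "continuous (at \<one>) (\<lambda>x. inv x)"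
    using continuous_inv by (simp add: continuous_on_eq_continuous_at)
  from isCont_tendsto_compose[OF this g1] have g2: "(\<lambda>n. inv (unit_curve \<xi> (s n))) \<longlonglongrightarrow> inv \<one>" .
  have "((\<lambda>r. y0 + r *\<^sub>R \<xi>) has_derivative (\<lambda>r. r *\<^sub>R \<xi>)) (at 0)"
    by (auto intro!: derivative_eq_intros)
  moreover have "((\<lambda>y. \<rho> (ucinv y) w) has_derivative (\<lambda>\<xi>. X \<xi> w)) (at (y0 + 0 *\<^sub>R \<xi>))"
    using orbit_derivative by simp
  ultimately have "((\<lambda>r. \<rho> (ucinv (y0 + r *\<^sub>R \<xi>)) w) has_derivative (\<lambda>r. X (r *\<^sub>R \<xi>) w)) (at 0)"
    by (rule has_derivative_compose)
  then have "((\<lambda>r. \<rho> (unit_curve \<xi> r) w) has_vector_derivative X \<xi> w) (at 0)"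
    by (simp add: unit_curve_def has_vector_derivative_def linear_scale[OF linear_X_left])
  then have "((\<lambda>r. norm (\<rho> (unit_curve \<xi> r) w - \<rho> (unit_curve \<xi> 0) w - (r - 0) *\<^sub>R X \<xi> w) / norm (r - 0)) \<longlongrightarrow> 0) (at 0)"
    unfolding has_vector_derivative_def has_derivative_iff_norm by (rule conjunct2)
  moreover have "filterlim s (at 0) sequentially"
    using s by (auto simp: filterlim_at intro!: always_eventually less_imp_neq[symmetric])
  ultimately have "(\<lambda>n. norm (\<rho> (unit_curve \<xi> (s n)) w - \<rho> (unit_curve \<xi> 0) w - (s n - 0) *\<^sub>R X \<xi> w) / norm (s n - 0)) \<longlonglongrightarrow> 0"
    by (rule filterlim_compose)
  moreover have "norm (\<rho> (unit_curve \<xi> (s n)) w - \<rho> (unit_curve \<xi> 0) w - (s n - 0) *\<^sub>R X \<xi> w) / norm (s n - 0)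
      = norm ((\<rho> (unit_curve \<xi> (s n)) w - w) /\<^sub>R s n - X \<xi> w)" for n
  proof -
    have "(\<rho> (unit_curve \<xi> (s n)) w - w) /\<^sub>R s n - X \<xi> w = (\<rho> (unit_curve \<xi> (s n)) w - w - s n *\<^sub>R X \<xi> w) /\<^sub>R s n"
      using s(2)[of n] by (simp add: scaleR_diff_right)
    then show ?thesis using s(2)[of n] by (simp add: divide_inverse mult.commute)
  qed
  ultimately have "(\<lambda>n. norm ((\<rho> (unit_curve \<xi> (s n)) w - w) /\<^sub>R s n - X \<xi> w)) \<longlonglongrightarrow> 0" by simp
  then have u: "(\<lambda>n. (\<rho> (unit_curve \<xi> (s n)) w - w) /\<^sub>R s n) \<longlonglongrightarrow> X \<xi> w"
    by (rule LIM_zero_cancel[OF tendsto_norm_zero_cancel])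
  have "continuous_on UNIV (\<lambda>p. \<rho> (fst p) (snd p))"
    by (intro continuous_on_\<rho> continuous_on_fst continuous_on_snd continuous_on_id)
  then have "isCont (\<lambda>p. \<rho> (fst p) (snd p)) (inv \<one>, X \<xi> w)"
    by (simp add: continuous_on_eq_continuous_at)
  from isCont_tendsto_compose[OF this tendsto_Pair[OF g2 u]]
  have "(\<lambda>n. \<rho> (inv (unit_curve \<xi> (s n))) ((\<rho> (unit_curve \<xi> (s n)) w - w) /\<^sub>R s n)) \<longlonglongrightarrow> X \<xi> w"
    by simp
  from tendsto_minus[OF this] show ?thesis
    by (simp add: linear_scale[OF linear_\<rho>] linear_diff[OF linear_\<rho>] divide_inverse scaleR_minus_right[symmetric] del: scaleR_minus_right)
qed

text \<open>Right translation moves the difference quotient from \<^term>\<open>h\<close> to the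
  representation; the Lipschitz bound justifies passing to the limit.\<close>
lemma integration_by_parts:
  fixes h :: "'g \<Rightarrow> real"
  assumes h: "Ck_map A 1 h"
  shows "(\<integral>g. lvf G A \<xi> h g *\<^sub>R \<rho> g w \<partial>\<mu>) = - (\<integral>g. h g *\<^sub>R \<rho> g (X \<xi> w) \<partial>\<mu>)"
proof -
  have ch: "continuous_on UNIV h" by (rule Ck_map_continuous[OF h])
  note T = weighted_integral_linear[OF ch]
  obtain \<delta> L where L: "\<delta> > 0" "L \<ge> 0" "\<And>g s. \<bar>s\<bar> < \<delta> \<Longrightarrow> norm (h (g \<otimes> unit_curve \<xi> s) - h g) \<le> L * \<bar>s\<bar>"
    using C1_Lipschitz_along_curve[OF h cpt, of \<xi>] by auto
  obtain K where K: "\<And>g. norm (\<rho> g w) \<le> K" using continuous_norm_bounded[OF continuous_\<rho>[of w]] by auto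
  have K0: "K \<ge> 0" using order_trans[OF norm_ge_zero K] by auto
  \<comment> \<open>A null sequence of positive numbers; adding 2 keeps it strictly below \<delta>
    from the first index on.\<close>
  define s where "s n = \<delta> / (real n + 2)" for n
  have s0: "s n > 0" "s n < \<delta>" for n using L(1) by (auto simp: s_def field_simps intro!: add_pos_nonneg)
  have slim: "s \<longlonglongrightarrow> 0"
  proof -
    have "(\<lambda>n. \<delta> * inverse (real (Suc (Suc n)))) \<longlonglongrightarrow> \<delta> * 0"
      by (intro tendsto_mult tendsto_const LIMSEQ_Suc[OF LIMSEQ_inverse_real_of_nat])
    then show ?thesis by (simp add: s_def[abs_def] divide_inverse add.commute)
  qed
  define z where "z n = (1 / s n) *\<^sub>R (\<rho> (inv (unit_curve \<xi> (s n))) w - w)" for n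
  define Q where "Q n g = ((h (g \<otimes> unit_curve \<xi> (s n)) - h g) / s n) *\<^sub>R \<rho> g w" for n g
  have shift: "(\<integral>g. Q n g \<partial>\<mu>) = (\<integral>g. h g *\<^sub>R \<rho> g (z n) \<partial>\<mu>)" for n
  proof -
    let ?u = "unit_curve \<xi> (s n)"
    define k where "k g = h g *\<^sub>R \<rho> g (\<rho> (inv ?u) w)" for g
    have ck: "continuous_on UNIV k" unfolding k_def by (intro continuous_on_scaleR ch continuous_\<rho>)
    have ku: "k (g \<otimes> ?u) = h (g \<otimes> ?u) *\<^sub>R \<rho> g w" for g by (simp add: k_def \<rho>_mult)
    have c2: "continuous_on UNIV (\<lambda>g. k (g \<otimes> ?u))"
      by (rule continuous_on_compose2[OF ck]) (auto intro!: continuous_on_mult)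
    have "(\<integral>g. Q n g \<partial>\<mu>) = (\<integral>g. (1 / s n) *\<^sub>R (k (g \<otimes> ?u) - h g *\<^sub>R \<rho> g w) \<partial>\<mu>)"
      by (simp add: Q_def ku scaleR_diff_left[symmetric])
    also have "\<dots> = (1 / s n) *\<^sub>R ((\<integral>g. k (g \<otimes> ?u) \<partial>\<mu>) - (\<integral>g. h g *\<^sub>R \<rho> g w \<partial>\<mu>))"
      using continuous_integrable[OF c2] T(2) by simp
    also have "\<dots> = (1 / s n) *\<^sub>R ((\<integral>g. h g *\<^sub>R \<rho> g (\<rho> (inv ?u) w) \<partial>\<mu>) - (\<integral>g. h g *\<^sub>R \<rho> g w \<partial>\<mu>))"
      unfolding right_invariant[OF ck] by (simp add: k_def[abs_def])
    also have "\<dots> = (\<integral>g. h g *\<^sub>R \<rho> g (z n) \<partial>\<mu>)"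
      unfolding z_def using linear_scale[OF bounded_linear.linear[OF T(1)]] linear_diff[OF bounded_linear.linear[OF T(1)]]
      by simp
    finally show ?thesis .
  qed
  have "z \<longlonglongrightarrow> - X \<xi> w" unfolding z_def[abs_def] by (rule orbit_difference_quotient[OF slim s0(1)])
  from bounded_linear.tendsto[OF T(1) this]
  have lim1: "(\<lambda>n. \<integral>g. Q n g \<partial>\<mu>) \<longlonglongrightarrow> (\<integral>g. h g *\<^sub>R \<rho> g (- X \<xi> w) \<partial>\<mu>)" unfolding shift .
  have pt: "(\<lambda>n. Q n g) \<longlonglongrightarrow> lvf G A \<xi> h g *\<^sub>R \<rho> g w" for g
  proof -
    have "((\<lambda>r. h (g \<otimes> unit_curve \<xi> r)) has_field_derivative lvf G A \<xi> h g) (at 0)"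
      using C1_derivative_along_curve[OF h] by (simp add: has_real_derivative_iff_has_vector_derivative)
    then have "((\<lambda>r. (h (g \<otimes> unit_curve \<xi> r) - h g) / r) \<longlongrightarrow> lvf G A \<xi> h g) (at 0)"
      by (simp add: has_field_derivative_iff)
    moreover have "filterlim s (at 0) sequentially"
      using slim s0(1) by (auto simp: filterlim_at intro!: always_eventually less_imp_neq[symmetric])
    ultimately have "(\<lambda>n. (h (g \<otimes> unit_curve \<xi> (s n)) - h g) / s n) \<longlonglongrightarrow> lvf G A \<xi> h g"
      by (rule filterlim_compose)
    then show ?thesis unfolding Q_def by (intro tendsto_scaleR tendsto_const)
  qed
  have Qm: "Q n \<in> borel_measurable \<mu>" for n
  proof (rule continuous_measurable)
    have "continuous_on UNIV (\<lambda>g. h (g \<otimes> unit_curve \<xi> (s n)))"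
      by (rule continuous_on_compose2[OF ch]) (auto intro!: continuous_on_mult)
    then show "continuous_on UNIV (Q n)"
      unfolding Q_def[abs_def] using s0(1)[of n]
      by (intro continuous_on_scaleR continuous_on_divide continuous_on_diff ch continuous_on_const continuous_\<rho>) auto
  qed
  have bound: "norm (Q n g) \<le> L * K" for n g
  proof -
    have "\<bar>h (g \<otimes> unit_curve \<xi> (s n)) - h g\<bar> \<le> L * s n" using L(3)[of "s n" g] s0[of n] by simp
    then have "\<bar>(h (g \<otimes> unit_curve \<xi> (s n)) - h g) / s n\<bar> \<le> L" using s0(1)[of n] by (simp add: divide_le_eq)
    then show ?thesis unfolding Q_def norm_scaleR using K L(2) by (intro mult_mono) auto
  qed
  have lm: "(\<lambda>g. lvf G A \<xi> h g *\<^sub>R \<rho> g w) \<in> borel_measurable \<mu>"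
    by (rule borel_measurable_LIMSEQ_metric[OF Qm pt])
  have lim2: "(\<lambda>n. \<integral>g. Q n g \<partial>\<mu>) \<longlonglongrightarrow> (\<integral>g. lvf G A \<xi> h g *\<^sub>R \<rho> g w \<partial>\<mu>)"
    by (rule integral_dominated_convergence[OF lm Qm, of "\<lambda>_. L * K"]) (use pt bound in auto)
  have "(\<integral>g. lvf G A \<xi> h g *\<^sub>R \<rho> g w \<partial>\<mu>) = (\<integral>g. h g *\<^sub>R \<rho> g (- X \<xi> w) \<partial>\<mu>)"
    by (rule LIMSEQ_unique[OF lim2 lim1])
  also have "\<dots> = - (\<integral>g. h g *\<^sub>R \<rho> g (X \<xi> w) \<partial>\<mu>)"
    using linear_neg[OF bounded_linear.linear[OF T(1)], of "X \<xi> w"] .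
  finally show ?thesis .
qed

text \<open>Integrate by parts twice in each direction; the two minus signs cancel.\<close>

lemma density_op_laplacian:
  assumes \<nu>: "Ck_map A 2 \<nu>"
  shows "density_op \<mu> \<rho> (laplacian G A \<Xi> \<nu>) v = density_op \<mu> \<rho> \<nu> (Cas v)"
proof -
  have \<nu>1: "Ck_map A 1 \<nu>" by (rule Ck_map_le[OF _ \<nu>]) simp
  have l1: "Ck_map A 1 (lvf G A a \<nu>)" for a by (rule lvf_C1[OF \<nu>])
  \<comment> \<open>Second derivatives of a C2 function are only continuous, which is what
    integrability of the separate summands requires.\<close>
  have l2: "continuous_on UNIV (lvf G A a (lvf G A a \<nu>))" for a
  proof -
    have "continuous_on (snd c ` fst c) (lvf G A a (lvf G A a \<nu>) \<circ> chart_inv c)" if c: "c \<in> A" for c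
    proof -
      have "continuous_on (snd c ` fst c) (\<lambda>x. deriv_right (lvf G A a \<nu>) c (x, y0) a)"
        by (rule continuous_on_compose2[OF deriv_right_continuous[OF l1 c]])
           (use mult_dom_unit[OF c] in \<open>auto intro!: continuous_on_Pair continuous_on_id continuous_on_const\<close>)
      then show ?thesis
        by (rule continuous_on_eq) (simp add: lvf_chart[OF l1 c])
    qed
    then have "Ck_map A 0 (lvf G A a (lvf G A a \<nu>))" unfolding Ck_map_def Ck_on.simps by (rule ballI)
    then show ?thesis by (rule Ck_map_continuous)
  qed
  have c0: "continuous_on UNIV \<nu>" by (rule Ck_map_continuous[OF \<nu>])
  have "density_op \<mu> \<rho> (laplacian G A \<Xi> \<nu>) v = (\<integral>g. (\<Sum>a\<in>\<Xi>. lvf G A a (lvf G A a \<nu>) g *\<^sub>R \<rho> g v) \<partial>\<mu>)"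
    by (simp add: density_op_def op_integral_def laplacian_def scaleR_sum_left)
  also have "\<dots> = (\<Sum>a\<in>\<Xi>. \<integral>g. lvf G A a (lvf G A a \<nu>) g *\<^sub>R \<rho> g v \<partial>\<mu>)"
    by (rule Bochner_Integration.integral_sum) (rule weighted_integral_linear(2)[OF l2])
  also have "\<dots> = (\<Sum>a\<in>\<Xi>. \<integral>g. \<nu> g *\<^sub>R \<rho> g (X a (X a v)) \<partial>\<mu>)"
    by (simp add: integration_by_parts[OF l1] integration_by_parts[OF \<nu>1])
  also have "\<dots> = density_op \<mu> \<rho> \<nu> (Cas v)"
    unfolding density_op_def op_integral_def casimir_op_def
    by (rule linear_sum[OF bounded_linear.linear[OF weighted_integral_linear(1)[OF c0]], symmetric])
  finally show ?thesis .
qed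

text \<open>The density is a constant perturbed by a coordinate of \<^term>\<open>\<lambda>g. \<rho> g v\<close>.\<close>
lemma density_op_nonzero:
  assumes v: "v \<noteq> 0"
  shows "\<exists>\<nu>. C2_density A \<mu> \<nu> \<and> density_op \<mu> \<rho> \<nu> v \<noteq> 0"
proof (rule ccontr)
  assume "\<not> ?thesis"
  then have zero: "density_op \<mu> \<rho> \<nu> v = 0" if "C2_density A \<mu> \<nu>" for \<nu> using that by blast
  have const: "C2_density A \<mu> (\<lambda>_. 1)"
  proof -
    have "smooth_map A (\<lambda>g. 1 + (\<lambda>_. 0 :: real) (\<rho> g v))" by (rule matrix_coefficient_smooth[OF bounded_linear_zero])
    then show ?thesis by (simp add: C2_density_def smooth_map_def)
  qed
  have z1: "(\<integral>g. \<rho> g v \<partial>\<mu>) = 0"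
    using zero[OF const] by (simp add: density_op_def op_integral_def)
  \<comment> \<open>Perturb the density 1 by a multiple of the coefficient itself. The vanishing of
    its operator at \<open>v\<close>, tested with \<phi>, makes the integral of the squared
    coefficient zero.\<close>
  have cf: "AE g in \<mu>. \<phi> (\<rho> g v) = 0" if \<phi>: "bounded_linear \<phi>" for \<phi> :: "'v \<Rightarrow> real"
  proof -
    have c\<phi>: "continuous_on UNIV (\<lambda>g. \<phi> (\<rho> g v))"
      by (rule bounded_linear.continuous_on[OF \<phi> continuous_\<rho>])
    obtain K where K: "\<And>g. norm (\<phi> (\<rho> g v)) \<le> K" using continuous_norm_bounded[OF c\<phi>] by auto
    have int: "integrable \<mu> (\<lambda>g. \<phi> (\<rho> g v))" by (rule continuous_integrable[OF c\<phi>])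
    have "(\<integral>g. \<phi> (\<rho> g v) \<partial>\<mu>) = \<phi> (\<integral>g. \<rho> g v \<partial>\<mu>)"
      by (rule integral_bounded_linear[OF \<phi> continuous_integrable[OF continuous_\<rho>]])
    then have i0: "(\<integral>g. \<phi> (\<rho> g v) \<partial>\<mu>) = 0" using z1 linear_0[OF bounded_linear.linear[OF \<phi>]] by simp
    \<comment> \<open>Larger than every value of the coefficient, so the perturbed density is
      non-negative; its mass stays 1 because the coefficient has mean zero.\<close>
    define Z where "Z = K + 1"
    have K0: "K \<ge> 0" using order_trans[OF norm_ge_zero K] by auto
    have Z: "Z > 0" using K0 by (simp add: Z_def)
    define \<nu> where "\<nu> g = 1 + (1 / Z) * \<phi> (\<rho> g v)" for g
    have "smooth_map A \<nu>" unfolding \<nu>_def[abs_def]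
      by (rule matrix_coefficient_smooth) (rule bounded_linear_compose[OF bounded_linear_mult_right \<phi>])
    moreover have "0 \<le> \<nu> g" for g
    proof -
      have "- \<phi> (\<rho> g v) \<le> Z" using K[of g] by (simp add: Z_def)
      then have "(1 / Z) * (- \<phi> (\<rho> g v)) \<le> (1 / Z) * Z" using Z by (intro mult_left_mono) auto
      then show ?thesis using Z by (simp add: \<nu>_def)
    qed
    moreover have "(\<integral>g. \<nu> g \<partial>\<mu>) = 1" unfolding \<nu>_def using int i0 by simp
    ultimately have "C2_density A \<mu> \<nu>" by (simp add: C2_density_def smooth_map_def)
    from zero[OF this] have "(\<integral>g. \<rho> g v + (1 / Z) *\<^sub>R (\<phi> (\<rho> g v) *\<^sub>R \<rho> g v) \<partial>\<mu>) = 0"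
      unfolding density_op_def op_integral_def \<nu>_def scaleR_add_left scaleR_scaleR scaleR_one .
    then have "(1 / Z) *\<^sub>R (\<integral>g. \<phi> (\<rho> g v) *\<^sub>R \<rho> g v \<partial>\<mu>) = 0"
      unfolding Bochner_Integration.integral_add[OF continuous_integrable[OF continuous_\<rho>[of v]]
          integrable_scaleR_right[OF weighted_integral_linear(2)[OF c\<phi>]]] integral_scaleR_right z1
      by (simp only: add_0_left)
    then have "(\<integral>g. \<phi> (\<rho> g v) *\<^sub>R \<rho> g v \<partial>\<mu>) = 0" using Z by simp
    then have "\<phi> (\<integral>g. \<phi> (\<rho> g v) *\<^sub>R \<rho> g v \<partial>\<mu>) = 0" by (simp add: linear_0[OF bounded_linear.linear[OF \<phi>]])
    then have "(\<integral>g. \<phi> (\<rho> g v) * \<phi> (\<rho> g v) \<partial>\<mu>) = 0"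
      using integral_bounded_linear[OF \<phi> weighted_integral_linear(2)[OF c\<phi>], of v]
      by (simp add: linear_scale[OF bounded_linear.linear[OF \<phi>]])
    moreover have "integrable \<mu> (\<lambda>g. \<phi> (\<rho> g v) * \<phi> (\<rho> g v))"
      by (rule continuous_integrable) (rule continuous_on_mult'[OF c\<phi> c\<phi>])
    ultimately have "AE g in \<mu>. \<phi> (\<rho> g v) * \<phi> (\<rho> g v) = 0"
      using integral_nonneg_eq_0_iff_AE[of \<mu> "\<lambda>g. \<phi> (\<rho> g v) * \<phi> (\<rho> g v)"] by simp
    then show ?thesis by simp
  qed
  obtain B :: "'v set" where B: "finite B" "independent B" "span B = UNIV"
    using fin_dim_basis[OF fin_dim_V] .
  have "AE g in \<mu>. \<forall>b\<in>B. representation B (\<rho> g v) b = 0"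
    using B(1) by (intro AE_finite_allI cf representation_bounded_linear[OF B(2,3) fin_dim_V])
  then have "AE g in \<mu>. False"
  proof eventually_elim
    fix g assume "\<forall>b\<in>B. representation B (\<rho> g v) b = 0"
    then have "(\<Sum>b\<in>B. representation B (\<rho> g v) b *\<^sub>R b) = 0" by simp
    then have "\<rho> g v = 0" using B by (simp add: sum_representation_eq)
    then have "\<rho> (inv g) (\<rho> g v) = 0" by (simp only: linear_0[OF linear_\<rho>])
    then show False using v by simp
  qed
  then show False by simp
qed

text \<open>The double integration by parts shows that \<open>c\<close> qualifies; any other
  candidate is excluded by a density whose operator does not annihilate a chosen nonzero vector of
  \<open>U\<close>.\<close>

lemma casimir_const_eq:
  assumes U: "irreducible_subrep scal \<rho> U" and c: "c \<le> 0" "\<And>x. x \<in> U \<Longrightarrow> Cas x = c *\<^sub>R x"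
  shows "casimir_const G A \<Xi> \<mu> \<rho> U = c"
  unfolding casimir_const_def
proof (rule the_equality)
  have T: "density_op \<mu> \<rho> (laplacian G A \<Xi> \<nu>) v = c *\<^sub>R density_op \<mu> \<rho> \<nu> v" if "C2_density A \<mu> \<nu>" "v \<in> U" for \<nu> v
  proof -
    have \<nu>: "Ck_map A 2 \<nu>" using that(1) by (simp add: C2_density_def)
    have "density_op \<mu> \<rho> \<nu> (c *\<^sub>R v) = c *\<^sub>R density_op \<mu> \<rho> \<nu> v"
      unfolding density_op_def op_integral_def
      by (rule linear_scale[OF bounded_linear.linear[OF weighted_integral_linear(1)[OF Ck_map_continuous[OF \<nu>]]]])
    then show ?thesis by (simp add: density_op_laplacian[OF \<nu>] c(2)[OF that(2)])
  qed
  then show "c \<le> 0 \<and> (\<forall>\<nu>. C2_density A \<mu> \<nu> \<longrightarrow> (\<forall>v\<in>U. c *\<^sub>R density_op \<mu> \<rho> \<nu> v = density_op \<mu> \<rho> (laplacian G A \<Xi> \<nu>) v))"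
    using c(1) by simp
  fix c' assume c': "c' \<le> 0 \<and> (\<forall>\<nu>. C2_density A \<mu> \<nu> \<longrightarrow> (\<forall>v\<in>U. c' *\<^sub>R density_op \<mu> \<rho> \<nu> v = density_op \<mu> \<rho> (laplacian G A \<Xi> \<nu>) v))"
  have "subrep scal \<rho> U" "U \<noteq> {0}" using U by (simp_all add: irreducible_subrep_def)
  then obtain v where v: "v \<in> U" "v \<noteq> 0" using subrep_zero by blast
  obtain \<nu> where \<nu>: "C2_density A \<mu> \<nu>" "density_op \<mu> \<rho> \<nu> v \<noteq> 0"
    using density_op_nonzero[OF v(2)] by (elim exE conjE)
  have "c' *\<^sub>R density_op \<mu> \<rho> \<nu> v = c *\<^sub>R density_op \<mu> \<rho> \<nu> v"
    using c' \<nu>(1) v(1) T[OF \<nu>(1) v(1)] by simp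
  then show "c' = c" using \<nu>(2) by simp
qed

end

section \<open>Brownian motion in a representation\<close>

context compact_rep
begin

text \<open>Orbits of basis vectors are bounded by compactness. Proportionality to
  \<open>norm v\<close> is what later gives geometric bounds along powers of the Casimir
  operator.\<close>

lemma \<rho>_uniformly_bounded: "\<exists>K\<ge>0. \<forall>g v. norm (\<rho> g v) \<le> K * norm v"
proof -
  obtain B :: "'v set" where B: "finite B" "independent B" "span B = UNIV"
    using fin_dim_basis[OF fin_dim_V] .
  have "\<forall>b. \<exists>R\<ge>0. \<forall>v. norm (representation B v b) \<le> norm v * R"
    using bounded_linear.nonneg_bounded[OF representation_bounded_linear[OF B(2,3) fin_dim_V]] by (rule allI)
  from choice[OF this] obtain R where R: "\<forall>b. R b \<ge> 0 \<and> (\<forall>v. norm (representation B v b) \<le> norm v * R b)" by (rule exE)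
  have "\<forall>b. \<exists>N. \<forall>g. norm (\<rho> g b) \<le> N"
  proof
    fix b
    obtain N where "\<And>g. norm (\<rho> g b) \<le> N" using continuous_norm_bounded[OF continuous_\<rho>[of b]] by auto
    then show "\<exists>N. \<forall>g. norm (\<rho> g b) \<le> N" by (intro exI allI)
  qed
  from choice[OF this] obtain N where N: "\<forall>b g. norm (\<rho> g b) \<le> N b" by (rule exE)
  have N0: "N b \<ge> 0" for b using order_trans[OF norm_ge_zero N[rule_format, of undefined b]] .
  define K where "K = (\<Sum>b\<in>B. R b * N b)"
  have "norm (\<rho> g v) \<le> K * norm v" for g v
  proof -
    have "\<rho> g v = \<rho> g (\<Sum>b\<in>B. representation B v b *\<^sub>R b)"
      using B by (simp add: sum_representation_eq)
    also have "\<dots> = (\<Sum>b\<in>B. representation B v b *\<^sub>R \<rho> g b)"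
      by (simp add: linear_sum[OF linear_\<rho>] linear_scale[OF linear_\<rho>])
    also have "norm \<dots> \<le> (\<Sum>b\<in>B. norm (representation B v b) * norm (\<rho> g b))"
      by (rule order_trans[OF norm_sum]) simp
    also have "\<dots> \<le> (\<Sum>b\<in>B. (norm v * R b) * N b)"
      using R N N0 by (intro sum_mono mult_mono) auto
    also have "\<dots> = (\<Sum>b\<in>B. R b * N b * norm v)" by (simp add: mult_ac)
    also have "\<dots> = K * norm v" by (simp only: K_def sum_distrib_right)
    finally show ?thesis .
  qed
  moreover have "K \<ge> 0" unfolding K_def using R N0 by (intro sum_nonneg mult_nonneg_nonneg) auto
  ultimately show ?thesis by (intro exI[of _ K] conjI allI)
qed

end

locale brownian_rep = casimir_rep G A \<mu> scal \<rho> \<kappa> \<Xi>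
  for G :: "'g::{second_countable_topology,t2_space} monoid" (structure)
    and A :: "('g, 'e::real_normed_vector) chart set" and \<mu>
    and scal :: "'k::{real_normed_field,euclidean_space} \<Rightarrow> 'v::{banach,second_countable_topology} \<Rightarrow> 'v"
    and \<rho> :: "'g \<Rightarrow> 'v \<Rightarrow> 'v" and \<kappa> \<Xi> +
  fixes M :: "'w measure" and F :: "real \<Rightarrow> 'w measure" and W :: "'e \<Rightarrow> real \<Rightarrow> 'w \<Rightarrow> real"
    and g :: "real \<Rightarrow> 'w \<Rightarrow> 'g"
  assumes bm: "lie_brownian_motion G A \<Xi> M F W g"
begin

sublocale bm: prob_space M
  using bm by (simp add: lie_brownian_motion_def)

sublocale bm: driver M \<Xi> F W
proof unfold_locales
  show "finite \<Xi>" by (rule finite_basis)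
  show "gaussian_driver \<Xi> M W" "driver_filtration \<Xi> M F W" using bm by (simp_all add: lie_brownian_motion_def)
qed

lemma g_adapted: "t \<ge> 0 \<Longrightarrow> g t \<in> measurable (F t) borel"
  using bm by (simp add: lie_brownian_motion_def)

lemma g_measurable: "t \<ge> 0 \<Longrightarrow> g t \<in> measurable M borel"
  by (rule bm.adapted_measurable[OF g_adapted])

lemma g_continuous: "AE \<omega> in M. continuous_on {0..} (\<lambda>t. g t \<omega>)"
  using bm by (simp add: lie_brownian_motion_def)

lemma g_start: "AE \<omega> in M. g 0 \<omega> = \<one>"
  using bm by (simp add: lie_brownian_motion_def)

lemma g_equation:
  fixes f :: "'g \<Rightarrow> real"
  assumes "smooth_map A f"
  shows "bm.stratonovich_equation (\<lambda>t \<omega>. f (g t \<omega>)) (\<lambda>a t \<omega>. lvf G A a f (g t \<omega>))"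
proof -
  have "\<forall>f :: 'g \<Rightarrow> real. smooth_map A f \<longrightarrow>
        (\<forall>t\<ge>0. \<exists>S.
           (\<forall>a\<in>\<Xi>. has_stratonovich_integral M (\<lambda>s \<omega>. lvf G A a f (g s \<omega>)) (W a) t (S a)) \<and>
           (AE \<omega> in M. f (g t \<omega>) = f (g 0 \<omega>) + (\<Sum>a\<in>\<Xi>. S a \<omega>)))"
    using bm unfolding lie_brownian_motion_def by (elim conjE)
  from this[rule_format, OF assms] show ?thesis
    unfolding bm.stratonovich_equation_def by (intro allI impI)
qed

lemma coefficient_equation:
  assumes "bounded_linear (\<phi> :: 'v \<Rightarrow> real)"
  shows "bm.stratonovich_equation (\<lambda>t \<omega>. \<phi> (\<rho> (g t \<omega>) v)) (\<lambda>a t \<omega>. \<phi> (\<rho> (g t \<omega>) (X a v)))"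
proof -
  have "smooth_map A (\<lambda>g. 0 + \<phi> (\<rho> g v))" by (rule matrix_coefficient_smooth[OF assms])
  then have "smooth_map A (\<lambda>g. \<phi> (\<rho> g v))" by (simp only: add_0_left)
  from g_equation[OF this] show ?thesis unfolding lvf_matrix_coefficient[OF assms] .
qed

lemma function_measurable:
  fixes u :: "'g \<Rightarrow> 'b::topological_space"
  assumes "continuous_on UNIV u" "t \<ge> 0"
  shows "(\<lambda>\<omega>. u (g t \<omega>)) \<in> borel_measurable (F t)" "(\<lambda>\<omega>. u (g t \<omega>)) \<in> borel_measurable M"
  by (rule measurable_compose[OF g_adapted[OF assms(2)] borel_measurable_continuous_onI[OF assms(1)]],
      rule measurable_compose[OF g_measurable[OF assms(2)] borel_measurable_continuous_onI[OF assms(1)]])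

lemma function_integrable:
  fixes u :: "'g \<Rightarrow> 'b::{banach,second_countable_topology}"
  assumes "continuous_on UNIV u" "t \<ge> 0"
  shows "integrable M (\<lambda>\<omega>. u (g t \<omega>))"
proof -
  obtain K where K: "\<And>h. norm (u h) \<le> K" using continuous_norm_bounded[OF assms(1)] by auto
  show ?thesis
    by (rule bm.integrable_const_bound[of _ K]) (use K function_measurable(2)[OF assms] in auto)
qed

lemma function_path_tendsto:
  fixes u :: "'g \<Rightarrow> 'b::topological_space"
  assumes u: "continuous_on UNIV u" and s: "\<And>n. s n \<ge> 0" "t \<ge> 0" "s \<longlonglongrightarrow> t"
  shows "AE \<omega> in M. (\<lambda>n. u (g (s n) \<omega>)) \<longlonglongrightarrow> u (g t \<omega>)"
  using g_continuous
proof eventually_elim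
  fix \<omega> assume "continuous_on {0..} (\<lambda>t. g t \<omega>)"
  then have "continuous_on {0..} (\<lambda>t. u (g t \<omega>))"
    by (rule continuous_on_compose2[OF u]) simp
  then show "(\<lambda>n. u (g (s n) \<omega>)) \<longlonglongrightarrow> u (g t \<omega>)"
    using s unfolding continuous_on_sequentially comp_def by auto
qed

lemma expectation_continuous:
  fixes u :: "'g \<Rightarrow> real"
  assumes u: "continuous_on UNIV u"
  shows "continuous_on {0..} (\<lambda>t. \<integral>\<omega>. u (g t \<omega>) \<partial>M)"
  unfolding continuous_on_sequentially comp_def
proof (intro allI impI ballI)
  fix s :: "nat \<Rightarrow> real" and t :: real
  assume "t \<in> {0..}" "(\<forall>n. s n \<in> {0..}) \<and> s \<longlonglongrightarrow> t"
  then have s: "\<And>n. s n \<ge> 0" "t \<ge> 0" "s \<longlonglongrightarrow> t" by auto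
  obtain K where K: "\<And>h. norm (u h) \<le> K" using continuous_norm_bounded[OF u] by auto
  show "(\<lambda>n. \<integral>\<omega>. u (g (s n) \<omega>) \<partial>M) \<longlonglongrightarrow> (\<integral>\<omega>. u (g t \<omega>) \<partial>M)"
    by (rule integral_dominated_convergence[of _ _ _ "\<lambda>_. K"])
      (use K function_path_tendsto[OF u s] function_measurable(2)[OF u] s in auto)
qed

text \<open>By dominated convergence along continuous paths, the mean square distance is a
  continuous function on the compact square of pairs of times.\<close>

lemma mean_square_continuous:
  fixes u :: "'g \<Rightarrow> real"
  assumes u: "continuous_on UNIV u" and e: "e > 0"
  shows "\<exists>d>0. \<forall>s\<in>{0..T}. \<forall>t\<in>{0..T}. \<bar>s - t\<bar> < d \<longrightarrow> (\<integral>\<omega>. (u (g s \<omega>) - u (g t \<omega>))\<^sup>2 \<partial>M) \<le> e"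
proof -
  let ?S = "{0..T} \<times> {0..T}"
  define q where "q p = (\<integral>\<omega>. (u (g (fst p) \<omega>) - u (g (snd p) \<omega>))\<^sup>2 \<partial>M)" for p
  obtain K where K: "\<And>h. norm (u h) \<le> K" using continuous_norm_bounded[OF u] by auto
  have b: "norm ((u x - u y)\<^sup>2) \<le> (2 * K)\<^sup>2" for x y
  proof -
    have "\<bar>u x - u y\<bar> \<le> 2 * K" using K[of x] K[of y] by simp
    from power_mono[OF this, of 2] show ?thesis by simp
  qed
  have "continuous_on ?S q"
    unfolding continuous_on_sequentially comp_def
  proof (intro allI impI ballI)
    fix x p assume "p \<in> ?S" "(\<forall>n. x n \<in> ?S) \<and> x \<longlonglongrightarrow> p"
    then have p: "p \<in> ?S" and x: "\<And>n. x n \<in> ?S" and lim: "x \<longlonglongrightarrow> p" by auto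
    have s: "\<And>n. fst (x n) \<ge> 0" "fst p \<ge> 0" "(\<lambda>n. fst (x n)) \<longlonglongrightarrow> fst p"
      and t: "\<And>n. snd (x n) \<ge> 0" "snd p \<ge> 0" "(\<lambda>n. snd (x n)) \<longlonglongrightarrow> snd p"
      using p x tendsto_fst[OF lim] tendsto_snd[OF lim] by (auto simp: mem_Times_iff)
    note m = function_measurable(2)[OF u]
    show "(\<lambda>n. q (x n)) \<longlonglongrightarrow> q p"
      unfolding q_def
    proof (rule integral_dominated_convergence[of _ _ _ "\<lambda>_. (2 * K)\<^sup>2"])
      show "(\<lambda>\<omega>. (u (g (fst p) \<omega>) - u (g (snd p) \<omega>))\<^sup>2) \<in> borel_measurable M"
        using m[OF s(2)] m[OF t(2)] by measurable
      show "(\<lambda>\<omega>. (u (g (fst (x n)) \<omega>) - u (g (snd (x n)) \<omega>))\<^sup>2) \<in> borel_measurable M" for n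
        using m[OF s(1)[of n]] m[OF t(1)[of n]] by measurable
      show "AE \<omega> in M. (\<lambda>n. (u (g (fst (x n)) \<omega>) - u (g (snd (x n)) \<omega>))\<^sup>2) \<longlonglongrightarrow> (u (g (fst p) \<omega>) - u (g (snd p) \<omega>))\<^sup>2"
        using function_path_tendsto[OF u s] function_path_tendsto[OF u t]
        by eventually_elim (intro tendsto_power tendsto_diff)
      show "AE \<omega> in M. norm ((u (g (fst (x n)) \<omega>) - u (g (snd (x n)) \<omega>))\<^sup>2) \<le> (2 * K)\<^sup>2" for n
        using b by (rule AE_I2)
    qed simp
  qed
  then have "uniformly_continuous_on ?S q"
    by (rule compact_uniformly_continuous) (intro compact_Times compact_Icc)
  then obtain d where d: "d > 0" "\<And>x y. x \<in> ?S \<Longrightarrow> y \<in> ?S \<Longrightarrow> dist y x < d \<Longrightarrow> dist (q y) (q x) < e"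
    using e unfolding uniformly_continuous_on_def by (metis (no_types))
  show ?thesis
  proof (intro exI[of _ d] conjI ballI impI d(1))
    fix s t assume st: "s \<in> {0..T}" "t \<in> {0..T}" "\<bar>s - t\<bar> < d"
    \<comment> \<open>Compare with the diagonal, where \<open>q\<close> vanishes.\<close>
    have "dist (q (s, t)) (q (t, t)) < e"
      by (rule d(2)) (use st in \<open>auto simp: dist_Pair_Pair dist_real_def\<close>)
    then show "(\<integral>\<omega>. (u (g s \<omega>) - u (g t \<omega>))\<^sup>2 \<partial>M) \<le> e" by (simp add: q_def dist_real_def)
  qed
qed

section \<open>Expected matrix coefficients\<close>

definition coef_mean :: "('v \<Rightarrow> real) \<Rightarrow> 'v \<Rightarrow> real \<Rightarrow> real" where
  "coef_mean \<phi> v t = (\<integral>\<omega>. \<phi> (\<rho> (g t \<omega>) v) \<partial>M)"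

lemma continuous_coefficient: "bounded_linear \<phi> \<Longrightarrow> continuous_on UNIV (\<lambda>g. \<phi> (\<rho> g v))"
  by (rule bounded_linear.continuous_on[OF _ continuous_\<rho>])

lemma coef_mean_continuous:
  assumes "bounded_linear \<phi>"
  shows "continuous_on {0..} (coef_mean \<phi> v)"
  unfolding coef_mean_def[abs_def]
  by (rule expectation_continuous[OF continuous_coefficient[OF assms]])

text \<open>The derivatives of a coefficient are the coefficients of \<open>X a v\<close> and
  \<open>X b (X a v)\<close>, so \<open>expectation_increment\<close> applies; its sums are Riemann
  sums of a continuous function.\<close>

lemma coef_mean_increment:
  assumes \<phi>: "bounded_linear \<phi>" and T: "T > 0"
  shows "coef_mean \<phi> v T - coef_mean \<phi> v 0 = integral {0..T} (coef_mean \<phi> ((1/2) *\<^sub>R Cas v))"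
proof -
  note cc = continuous_coefficient[OF \<phi>]
  obtain R where R: "R \<ge> 0" "\<forall>g v. norm (\<rho> g v) \<le> R * norm v" using \<rho>_uniformly_bounded by (elim exE conjE)
  obtain P where P: "P \<ge> 0" "\<forall>x. norm (\<phi> x) \<le> norm x * P" using bounded_linear.nonneg_bounded[OF \<phi>] by (elim exE conjE)
  have bnd: "\<bar>\<phi> (\<rho> h w)\<bar> \<le> R * P * norm w" for h w
  proof -
    have "\<bar>\<phi> (\<rho> h w)\<bar> \<le> norm (\<rho> h w) * P" using P(2) by simp
    also have "\<dots> \<le> (R * norm w) * P" using R(2) P(1) by (intro mult_right_mono) auto
    finally show ?thesis by (simp add: mult_ac)
  qed
  define n1 where "n1 = (\<Sum>a\<in>\<Xi>. norm (X a v))"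
  define n2 where "n2 = (\<Sum>a\<in>\<Xi>. \<Sum>b\<in>\<Xi>. norm (X b (X a v)))"
  have n: "n1 \<ge> 0" "n2 \<ge> 0" by (auto simp: n1_def n2_def sum_nonneg)
  have n1: "norm (X a v) \<le> n1" if "a \<in> \<Xi>" for a
    unfolding n1_def using that finite_basis by (intro member_le_sum) auto
  have n2: "norm (X b (X a v)) \<le> n2" if "a \<in> \<Xi>" "b \<in> \<Xi>" for a b
  proof -
    have "norm (X b (X a v)) \<le> (\<Sum>b\<in>\<Xi>. norm (X b (X a v)))" using that finite_basis by (intro member_le_sum) auto
    also have "\<dots> \<le> n2" unfolding n2_def using that finite_basis by (intro member_le_sum) (auto simp: sum_nonneg)
    finally show ?thesis .
  qed
  define K where "K = R * P * (norm v + n1 + n2)"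
  have K: "\<bar>\<phi> (\<rho> h w)\<bar> \<le> K" if "norm w \<le> norm v + n1 + n2" for h w
    using order_trans[OF bnd mult_left_mono[OF that, of "R * P"]] R(1) P(1) by (simp add: K_def)
  have lim: "(\<lambda>n. (T / n) * (\<Sum>i<n. (\<Sum>a\<in>\<Xi>. \<integral>\<omega>. \<phi> (\<rho> (g (grid T n i) \<omega>) (X a (X a v))) \<partial>M) / 2))
     \<longlonglongrightarrow> (\<integral>\<omega>. \<phi> (\<rho> (g T \<omega>) v) \<partial>M) - (\<integral>\<omega>. \<phi> (\<rho> (g 0 \<omega>) v) \<partial>M)"
  proof (rule bm.expectation_increment[OF T, where f = "\<lambda>t \<omega>. \<phi> (\<rho> (g t \<omega>) v)"
        and ?f1.0 = "\<lambda>a t \<omega>. \<phi> (\<rho> (g t \<omega>) (X a v))" and ?f2.0 = "\<lambda>b a t \<omega>. \<phi> (\<rho> (g t \<omega>) (X b (X a v)))" and K = K])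
    show "bm.stratonovich_equation (\<lambda>t \<omega>. \<phi> (\<rho> (g t \<omega>) v)) (\<lambda>a t \<omega>. \<phi> (\<rho> (g t \<omega>) (X a v)))"
      by (rule coefficient_equation[OF \<phi>])
    show "bm.stratonovich_equation (\<lambda>t \<omega>. \<phi> (\<rho> (g t \<omega>) (X a v))) (\<lambda>b t \<omega>. \<phi> (\<rho> (g t \<omega>) (X b (X a v))))" for a
      by (rule coefficient_equation[OF \<phi>])
    show "(\<lambda>\<omega>. \<phi> (\<rho> (g t \<omega>) v)) \<in> borel_measurable (F t)"
      "(\<lambda>\<omega>. \<phi> (\<rho> (g t \<omega>) (X a v))) \<in> borel_measurable (F t)"
      "(\<lambda>\<omega>. \<phi> (\<rho> (g t \<omega>) (X b (X a v)))) \<in> borel_measurable (F t)" if "t \<ge> 0" for a b t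
      using function_measurable(1)[OF cc that] by simp_all
    show "\<bar>\<phi> (\<rho> (g t \<omega>) v)\<bar> \<le> K" for t \<omega> using n by (intro K) simp
    show "\<bar>\<phi> (\<rho> (g t \<omega>) (X a v))\<bar> \<le> K" if "a \<in> \<Xi>" for a t \<omega>
      using n n1[OF that] norm_ge_zero[of v] by (intro K) linarith
    show "\<bar>\<phi> (\<rho> (g t \<omega>) (X b (X a v)))\<bar> \<le> K" if "a \<in> \<Xi>" "b \<in> \<Xi>" for a b t \<omega>
      using n n2[OF that] norm_ge_zero[of v] by (intro K) linarith
  next
    fix e :: real assume e: "e > 0"
    \<comment> \<open>Finitely many pairs of directions share one modulus; the filter at 0 from the
      right takes the minimum and also handles empty \<Xi>.\<close>
    have "eventually (\<lambda>d. \<forall>p\<in>\<Xi> \<times> \<Xi>. \<forall>s\<in>{0..T}. \<forall>t\<in>{0..T}. \<bar>s - t\<bar> < d \<longrightarrow>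
        (\<integral>\<omega>. (\<phi> (\<rho> (g s \<omega>) (X (snd p) (X (fst p) v))) - \<phi> (\<rho> (g t \<omega>) (X (snd p) (X (fst p) v))))\<^sup>2 \<partial>M) \<le> e) (at_right 0)"
    proof (rule eventually_ball_finite, goal_cases)
      case 1
      show "finite (\<Xi> \<times> \<Xi>)" using finite_basis by simp
    next
      case 2
      show ?case
      proof
        fix p assume "p \<in> \<Xi> \<times> \<Xi>"
        obtain d where d: "d > 0" "\<forall>s\<in>{0..T}. \<forall>t\<in>{0..T}. \<bar>s - t\<bar> < d \<longrightarrow>
          (\<integral>\<omega>. (\<phi> (\<rho> (g s \<omega>) (X (snd p) (X (fst p) v))) - \<phi> (\<rho> (g t \<omega>) (X (snd p) (X (fst p) v))))\<^sup>2 \<partial>M) \<le> e"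
          using mean_square_continuous[OF cc[of "X (snd p) (X (fst p) v)"] e, of T] by (elim exE conjE)
        show "eventually (\<lambda>d. \<forall>s\<in>{0..T}. \<forall>t\<in>{0..T}. \<bar>s - t\<bar> < d \<longrightarrow>
          (\<integral>\<omega>. (\<phi> (\<rho> (g s \<omega>) (X (snd p) (X (fst p) v))) - \<phi> (\<rho> (g t \<omega>) (X (snd p) (X (fst p) v))))\<^sup>2 \<partial>M) \<le> e) (at_right 0)"
          unfolding eventually_at_right_field
        proof (intro exI[of _ d] conjI d(1) allI impI ballI)
          fix y s t assume "0 < y" "y < d" "s \<in> {0..T}" "t \<in> {0..T}" "\<bar>s - t\<bar> < y"
          then have "\<bar>s - t\<bar> < d" by linarith
          from d(2)[rule_format, OF \<open>s \<in> {0..T}\<close> \<open>t \<in> {0..T}\<close> this]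
          show "(\<integral>\<omega>. (\<phi> (\<rho> (g s \<omega>) (X (snd p) (X (fst p) v))) - \<phi> (\<rho> (g t \<omega>) (X (snd p) (X (fst p) v))))\<^sup>2 \<partial>M) \<le> e"
            .
        qed
      qed
    qed
    from eventually_happens'[OF trivial_limit_at_right_real eventually_conj[OF this eventually_at_right_less]]
    obtain d where d: "(\<forall>p\<in>\<Xi> \<times> \<Xi>. \<forall>s\<in>{0..T}. \<forall>t\<in>{0..T}. \<bar>s - t\<bar> < d \<longrightarrow>
        (\<integral>\<omega>. (\<phi> (\<rho> (g s \<omega>) (X (snd p) (X (fst p) v))) - \<phi> (\<rho> (g t \<omega>) (X (snd p) (X (fst p) v))))\<^sup>2 \<partial>M) \<le> e) \<and> 0 < d"
      by (rule exE)
    show "\<exists>d>0. \<forall>s\<in>{0..T}. \<forall>t\<in>{0..T}. \<forall>a\<in>\<Xi>. \<forall>b\<in>\<Xi>. \<bar>s - t\<bar> < d \<longrightarrow>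
        (\<integral>\<omega>. (\<phi> (\<rho> (g s \<omega>) (X b (X a v))) - \<phi> (\<rho> (g t \<omega>) (X b (X a v))))\<^sup>2 \<partial>M) \<le> e"
    proof (intro exI[of _ d] conjI ballI impI conjunct2[OF d])
      fix s t a b assume *: "s \<in> {0..T}" "t \<in> {0..T}" "a \<in> \<Xi>" "b \<in> \<Xi>" "\<bar>s - t\<bar> < d"
      have "(a, b) \<in> \<Xi> \<times> \<Xi>" using * by simp
      from bspec[OF bspec[OF bspec[OF conjunct1[OF d] this] *(1)] *(2), rule_format, OF *(5)]
      show "(\<integral>\<omega>. (\<phi> (\<rho> (g s \<omega>) (X b (X a v))) - \<phi> (\<rho> (g t \<omega>) (X b (X a v))))\<^sup>2 \<partial>M) \<le> e" by simp
    qed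
  qed
  have half: "(\<Sum>a\<in>\<Xi>. \<integral>\<omega>. \<phi> (\<rho> (g t \<omega>) (X a (X a v))) \<partial>M) / 2 = coef_mean \<phi> ((1/2) *\<^sub>R Cas v) t" if t: "t \<ge> 0" for t
  proof -
    note lin = linear_compose[OF linear_\<rho> bounded_linear.linear[OF \<phi>], unfolded comp_def]
    have "coef_mean \<phi> ((1/2) *\<^sub>R Cas v) t = (\<integral>\<omega>. (\<Sum>a\<in>\<Xi>. \<phi> (\<rho> (g t \<omega>) (X a (X a v)))) / 2 \<partial>M)"
      unfolding coef_mean_def by (simp add: linear_scale[OF lin] linear_sum[OF lin] casimir_op_def)
    also have "\<dots> = (\<Sum>a\<in>\<Xi>. \<integral>\<omega>. \<phi> (\<rho> (g t \<omega>) (X a (X a v))) \<partial>M) / 2"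
      using function_integrable[OF cc t] by simp
    finally show ?thesis by simp
  qed
  have "(\<lambda>n. (T / n) * (\<Sum>i<n. coef_mean \<phi> ((1/2) *\<^sub>R Cas v) (grid T n i))) \<longlonglongrightarrow> coef_mean \<phi> v T - coef_mean \<phi> v 0"
    using lim unfolding half[OF grid_nonneg[OF T]] coef_mean_def[of \<phi> v] .
  moreover have "(\<lambda>n. (T / n) * (\<Sum>i<n. coef_mean \<phi> ((1/2) *\<^sub>R Cas v) (grid T n i))) \<longlonglongrightarrow> integral {0..T} (coef_mean \<phi> ((1/2) *\<^sub>R Cas v))"
    by (rule riemann_sum_limit[OF T continuous_on_subset[OF coef_mean_continuous[OF \<phi>]]]) simp
  ultimately show ?thesis by (rule LIMSEQ_unique)
qed

abbreviation mean_op :: "real \<Rightarrow> 'v \<Rightarrow> 'v" where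
  "mean_op t \<equiv> op_integral M (\<lambda>\<omega>. \<rho> (g t \<omega>))"

lemma mean_op_integrable: "t \<ge> 0 \<Longrightarrow> integrable M (\<lambda>\<omega>. \<rho> (g t \<omega>) v)"
  by (rule function_integrable[OF continuous_\<rho>])

lemma coef_mean_op: "bounded_linear \<phi> \<Longrightarrow> t \<ge> 0 \<Longrightarrow> \<phi> (mean_op t v) = coef_mean \<phi> v t"
  unfolding op_integral_def coef_mean_def
  by (rule integral_bounded_linear[symmetric, OF _ mean_op_integrable])

lemma coef_mean_0:
  assumes "bounded_linear \<phi>"
  shows "coef_mean \<phi> v 0 = \<phi> v"
proof -
  have "coef_mean \<phi> v 0 = (\<integral>\<omega>. \<phi> v \<partial>M)"
    unfolding coef_mean_def
  proof (rule integral_cong_AE)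
    show "(\<lambda>\<omega>. \<phi> (\<rho> (g 0 \<omega>) v)) \<in> borel_measurable M"
      by (rule function_measurable(2)[OF continuous_coefficient[OF assms] order_refl])
    show "AE \<omega> in M. \<phi> (\<rho> (g 0 \<omega>) v) = \<phi> v"
      using g_start by eventually_elim simp
  qed simp
  then show ?thesis by (simp add: bm.prob_space)
qed

lemma funpow_scaled:
  fixes D :: "'v \<Rightarrow> 'v"
  assumes "linear D"
  shows "((\<lambda>v. t *\<^sub>R D v) ^^ n) v = t ^ n *\<^sub>R (D ^^ n) v"
  by (induction n) (simp_all add: linear_scale[OF assms])

lemma funpow_bound:
  fixes D :: "'v \<Rightarrow> 'v"
  assumes "\<And>v. norm (D v) \<le> norm v * L" "L \<ge> 0"
  shows "norm ((D ^^ n) v) \<le> L ^ n * norm v"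
proof (induction n)
  case (Suc n)
  have "norm ((D ^^ Suc n) v) \<le> norm ((D ^^ n) v) * L" using assms(1) by simp
  also have "\<dots> \<le> (L ^ n * norm v) * L" using Suc assms(2) by (intro mult_right_mono)
  finally show ?case by (simp add: mult_ac)
qed simp

lemma op_exp_sums:
  assumes D: "bounded_linear D"
  shows "(\<lambda>n. (D ^^ n) v /\<^sub>R fact n) sums op_exp D (v :: 'v)"
proof -
  obtain L where L: "L \<ge> 0" "\<forall>v. norm (D v) \<le> norm v * L"
    using bounded_linear.nonneg_bounded[OF D] by (elim exE conjE)
  have "summable (\<lambda>n. (D ^^ n) v /\<^sub>R fact n)"
  proof (rule summable_comparison_test')
    show "summable (\<lambda>n. L ^ n /\<^sub>R fact n * norm v)" by (intro summable_mult2 summable_exp_generic)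
    fix n :: nat
    have "inverse (fact n) * norm ((D ^^ n) v) \<le> inverse (fact n) * (L ^ n * norm v)"
      using funpow_bound[OF L(2)[rule_format] L(1)] by (intro mult_left_mono) auto
    then show "norm ((D ^^ n) v /\<^sub>R fact n) \<le> L ^ n /\<^sub>R fact n * norm v" by simp
  qed
  then show ?thesis unfolding op_exp_def by (rule summable_sums)
qed

text \<open>Tested with a functional, the means for the powers of half the Casimir operator form a
  chain of successive primitives with geometric bounds, so the series lemma applies. Coordinates
  then determine the vector.\<close>

lemma mean_op_exp:
  assumes T: "T \<ge> 0"
  shows "mean_op T = op_exp (\<lambda>v. (T / 2) *\<^sub>R Cas v)"
proof
  fix v
  define D where "D w = (1/2) *\<^sub>R Cas w" for w
  have Cl: "linear Cas" by (rule klin_linear[OF klin_Cas])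
  have Dl: "linear D" unfolding D_def[abs_def] by (rule linear_compose_scale_right[OF Cl])
  have e: "(\<lambda>v. (T / 2) *\<^sub>R Cas v) = (\<lambda>v. T *\<^sub>R D v)" by (simp add: D_def fun_eq_iff)
  have TDl: "linear (\<lambda>v. T *\<^sub>R D v)" by (rule linear_compose_scale_right[OF Dl])
  obtain L where L: "L \<ge> 0" "\<forall>v. norm (D v) \<le> norm v * L"
    using bounded_linear.nonneg_bounded[OF linear_bounded[OF Dl]] by (elim exE conjE)
  obtain R where R: "R \<ge> 0" "\<forall>g v. norm (\<rho> g v) \<le> R * norm v" using \<rho>_uniformly_bounded by (elim exE conjE)
  have eq: "\<phi> (mean_op T v) = \<phi> (op_exp (\<lambda>v. T *\<^sub>R D v) v)" if \<phi>: "bounded_linear \<phi>" for \<phi> :: "'v \<Rightarrow> real"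
  proof -
    obtain P where P: "P \<ge> 0" "\<forall>x. norm (\<phi> x) \<le> norm x * P" using bounded_linear.nonneg_bounded[OF \<phi>] by (elim exE conjE)
    define F where "F k = coef_mean \<phi> ((D ^^ k) v)" for k
    have "(\<lambda>k. F k 0 * T ^ k / fact k) sums F 0 T"
    proof (rule iterated_integral_exponential_series)
      show "continuous_on {0..} (F k)" for k unfolding F_def by (rule coef_mean_continuous[OF \<phi>])
      show "F k T - F k 0 = integral {0..T} (F (Suc k))" if "T > 0" for k T
        unfolding F_def using coef_mean_increment[OF \<phi> that, of "(D ^^ k) v"] by (simp add: D_def)
      show "\<bar>F k t\<bar> \<le> (P * (R * norm v)) * L ^ k" if t: "t \<ge> 0" for k t
      proof -
        have b: "\<bar>\<phi> (\<rho> h ((D ^^ k) v))\<bar> \<le> (P * (R * norm v)) * L ^ k" for h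
        proof -
          have "\<bar>\<phi> (\<rho> h ((D ^^ k) v))\<bar> \<le> norm (\<rho> h ((D ^^ k) v)) * P" using P(2) by simp
          also have "\<dots> \<le> (R * norm ((D ^^ k) v)) * P" using R(2) P(1) by (intro mult_right_mono) auto
          also have "\<dots> \<le> (R * (L ^ k * norm v)) * P"
            using R(1) P(1) funpow_bound[OF L(2)[rule_format] L(1)] by (intro mult_right_mono mult_left_mono) auto
          finally show ?thesis by (simp add: mult_ac)
        qed
        have "\<bar>F k t\<bar> \<le> (\<integral>\<omega>. \<bar>\<phi> (\<rho> (g t \<omega>) ((D ^^ k) v))\<bar> \<partial>M)"
          unfolding F_def coef_mean_def by (rule integral_abs_bound)
        also have "\<dots> \<le> (\<integral>\<omega>. (P * (R * norm v)) * L ^ k \<partial>M)"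
          using b function_integrable[OF continuous_coefficient[OF \<phi>] t]
          by (intro integral_mono integrable_abs bm.integrable_const) auto
        finally show ?thesis by (simp add: bm.prob_space)
      qed
    qed (use L T in auto)
    moreover have "(\<lambda>n. \<phi> (((\<lambda>v. T *\<^sub>R D v) ^^ n) v /\<^sub>R fact n)) sums \<phi> (op_exp (\<lambda>v. T *\<^sub>R D v) v)"
      by (rule bounded_linear.sums[OF \<phi> op_exp_sums[OF linear_bounded[OF TDl]]])
    moreover have "\<phi> (((\<lambda>v. T *\<^sub>R D v) ^^ n) v /\<^sub>R fact n) = F n 0 * T ^ n / fact n" for n
      by (simp add: F_def coef_mean_0[OF \<phi>] funpow_scaled[OF Dl] linear_scale[OF bounded_linear.linear[OF \<phi>]] divide_inverse)
    ultimately have "F 0 T = \<phi> (op_exp (\<lambda>v. T *\<^sub>R D v) v)"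
      using sums_unique2 by simp
    then show ?thesis by (simp add: F_def coef_mean_op[OF \<phi> T])
  qed
  obtain B :: "'v set" where B: "finite B" "independent B" "span B = UNIV"
    using fin_dim_basis[OF fin_dim_V] .
  have "representation B (mean_op T v) b = representation B (op_exp (\<lambda>v. T *\<^sub>R D v) v) b" for b
    by (rule eq[OF representation_bounded_linear[OF B(2,3) fin_dim_V]])
  then have "(\<Sum>b\<in>B. representation B (mean_op T v) b *\<^sub>R b) = (\<Sum>b\<in>B. representation B (op_exp (\<lambda>v. T *\<^sub>R D v) v) b *\<^sub>R b)"
    by simp
  then show "mean_op T v = op_exp (\<lambda>v. (T / 2) *\<^sub>R Cas v) v"
    using B unfolding e by (simp add: sum_representation_eq)
qed

lemma mean_op_eigenvector:
  assumes T: "T \<ge> 0" and v: "Cas v = c *\<^sub>R v"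
  shows "mean_op T v = exp (1 / 2 * c * T) *\<^sub>R v"
proof -
  have Cl: "linear Cas" by (rule klin_linear[OF klin_Cas])
  have l: "linear (\<lambda>v. (T / 2) *\<^sub>R Cas v)" by (rule linear_compose_scale_right[OF Cl])
  have p: "((\<lambda>v. (T / 2) *\<^sub>R Cas v) ^^ n) v = (1 / 2 * c * T) ^ n *\<^sub>R v" for n
    by (induction n) (simp_all add: linear_scale[OF Cl] v)
  have "(\<lambda>n. (1 / 2 * c * T) ^ n /\<^sub>R fact n) sums exp (1 / 2 * c * T)"
    by (rule exp_converges)
  from bounded_linear.sums[OF bounded_linear_scaleR_left this, of v]
  have "(\<lambda>n. ((\<lambda>v. (T / 2) *\<^sub>R Cas v) ^^ n) v /\<^sub>R fact n) sums (exp (1 / 2 * c * T) *\<^sub>R v)"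
    unfolding p by simp
  from sums_unique2[OF op_exp_sums[OF linear_bounded[OF l]] this] show ?thesis
    unfolding mean_op_exp[OF T] .
qed

lemma isotypic_mean_op:
  assumes t: "t \<ge> 0" and \<tau>: "\<tau> \<in> irr_classes scal \<rho>" and U: "U \<in> \<tau>" and v: "v \<in> isotypic scal \<tau>"
  shows "mean_op t v = exp (1 / 2 * casimir_const G A \<Xi> \<mu> \<rho> U * t) *\<^sub>R v"
    "Cas v = casimir_const G A \<Xi> \<mu> \<rho> U *\<^sub>R v" "casimir_const G A \<Xi> \<mu> \<rho> U \<le> 0"
proof -
  have iU: "irreducible_subrep scal \<rho> U" using irr_class_members(1)[OF \<tau>] U by (auto simp: Irr_def)
  obtain c where c: "c \<le> 0" "\<forall>x\<in>U. Cas x = c *\<^sub>R x"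
    using irreducible_Cas_scalar[OF iU] by (elim exE conjE)
  have e: "casimir_const G A \<Xi> \<mu> \<rho> U = c" by (rule casimir_const_eq[OF iU c(1) c(2)[rule_format]])
  show C: "Cas v = casimir_const G A \<Xi> \<mu> \<rho> U *\<^sub>R v"
    unfolding e by (rule isotypic_Cas_scalar[OF \<tau> U c(2)[rule_format] v])
  show "mean_op t v = exp (1 / 2 * casimir_const G A \<Xi> \<mu> \<rho> U * t) *\<^sub>R v"
    by (rule mean_op_eigenvector[OF t C])
  show "casimir_const G A \<Xi> \<mu> \<rho> U \<le> 0" using c(1) e by simp
qed

lemma density_op_1: "density_op \<mu> \<rho> (\<lambda>_. 1) = op_integral \<mu> \<rho>"
  by (simp add: density_op_def op_integral_def fun_eq_iff)

text \<open>Move the Casimir operator onto the constant density 1, whose Laplacian vanishes.\<close>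

lemma haar_mean_Cas: "op_integral \<mu> \<rho> (Cas v) = 0"
proof -
  have "smooth_map A (\<lambda>g. 1 + (\<lambda>_. 0 :: real) (\<rho> g v))"
    by (rule matrix_coefficient_smooth[OF bounded_linear_zero])
  then have c1: "Ck_map A k (\<lambda>_. 1 :: real)" for k by (simp add: smooth_map_def)
  have "density_op \<mu> \<rho> (\<lambda>_. 1) (Cas v) = density_op \<mu> \<rho> (laplacian G A \<Xi> (\<lambda>_. 1)) v"
    by (rule density_op_laplacian[OF c1, symmetric])
  also have "laplacian G A \<Xi> (\<lambda>_. 1 :: real) = (\<lambda>_. 0)"
    by (simp add: laplacian_def lvf_def fun_eq_iff frechet_derivative_const)
  finally show ?thesis by (simp add: density_op_1) (simp add: density_op_def op_integral_def)
qed

text \<open>For \<open>c = 0\<close> the vector is invariant, so the mean and the Haar mean both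
  equal it. For \<open>c < 0\<close> the mean decays, and the Haar mean is zero since it annihilates
  the image of the Casimir operator.\<close>

lemma mean_op_limit_isotypic:
  assumes \<tau>: "\<tau> \<in> irr_classes scal \<rho>" and v: "v \<in> isotypic scal \<tau>"
  shows "((\<lambda>t. mean_op t v) \<longlongrightarrow> op_integral \<mu> \<rho> v) at_top"
proof -
  obtain U where U: "U \<in> \<tau>" using irr_class_members(2)[OF \<tau>] by blast
  define c where "c = casimir_const G A \<Xi> \<mu> \<rho> U"
  note iso = isotypic_mean_op[OF _ \<tau> U v, folded c_def]
  have ev: "eventually (\<lambda>t. exp (1 / 2 * c * t) *\<^sub>R v = mean_op t v) at_top"
    using eventually_ge_at_top[of 0] by eventually_elim (simp add: iso(1))
  have "((\<lambda>t. exp (1 / 2 * c * t) *\<^sub>R v) \<longlongrightarrow> op_integral \<mu> \<rho> v) at_top"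
  proof (cases "c = 0")
    case True
    have "Cas v = 0" using iso(2)[of 0] True by simp
    then have "\<rho> h v = v" for h by (rule Cas_zero_invariant)
    then have "op_integral \<mu> \<rho> v = v" by (simp add: op_integral_def)
    then show ?thesis using True by simp
  next
    case False
    then have c: "1 / 2 * c < 0" using iso(3)[of 0] by simp
    have "filterlim (\<lambda>t. 1 / 2 * c * t) at_bot at_top"
      by (rule filterlim_tendsto_neg_mult_at_bot[OF tendsto_const c filterlim_ident])
    from filterlim_compose[OF exp_at_bot this] have "((\<lambda>t. exp (1 / 2 * c * t) *\<^sub>R v) \<longlongrightarrow> 0 *\<^sub>R v) at_top"
      by (intro tendsto_scaleR tendsto_const)
    moreover have "op_integral \<mu> \<rho> v = 0"
    proof -
      have "bounded_linear (op_integral \<mu> \<rho>)"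
        using weighted_integral_linear(1)[OF continuous_on_const[of UNIV 1]] by (simp add: op_integral_def[abs_def])
      from linear_scale[OF bounded_linear.linear[OF this], of c v]
      have "c *\<^sub>R op_integral \<mu> \<rho> v = op_integral \<mu> \<rho> (Cas v)" using iso(2)[of 0] by simp
      then show ?thesis using False haar_mean_Cas by simp
    qed
    ultimately show ?thesis by simp
  qed
  then show ?thesis using ev by (rule Lim_transform_eventually)
qed

lemma mean_op_limit: "((\<lambda>t. mean_op t v) \<longlongrightarrow> op_integral \<mu> \<rho> v) at_top"
proof -
  let ?I = "irr_classes scal \<rho>"
  obtain u where u: "(\<forall>\<tau>\<in>?I. u \<tau> \<in> isotypic scal \<tau>) \<and> (\<forall>\<tau>. \<tau> \<notin> ?I \<longrightarrow> u \<tau> = 0) \<and> v = (\<Sum>\<tau>\<in>?I. u \<tau>)"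
    using isotypic_decomposition_exists by (rule exE)
  have ut: "u \<tau> \<in> isotypic scal \<tau>" if "\<tau> \<in> ?I" for \<tau> using conjunct1[OF u] that by (rule bspec)
  have vs: "v = (\<Sum>\<tau>\<in>?I. u \<tau>)" by (rule conjunct2[OF conjunct2[OF u]])
  have m: "(\<Sum>\<tau>\<in>?I. mean_op t (u \<tau>)) = mean_op t v" if t: "t \<ge> 0" for t
    unfolding op_integral_def vs linear_sum[OF linear_\<rho>]
    by (rule Bochner_Integration.integral_sum[symmetric]) (rule mean_op_integrable[OF t])
  have i: "(\<Sum>\<tau>\<in>?I. op_integral \<mu> \<rho> (u \<tau>)) = op_integral \<mu> \<rho> v"
    unfolding op_integral_def vs linear_sum[OF linear_\<rho>]
    by (rule Bochner_Integration.integral_sum[symmetric]) (rule continuous_integrable[OF continuous_\<rho>])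
  have "((\<lambda>t. \<Sum>\<tau>\<in>?I. mean_op t (u \<tau>)) \<longlongrightarrow> (\<Sum>\<tau>\<in>?I. op_integral \<mu> \<rho> (u \<tau>))) at_top"
    by (rule tendsto_sum) (rule mean_op_limit_isotypic[OF _ ut])
  then have "((\<lambda>t. \<Sum>\<tau>\<in>?I. mean_op t (u \<tau>)) \<longlongrightarrow> op_integral \<mu> \<rho> v) at_top" unfolding i .
  moreover have "eventually (\<lambda>t. (\<Sum>\<tau>\<in>?I. mean_op t (u \<tau>)) = mean_op t v) at_top"
    using eventually_ge_at_top[of 0] by eventually_elim (rule m)
  ultimately show ?thesis by (rule Lim_transform_eventually)
qed

end

theorem corollary4p4:
  fixes G :: "'g::{second_countable_topology,t2_space} monoid"
    and A :: "('g, 'e::real_normed_vector) chart set"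
    and \<kappa> :: "'e \<Rightarrow> 'e \<Rightarrow> real"
    and \<Xi> :: "'e set"
    and \<mu> :: "'g measure"
    and scal :: "'k::{real_normed_field,euclidean_space} \<Rightarrow>
                  'v::{banach,second_countable_topology} \<Rightarrow> 'v"
    and \<rho> :: "'g \<Rightarrow> 'v \<Rightarrow> 'v"
    and M :: "'w measure"
    and F :: "real \<Rightarrow> 'w measure"
    and W :: "'e \<Rightarrow> real \<Rightarrow> 'w \<Rightarrow> real"
    and g :: "real \<Rightarrow> 'w \<Rightarrow> 'g"
  assumes "lie_group G A"
    and "compact (UNIV :: 'g set)"
    and "connected (UNIV :: 'g set)"
    and "Ad_invariant_inner G A \<kappa>"
    and "orthonormal_basis \<kappa> \<Xi>"
    and "normalized_haar G \<mu>"
    and "fd_representation G A scal \<rho>"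
    and "lie_brownian_motion G A \<Xi> M F W g"
  shows
    "is_direct_sum (irr_classes scal \<rho>) (isotypic scal) \<and>
     (\<forall>t\<ge>0. \<forall>\<tau>\<in>irr_classes scal \<rho>.
        op_integral M (\<lambda>\<omega>. \<rho> (g t \<omega>)) ` isotypic scal \<tau> \<subseteq> isotypic scal \<tau> \<and>
        (\<forall>U\<in>\<tau>. \<forall>v\<in>isotypic scal \<tau>.
           op_integral M (\<lambda>\<omega>. \<rho> (g t \<omega>)) v =
             exp (1 / 2 * casimir_const G A \<Xi> \<mu> \<rho> U * t) *\<^sub>R v)) \<and>
     (\<forall>t\<ge>0. op_integral M (\<lambda>\<omega>. \<rho> (g t \<omega>)) =
        op_exp (\<lambda>v. (t / 2) *\<^sub>R casimir_op G A \<Xi> \<rho> v)) \<and>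
     (\<forall>v. ((\<lambda>t. op_integral M (\<lambda>\<omega>. \<rho> (g t \<omega>)) v) \<longlongrightarrow> density_op \<mu> \<rho> (\<lambda>_. 1) v) at_top) \<and>
     density_op \<mu> \<rho> (\<lambda>_. 1) = op_integral \<mu> \<rho>"
proof -
  interpret brownian_rep G A \<mu> scal \<rho> \<kappa> \<Xi> M F W g
    by unfold_locales (fact assms)+
  show ?thesis
  proof (intro conjI allI ballI impI)
    show "is_direct_sum (irr_classes scal \<rho>) (isotypic scal)" by (rule isotypic_direct_sum)
    show "density_op \<mu> \<rho> (\<lambda>_. 1) = op_integral \<mu> \<rho>" by (rule density_op_1)
    show "((\<lambda>t. mean_op t v) \<longlongrightarrow> density_op \<mu> \<rho> (\<lambda>_. 1) v) at_top" for v
      unfolding density_op_1 by (rule mean_op_limit)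
  next
    fix t :: real assume t: "t \<ge> 0"
    show "mean_op t = op_exp (\<lambda>v. (t / 2) *\<^sub>R casimir_op G A \<Xi> \<rho> v)" by (rule mean_op_exp[OF t])
  next
    fix t :: real and \<tau> U v assume t: "t \<ge> 0" and \<tau>: "\<tau> \<in> irr_classes scal \<rho>" "U \<in> \<tau>" "v \<in> isotypic scal \<tau>"
    show "mean_op t v = exp (1 / 2 * casimir_const G A \<Xi> \<mu> \<rho> U * t) *\<^sub>R v"
      by (rule isotypic_mean_op(1)[OF t \<tau>])
  next
    fix t :: real and \<tau> assume t: "t \<ge> 0" and \<tau>: "\<tau> \<in> irr_classes scal \<rho>"
    obtain U where U: "U \<in> \<tau>" using irr_class_members(2)[OF \<tau>] by blast
    show "mean_op t ` isotypic scal \<tau> \<subseteq> isotypic scal \<tau>"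
    proof (rule image_subsetI)
      fix v assume v: "v \<in> isotypic scal \<tau>"
      \<comment> \<open>The real factor is read as a scalar of the field, since the isotypic
        component is a span over that field.\<close>
      have "scal (of_real (exp (1 / 2 * casimir_const G A \<Xi> \<mu> \<rho> U * t))) v \<in> isotypic scal \<tau>"
        using v unfolding isotypic_def by (rule vs.span_scale)
      then show "mean_op t v \<in> isotypic scal \<tau>"
        unfolding isotypic_mean_op(1)[OF t \<tau> U v] scal_of_real .
    qed
  qed
qed

end
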